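(* Let $n\ge1$, let $H^n$ be the Heisenberg group of topological dimension $2n+1$, $\mu$ its Haar measure, $\{X_i\}_{i=1}^{2n}$ left-invariant vector fields on $H^n$ satisfying the Hörmander condition, and let $P$ be the sub-Riemannian perimeter functional corresponding to the choice of the $X_i$, i.e. $P(E)$ is the total variation over $H^n$ of the $\mathbb R^{2n}$-valued measure \[ D_X\mathbf 1_E:=(D_{X_1}\mathbf 1_E,\ldots,D_{X_{2n}}\mathbf 1_E). \] Let $N\in\mathbb N\cup\{\infty\}$. Then for every $\mathbf m\in\mathbb R^N_+$ there exists a minimal generalized $N$-cluster $\mathbf E$ in $H^n$ with $\mathbf m^\infty(\mathbf E)=\mathbf m$.
   Context: $H^n$ is identified with $\mathbb R^{2n+1}$ in the usual global coordinates (so that Haar measure is Lebesgue measure $dx$). The Hörmander condition means that the $X_i$ together with their iterated commutators span the tangent space at every point. The distribution $D_{X_i}f$ is defined by its action on every test function $\varphi\in C_0^\infty(\mathbb R^{2n+1})$ (smooth, compactly supported): \[ \langle\varphi,D_{X_i}f\rangle:=-\int_{\mathbb R^{2n+1}}f\,X_i\cdot\nabla\varphi\,dx-\int_{\mathbb R^{2n+1}}f\varphi\,\mathrm{div}\,X_i\,dx . \] $P(E)=+\infty$ if $D_X\mathbf 1_E$ is not a vector measure of finite total variation. $\mathbb R^N_+$ is the set of vectors (sequences if $N=\infty$) with nonnegative real components. An $N$-cluster in $X:=H^n$, $N\in\mathbb N\cup\{\infty\}$, is $\mathbf E=(E_j)_{j=1}^N$ with each $E_j\subset X$ Borel (possibly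 empty) and $\mu(E_i\cap E_j)=0$ for $i\ne j$. One sets $\mathbf m(\mathbf E):=(\mu(E_j))_{j=1}^N$ and $P(\mathbf E):=\frac12\sum_{j\ge1}P(E_j)+\frac12P\big(\bigcup_{j\ge1}E_j\big)$. Let $X^\infty:=\mathbb Z\times X$ and $\phi_j\colon X\to X^\infty$, $\phi_j(x)=(j,x)$. A generalized $N$-cluster in $X$ is $\mathbf E=(E_i)_{i=1}^N$ with $E_i\subset X^\infty$ such that for each $j\in\mathbb Z$ the vector $\mathbf E^j$ with components $E_i^j:=\phi_j^{-1}(E_i)$, $i=1,\dots,N$, is an $N$-cluster in $X$. One sets $\mathbf m^\infty(\mathbf E):=\sum_{j\in\mathbb Z}\mathbf m(\mathbf E^j)$ and $P^\infty(\mathbf E):=\sum_{j\in\mathbb Z}P(\mathbf E^j)$. A generalized $N$-cluster $\mathbf E$ is minimal (isoperimetric) if $P^\infty(\mathbf E)=\inf\{P^\infty(\mathbf F):\mathbf F\text{ a generalized }N\text{-cluster in }X,\ \mathbf m^\infty(\mathbf F)=\mathbf m^\infty(\mathbf E)\}$. *)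

theory Defs
  imports "HOL-Analysis.Analysis" "HOL-Library.Extended_Nat"
begin

text \<open>
  A point (x, y, t) of the Heisenberg group with n = CARD('n) is given by its exponential
  coordinates, so the underlying space is a Euclidean space of dimension 2 n + 1 and Haar measure
  is \<^const>\<open>lborel\<close>. The identity is 0 and the inverse of p is - p. The 2 n vector
  fields are indexed by the type 'n + 'n.
\<close>

type_synonym 'n heis = "(real ^ 'n) \<times> (real ^ 'n) \<times> real"

definition heis_mult :: "'n::finite heis \<Rightarrow> 'n heis \<Rightarrow> 'n heis" where
  "heis_mult p q =
     (case p of (x, y, t) \<Rightarrow> case q of (x', y', t') \<Rightarrow>
        (x + x', y + y', t + t' + (x \<bullet> y' - y \<bullet> x') / 2))"

lemma heis_mult_assoc: "heis_mult (heis_mult p q) r = heis_mult p (heis_mult q r)"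
  by (cases p, cases q, cases r) (simp add: heis_mult_def algebra_simps field_simps)

lemma heis_mult_0_left: "heis_mult 0 p = p" and heis_mult_0_right: "heis_mult p 0 = p"
  by (cases p; simp add: heis_mult_def zero_prod_def)+

lemma heis_mult_uminus_left: "heis_mult (- p) p = 0"
  by (cases p) (simp add: heis_mult_def zero_prod_def inner_commute)

text \<open>
  Vector fields are written in coordinates, as maps from the space to itself. No smoothness needs
  to be required below: a left-invariant field V satisfies V p = dL_p (V 0), where L_p is left
  translation, and this is affine in p.
\<close>

definition left_invariant :: "('n::finite heis \<Rightarrow> 'n heis) \<Rightarrow> bool" where
  "left_invariant V \<longleftrightarrow>
     (\<forall>p q. V (heis_mult p q) = frechet_derivative (heis_mult p) (at q) (V q))"

definition lie_bracket ::
  "('a::euclidean_space \<Rightarrow> 'a) \<Rightarrow> ('a \<Rightarrow> 'a) \<Rightarrow> 'a \<Rightarrow> 'a" where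
  "lie_bracket V W = (\<lambda>p. frechet_derivative W (at p) (V p) - frechet_derivative V (at p) (W p))"

inductive_set iterated_brackets :: "('i \<Rightarrow> 'a::euclidean_space \<Rightarrow> 'a) \<Rightarrow> ('a \<Rightarrow> 'a) set"
  for X :: "'i \<Rightarrow> 'a \<Rightarrow> 'a" where
  base: "X i \<in> iterated_brackets X"
| bracket: "\<lbrakk>V \<in> iterated_brackets X; W \<in> iterated_brackets X\<rbrakk>
    \<Longrightarrow> lie_bracket V W \<in> iterated_brackets X"

definition hoermander :: "('i \<Rightarrow> 'a::euclidean_space \<Rightarrow> 'a) \<Rightarrow> bool" where
  "hoermander X \<longleftrightarrow> (\<forall>p. span ((\<lambda>V. V p) ` iterated_brackets X) = UNIV)"

definition divergence :: "('a::euclidean_space \<Rightarrow> 'a) \<Rightarrow> 'a \<Rightarrow> real" where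
  "divergence V p = (\<Sum>b\<in>Basis. frechet_derivative V (at p) b \<bullet> b)"

definition gradient :: "('a::euclidean_space \<Rightarrow> real) \<Rightarrow> 'a \<Rightarrow> 'a" where
  "gradient f p = (\<Sum>b\<in>Basis. frechet_derivative f (at p) b *\<^sub>R b)"

primrec k_smooth :: "nat \<Rightarrow> ('a::euclidean_space \<Rightarrow> real) \<Rightarrow> bool" where
  "k_smooth 0 f \<longleftrightarrow> continuous_on UNIV f"
| "k_smooth (Suc k) f \<longleftrightarrow>
     (\<forall>x. f differentiable (at x)) \<and> (\<forall>v. k_smooth k (\<lambda>x. frechet_derivative f (at x) v))"

definition test_function :: "('a::euclidean_space \<Rightarrow> real) \<Rightarrow> bool" where
  "test_function \<phi> \<longleftrightarrow> (\<forall>k. k_smooth k \<phi>) \<and> compact (closure {x. \<phi> x \<noteq> 0})"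

definition distr_deriv ::
  "('a::euclidean_space \<Rightarrow> 'a) \<Rightarrow> ('a \<Rightarrow> real) \<Rightarrow> ('a \<Rightarrow> real) \<Rightarrow> real" where
  "distr_deriv V f \<phi> =
     - (LINT x|lborel. f x * (V x \<bullet> gradient \<phi> x))
     - (LINT x|lborel. f x * \<phi> x * divergence V x)"

text \<open>
  Vector measures are functions on all sets of which only the values on Borel sets matter.
\<close>

definition vector_measure :: "('a::topological_space set \<Rightarrow> 'b::real_normed_vector) \<Rightarrow> bool" where
  "vector_measure \<nu> \<longleftrightarrow>
     (\<forall>A. range A \<subseteq> sets borel \<and> disjoint_family A \<longrightarrow>
        (\<lambda>i::nat. \<nu> (A i)) sums \<nu> (\<Union>i. A i))"

definition total_variation ::
  "('a::topological_space set \<Rightarrow> 'b::real_normed_vector) \<Rightarrow> 'a set \<Rightarrow> ennreal" where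
  "total_variation \<nu> B =
     (SUP A\<in>{A. range A \<subseteq> sets borel \<and> disjoint_family A \<and> (\<Union>i. A i) = B}.
        \<Sum>i::nat. ennreal (norm (\<nu> (A i))))"

text \<open>
  The integral against a finite signed measure is taken with respect to its Jordan decomposition,
  whose positive and negative parts are half the total variation plus or minus half the measure.
\<close>

definition positive_part :: "('a::topological_space set \<Rightarrow> real) \<Rightarrow> 'a measure" where
  "positive_part \<nu> =
     measure_of UNIV (sets borel) (\<lambda>A. ennreal ((enn2real (total_variation \<nu> A) + \<nu> A) / 2))"

definition negative_part :: "('a::topological_space set \<Rightarrow> real) \<Rightarrow> 'a measure" where
  "negative_part \<nu> =
     measure_of UNIV (sets borel) (\<lambda>A. ennreal ((enn2real (total_variation \<nu> A) - \<nu> A) / 2))"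

definition signed_integral ::
  "('a::topological_space set \<Rightarrow> real) \<Rightarrow> ('a \<Rightarrow> real) \<Rightarrow> real" where
  "signed_integral \<nu> \<phi> = (LINT x|positive_part \<nu>. \<phi> x) - (LINT x|negative_part \<nu>. \<phi> x)"

definition is_distr_gradient ::
  "('i::finite \<Rightarrow> 'a::euclidean_space \<Rightarrow> 'a) \<Rightarrow> ('a \<Rightarrow> real) \<Rightarrow> ('a set \<Rightarrow> real ^ 'i) \<Rightarrow> bool" where
  "is_distr_gradient X f \<nu> \<longleftrightarrow>
     vector_measure \<nu> \<and> total_variation \<nu> UNIV < \<infinity> \<and>
     (\<forall>\<phi> i. test_function \<phi> \<longrightarrow> distr_deriv (X i) f \<phi> = signed_integral (\<lambda>A. \<nu> A $ i) \<phi>)"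

text \<open>
  Any two choices of the vector measure agree on Borel sets, so the choice operator is harmless.
\<close>

definition perimeter ::
  "('i::finite \<Rightarrow> 'a::euclidean_space \<Rightarrow> 'a) \<Rightarrow> 'a set \<Rightarrow> ennreal" where
  "perimeter X E =
     (if \<exists>\<nu>. is_distr_gradient X (indicat_real E) \<nu>
      then total_variation (SOME \<nu>. is_distr_gradient X (indicat_real E) \<nu>) UNIV
      else \<infinity>)"

text \<open>
  Vectors with N components, where N may be infinite, are functions on nat of which only the values
  at the indices 1, ..., N matter.
\<close>

definition indices :: "enat \<Rightarrow> nat set" where
  "indices N = {j. 1 \<le> j \<and> enat j \<le> N}"

definition cluster :: "enat \<Rightarrow> (nat \<Rightarrow> 'a::euclidean_space set) \<Rightarrow> bool" where
  "cluster N E \<longleftrightarrow>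
     (\<forall>j\<in>indices N. E j \<in> sets borel) \<and>
     (\<forall>i\<in>indices N. \<forall>j\<in>indices N. i \<noteq> j \<longrightarrow> emeasure lborel (E i \<inter> E j) = 0)"

definition cluster_perimeter ::
  "('i::finite \<Rightarrow> 'a::euclidean_space \<Rightarrow> 'a) \<Rightarrow> enat \<Rightarrow> (nat \<Rightarrow> 'a set) \<Rightarrow> ennreal" where
  "cluster_perimeter X N E =
     (\<Sum>\<^sub>\<infinity>j\<in>indices N. perimeter X (E j)) / 2 + perimeter X (\<Union>j\<in>indices N. E j) / 2"

definition layer :: "int \<Rightarrow> (nat \<Rightarrow> (int \<times> 'a) set) \<Rightarrow> nat \<Rightarrow> 'a set" where
  "layer k E = (\<lambda>i. Pair k -` E i)"

definition gen_cluster :: "enat \<Rightarrow> (nat \<Rightarrow> (int \<times> 'a::euclidean_space) set) \<Rightarrow> bool" where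
  "gen_cluster N E \<longleftrightarrow> (\<forall>k. cluster N (layer k E))"

definition gen_mass :: "(nat \<Rightarrow> (int \<times> 'a::euclidean_space) set) \<Rightarrow> nat \<Rightarrow> ennreal" where
  "gen_mass E i = (\<Sum>\<^sub>\<infinity>k\<in>UNIV. emeasure lborel (layer k E i))"

definition gen_perimeter ::
  "('i::finite \<Rightarrow> 'a::euclidean_space \<Rightarrow> 'a) \<Rightarrow> enat \<Rightarrow> (nat \<Rightarrow> (int \<times> 'a) set) \<Rightarrow> ennreal" where
  "gen_perimeter X N E = (\<Sum>\<^sub>\<infinity>k\<in>UNIV. cluster_perimeter X N (layer k E))"

definition minimal_gen_cluster ::
  "('i::finite \<Rightarrow> 'a::euclidean_space \<Rightarrow> 'a) \<Rightarrow> enat \<Rightarrow> (nat \<Rightarrow> (int \<times> 'a) set) \<Rightarrow> bool" where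
  "minimal_gen_cluster X N E \<longleftrightarrow>
     gen_cluster N E \<and>
     gen_perimeter X N E =
       (INF F\<in>{F. gen_cluster N F \<and> (\<forall>i\<in>indices N. gen_mass F i = gen_mass E i)}.
          gen_perimeter X N F)"

end

theory Submission
  imports Defs "HOL-Probability.Probability" "HOL-Library.Diagonal_Subsequence"
begin

text \<open>
  The proof is a concentration-compactness argument: a minimizing sequence of generalized clusters
  may split into countably many pieces that drift away from each other, and the layers of a
  generalized cluster have room for all of them.

  Everything about sets of finite perimeter follows from one inequality. The flow of a
  left-invariant field is right translation by multiples of its value at 0 and commutes with the
  field; therefore right translation of a set E by s X changes the set by a measure of at most
  s P(E). By the Hoermander condition the fields span modulo the center and do not all commute, so
  each element of the group is a product of such translations and of a commutator. Hence right
  translation by h changes E by at most \<omega>(|h|) P(E), where \<omega>(r) is a multiple of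
  sqrt r + r (\<open>shift_bound_exists\<close>). Averaging over h in a ball of radius r shows that E
  is close in the mean to its density at scale r (\<open>density_deviation_integral\<close>), with three
  consequences: local compactness (\<open>finite_perimeter_compact\<close>), an isoperimetric inequality
  (\<open>isoperimetric_layers\<close>), and concentration (\<open>concentration\<close>): up to an
  arbitrarily small mass, the set lies in finitely many unit-scale balls, whose number depends on
  mass, perimeter and precision only.

  The perimeter is the supremum of the pairings of the distributional gradient with test fields
  (\<open>field_variation_le_perimeter\<close>, \<open>perimeter_le_field_variation\<close>). For a fixed field
  the pairing is continuous under local convergence of sets, and fields with disjoint supports can
  be added. So the sum of the perimeters of finitely many limits seen from centers that drift
  apart is at most the lower limit of the perimeters (\<open>limit_perimeter_lsc\<close>). That the limit
  has a gradient measure at all follows from vague compactness of bounded measures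
  (\<open>vague_compactness\<close>), which is reduced to Helly's theorem on the line by a space-filling
  curve.

  Given a minimizing sequence, concentration provides countably many centers that capture all the
  mass of all components. Along a subsequence any two centers either stay at bounded distance or
  separate, and the components seen from each center converge locally. The limit cluster has one
  layer for each class of centers at bounded distance. Its masses are those prescribed: none is
  gained since balls around separated centers are disjoint, and none is lost by concentration. The
  union of infinitely many components converges too, since the isoperimetric inequality makes
  their masses summable (\<open>masses_summable\<close>). Its perimeter is at most the infimum, so it is
  minimal.
\<close>


section \<open>Smooth functions\<close>

lemma k_smooth_SucI:
  assumes "\<And>x. (f has_derivative D x) (at x)" and "\<And>v. k_smooth k (\<lambda>x. D x v)"
  shows "k_smooth (Suc k) f"
proof -
  have "frechet_derivative f (at x) = D x" for x
    using frechet_derivative_at[OF assms(1)] by simp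
  then show ?thesis using assms by (auto simp: differentiable_def)
qed

lemma k_smooth_SucD:
  assumes "k_smooth (Suc k) f"
  shows "(f has_derivative frechet_derivative f (at x)) (at x)"
    and "k_smooth k (\<lambda>x. frechet_derivative f (at x) v)"
  using assms by (auto simp: frechet_derivative_works[symmetric])

lemma k_smooth_dec: "k_smooth (Suc k) f \<Longrightarrow> k_smooth k f"
proof (induction k arbitrary: f)
  case 0 then show ?case
    by (auto intro!: continuous_at_imp_continuous_on differentiable_imp_continuous_within)
next
  case (Suc k) then show ?case by (metis k_smooth.simps(2))
qed

lemma k_smooth_const: "k_smooth k (\<lambda>x. c)"
proof (induction k arbitrary: c)
  case (Suc k)
  show ?case by (rule k_smooth_SucI[where D="\<lambda>x v. 0"]) (use Suc in auto)
qed auto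

lemma k_smooth_bounded_linear:
  assumes "bounded_linear f" shows "k_smooth k f"
proof (cases k)
  case 0 then show ?thesis using assms by (simp add: linear_continuous_on)
next
  case (Suc j)
  show ?thesis unfolding Suc
    by (rule k_smooth_SucI[where D="\<lambda>x. f"])
      (use assms in \<open>auto intro: bounded_linear_imp_has_derivative k_smooth_const\<close>)
qed

lemma k_smooth_add: "k_smooth k f \<Longrightarrow> k_smooth k g \<Longrightarrow> k_smooth k (\<lambda>x. f x + g x)"
proof (induction k arbitrary: f g)
  case (Suc k)
  show ?case
    by (rule k_smooth_SucI[OF has_derivative_add[OF k_smooth_SucD(1)[OF Suc.prems(1)]
            k_smooth_SucD(1)[OF Suc.prems(2)]]])
      (rule Suc.IH[OF k_smooth_SucD(2)[OF Suc.prems(1)] k_smooth_SucD(2)[OF Suc.prems(2)]])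
qed (auto intro: continuous_on_add)

lemma k_smooth_mult: "k_smooth k f \<Longrightarrow> k_smooth k g \<Longrightarrow> k_smooth k (\<lambda>x. f x * g x)"
proof (induction k arbitrary: f g)
  case (Suc k)
  show ?case
    by (rule k_smooth_SucI[OF has_derivative_mult[OF k_smooth_SucD(1)[OF Suc.prems(1)]
            k_smooth_SucD(1)[OF Suc.prems(2)]]])
      (rule k_smooth_add[OF Suc.IH[OF k_smooth_dec[OF Suc.prems(1)] k_smooth_SucD(2)[OF Suc.prems(2)]]
          Suc.IH[OF k_smooth_SucD(2)[OF Suc.prems(1)] k_smooth_dec[OF Suc.prems(2)]]])
qed (auto intro: continuous_on_mult)

lemma k_smooth_sum:
  "finite S \<Longrightarrow> (\<And>i. i \<in> S \<Longrightarrow> k_smooth k (f i)) \<Longrightarrow> k_smooth k (\<lambda>x. \<Sum>i\<in>S. f i x)"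
  by (induction S rule: finite_induct) (auto intro: k_smooth_const k_smooth_add)

lemma k_smooth_compose_affine:
  fixes f :: "'b::euclidean_space \<Rightarrow> real" and g :: "'a::euclidean_space \<Rightarrow> 'b"
  assumes g: "\<And>x. (g has_derivative A) (at x)"
  shows "k_smooth k f \<Longrightarrow> k_smooth k (\<lambda>x. f (g x))"
proof (induction k arbitrary: f)
  case 0
  have "continuous_on UNIV g"
    using g by (meson continuous_at_imp_continuous_on has_derivative_continuous)
  then show ?case using 0 by (auto intro: continuous_on_compose2)
next
  case (Suc k)
  show ?case
    by (rule k_smooth_SucI[OF has_derivative_compose[OF g k_smooth_SucD(1)[OF Suc.prems]]])
      (rule Suc.IH[OF k_smooth_SucD(2)[OF Suc.prems]])
qed

text \<open>
  Smooth functions of one variable are handed over together with the sequence of their derivatives.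
\<close>

lemma k_smooth_compose_real:
  fixes f :: "'a::euclidean_space \<Rightarrow> real"
  assumes H: "\<And>j x. (H j has_real_derivative H (Suc j) x) (at x)"
  shows "k_smooth k f \<Longrightarrow> k_smooth k (\<lambda>x. H j (f x))"
proof (induction k arbitrary: f j)
  case 0
  have "continuous_on UNIV (H j)"
    using H by (meson DERIV_isCont continuous_at_imp_continuous_on)
  then show ?case using 0 by (auto intro: continuous_on_compose2)
next
  case (Suc k)
  have "((\<lambda>x. H j (f x)) has_derivative (\<lambda>v. H (Suc j) (f x) * frechet_derivative f (at x) v)) (at x)"
    for x
    using has_derivative_compose[OF k_smooth_SucD(1)[OF Suc.prems] H[unfolded has_field_derivative_def]]
    by simp
  then show ?case
    by (rule k_smooth_SucI)
      (rule k_smooth_mult[OF Suc.IH[OF k_smooth_dec[OF Suc.prems]] k_smooth_SucD(2)[OF Suc.prems]])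
qed

primrec flat_poly :: "nat \<Rightarrow> real poly" where
  "flat_poly 0 = 1"
| "flat_poly (Suc j) = [:0, 0, 1:] * (flat_poly j - pderiv (flat_poly j))"

text \<open>
  \<open>flat 0\<close> is the classical smooth function exp (-1/x) that vanishes to infinite order at 0,
  and \<open>flat j\<close> is its derivative of order j.
\<close>

definition flat :: "nat \<Rightarrow> real \<Rightarrow> real" where
  "flat j x = (if x > 0 then poly (flat_poly j) (1 / x) * exp (- (1 / x)) else 0)"

lemma poly_times_exp_minus_tendsto_0:
  "((\<lambda>y::real. y ^ k * poly q y * exp (- y)) \<longlongrightarrow> 0) at_top"
proof (induction q arbitrary: k)
  case (pCons a q)
  have "((\<lambda>y::real. a * (y ^ k / exp y) + y ^ Suc k * poly q y * exp (- y)) \<longlongrightarrow> a * 0 + 0) at_top"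
    by (intro tendsto_add tendsto_mult tendsto_const tendsto_power_div_exp_0 pCons.IH)
  then show ?case
    by (simp add: algebra_simps exp_minus divide_inverse)
qed simp

lemma DERIV_flat: "(flat j has_real_derivative flat (Suc j) x) (at x)"
proof -
  consider "x < 0" | "x = 0" | "x > 0" by linarith
  then show ?thesis
  proof cases
    case 1
    have "((\<lambda>x. 0) has_real_derivative flat (Suc j) x) (at x)" using 1 by (simp add: flat_def)
    moreover have "eventually (\<lambda>y. y < 0) (nhds x)"
      using 1 by (simp add: eventually_nhds) (metis lessThan_iff open_lessThan)
    then have "eventually (\<lambda>y. 0 = flat j y) (nhds x)"
      by eventually_elim (simp add: flat_def)
    ultimately show ?thesis by (subst (asm) DERIV_cong_ev) auto
  next
    case 3
    let ?p = "flat_poly j"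
    have "((\<lambda>x. poly ?p (1 / x) * exp (- (1 / x))) has_real_derivative
        poly (pderiv ?p) (1 / x) * (- 1 / x\<^sup>2) * exp (- (1 / x)) +
        exp (- (1 / x)) * (1 / x\<^sup>2) * poly ?p (1 / x)) (at x)"
      using 3 by (auto intro!: derivative_eq_intros DERIV_chain2[OF poly_DERIV]
          simp: power2_eq_square divide_simps)
    moreover have "poly (pderiv ?p) (1 / x) * (- 1 / x\<^sup>2) * exp (- (1 / x)) +
        exp (- (1 / x)) * (1 / x\<^sup>2) * poly ?p (1 / x) = flat (Suc j) x"
      using 3 by (simp add: flat_def power2_eq_square field_simps)
    ultimately have *: "((\<lambda>x. poly ?p (1 / x) * exp (- (1 / x))) has_real_derivative flat (Suc j) x) (at x)"
      by simp
    have "eventually (\<lambda>y. y > 0) (nhds x)"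
      using 3 by (simp add: eventually_nhds) (metis greaterThan_iff open_greaterThan)
    then have "eventually (\<lambda>y. poly ?p (1 / y) * exp (- (1 / y)) = flat j y) (nhds x)"
      by eventually_elim (simp add: flat_def)
    with * show ?thesis by (subst (asm) DERIV_cong_ev) auto
  next
    case 2
    have "((\<lambda>h. flat j h / h) \<longlongrightarrow> 0) (at_right 0)"
    proof -
      have "((\<lambda>h::real. (inverse h) ^ 1 * poly (flat_poly j) (inverse h) * exp (- inverse h)) \<longlongrightarrow> 0) (at_right 0)"
        using filterlim_compose[OF poly_times_exp_minus_tendsto_0 filterlim_inverse_at_top_right] .
      moreover have "eventually (\<lambda>h::real. (inverse h) ^ 1 * poly (flat_poly j) (inverse h) * exp (- inverse h)
          = flat j h / h) (at_right 0)"
        by (auto simp: eventually_at_filter flat_def divide_inverse)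
      ultimately show ?thesis by (rule Lim_transform_eventually)
    qed
    moreover have "((\<lambda>h. flat j h / h) \<longlongrightarrow> 0) (at_left 0)"
      by (rule Lim_transform_eventually[OF tendsto_const]) (auto simp: eventually_at_filter flat_def)
    ultimately have "((\<lambda>h. flat j h / h) \<longlongrightarrow> 0) (at 0)"
      by (simp add: filterlim_split_at)
    then show ?thesis using 2 by (simp add: DERIV_def flat_def)
  qed
qed

lemma flat_0_nonneg: "0 \<le> flat 0 x" and flat_0_pos_iff: "0 < flat 0 x \<longleftrightarrow> 0 < x"
  by (auto simp: flat_def)

text \<open>
  The quadratic form is positive exactly on the ball, and composition with \<open>flat 0\<close>
  makes the zero extension smooth.
\<close>

definition bump :: "'a::euclidean_space \<Rightarrow> real \<Rightarrow> 'a \<Rightarrow> real" where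
  "bump c r x = flat 0 (r\<^sup>2 - (x - c) \<bullet> (x - c))"

lemma k_smooth_bump: "k_smooth k (bump c r)"
proof -
  have lin: "k_smooth k (\<lambda>x. (x - c) \<bullet> b)" for b :: 'a
  proof -
    have "k_smooth k (\<lambda>x. x \<bullet> b + (- (c \<bullet> b)))"
      by (rule k_smooth_add[OF k_smooth_bounded_linear[OF bounded_linear_inner_left] k_smooth_const])
    then show ?thesis by (simp add: inner_diff_left)
  qed
  have "k_smooth k (\<lambda>x. r\<^sup>2 + (- 1) * (\<Sum>b\<in>Basis. ((x - c) \<bullet> b) * ((x - c) \<bullet> b)))"
    by (rule k_smooth_add[OF k_smooth_const k_smooth_mult[OF k_smooth_const
            k_smooth_sum[OF finite_Basis k_smooth_mult[OF lin lin]]]])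
  then have "k_smooth k (\<lambda>x. r\<^sup>2 - (x - c) \<bullet> (x - c))"
    by (subst euclidean_inner) simp
  from k_smooth_compose_real[of flat, OF DERIV_flat this, of 0] show ?thesis
    unfolding bump_def .
qed

lemma bump_nonneg: "0 \<le> bump c r x"
  by (simp add: bump_def flat_0_nonneg)

lemma bump_pos_iff:
  assumes "0 < r" shows "0 < bump c r x \<longleftrightarrow> x \<in> ball c r"
proof -
  have "norm (x - c) < r \<longleftrightarrow> (norm (x - c))\<^sup>2 < r\<^sup>2"
    using assms by (meson less_imp_le norm_ge_zero pos2 power_less_imp_less_base power_strict_mono)
  then show ?thesis
    unfolding bump_def flat_0_pos_iff mem_ball dist_norm power2_norm_eq_inner
    by (simp add: norm_minus_commute)
qed

lemma test_functionI:
  assumes "\<And>k. k_smooth k f" "compact K" "\<And>x. x \<notin> K \<Longrightarrow> f x = 0"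
  shows "test_function f"
proof -
  have "{x. f x \<noteq> 0} \<subseteq> K" using assms(3) by auto
  then have "closure {x. f x \<noteq> 0} \<subseteq> K" using assms(2) by (simp add: closure_minimal compact_imp_closed)
  then show ?thesis unfolding test_function_def
    using assms(1,2) by (metis closed_closure compact_Int_closed inf.absorb_iff2)
qed

lemma test_functionD:
  assumes "test_function f"
  shows "k_smooth k f" "continuous_on UNIV f" "f differentiable (at x)" "f \<in> borel_measurable borel"
    "\<exists>R>0. \<forall>x. f x \<noteq> 0 \<longrightarrow> norm x < R"
proof -
  have sm: "k_smooth k f" for k using assms by (auto simp: test_function_def)
  show "k_smooth k f" by (rule sm)
  show c: "continuous_on UNIV f" using sm[of 0] by simp
  show "f differentiable (at x)" using sm[of 1] by simp
  show "f \<in> borel_measurable borel" using c by (rule borel_measurable_continuous_onI)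
  have "bounded (closure {x. f x \<noteq> 0})" using assms by (auto simp: test_function_def compact_imp_bounded)
  then obtain R where R: "\<forall>x\<in>closure {x. f x \<noteq> 0}. norm x \<le> R" by (auto simp: bounded_iff)
  show "\<exists>R>0. \<forall>x. f x \<noteq> 0 \<longrightarrow> norm x < R"
    using R closure_subset[of "{x. f x \<noteq> 0}"]
    by (intro exI[of _ "max 1 (R + 1)"]) force
qed

lemma test_function_sum_mult:
  assumes "finite S" "\<And>j. j \<in> S \<Longrightarrow> test_function (f j)"
  shows "test_function (\<lambda>x. \<Sum>j\<in>S. c j * f j x)"
proof -
  have "compact (\<Union>j\<in>S. closure {x. f j x \<noteq> 0})"
    using assms by (intro compact_UN) (auto simp: test_function_def)
  moreover have "(\<Sum>j\<in>S. c j * f j x) = 0" if "x \<notin> (\<Union>j\<in>S. closure {x. f j x \<noteq> 0})" for x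
  proof (intro sum.neutral ballI)
    fix j assume "j \<in> S"
    then have "f j x = 0" using that closure_subset[of "{x. f j x \<noteq> 0}"] by auto
    then show "c j * f j x = 0" by simp
  qed
  ultimately show ?thesis
    using assms
    by (intro test_functionI[of _ "\<Union>j\<in>S. closure {x. f j x \<noteq> 0}"]
        k_smooth_sum[OF assms(1) k_smooth_mult[OF k_smooth_const]]) (auto simp: test_function_def)
qed

lemma test_function_bounded:
  assumes "test_function f" shows "\<exists>C>0. \<forall>x. \<bar>f x\<bar> \<le> C"
proof -
  let ?K = "closure {x. f x \<noteq> 0}"
  have "compact (f ` ?K)"
    using assms test_functionD(2)[OF assms]
    by (intro compact_continuous_image) (auto simp: test_function_def intro: continuous_on_subset)
  then obtain C where C: "\<forall>y\<in>f ` ?K. norm y \<le> C" using bounded_iff compact_imp_bounded by blast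
  have "\<bar>f x\<bar> \<le> max 1 C" for x
    using C closure_subset[of "{x. f x \<noteq> 0}"] by (cases "f x = 0") (force simp: le_max_iff_disj)+
  then show ?thesis by (intro exI[of _ "max 1 C"]) auto
qed

text \<open>
  A finite sum f of bumps is positive on K and supported in U, and 1 - exp (- n f) is close to the
  indicator of its support. This avoids the construction of cutoff functions with a plateau.
\<close>

lemma smooth_cutoff:
  fixes K :: "'a::euclidean_space set"
  assumes "compact K" "open U" "K \<subseteq> U" "0 < e"
  obtains \<psi> where "test_function \<psi>" "\<And>x. 0 \<le> \<psi> x" "\<And>x. \<psi> x \<le> 1"
    "\<And>x. x \<in> K \<Longrightarrow> 1 - e \<le> \<psi> x" "\<And>x. x \<notin> U \<Longrightarrow> \<psi> x = 0"
proof -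
  have "\<exists>r>0. cball x r \<subseteq> U" if "x \<in> K" for x
    using that assms by (meson open_contains_cball subsetD)
  then obtain r where r: "\<And>x. x \<in> K \<Longrightarrow> r x > 0 \<and> cball x (r x) \<subseteq> U" by metis
  have "K \<subseteq> (\<Union>x\<in>K. ball x (r x))" using r by force
  then obtain S where S: "S \<subseteq> K" "finite S" "K \<subseteq> (\<Union>x\<in>S. ball x (r x))"
    using compactE_image[OF assms(1), of K "\<lambda>x. ball x (r x)"] by (metis open_ball)
  define f where "f x = (\<Sum>c\<in>S. bump c (r c) x)" for x
  have f_smooth: "k_smooth k f" for k
    unfolding f_def using S(2) k_smooth_bump by (rule k_smooth_sum)
  have f_nonneg: "0 \<le> f x" for x unfolding f_def by (intro sum_nonneg bump_nonneg)
  have f_pos: "0 < f x" if "x \<in> K" for x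
  proof -
    obtain c where c: "c \<in> S" "x \<in> ball c (r c)" using subsetD[OF S(3) \<open>x \<in> K\<close>] by blast
    then have "0 < bump c (r c) x" using r S bump_pos_iff by blast
    then show ?thesis unfolding f_def using S c
      by (intro sum_pos2[where i=c]) (auto intro: bump_nonneg)
  qed
  have f_0: "f x = 0" if "x \<notin> (\<Union>c\<in>S. cball c (r c))" for x
  proof -
    have "bump c (r c) x = 0" if "c \<in> S" for c
    proof -
      have "x \<notin> ball c (r c)" using \<open>x \<notin> _\<close> that by auto
      then have "\<not> 0 < bump c (r c) x" using bump_pos_iff[of "r c" c x] r S that by blast
      then show ?thesis using bump_nonneg[of c "r c" x] by linarith
    qed
    then show ?thesis by (simp add: f_def)
  qed
  obtain \<delta> where \<delta>: "\<delta> > 0" "\<And>x. x \<in> K \<Longrightarrow> \<delta> \<le> f x"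
  proof (cases "K = {}")
    case False
    have "continuous_on K f" using f_smooth[of 0] by (auto intro: continuous_on_subset)
    then obtain z where "z \<in> K" "\<forall>x\<in>K. f z \<le> f x" using continuous_attains_inf assms(1) False by blast
    then show ?thesis using that[of "f z"] f_pos by auto
  qed (use that[of 1] in auto)
  obtain n :: real where n: "n > 0" "exp (- (n * \<delta>)) \<le> e"
  proof
    show "0 < max 1 (- ln e / \<delta>)" by simp
    have "- ln e \<le> max 1 (- ln e / \<delta>) * \<delta>" using \<delta>(1) by (simp add: max_def field_simps)
    then have "- (max 1 (- ln e / \<delta>) * \<delta>) \<le> ln e" by linarith
    then show "exp (- (max 1 (- ln e / \<delta>) * \<delta>)) \<le> e" using assms(4)
      by (metis exp_le_cancel_iff exp_ln)
  qed
  define H where "H j x = (if j = 0 then 1 else 0) - (- n) ^ j * exp (- (n * x))" for j x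
  have H: "(H j has_real_derivative H (Suc j) x) (at x)" for j x
    unfolding H_def by (auto intro!: derivative_eq_intros)
  define \<psi> where "\<psi> x = 1 - exp (- (n * f x))" for x
  have "k_smooth k \<psi>" for k
    using k_smooth_compose_real[of H, OF H f_smooth, of k 0] by (simp add: H_def \<psi>_def[abs_def])
  moreover have "compact (\<Union>c\<in>S. cball c (r c))" using S by (intro compact_UN) auto
  moreover have "\<psi> x = 0" if "x \<notin> (\<Union>c\<in>S. cball c (r c))" for x
    using f_0[OF that] by (simp add: \<psi>_def)
  ultimately have "test_function \<psi>" by (rule test_functionI)
  moreover have "0 \<le> \<psi> x" "\<psi> x \<le> 1" for x
    using f_nonneg[of x] n by (auto simp: \<psi>_def)
  moreover have "1 - e \<le> \<psi> x" if "x \<in> K" for x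
  proof -
    have "exp (- (n * f x)) \<le> exp (- (n * \<delta>))" using \<delta>(2)[OF that] n by simp
    then show ?thesis unfolding \<psi>_def using n(2) by linarith
  qed
  moreover have "\<psi> x = 0" if "x \<notin> U" for x
  proof -
    have "x \<notin> (\<Union>c\<in>S. cball c (r c))" using that r S by blast
    then show ?thesis using f_0 by (simp add: \<psi>_def)
  qed
  ultimately show ?thesis by (rule that)
qed

section \<open>Vector measures\<close>

lemma vector_measure_sums:
  assumes "vector_measure \<nu>" "range A \<subseteq> sets borel" "disjoint_family A"
  shows "(\<lambda>i::nat. \<nu> (A i)) sums \<nu> (\<Union>i. A i)"
  using assms by (auto simp: vector_measure_def)

lemma vector_measure_empty:
  assumes "vector_measure \<nu>" shows "\<nu> {} = 0"
proof -
  have "(\<lambda>i::nat. \<nu> {}) sums \<nu> (\<Union>i::nat. {})"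
    by (rule vector_measure_sums[OF assms]) (auto simp: disjoint_family_on_def)
  then have "(\<lambda>i::nat. \<nu> {}) \<longlonglongrightarrow> 0" by (rule summable_LIMSEQ_zero[OF sums_summable])
  then show ?thesis by (simp add: LIMSEQ_const_iff)
qed

lemma vector_measure_Un:
  assumes "vector_measure \<nu>" "A \<in> sets borel" "B \<in> sets borel" "A \<inter> B = {}"
  shows "\<nu> (A \<union> B) = \<nu> A + \<nu> B"
proof -
  have "(\<lambda>i. \<nu> (binaryset A B i)) sums \<nu> (\<Union>i. binaryset A B i)"
    using assms by (intro vector_measure_sums) (auto simp: binaryset_def disjoint_family_on_def)
  moreover have "(\<lambda>i. \<nu> (binaryset A B i)) sums (\<nu> A + \<nu> B)"
    by (rule binaryset_sums[where f=\<nu>, OF vector_measure_empty[OF assms(1)]])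
  ultimately show ?thesis by (metis UN_binaryset_eq sums_unique2)
qed

lemma vector_measure_Diff:
  assumes "vector_measure \<nu>" "A \<in> sets borel" "B \<in> sets borel" "B \<subseteq> A"
  shows "\<nu> (A - B) = \<nu> A - \<nu> B"
  using vector_measure_Un[of \<nu> B "A - B"] assms by (simp add: Un_absorb1)

lemma sums_imp_norm_le_suminf:
  fixes f :: "nat \<Rightarrow> 'b::real_normed_vector"
  assumes "f sums s"
  shows "ennreal (norm s) \<le> (\<Sum>i. ennreal (norm (f i)))"
proof (rule LIMSEQ_le_const2)
  show "(\<lambda>n. ennreal (norm (\<Sum>i<n. f i))) \<longlonglongrightarrow> ennreal (norm s)"
    using assms by (auto simp: sums_def intro: tendsto_norm)
  have "ennreal (norm (\<Sum>i<n. f i)) \<le> (\<Sum>i. ennreal (norm (f i)))" for n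
  proof -
    have "ennreal (norm (\<Sum>i<n. f i)) \<le> ennreal (\<Sum>i<n. norm (f i))"
      by (intro ennreal_leI norm_sum)
    also have "\<dots> = (\<Sum>i<n. ennreal (norm (f i)))" by (subst sum_ennreal) auto
    also have "\<dots> \<le> (\<Sum>i. ennreal (norm (f i)))" by (intro sum_le_suminf) auto
    finally show ?thesis .
  qed
  then show "\<exists>N. \<forall>n\<ge>N. ennreal (norm (\<Sum>i<n. f i)) \<le> (\<Sum>i. ennreal (norm (f i)))" by blast
qed

lemma suminf_swap_ennreal: "(\<Sum>i. \<Sum>j. f i j :: ennreal) = (\<Sum>j. \<Sum>i. f i j)"
proof -
  have "(\<Sum>i. \<Sum>j. f i j) = (\<integral>\<^sup>+i. (\<Sum>j. f i j) \<partial>count_space UNIV)"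
    by (rule nn_integral_count_space_nat[symmetric])
  also have "\<dots> = (\<Sum>j. \<integral>\<^sup>+i. f i j \<partial>count_space UNIV)" by (rule nn_integral_suminf) auto
  finally show ?thesis by (simp only: nn_integral_count_space_nat)
qed

lemma total_variation_upper:
  assumes "range A \<subseteq> sets borel" "disjoint_family A" "(\<Union>i. A i) = B"
  shows "(\<Sum>i::nat. ennreal (norm (\<nu> (A i)))) \<le> total_variation \<nu> B"
  unfolding total_variation_def using assms by (intro SUP_upper) auto

lemma total_variation_least:
  assumes "\<And>A n. range A \<subseteq> sets borel \<Longrightarrow> disjoint_family A \<Longrightarrow> (\<Union>i::nat. A i) = B \<Longrightarrow>
      (\<Sum>i<n. ennreal (norm (\<nu> (A i)))) \<le> c"
  shows "total_variation \<nu> B \<le> c"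
  unfolding total_variation_def
  unfolding suminf_eq_SUP by (intro SUP_least) (use assms in blast)

text \<open>
  A finite disjoint family inside a set becomes a countable partition of it by adding the
  remainder and empty sets, which only increases the sum.
\<close>

lemma total_variation_finite_upper:
  assumes "finite J" "\<And>j. j \<in> J \<Longrightarrow> A j \<in> sets borel" "disjoint_family_on A J"
    "(\<Union>j\<in>J. A j) \<subseteq> B" "B \<in> sets borel"
  shows "(\<Sum>j\<in>J. ennreal (norm (\<nu> (A j)))) \<le> total_variation \<nu> B"
proof -
  obtain e where e: "bij_betw e {..<card J} J"
    using assms(1) ex_bij_betw_nat_finite[OF assms(1)] by (auto simp: atLeast0LessThan)
  have eJ: "e i \<in> J" if "i < card J" for i using e that by (auto simp: bij_betw_def)
  define C where "C i = (if i < card J then A (e i) else if i = card J then B - (\<Union>j\<in>J. A j) else {})" for i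
  have U: "(\<Union>j\<in>J. A j) \<in> sets borel" using assms by (intro sets.finite_UN) auto
  have "range C \<subseteq> sets borel" using assms U eJ by (auto simp: C_def)
  moreover have "disjoint_family C"
  proof -
    have "C i \<inter> C k = {}" if "i < k" for i k
    proof (cases "k < card J")
      case True
      then have "e i \<noteq> e k" using e that by (auto simp: bij_betw_def inj_on_def)
      then show ?thesis using True that eJ assms(3) by (auto simp: C_def disjoint_family_on_def)
    next
      case False then show ?thesis using that eJ by (auto simp: C_def)
    qed
    then show ?thesis unfolding disjoint_family_on_def by (metis Int_commute linorder_neqE_nat)
  qed
  moreover have "(\<Union>i. C i) = B"
  proof
    show "(\<Union>i. C i) \<subseteq> B" using assms(4) eJ by (auto simp: C_def split: if_splits)
    show "B \<subseteq> (\<Union>i. C i)"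
    proof
      fix x assume x: "x \<in> B"
      show "x \<in> (\<Union>i. C i)"
      proof (cases "x \<in> (\<Union>j\<in>J. A j)")
        case True
        then obtain j where "j \<in> J" "x \<in> A j" by auto
        moreover have "j \<in> e ` {..<card J}" using e \<open>j \<in> J\<close> by (simp add: bij_betw_def)
        moreover then obtain i where "i < card J" "e i = j" by auto
        ultimately show ?thesis by (auto simp: C_def intro!: exI[of _ i])
      next
        case False then show ?thesis using x by (auto simp: C_def intro!: exI[of _ "card J"])
      qed
    qed
  qed
  ultimately have "(\<Sum>i. ennreal (norm (\<nu> (C i)))) \<le> total_variation \<nu> B"
    by (rule total_variation_upper)
  moreover have "(\<Sum>i<card J. ennreal (norm (\<nu> (C i)))) \<le> (\<Sum>i. ennreal (norm (\<nu> (C i))))"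
    by (intro sum_le_suminf) auto
  moreover have "(\<Sum>i<card J. ennreal (norm (\<nu> (C i)))) = (\<Sum>j\<in>J. ennreal (norm (\<nu> (A j))))"
    by (subst sum.reindex_bij_betw[OF e, symmetric]) (auto simp: C_def)
  ultimately show ?thesis by (metis order_trans)
qed

lemma norm_le_total_variation:
  "A \<in> sets borel \<Longrightarrow> ennreal (norm (\<nu> A)) \<le> total_variation \<nu> A"
  using total_variation_finite_upper[of "{()}" "\<lambda>_. A" A \<nu>] by (simp add: disjoint_family_on_def)

lemma total_variation_mono_norm:
  assumes "\<And>A. A \<in> sets borel \<Longrightarrow> norm (\<mu> A) \<le> norm (\<nu> A)"
  shows "total_variation \<mu> B \<le> total_variation \<nu> B"
  unfolding total_variation_def
proof (rule SUP_mono, rule bexI)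
  fix A :: "nat \<Rightarrow> 'a set"
  assume "A \<in> {A. range A \<subseteq> sets borel \<and> disjoint_family A \<and> (\<Union>i. A i) = B}"
  then show "(\<Sum>i. ennreal (norm (\<mu> (A i)))) \<le> (\<Sum>i. ennreal (norm (\<nu> (A i))))"
    by (intro suminf_le) (auto intro!: ennreal_leI assms)
qed

text \<open>
  Partitions of two disjoint sets combine to a partition of the union.
\<close>

lemma total_variation_Un_ge:
  assumes AB: "A \<in> sets borel" "B \<in> sets borel" "A \<inter> B = {}"
  shows "total_variation \<nu> A + total_variation \<nu> B \<le> total_variation \<nu> (A \<union> B)" (is "_ \<le> ?c")
proof -
  let ?P = "\<lambda>A. {C. range C \<subseteq> sets borel \<and> disjoint_family C \<and> (\<Union>i::nat. C i) = A}"
  let ?s = "\<lambda>C. \<Sum>i::nat. ennreal (norm (\<nu> (C i)))"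
  have ne: "?P A \<noteq> {}" if "A \<in> sets borel" for A
  proof -
    have "binaryset A {} \<in> ?P A" using that
      by (auto simp: disjoint_family_on_def binaryset_def split: if_splits)
    then show ?thesis by blast
  qed
  have *: "?s C + ?s D \<le> ?c" if C: "C \<in> ?P A" and D: "D \<in> ?P B" for C D
  proof -
    have "(\<Sum>i<n. ennreal (norm (\<nu> (C i)))) + (\<Sum>i<n. ennreal (norm (\<nu> (D i)))) \<le> ?c" for n
    proof -
      define F where "F p = (case p of Inl i \<Rightarrow> C i | Inr i \<Rightarrow> D i)" for p :: "nat + nat"
      have CA: "C i \<subseteq> A" "D i \<subseteq> B" for i using C D by auto
      have "F p \<in> sets borel" for p using C D by (auto simp: F_def split: sum.splits)
      moreover have "disjoint_family_on F S" for S
      proof -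
        have "F p \<inter> F q = {}" if "p \<noteq> q" for p q
        proof (cases p; cases q)
          fix a b assume "p = Inl a" "q = Inl b"
          then show ?thesis using that C by (auto simp: F_def disjoint_family_on_def)
        next
          fix a b assume "p = Inr a" "q = Inr b"
          then show ?thesis using that D by (auto simp: F_def disjoint_family_on_def)
        next
          fix a b assume "p = Inl a" "q = Inr b"
          then show ?thesis using CA[of a] CA[of b] AB by (auto simp: F_def)
        next
          fix a b assume "p = Inr a" "q = Inl b"
          then show ?thesis using CA[of a] CA[of b] AB by (auto simp: F_def)
        qed
        then show ?thesis by (auto simp: disjoint_family_on_def)
      qed
      moreover have "(\<Union>p\<in>{..<n} <+> {..<n}. F p) \<subseteq> A \<union> B"
        unfolding F_def using CA by (auto split: sum.splits) blast+
      ultimately have "(\<Sum>p\<in>{..<n} <+> {..<n}. ennreal (norm (\<nu> (F p)))) \<le> ?c"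
        using AB by (intro total_variation_finite_upper) auto
      then show ?thesis by (subst (asm) sum.Plus) (auto simp: F_def)
    qed
    then have "(SUP n. (\<Sum>i<n. ennreal (norm (\<nu> (C i)))) + (\<Sum>i<n. ennreal (norm (\<nu> (D i))))) \<le> ?c"
      by (rule SUP_least)
    moreover have "?s C + ?s D = (SUP n. (\<Sum>i<n. ennreal (norm (\<nu> (C i)))) + (\<Sum>i<n. ennreal (norm (\<nu> (D i)))))"
      unfolding suminf_eq_SUP by (rule ennreal_SUP_add[symmetric]) (rule incseq_sumI, simp)+
    ultimately show ?thesis by simp
  qed
  have 1: "total_variation \<nu> A + ?s D \<le> ?c" if "D \<in> ?P B" for D
    unfolding total_variation_def[of \<nu> A]
    by (subst ennreal_SUP_add_left[OF ne[OF AB(1)], symmetric]) (intro SUP_least * that)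
  have "total_variation \<nu> A + total_variation \<nu> B = (SUP D\<in>?P B. total_variation \<nu> A + ?s D)"
    unfolding total_variation_def[of \<nu> B] by (rule ennreal_SUP_add_right[OF ne[OF AB(2)]])
  also have "\<dots> \<le> ?c" by (intro SUP_least 1)
  finally show ?thesis .
qed

lemma total_variation_mono:
  assumes "A \<in> sets borel" "B \<in> sets borel" "A \<subseteq> B"
  shows "total_variation \<nu> A \<le> total_variation \<nu> B"
proof -
  have "total_variation \<nu> A \<le> total_variation \<nu> A + total_variation \<nu> (B - A)" by simp
  also have "\<dots> \<le> total_variation \<nu> (A \<union> (B - A))" using assms by (intro total_variation_Un_ge) auto
  finally show ?thesis using assms by (simp add: Un_absorb1)
qed

lemma total_variation_empty:
  assumes "vector_measure \<nu>" shows "total_variation \<nu> {} = 0"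
proof -
  have "total_variation \<nu> {} \<le> 0"
    by (rule total_variation_least) (auto simp: vector_measure_empty[OF assms])
  then show ?thesis by simp
qed

text \<open>
  Countable additivity makes the total variation a measure. One inequality combines finitely many
  partitions at a time; the other refines a partition of the union by the given sets.
\<close>

lemma total_variation_suminf:
  assumes \<nu>: "vector_measure \<nu>" and B: "range B \<subseteq> sets borel" "disjoint_family B"
  shows "(\<Sum>n::nat. total_variation \<nu> (B n)) = total_variation \<nu> (\<Union>n. B n)"
proof (rule antisym)
  have UB: "(\<Union>n<k. B n) \<in> sets borel" for k using B by auto
  have "(\<Sum>n<k. total_variation \<nu> (B n)) \<le> total_variation \<nu> (\<Union>n<k. B n)" for k
  proof (induction k)
    case (Suc k)
    have "B n \<inter> B k = {}" if "n < k" for n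
      using B(2) that unfolding disjoint_family_on_def by (metis UNIV_I less_irrefl)
    then have "(\<Union>n<k. B n) \<inter> B k = {}" by blast
    then have "total_variation \<nu> (\<Union>n<k. B n) + total_variation \<nu> (B k)
        \<le> total_variation \<nu> ((\<Union>n<k. B n) \<union> B k)"
      using B UB by (intro total_variation_Un_ge) auto
    also have "(\<Union>n<k. B n) \<union> B k = (\<Union>n<Suc k. B n)" by (auto simp: lessThan_Suc)
    finally show ?case using order_trans[OF add_right_mono[OF Suc]] by simp
  qed simp
  moreover have "total_variation \<nu> (\<Union>n<k. B n) \<le> total_variation \<nu> (\<Union>n. B n)" for k
    using B by (intro total_variation_mono) auto
  ultimately show "(\<Sum>n. total_variation \<nu> (B n)) \<le> total_variation \<nu> (\<Union>n. B n)"
    unfolding suminf_eq_SUP by (meson SUP_least order_trans)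
next
  show "total_variation \<nu> (\<Union>n. B n) \<le> (\<Sum>n. total_variation \<nu> (B n))"
    unfolding total_variation_def[of \<nu> "\<Union>n. B n"]
  proof (rule SUP_least, safe)
    fix A :: "nat \<Rightarrow> 'a set"
    assume A: "range A \<subseteq> sets borel" "disjoint_family A" "(\<Union>i. A i) = (\<Union>n. B n)"
    have "(\<lambda>n. \<nu> (A i \<inter> B n)) sums \<nu> (\<Union>n. A i \<inter> B n)" for i
    proof (rule vector_measure_sums[OF \<nu>])
      show "disjoint_family (\<lambda>n. A i \<inter> B n)" using B(2) unfolding disjoint_family_on_def by blast
    qed (use A(1) B(1) in auto)
    moreover have "(\<Union>n. A i \<inter> B n) = A i" for i using A(3) by blast
    ultimately have "ennreal (norm (\<nu> (A i))) \<le> (\<Sum>n. ennreal (norm (\<nu> (A i \<inter> B n))))" for i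
      by (metis sums_imp_norm_le_suminf)
    then have "(\<Sum>i. ennreal (norm (\<nu> (A i)))) \<le> (\<Sum>i. \<Sum>n. ennreal (norm (\<nu> (A i \<inter> B n))))"
      by (intro suminf_le) auto
    also have "\<dots> = (\<Sum>n. \<Sum>i. ennreal (norm (\<nu> (A i \<inter> B n))))" by (rule suminf_swap_ennreal)
    also have "\<dots> \<le> (\<Sum>n. total_variation \<nu> (B n))"
    proof (intro suminf_le)
      fix n
      have "(\<Union>i. A i \<inter> B n) = B n" using A(3) by blast
      moreover have "disjoint_family (\<lambda>i. A i \<inter> B n)"
        using A(2) unfolding disjoint_family_on_def by blast
      ultimately show "(\<Sum>i. ennreal (norm (\<nu> (A i \<inter> B n)))) \<le> total_variation \<nu> (B n)"
        using A B by (intro total_variation_upper) auto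
    qed auto
    finally show "(\<Sum>i. ennreal (norm (\<nu> (A i)))) \<le> (\<Sum>n. total_variation \<nu> (B n))" .
  qed
qed

definition variation_measure :: "('a::topological_space set \<Rightarrow> 'b::real_normed_vector) \<Rightarrow> 'a measure" where
  "variation_measure \<nu> = measure_of UNIV (sets borel) (total_variation \<nu>)"

lemma sets_borel_measure_of: "sets (measure_of UNIV (sets borel) f) = sets borel"
  using sets.sigma_sets_eq[of borel] by (simp add: sets_measure_of)

lemma emeasure_borel_measure_of:
  assumes "f {} = 0"
    "\<And>A. range A \<subseteq> sets borel \<Longrightarrow> disjoint_family A \<Longrightarrow> (\<Sum>i::nat. f (A i)) = f (\<Union>i. A i)"
    "A \<in> sets (borel :: 'a::topological_space measure)"
  shows "emeasure (measure_of UNIV (sets borel) f) A = f A"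
proof (rule emeasure_measure_of_sigma)
  show "sigma_algebra UNIV (sets (borel :: 'a measure))"
    using sets.sigma_algebra_axioms[of "borel :: 'a measure"] by simp
  show "positive (sets borel) f" using assms(1) by (simp add: positive_def)
  show "countably_additive (sets borel) f" using assms(2) by (auto simp: countably_additive_def)
qed fact

lemma sets_variation_measure: "sets (variation_measure \<nu>) = sets borel"
  by (simp add: variation_measure_def sets_borel_measure_of)

lemma emeasure_variation_measure:
  "vector_measure \<nu> \<Longrightarrow> A \<in> sets borel \<Longrightarrow> emeasure (variation_measure \<nu>) A = total_variation \<nu> A"
  unfolding variation_measure_def
  by (rule emeasure_borel_measure_of) (auto simp: total_variation_empty total_variation_suminf)

section \<open>Integration against vector measures\<close>

text \<open>
  Signed integrals are defined by the Jordan decomposition, whereas the measures met below come as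
  differences of two arbitrary finite measures. All decompositions are therefore treated together.
\<close>

locale measure_difference =
  P: finite_measure p + N: finite_measure n for p n :: "'a::topological_space measure" +
  fixes \<nu> :: "'a set \<Rightarrow> real"
  assumes sets_p[measurable_cong]: "sets p = sets borel" and sets_n[measurable_cong]: "sets n = sets borel"
    and diff: "\<And>A. A \<in> sets borel \<Longrightarrow> \<nu> A = measure p A - measure n A"

lemma (in finite_measure) integral_partition_approx:
  fixes \<phi> :: "'a \<Rightarrow> real"
  assumes "finite J" "\<And>j. j \<in> J \<Longrightarrow> A j \<in> sets M" "disjoint_family_on A J" "(\<Union>j\<in>J. A j) = space M"
    and "\<phi> \<in> borel_measurable M" "\<And>j x. j \<in> J \<Longrightarrow> x \<in> A j \<Longrightarrow> \<bar>\<phi> x - c j\<bar> \<le> e" and e: "0 \<le> e"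
  shows "\<bar>(LINT x|M. \<phi> x) - (\<Sum>j\<in>J. c j * measure M (A j))\<bar> \<le> e * measure M (space M)"
    and "integrable M \<phi>"
proof -
  define s where "s x = (\<Sum>j\<in>J. c j * indicator (A j) x)" for x :: 'a
  have ind: "integrable M (\<lambda>x. c j * indicat_real (A j) x)" if "j \<in> J" for j
    using assms(2)[OF that] by (intro integrable_mult_right integrable_real_indicator) (auto simp: emeasure_eq_measure)
  have s_int: "integrable M s" unfolding s_def using ind by (rule Bochner_Integration.integrable_sum)
  have s_val: "(LINT x|M. s x) = (\<Sum>j\<in>J. c j * measure M (A j))"
  proof -
    have "(LINT x|M. s x) = (\<Sum>j\<in>J. LINT x|M. c j * indicat_real (A j) x)"
      unfolding s_def using ind by (rule Bochner_Integration.integral_sum)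
    also have "\<dots> = (\<Sum>j\<in>J. c j * measure M (A j))"
    proof (rule sum.cong)
      fix j assume "j \<in> J"
      then have "A j \<inter> space M = A j" using assms(2) sets.Int_space_eq2 by blast
      then show "(LINT x|M. c j * indicat_real (A j) x) = c j * measure M (A j)" by simp
    qed simp
    finally show ?thesis .
  qed
  have near: "\<bar>\<phi> x - s x\<bar> \<le> e" if "x \<in> space M" for x
  proof -
    have "x \<in> (\<Union>j\<in>J. A j)" using that assms(4) by simp
    then obtain j where j: "j \<in> J" "x \<in> A j" by blast
    have "s x = (\<Sum>k\<in>J. if k = j then c j else 0)"
      unfolding s_def
    proof (rule sum.cong)
      fix k assume "k \<in> J"
      then have "x \<notin> A k" if "k \<noteq> j" using j assms(3) that unfolding disjoint_family_on_def by blast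
      then show "c k * indicat_real (A k) x = (if k = j then c j else 0)" using j by auto
    qed simp
    then have "s x = c j" using j assms(1) by simp
    then show ?thesis using assms(6)[OF j] by simp
  qed
  have d: "integrable M (\<lambda>x. \<phi> x - s x)"
    using near s_int assms(5) by (intro integrable_const_bound[of _ e] AE_I2) auto
  from Bochner_Integration.integrable_add[OF d s_int] show i: "integrable M \<phi>" by simp
  have "\<bar>LINT x|M. \<phi> x - s x\<bar> \<le> (LINT x|M. e)"
    using near d by (intro order_trans[OF integral_abs_bound] integral_mono integrable_abs) auto
  then show "\<bar>(LINT x|M. \<phi> x) - (\<Sum>j\<in>J. c j * measure M (A j))\<bar> \<le> e * measure M (space M)"
    using i s_int by (simp add: s_val[symmetric] mult.commute)
qed

lemma (in measure_difference) diff_partition_approx: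
  assumes "finite J" "\<And>j. j \<in> J \<Longrightarrow> A j \<in> sets borel" "disjoint_family_on A J" "(\<Union>j\<in>J. A j) = UNIV"
    and "\<phi> \<in> borel_measurable borel" "\<And>j x. j \<in> J \<Longrightarrow> x \<in> A j \<Longrightarrow> \<bar>\<phi> x - c j\<bar> \<le> e" and e: "0 \<le> e"
  shows "\<bar>(LINT x|p. \<phi> x) - (LINT x|n. \<phi> x) - (\<Sum>j\<in>J. c j * \<nu> (A j))\<bar>
      \<le> e * (measure p UNIV + measure n UNIV)"
proof -
  have sp: "space p = UNIV" "space n = UNIV"
    using sets_p sets_n by (auto dest!: sets_eq_imp_space_eq)
  have "\<bar>(LINT x|p. \<phi> x) - (\<Sum>j\<in>J. c j * measure p (A j))\<bar> \<le> e * measure p (space p)"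
    using assms sp by (intro P.integral_partition_approx) (auto simp: sets_p measurable_cong_sets[OF sets_p])
  moreover have "\<bar>(LINT x|n. \<phi> x) - (\<Sum>j\<in>J. c j * measure n (A j))\<bar> \<le> e * measure n (space n)"
    using assms sp by (intro N.integral_partition_approx) (auto simp: sets_n measurable_cong_sets[OF sets_n])
  moreover have "(\<Sum>j\<in>J. c j * \<nu> (A j)) = (\<Sum>j\<in>J. c j * measure p (A j)) - (\<Sum>j\<in>J. c j * measure n (A j))"
    using assms(2) by (simp add: diff sum_subtractf[symmetric] right_diff_distrib cong: sum.cong)
  ultimately show ?thesis unfolding sp distrib_left by linarith
qed

text \<open>
  The pieces are the joint level sets of the functions \<open>\<lfloor>\<phi> i x /
  e\<rfloor>\<close>; by boundedness only finitely many of them are nonempty.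
\<close>

lemma small_oscillation_partition:
  fixes \<phi> :: "'i::finite \<Rightarrow> 'a::topological_space \<Rightarrow> real"
  assumes [measurable]: "\<And>i. \<phi> i \<in> borel_measurable borel" and C: "\<And>i x. \<bar>\<phi> i x\<bar> \<le> C" and e: "0 < e"
  obtains J :: "('i \<Rightarrow> int) set" and A where "finite J" "\<And>j. A j \<in> sets borel" "disjoint_family A"
    "(\<Union>j\<in>J. A j) = UNIV" "\<And>i j x y. x \<in> A j \<Longrightarrow> y \<in> A j \<Longrightarrow> \<bar>\<phi> i x - \<phi> i y\<bar> \<le> e"
proof -
  define A where "A j = {x. \<forall>i. \<lfloor>\<phi> i x / e\<rfloor> = j i}" for j
  define J where "J = PiE (UNIV :: 'i set) (\<lambda>_. {\<lfloor>- C / e\<rfloor>..\<lfloor>C / e\<rfloor>})"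
  show ?thesis
  proof (rule that)
    show "finite J" unfolding J_def by (intro finite_PiE) auto
    have "{x \<in> space borel. \<forall>i\<in>UNIV. \<lfloor>\<phi> i x / e\<rfloor> = j i} \<in> sets borel" for j by measurable
    then show "A j \<in> sets borel" for j by (simp add: A_def)
    show "disjoint_family A" by (auto simp: A_def disjoint_family_on_def fun_eq_iff)
    have "x \<in> A (\<lambda>i. \<lfloor>\<phi> i x / e\<rfloor>) \<and> (\<lambda>i. \<lfloor>\<phi> i x / e\<rfloor>) \<in> J" for x
    proof -
      have "- C / e \<le> \<phi> i x / e \<and> \<phi> i x / e \<le> C / e" for i
        using C[of i x] e unfolding abs_le_iff
        by (intro conjI divide_right_mono) (linarith | simp)+
      then show ?thesis by (auto simp: A_def J_def PiE_def extensional_def intro!: floor_mono)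
    qed
    then show "(\<Union>j\<in>J. A j) = UNIV" by blast
    show "\<bar>\<phi> i x - \<phi> i y\<bar> \<le> e" if "x \<in> A j" "y \<in> A j" for i j x y
    proof -
      have "\<lfloor>\<phi> i x / e\<rfloor> = \<lfloor>\<phi> i y / e\<rfloor>" using that by (simp add: A_def)
      then have "\<bar>\<phi> i x / e - \<phi> i y / e\<bar> \<le> 1" by linarith
      then show ?thesis using e by (simp add: diff_divide_distrib[symmetric] abs_divide field_simps)
    qed
  qed
qed

text \<open>
  Both sides are close to the same Riemann sums, which involve the signed measure but not its
  decomposition.
\<close>

lemma measure_difference_integral_unique:
  fixes \<phi> :: "'a::topological_space \<Rightarrow> real"
  assumes "measure_difference p n \<nu>" "measure_difference p' n' \<nu>"
    and m: "\<phi> \<in> borel_measurable borel" and C: "\<And>x. \<bar>\<phi> x\<bar> \<le> C"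
  shows "(LINT x|p. \<phi> x) - (LINT x|n. \<phi> x) = (LINT x|p'. \<phi> x) - (LINT x|n'. \<phi> x)" (is "?a = ?b")
proof -
  interpret D1: measure_difference p n \<nu> by fact
  interpret D2: measure_difference p' n' \<nu> by fact
  define K where "K = measure p UNIV + measure n UNIV + (measure p' UNIV + measure n' UNIV)"
  have K: "0 \<le> K" by (simp add: K_def)
  have *: "\<bar>?a - ?b\<bar> \<le> e * K" if "0 < e" for e
  proof -
    obtain J :: "(unit \<Rightarrow> int) set" and A where J: "finite J" "\<And>j. A j \<in> sets borel" "disjoint_family A"
      "(\<Union>j\<in>J. A j) = UNIV" "\<And>(i::unit) j x y. x \<in> A j \<Longrightarrow> y \<in> A j \<Longrightarrow> \<bar>\<phi> x - \<phi> y\<bar> \<le> e"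
      by (rule small_oscillation_partition[of "\<lambda>_::unit. \<phi>" C e, OF m C \<open>0 < e\<close>]) (rule that)
    define c where "c j = \<phi> (SOME x. x \<in> A j)" for j
    have c: "\<bar>\<phi> x - c j\<bar> \<le> e" if "x \<in> A j" for x j
      unfolding c_def using J(5)[OF that someI[of "\<lambda>x. x \<in> A j", OF that]] .
    have d: "disjoint_family_on A J" using J(3) by (auto simp: disjoint_family_on_def)
    have "\<bar>?a - (\<Sum>j\<in>J. c j * \<nu> (A j))\<bar> \<le> e * (measure p UNIV + measure n UNIV)"
      using J c d m that by (intro D1.diff_partition_approx) auto
    moreover have "\<bar>?b - (\<Sum>j\<in>J. c j * \<nu> (A j))\<bar> \<le> e * (measure p' UNIV + measure n' UNIV)"
      using J c d m that by (intro D2.diff_partition_approx) auto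
    ultimately show ?thesis unfolding K_def distrib_left by linarith
  qed
  have "\<bar>?a - ?b\<bar> \<le> 0 + e" if "0 < e" for e
  proof -
    have "\<bar>?a - ?b\<bar> \<le> (e / (K + 1)) * K" using K that by (intro *) simp
    also have "\<dots> \<le> e" using K that by (simp add: field_simps)
    finally show ?thesis by simp
  qed
  then have "\<bar>?a - ?b\<bar> \<le> 0" by (rule field_le_epsilon)
  then show ?thesis by simp
qed

lemma emeasure_measure_of_real:
  fixes r :: "'a::topological_space set \<Rightarrow> real"
  assumes nn: "\<And>A. A \<in> sets borel \<Longrightarrow> 0 \<le> r A" and "r {} = 0"
    and s: "\<And>A. range A \<subseteq> sets borel \<Longrightarrow> disjoint_family A \<Longrightarrow> (\<lambda>i::nat. r (A i)) sums r (\<Union>i. A i)"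
    and "A \<in> sets borel"
  shows "emeasure (measure_of UNIV (sets borel) (\<lambda>A. ennreal (r A))) A = ennreal (r A)"
proof (rule emeasure_borel_measure_of)
  show "(\<Sum>i. ennreal (r (A i))) = ennreal (r (\<Union>i. A i))"
    if "range A \<subseteq> sets borel" "disjoint_family A" for A :: "nat \<Rightarrow> 'a set"
    using that by (intro suminf_ennreal_eq[OF _ s] nn) auto
qed (use assms in auto)

lemma vector_measureI_difference:
  assumes "measure_difference p n \<nu>" shows "vector_measure \<nu>"
proof -
  interpret measure_difference p n \<nu> by fact
  show ?thesis
  proof (unfold vector_measure_def, safe)
    fix A :: "nat \<Rightarrow> 'a set" assume A: "range A \<subseteq> sets borel" "disjoint_family A"
    have "(\<lambda>i. measure p (A i) - measure n (A i)) sums (measure p (\<Union>i. A i) - measure n (\<Union>i. A i))"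
      using A by (intro sums_diff P.finite_measure_UNION N.finite_measure_UNION) (auto simp: sets_p sets_n)
    moreover have "(\<Union>i. A i) \<in> sets borel" using A by auto
    ultimately show "(\<lambda>i. \<nu> (A i)) sums \<nu> (\<Union>i. A i)" using A by (simp add: diff image_subset_iff)
  qed
qed

text \<open>
  A countably additive bound of the norm on each set bounds the sum over every partition.
\<close>

lemma total_variation_le_additive:
  fixes b :: "'a::topological_space set \<Rightarrow> real"
  assumes "\<And>A. A \<in> sets borel \<Longrightarrow> norm (\<nu> A) \<le> b A"
    and s: "\<And>A. range A \<subseteq> sets borel \<Longrightarrow> disjoint_family A \<Longrightarrow> (\<lambda>i::nat. b (A i)) sums b (\<Union>i. A i)"
  shows "total_variation \<nu> B \<le> ennreal (b B)"
  unfolding total_variation_def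
proof (rule SUP_least, safe)
  fix A :: "nat \<Rightarrow> 'a set" assume A: "range A \<subseteq> sets borel" "disjoint_family A"
  have nn: "0 \<le> b (A i)" for i using assms(1)[of "A i"] A norm_ge_zero order_trans by blast
  have "(\<Sum>i. ennreal (norm (\<nu> (A i)))) \<le> (\<Sum>i. ennreal (b (A i)))"
    using A by (intro suminf_le ennreal_leI assms) auto
  also have "\<dots> = ennreal (b (\<Union>i. A i))" by (rule suminf_ennreal_eq[OF nn s[OF A]])
  finally show "(\<Sum>i. ennreal (norm (\<nu> (A i)))) \<le> ennreal (b (\<Union>i. A i))" .
qed

text \<open>
  Finiteness of the total variation allows computations with real numbers and gives the Jordan
  decompositions of the components as genuine finite measures.
\<close>

locale finite_vector_measure =
  fixes \<nu> :: "'a::topological_space set \<Rightarrow> real ^ 'i::finite"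
  assumes vm: "vector_measure \<nu>" and tv_finite: "total_variation \<nu> UNIV < \<infinity>"
begin

definition tv :: "'a set \<Rightarrow> real" where "tv A = enn2real (total_variation \<nu> A)"

lemma vm_component: "vector_measure (\<lambda>A. \<nu> A $ i)"
  using vm unfolding vector_measure_def by (auto intro: sums_vec_nth)

lemma total_variation_eq_tv: "A \<in> sets borel \<Longrightarrow> total_variation \<nu> A = ennreal (tv A)"
proof -
  assume "A \<in> sets borel"
  then have "total_variation \<nu> A \<le> total_variation \<nu> UNIV" by (intro total_variation_mono) auto
  then have "total_variation \<nu> A < top" using tv_finite by (simp add: le_less_trans)
  then show ?thesis by (simp add: tv_def)
qed

lemma tv_nonneg: "0 \<le> tv A" by (simp add: tv_def)

lemma norm_le_tv:
  assumes "A \<in> sets borel" shows "norm (\<nu> A) \<le> tv A"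
  using norm_le_total_variation[OF assms, of \<nu>]
  unfolding total_variation_eq_tv[OF assms] by (simp add: ennreal_le_iff[OF tv_nonneg])

lemma component_total_variation_le: "total_variation (\<lambda>A. \<nu> A $ i) A \<le> total_variation \<nu> A"
  by (rule total_variation_mono_norm) (simp add: component_le_norm_cart)

definition ctv :: "'i \<Rightarrow> 'a set \<Rightarrow> real" where "ctv i A = enn2real (total_variation (\<lambda>A. \<nu> A $ i) A)"

lemma component_total_variation_eq:
  assumes "A \<in> sets borel" shows "total_variation (\<lambda>A. \<nu> A $ i) A = ennreal (ctv i A)"
proof -
  have "total_variation (\<lambda>A. \<nu> A $ i) A < top"
    using component_total_variation_le[of i A] total_variation_eq_tv[OF assms]
    by (metis ennreal_less_top le_less_trans)
  then show ?thesis unfolding ctv_def by simp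
qed

lemma ctv_nonneg: "0 \<le> ctv i A" by (simp add: ctv_def)

lemma ctv_le_tv:
  assumes "A \<in> sets borel" shows "ctv i A \<le> tv A"
proof -
  have "ennreal (ctv i A) \<le> ennreal (tv A)"
    using component_total_variation_le[of i A]
    unfolding component_total_variation_eq[OF assms] total_variation_eq_tv[OF assms] .
  then show ?thesis by (simp add: ennreal_le_iff[OF tv_nonneg])
qed

lemma abs_le_ctv:
  assumes "A \<in> sets borel" shows "\<bar>\<nu> A $ i\<bar> \<le> ctv i A"
proof -
  have "ennreal \<bar>\<nu> A $ i\<bar> \<le> ennreal (ctv i A)"
    using norm_le_total_variation[OF assms, of "\<lambda>A. \<nu> A $ i"]
    unfolding component_total_variation_eq[OF assms] real_norm_def .
  then show ?thesis by (simp add: ennreal_le_iff[OF ctv_nonneg])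
qed

lemma ctv_sums:
  assumes "range A \<subseteq> sets borel" "disjoint_family A"
  shows "(\<lambda>k::nat. ctv i (A k)) sums ctv i (\<Union>k. A k)"
proof -
  have UA: "(\<Union>k. A k) \<in> sets borel" using assms by auto
  have "(\<Sum>k. ennreal (ctv i (A k))) = ennreal (ctv i (\<Union>k. A k))"
    using total_variation_suminf[OF vm_component assms, of i] assms(1)
    unfolding component_total_variation_eq[OF UA]
    by (simp add: component_total_variation_eq image_subset_iff)
  then have "(\<lambda>k. ennreal (ctv i (A k))) sums ennreal (ctv i (\<Union>k. A k))"
    by (metis summable_sums summableI)
  then show ?thesis by (subst (asm) sums_ennreal) (auto simp: ctv_def)
qed

abbreviation "pos i \<equiv> positive_part (\<lambda>A. \<nu> A $ i)"
abbreviation "neg i \<equiv> negative_part (\<lambda>A. \<nu> A $ i)"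

lemma sets_pos[measurable_cong]: "sets (pos i) = sets borel" and sets_neg[measurable_cong]: "sets (neg i) = sets borel"
  by (simp_all add: positive_part_def negative_part_def sets_borel_measure_of)

lemma emeasure_pos: "A \<in> sets borel \<Longrightarrow> emeasure (pos i) A = ennreal ((ctv i A + \<nu> A $ i) / 2)"
  and emeasure_neg: "A \<in> sets borel \<Longrightarrow> emeasure (neg i) A = ennreal ((ctv i A - \<nu> A $ i) / 2)"
  unfolding positive_part_def negative_part_def ctv_def[symmetric]
proof -
  have vs: "(\<lambda>k::nat. \<nu> (A k) $ i) sums (\<nu> (\<Union>k. A k) $ i)" if "range A \<subseteq> sets borel" "disjoint_family A" for A
    using vector_measure_sums[OF vm_component that] .
  have z: "ctv i {} = 0" "\<nu> {} $ i = 0"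
    using total_variation_empty[OF vm_component] vector_measure_empty[OF vm] by (auto simp: ctv_def)
  show "emeasure (measure_of UNIV (sets borel) (\<lambda>A. ennreal ((ctv i A + \<nu> A $ i) / 2))) A =
      ennreal ((ctv i A + \<nu> A $ i) / 2)" if "A \<in> sets borel"
  proof (rule emeasure_measure_of_real[OF _ _ _ that])
    show "0 \<le> (ctv i A + \<nu> A $ i) / 2" if "A \<in> sets borel" for A
      using abs_le_D1[OF abs_le_ctv[OF that, of i]] abs_le_D2[OF abs_le_ctv[OF that, of i]] by simp
    show "(\<lambda>k. (ctv i (A k) + \<nu> (A k) $ i) / 2) sums ((ctv i (\<Union>k. A k) + \<nu> (\<Union>k. A k) $ i) / 2)"
      if "range A \<subseteq> sets borel" "disjoint_family A" for A :: "nat \<Rightarrow> 'a set"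
      by (intro sums_divide sums_add ctv_sums vs that)
  qed (simp add: z)
  show "emeasure (measure_of UNIV (sets borel) (\<lambda>A. ennreal ((ctv i A - \<nu> A $ i) / 2))) A =
      ennreal ((ctv i A - \<nu> A $ i) / 2)" if "A \<in> sets borel"
  proof (rule emeasure_measure_of_real[OF _ _ _ that])
    show "0 \<le> (ctv i A - \<nu> A $ i) / 2" if "A \<in> sets borel" for A
      using abs_le_D1[OF abs_le_ctv[OF that, of i]] abs_le_D2[OF abs_le_ctv[OF that, of i]] by simp
    show "(\<lambda>k. (ctv i (A k) - \<nu> (A k) $ i) / 2) sums ((ctv i (\<Union>k. A k) - \<nu> (\<Union>k. A k) $ i) / 2)"
      if "range A \<subseteq> sets borel" "disjoint_family A" for A :: "nat \<Rightarrow> 'a set"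
      by (intro sums_divide sums_diff ctv_sums vs that)
  qed (simp add: z)
qed

lemma measure_pos: "A \<in> sets borel \<Longrightarrow> measure (pos i) A = (ctv i A + \<nu> A $ i) / 2"
  and measure_neg: "A \<in> sets borel \<Longrightarrow> measure (neg i) A = (ctv i A - \<nu> A $ i) / 2"
proof -
  assume A: "A \<in> sets borel"
  have "0 \<le> (ctv i A + \<nu> A $ i) / 2" "0 \<le> (ctv i A - \<nu> A $ i) / 2"
    using abs_le_D1[OF abs_le_ctv[OF A, of i]] abs_le_D2[OF abs_le_ctv[OF A, of i]] by simp_all
  then show "measure (pos i) A = (ctv i A + \<nu> A $ i) / 2" "measure (neg i) A = (ctv i A - \<nu> A $ i) / 2"
    unfolding measure_def emeasure_pos[OF A] emeasure_neg[OF A] by (simp_all only: enn2real_ennreal)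
qed

lemma measure_difference_pos_neg: "measure_difference (pos i) (neg i) (\<lambda>A. \<nu> A $ i)"
proof -
  have sp: "space (pos i) = UNIV" "space (neg i) = UNIV"
    using sets_eq_imp_space_eq[OF sets_pos] sets_eq_imp_space_eq[OF sets_neg] by simp_all
  show ?thesis
  proof (unfold measure_difference_def measure_difference_axioms_def, intro conjI allI impI)
    show "finite_measure (pos i)" by (rule finite_measureI) (simp add: sp emeasure_pos)
    show "finite_measure (neg i)" by (rule finite_measureI) (simp add: sp emeasure_neg)
  qed (auto simp: sets_pos sets_neg measure_pos measure_neg field_simps)
qed

lemma signed_integral_component:
  fixes \<phi> :: "'a \<Rightarrow> real"
  assumes "measure_difference p n (\<lambda>A. \<nu> A $ i)"
    and "\<phi> \<in> borel_measurable borel" and "\<And>x. \<bar>\<phi> x\<bar> \<le> C"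
  shows "signed_integral (\<lambda>A. \<nu> A $ i) \<phi> = (LINT x|p. \<phi> x) - (LINT x|n. \<phi> x)"
  unfolding signed_integral_def
  by (rule measure_difference_integral_unique[OF measure_difference_pos_neg assms])

lemma
  fixes \<phi> :: "'a \<Rightarrow> real"
  assumes "\<phi> \<in> borel_measurable borel" "\<And>x. \<bar>\<phi> x\<bar> \<le> C"
  shows integrable_pos: "integrable (pos i) \<phi>" and integrable_neg: "integrable (neg i) \<phi>"
proof -
  interpret measure_difference "pos i" "neg i" "\<lambda>A. \<nu> A $ i" by (rule measure_difference_pos_neg)
  show "integrable (pos i) \<phi>" "integrable (neg i) \<phi>"
    using assms by (auto intro!: P.integrable_const_bound[of _ C] N.integrable_const_bound[of _ C]
        simp: measurable_cong_sets[OF sets_pos] measurable_cong_sets[OF sets_neg])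
qed

text \<open>
  On the pieces of a fine partition the field is almost a constant vector of norm at most 1, and
  the Cauchy-Schwarz inequality applies to each piece.
\<close>

lemma sum_signed_integral_le_tv:
  assumes [measurable]: "\<And>i. \<phi> i \<in> borel_measurable borel" and le: "\<And>x. (\<Sum>i\<in>UNIV. (\<phi> i x)\<^sup>2) \<le> 1"
  shows "(\<Sum>i\<in>UNIV. signed_integral (\<lambda>A. \<nu> A $ i) (\<phi> i)) \<le> tv UNIV"
proof (rule field_le_epsilon)
  fix e :: real assume "0 < e"
  define K where "K = (\<Sum>i\<in>UNIV. measure (pos i) UNIV + measure (neg i) UNIV)"
  have K: "0 \<le> K" by (auto simp: K_def intro!: sum_nonneg)
  define d where "d = e / (K + 1)"
  have d: "0 < d" "d * K \<le> e" using \<open>0 < e\<close> K by (auto simp: d_def field_simps)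
  have 1: "\<bar>\<phi> i x\<bar> \<le> 1" for i x
  proof -
    have "(\<phi> i x)\<^sup>2 \<le> (\<Sum>i\<in>UNIV. (\<phi> i x)\<^sup>2)" by (rule member_le_sum) auto
    then have "(\<phi> i x)\<^sup>2 \<le> 1" using le[of x] by linarith
    then show ?thesis by (simp only: abs_square_le_1)
  qed
  obtain J :: "('i \<Rightarrow> int) set" and A where J: "finite J" "\<And>j. A j \<in> sets borel" "disjoint_family A"
      "(\<Union>j\<in>J. A j) = UNIV" "\<And>i j x y. x \<in> A j \<Longrightarrow> y \<in> A j \<Longrightarrow> \<bar>\<phi> i x - \<phi> i y\<bar> \<le> d"
    using small_oscillation_partition[of \<phi> 1 d] assms(1) 1 d by metis
  define c where "c i j = \<phi> i (SOME x. x \<in> A j)" for i j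
  have c: "\<bar>\<phi> i x - c i j\<bar> \<le> d" if "x \<in> A j" for x i j
    unfolding c_def using J(5)[OF that someI[of "\<lambda>x. x \<in> A j", OF that]] .
  have dj: "disjoint_family_on A J" using J(3) by (auto simp: disjoint_family_on_def)
  have "\<bar>signed_integral (\<lambda>A. \<nu> A $ i) (\<phi> i) - (\<Sum>j\<in>J. c i j * \<nu> (A j) $ i)\<bar>
      \<le> d * (measure (pos i) UNIV + measure (neg i) UNIV)" for i
    unfolding signed_integral_def
    using J c d(1) dj
    by (intro measure_difference.diff_partition_approx[OF measure_difference_pos_neg]) auto
  then have "(\<Sum>i\<in>UNIV. signed_integral (\<lambda>A. \<nu> A $ i) (\<phi> i)) \<le>
      (\<Sum>i\<in>UNIV. (\<Sum>j\<in>J. c i j * \<nu> (A j) $ i) + d * (measure (pos i) UNIV + measure (neg i) UNIV))"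
    by (intro sum_mono) (smt (verit))
  also have "\<dots> = (\<Sum>i\<in>UNIV. \<Sum>j\<in>J. c i j * \<nu> (A j) $ i) + d * K"
    by (simp add: sum.distrib K_def sum_distrib_left distrib_left)
  also have "(\<Sum>i\<in>UNIV. \<Sum>j\<in>J. c i j * \<nu> (A j) $ i) = (\<Sum>j\<in>J. \<Sum>i\<in>UNIV. c i j * \<nu> (A j) $ i)"
    by (rule sum.swap)
  also have "\<dots> \<le> (\<Sum>j\<in>J. norm (\<nu> (A j)))"
  proof (rule sum_mono)
    fix j
    let ?c = "\<chi> i. c i j"
    have "norm ?c \<le> 1"
      using le[of "SOME x. x \<in> A j"] by (simp add: norm_vec_def L2_set_def c_def real_sqrt_le_1_iff)
    have "(\<Sum>i\<in>UNIV. c i j * \<nu> (A j) $ i) = ?c \<bullet> \<nu> (A j)" by (simp add: inner_vec_def)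
    also have "\<dots> \<le> norm ?c * norm (\<nu> (A j))" by (rule norm_cauchy_schwarz)
    also have "\<dots> \<le> norm (\<nu> (A j))" using \<open>norm ?c \<le> 1\<close> by (simp add: mult_left_le_one_le)
    finally show "(\<Sum>i\<in>UNIV. c i j * \<nu> (A j) $ i) \<le> norm (\<nu> (A j))" .
  qed
  also have "\<dots> \<le> tv UNIV"
  proof -
    have "(\<Sum>j\<in>J. ennreal (norm (\<nu> (A j)))) \<le> total_variation \<nu> UNIV"
      using J dj by (intro total_variation_finite_upper) auto
    then have "ennreal (\<Sum>j\<in>J. norm (\<nu> (A j))) \<le> ennreal (tv UNIV)"
      by (simp add: total_variation_eq_tv sum_ennreal)
    then show ?thesis by (simp only: ennreal_le_iff[OF tv_nonneg])
  qed
  finally show "(\<Sum>i\<in>UNIV. signed_integral (\<lambda>A. \<nu> A $ i) (\<phi> i)) \<le> tv UNIV + e"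
    using d(2) by simp
qed

end

section \<open>The perimeter as a supremum over test fields\<close>

text \<open>
  Fields are families of coefficients with respect to the vector fields, hence the Euclidean norm
  of the coefficients is bounded rather than that of a tangent vector.
\<close>

definition test_field :: "('i::finite \<Rightarrow> 'a::euclidean_space \<Rightarrow> real) \<Rightarrow> bool" where
  "test_field \<phi> \<longleftrightarrow> (\<forall>i. test_function (\<phi> i)) \<and> (\<forall>x. (\<Sum>i\<in>UNIV. (\<phi> i x)\<^sup>2) \<le> 1)"

lemma test_field_component_le:
  assumes "test_field \<phi>" shows "\<bar>\<phi> i x\<bar> \<le> 1"
proof -
  have "(\<phi> i x)\<^sup>2 \<le> (\<Sum>i\<in>UNIV. (\<phi> i x)\<^sup>2)" by (rule member_le_sum) auto
  also have "\<dots> \<le> 1" using assms by (simp add: test_field_def)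
  finally show ?thesis by (simp only: abs_square_le_1)
qed

lemma (in finite_measure) integral_near_indicator:
  fixes \<psi> :: "'a \<Rightarrow> real"
  assumes [measurable]: "\<psi> \<in> borel_measurable M" "K \<in> sets M" "U \<in> sets M" and "K \<subseteq> U"
    and \<psi>: "\<And>x. 0 \<le> \<psi> x" "\<And>x. \<psi> x \<le> 1" "\<And>x. x \<in> K \<Longrightarrow> 1 - e \<le> \<psi> x" "\<And>x. x \<notin> U \<Longrightarrow> \<psi> x = 0"
    and "0 \<le> e"
  shows "\<bar>(LINT x|M. \<psi> x) - measure M K\<bar> \<le> e * measure M (space M) + measure M (U - K)"
proof -
  have i: "integrable M \<psi>" using \<psi> by (intro integrable_const_bound[of _ 1] AE_I2) auto
  have ind: "integrable M (indicat_real A)" if "A \<in> sets M" for A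
    using that by (intro integrable_real_indicator) (auto simp: emeasure_eq_measure)
  have ie: "integrable M (\<lambda>x. e + indicat_real (U - K) x)" using ind by auto
  have "\<bar>(LINT x|M. \<psi> x - indicat_real K x)\<bar> \<le> (LINT x|M. e + indicat_real (U - K) x)"
  proof (rule order_trans[OF integral_abs_bound integral_mono[OF _ ie]])
    show "integrable M (\<lambda>x. \<bar>\<psi> x - indicat_real K x\<bar>)" using i ind by auto
    show "\<bar>\<psi> x - indicat_real K x\<bar> \<le> e + indicat_real (U - K) x" for x
    proof -
      consider "x \<in> K" | "x \<in> U - K" | "x \<notin> U" by blast
      then show ?thesis
      proof cases
        case 1 then show ?thesis using \<psi>(2)[of x] \<psi>(3)[of x] by auto
      next
        case 2 then show ?thesis using \<psi>(1,2)[of x] \<open>0 \<le> e\<close> by auto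
      next
        case 3
        then have "x \<notin> K" using \<open>K \<subseteq> U\<close> by blast
        then show ?thesis using \<psi>(4)[OF 3] 3 \<open>0 \<le> e\<close> by auto
      qed
    qed
  qed
  moreover have "(LINT x|M. \<psi> x - indicat_real K x) = (LINT x|M. \<psi> x) - measure M K"
    using i ind by (subst Bochner_Integration.integral_diff) (auto simp: sets.Int_space_eq2)
  moreover have "(LINT x|M. e + indicat_real (U - K) x) = e * measure M (space M) + measure M (U - K)"
    using ind[of "U - K"] by (subst Bochner_Integration.integral_add) (auto simp: sets.Int_space_eq2 mult.commute)
  ultimately show ?thesis by simp
qed

lemma disjoint_compacts_separated:
  fixes K :: "nat \<Rightarrow> 'a::euclidean_space set"
  assumes "\<And>j. compact (K j)" "\<And>i j. i \<noteq> j \<Longrightarrow> K i \<inter> K j = {}"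
  obtains \<delta> where "\<delta> > 0" "\<And>i j x y. i < n \<Longrightarrow> j < n \<Longrightarrow> i \<noteq> j \<Longrightarrow> x \<in> K i \<Longrightarrow> y \<in> K j \<Longrightarrow> \<delta> \<le> dist x y"
proof -
  have "\<exists>d>0. \<forall>x\<in>K i. \<forall>y\<in>K j. d \<le> dist x y" if "i \<noteq> j" for i j
    using separate_compact_closed[OF assms(1)[of i] compact_imp_closed[OF assms(1)[of j]] assms(2)[OF that]] by blast
  then obtain d where d: "\<And>i j. i \<noteq> j \<Longrightarrow> d i j > 0" "\<And>i j x y. i \<noteq> j \<Longrightarrow> x \<in> K i \<Longrightarrow> y \<in> K j \<Longrightarrow> d i j \<le> dist x y"
    by metis
  let ?D = "insert 1 ((\<lambda>(i, j). d i j) ` {(i, j). i < n \<and> j < n \<and> i \<noteq> j})"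
  have "{(i, j). i < n \<and> j < n \<and> i \<noteq> j} \<subseteq> {..<n} \<times> {..<n}" by auto
  then have fin: "finite ?D" using finite_subset by blast
  show ?thesis
  proof (rule that[of "Min ?D"])
    show "Min ?D > 0" using fin d(1) by (subst Min_gr_iff) auto
    show "Min ?D \<le> dist x y" if *: "i < n" "j < n" "i \<noteq> j" "x \<in> K i" "y \<in> K j" for i j x y
    proof -
      have "d i j \<in> ?D" using * by force
      then have "Min ?D \<le> d i j" using fin by (intro Min_le)
      then show ?thesis using d(2)[OF *(3-5)] by linarith
    qed
  qed
qed

locale finite_vector_measure_euclidean =
  finite_vector_measure \<nu> for \<nu> :: "'a::euclidean_space set \<Rightarrow> real ^ 'i::finite"
begin

lemma emeasure_variation_eq_tv: "A \<in> sets borel \<Longrightarrow> emeasure (variation_measure \<nu>) A = ennreal (tv A)"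
  by (simp add: emeasure_variation_measure[OF vm] total_variation_eq_tv)

lemma space_variation_measure: "space (variation_measure \<nu>) = UNIV"
  using sets_eq_imp_space_eq[OF sets_variation_measure[of \<nu>]] by simp

lemma tv_Diff:
  assumes "A \<in> sets borel" "B \<in> sets borel" "B \<subseteq> A"
  shows "tv (A - B) = tv A - tv B"
proof -
  interpret finite_measure "variation_measure \<nu>"
    by (rule finite_measureI) (simp add: space_variation_measure emeasure_variation_eq_tv)
  have m: "measure (variation_measure \<nu>) A = tv A" if "A \<in> sets borel" for A
    using emeasure_variation_eq_tv[OF that] tv_nonneg by (simp add: measure_def)
  show ?thesis
    using finite_measure_Diff[of A B] assms by (simp add: m sets_variation_measure)
qed

lemma tv_inner_regular:
  assumes A: "A \<in> sets borel" and e: "0 < e"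
  obtains K where "compact K" "K \<subseteq> A" "tv (A - K) < e"
proof -
  have "ennreal (tv A) = (SUP K\<in>{K. K \<subseteq> A \<and> compact K}. emeasure (variation_measure \<nu>) K)"
    using inner_regular[OF sets_variation_measure, of \<nu> A] A
    by (simp add: space_variation_measure emeasure_variation_eq_tv)
  moreover have "\<exists>K. K \<subseteq> A \<and> compact K \<and> tv A - e < tv K"
  proof (cases "tv A - e < 0")
    case True then show ?thesis using tv_nonneg[of "{}"] by (intro exI[of _ "{}"]) (auto simp: less_le_trans)
  next
    case False
    then have "ennreal (tv A - e) < ennreal (tv A)" using e by (intro ennreal_lessI) auto
    then obtain K where K: "K \<subseteq> A" "compact K" "ennreal (tv A - e) < emeasure (variation_measure \<nu>) K"
      unfolding calculation less_SUP_iff by blast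
    then have "ennreal (tv A - e) < ennreal (tv K)"
      by (simp add: emeasure_variation_eq_tv compact_imp_closed)
    then show ?thesis using K False by (auto simp: ennreal_less_iff)
  qed
  ultimately obtain K where K: "K \<subseteq> A" "compact K" "tv A - e < tv K" by blast
  then show ?thesis using that[of K] tv_Diff[of A K] A by (simp add: compact_imp_closed)
qed

lemma tv_outer_regular:
  assumes A: "A \<in> sets borel" and e: "0 < e"
  obtains U where "open U" "A \<subseteq> U" "tv (U - A) < e"
proof -
  have "(INF U\<in>{U. A \<subseteq> U \<and> open U}. emeasure (variation_measure \<nu>) U) = ennreal (tv A)"
    using outer_regular[OF sets_variation_measure, of \<nu> A] A
    by (simp add: space_variation_measure emeasure_variation_eq_tv)
  also have "\<dots> < ennreal (tv A + e)"
    using e tv_nonneg[of A] by (intro ennreal_lessI) auto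
  finally obtain U where U: "A \<subseteq> U" "open U" "emeasure (variation_measure \<nu>) U < ennreal (tv A + e)"
    unfolding INF_less_iff by auto
  then have "ennreal (tv U) < ennreal (tv A + e)" by (simp add: emeasure_variation_eq_tv)
  then have "tv U < tv A + e" using tv_nonneg by (simp add: ennreal_less_iff)
  then show ?thesis using that[of U] U tv_Diff[of U A] A by simp
qed

text \<open>
  A function between the indicators of a set K and of a neighborhood of K with small excess
  variation integrates almost to the measure of K.
\<close>

lemma signed_integral_near_component:
  fixes \<psi> :: "'a \<Rightarrow> real"
  assumes [measurable]: "\<psi> \<in> borel_measurable borel" "K \<in> sets borel" "U \<in> sets borel" and "K \<subseteq> U"
    and \<psi>: "\<And>x. 0 \<le> \<psi> x" "\<And>x. \<psi> x \<le> 1" "\<And>x. x \<in> K \<Longrightarrow> 1 - e \<le> \<psi> x" "\<And>x. x \<notin> U \<Longrightarrow> \<psi> x = 0"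
    and "0 \<le> e" "tv (U - K) \<le> e"
  shows "\<bar>signed_integral (\<lambda>A. \<nu> A $ i) \<psi> - \<nu> K $ i\<bar> \<le> 2 * (e * (tv UNIV + 1))"
proof -
  interpret D: measure_difference "pos i" "neg i" "\<lambda>A. \<nu> A $ i" by (rule measure_difference_pos_neg)
  have sp: "space (pos i) = UNIV" "space (neg i) = UNIV"
    using sets_eq_imp_space_eq[OF sets_pos] sets_eq_imp_space_eq[OF sets_neg] by simp_all
  have le: "measure (pos i) A \<le> tv A" "measure (neg i) A \<le> tv A" if "A \<in> sets borel" for A
    using abs_le_D1[OF abs_le_ctv[OF that, of i]] abs_le_D2[OF abs_le_ctv[OF that, of i]]
      ctv_le_tv[OF that, of i] unfolding measure_pos[OF that] measure_neg[OF that] by simp_all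
  have UK: "U - K \<in> sets borel" by simp
  have eU: "e * measure (pos i) UNIV \<le> e * tv UNIV" "e * measure (neg i) UNIV \<le> e * tv UNIV"
    using \<open>0 \<le> e\<close> le by (auto intro!: mult_left_mono)
  have "\<bar>(LINT x|pos i. \<psi> x) - measure (pos i) K\<bar> \<le> e * measure (pos i) (space (pos i)) + measure (pos i) (U - K)"
    using assms by (intro D.P.integral_near_indicator) (auto simp: sets_pos measurable_cong_sets[OF sets_pos])
  moreover have "\<bar>(LINT x|neg i. \<psi> x) - measure (neg i) K\<bar> \<le> e * measure (neg i) (space (neg i)) + measure (neg i) (U - K)"
    using assms by (intro D.N.integral_near_indicator) (auto simp: sets_neg measurable_cong_sets[OF sets_neg])
  moreover have "\<nu> K $ i = measure (pos i) K - measure (neg i) K"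
    using D.diff[of K] by simp
  ultimately show ?thesis
    using eU le[OF UK] \<open>tv (U - K) \<le> e\<close> unfolding sp signed_integral_def distrib_left by linarith
qed

text \<open>
  Test fields recover the total variation: by regularity, the pieces of a Borel partition may be
  shrunk to compact sets, and near each of them the field follows the direction of the measure.
\<close>

lemma total_variation_le_test_fields:
  assumes le: "\<And>\<phi>. test_field \<phi> \<Longrightarrow> (\<Sum>i\<in>UNIV. signed_integral (\<lambda>A. \<nu> A $ i) (\<phi> i)) \<le> c"
  shows "total_variation \<nu> UNIV \<le> ennreal c"
proof (rule total_variation_least)
  fix A :: "nat \<Rightarrow> 'a set" and n
  assume A: "range A \<subseteq> sets borel" "disjoint_family A"
  define D where "D = real n * (1 + real CARD('i) * (2 * (tv UNIV + 1)))"
  have D: "0 \<le> D" by (auto simp: D_def tv_nonneg intro!: mult_nonneg_nonneg add_nonneg_nonneg)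
  have *: "(\<Sum>j<n. norm (\<nu> (A j))) \<le> c + e * D" if e: "0 < e" for e
  proof -
    have "\<exists>K. compact K \<and> K \<subseteq> A j \<and> tv (A j - K) < e" for j
    proof -
      have "A j \<in> sets borel" using A by auto
      then show ?thesis by (rule tv_inner_regular[OF _ e]) blast
    qed
    then obtain K where K: "\<And>j. compact (K j)" "\<And>j. K j \<subseteq> A j" "\<And>j. tv (A j - K j) < e" by metis
    have Kb: "K j \<in> sets borel" for j using K(1) by (simp add: compact_imp_closed)
    have "\<exists>V. open V \<and> K j \<subseteq> V \<and> tv (V - K j) < e" for j
      by (rule tv_outer_regular[OF Kb e]) blast
    then obtain V where V: "\<And>j. open (V j)" "\<And>j. K j \<subseteq> V j" "\<And>j. tv (V j - K j) < e" by metis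
    have Kd: "K i \<inter> K j = {}" if "i \<noteq> j" for i j
      using A(2) K(2)[of i] K(2)[of j] that unfolding disjoint_family_on_def by blast
    obtain \<delta> where \<delta>: "\<delta> > 0" "\<And>i j x y. i < n \<Longrightarrow> j < n \<Longrightarrow> i \<noteq> j \<Longrightarrow> x \<in> K i \<Longrightarrow> y \<in> K j \<Longrightarrow> \<delta> \<le> dist x y"
      by (rule disjoint_compacts_separated[of K n]) (rule K(1), erule Kd, rule that)
    define U where "U j = V j \<inter> (\<Union>y\<in>K j. ball y (\<delta> / 2))" for j
    have U: "open (U j)" "K j \<subseteq> U j" for j
      using V \<delta>(1) by (auto simp: U_def intro!: open_Int open_UN)
    have Ud: "U i \<inter> U j = {}" if "i < n" "j < n" "i \<noteq> j" for i j
    proof (rule ccontr)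
      assume "U i \<inter> U j \<noteq> {}"
      then obtain x y z where "y \<in> K i" "z \<in> K j" "dist y x < \<delta> / 2" "dist z x < \<delta> / 2"
        by (auto simp: U_def)
      moreover from this have "dist y z < \<delta>" using dist_triangle_half_l[of y x \<delta> z] by simp
      ultimately show False using \<delta>(2)[OF that] by fastforce
    qed
    have Ue: "tv (U j - K j) \<le> e" for j
    proof -
      have "total_variation \<nu> (U j - K j) \<le> total_variation \<nu> (V j - K j)"
        using U V Kb by (intro total_variation_mono) (auto simp: U_def)
      then have "ennreal (tv (U j - K j)) \<le> ennreal (tv (V j - K j))"
        using U V Kb by (simp add: total_variation_eq_tv)
      then show ?thesis using V(3)[of j] by (simp add: ennreal_le_iff tv_nonneg)
    qed
    have "\<exists>\<psi>. test_function \<psi> \<and> (\<forall>x. 0 \<le> \<psi> x) \<and> (\<forall>x. \<psi> x \<le> 1) \<and> (\<forall>x\<in>K j. 1 - e \<le> \<psi> x) \<and> (\<forall>x. x \<notin> U j \<longrightarrow> \<psi> x = 0)" for j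
      by (rule smooth_cutoff[OF K(1) U e]) blast
    then obtain \<psi> where \<psi>: "\<And>j. test_function (\<psi> j)" "\<And>j x. 0 \<le> \<psi> j x" "\<And>j x. \<psi> j x \<le> 1"
      "\<And>j x. x \<in> K j \<Longrightarrow> 1 - e \<le> \<psi> j x" "\<And>j x. x \<notin> U j \<Longrightarrow> \<psi> j x = 0"
      by metis
    \<comment> \<open>the constant direction that attains the norm on K j\<close>
    define u where "u j = sgn (\<nu> (K j))" for j
    have u1: "norm (u j) \<le> 1" for j by (simp add: u_def norm_sgn)
    have u1': "\<bar>u j $ i\<bar> \<le> 1" for i j using component_le_norm_cart[of "u j" i] u1[of j] by linarith
    define \<phi> where "\<phi> i x = (\<Sum>j<n. u j $ i * \<psi> j x)" for i x
    have "(\<Sum>i\<in>UNIV. (\<phi> i x)\<^sup>2) \<le> 1" for x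
    proof (cases "\<exists>j<n. x \<in> U j")
      case True
      then obtain j where j: "j < n" "x \<in> U j" by blast
      have "\<phi> i x = u j $ i * \<psi> j x" for i
      proof -
        have "\<phi> i x = (\<Sum>k<n. if k = j then u j $ i * \<psi> j x else 0)"
          unfolding \<phi>_def
        proof (rule sum.cong)
          fix k assume "k \<in> {..<n}"
          moreover have "x \<notin> U k" if "k \<noteq> j" "k < n" using Ud[of k j] j that by blast
          ultimately show "u k $ i * \<psi> k x = (if k = j then u j $ i * \<psi> j x else 0)"
            using \<psi>(5) by auto
        qed simp
        then show ?thesis using j by simp
      qed
      then have "(\<Sum>i\<in>UNIV. (\<phi> i x)\<^sup>2) = (\<Sum>i\<in>UNIV. (u j $ i)\<^sup>2) * (\<psi> j x)\<^sup>2"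
        by (simp add: power_mult_distrib sum_distrib_right)
      also have "\<dots> \<le> 1 * 1"
      proof (intro mult_mono)
        show "(\<Sum>i\<in>UNIV. (u j $ i)\<^sup>2) \<le> 1"
          using u1[of j] by (simp add: norm_vec_def L2_set_def real_sqrt_le_1_iff)
        show "(\<psi> j x)\<^sup>2 \<le> 1" using \<psi>(2,3)[of j x] by (simp add: power_le_one)
      qed auto
      finally show ?thesis by simp
    next
      case False
      then have "\<phi> i x = 0" for i using \<psi>(5) by (auto simp: \<phi>_def)
      then show ?thesis by simp
    qed
    moreover have "test_function (\<phi> i)" for i
      unfolding \<phi>_def using \<psi>(1) by (intro test_function_sum_mult) auto
    ultimately have "test_field \<phi>" by (simp add: test_field_def)
    define S where "S i j = signed_integral (\<lambda>A. \<nu> A $ i) (\<psi> j)" for i j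
    have \<psi>m: "\<psi> j \<in> borel_measurable borel" for j using \<psi>(1) test_functionD(4) by blast
    have \<psi>1: "\<bar>\<psi> j x\<bar> \<le> 1" for j x using \<psi>(2,3)[of j x] by simp
    have S_sum: "signed_integral (\<lambda>A. \<nu> A $ i) (\<phi> i) = (\<Sum>j<n. u j $ i * S i j)" for i
    proof -
      have "(LINT x|M. \<phi> i x) = (\<Sum>j<n. u j $ i * (LINT x|M. \<psi> j x))" if "\<And>j. integrable M (\<psi> j)" for M
        unfolding \<phi>_def using that by (subst Bochner_Integration.integral_sum) auto
      then show ?thesis unfolding signed_integral_def S_def
        using integrable_pos[OF \<psi>m \<psi>1] integrable_neg[OF \<psi>m \<psi>1]
        by (simp add: sum_subtractf right_diff_distrib)
    qed
    define B where "B = 2 * (e * (tv UNIV + 1))"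
    have S_near: "\<bar>S i j - \<nu> (K j) $ i\<bar> \<le> B" for i j
      unfolding S_def B_def using \<psi> U Kb Ue \<psi>m e
      by (intro signed_integral_near_component[of _ _ "U j"]) auto
    have piece: "norm (\<nu> (A j)) - e - real CARD('i) * B \<le> (\<Sum>i\<in>UNIV. u j $ i * S i j)" for j
    proof -
      have Aj: "A j \<in> sets borel" using A by auto
      have "norm (\<nu> (A j)) - norm (\<nu> (K j)) \<le> norm (\<nu> (A j) - \<nu> (K j))" by (rule norm_triangle_ineq2)
      also have "\<dots> = norm (\<nu> (A j - K j))" using vector_measure_Diff[OF vm Aj Kb K(2)] by simp
      also have "\<dots> \<le> e" using norm_le_tv[of "A j - K j"] K(3)[of j] Aj Kb[of j] by force
      finally have "norm (\<nu> (A j)) - e \<le> norm (\<nu> (K j))" by simp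
      also have "\<dots> = u j \<bullet> \<nu> (K j)"
        by (cases "\<nu> (K j) = 0") (simp_all add: u_def sgn_div_norm power2_norm_eq_inner[symmetric] power2_eq_square)
      also have "\<dots> = (\<Sum>i\<in>UNIV. u j $ i * \<nu> (K j) $ i)" by (simp add: inner_vec_def)
      also have "\<dots> \<le> (\<Sum>i\<in>UNIV. u j $ i * S i j + B)"
      proof (rule sum_mono)
        fix i
        have "u j $ i * (\<nu> (K j) $ i - S i j) \<le> \<bar>u j $ i\<bar> * \<bar>S i j - \<nu> (K j) $ i\<bar>"
          by (metis abs_ge_self abs_minus_commute abs_mult)
        also have "\<dots> \<le> 1 * B" by (intro mult_mono u1' S_near) auto
        finally show "u j $ i * \<nu> (K j) $ i \<le> u j $ i * S i j + B" by (simp add: right_diff_distrib)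
      qed
      finally show ?thesis by (simp add: sum.distrib)
    qed
    have "(\<Sum>j<n. norm (\<nu> (A j)) - e - real CARD('i) * B) \<le> (\<Sum>j<n. \<Sum>i\<in>UNIV. u j $ i * S i j)"
      by (intro sum_mono piece)
    also have "\<dots> = (\<Sum>i\<in>UNIV. \<Sum>j<n. u j $ i * S i j)" by (rule sum.swap)
    also have "\<dots> \<le> c" using le[OF \<open>test_field \<phi>\<close>] by (simp add: S_sum)
    finally show ?thesis by (simp add: sum_subtractf D_def B_def algebra_simps)
  qed
  have "(\<Sum>j<n. norm (\<nu> (A j))) \<le> c"
  proof (rule field_le_epsilon)
    fix e :: real assume e: "0 < e"
    have "e / (D + 1) * D \<le> e" using D e by (simp add: field_simps)
    then show "(\<Sum>j<n. norm (\<nu> (A j))) \<le> c + e" using *[of "e / (D + 1)"] D e by simp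
  qed
  then show "(\<Sum>j<n. ennreal (norm (\<nu> (A j)))) \<le> ennreal c"
    by (subst sum_ennreal) (auto intro: ennreal_leI)
qed

end

text \<open>
  Integration by parts turns the pairing of a field with the gradient of a set into an expression
  that makes sense for all sets.
\<close>

definition field_variation ::
  "('i::finite \<Rightarrow> 'a::euclidean_space \<Rightarrow> 'a) \<Rightarrow> 'a set \<Rightarrow> ('i \<Rightarrow> 'a \<Rightarrow> real) \<Rightarrow> real" where
  "field_variation X E \<phi> = (\<Sum>i\<in>UNIV. distr_deriv (X i) (indicat_real E) (\<phi> i))"

lemma finite_vector_measure_gradient:
  "is_distr_gradient X f \<nu> \<Longrightarrow> finite_vector_measure_euclidean \<nu>"
  by (simp add: is_distr_gradient_def finite_vector_measure_euclidean_def finite_vector_measure_def)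

lemma perimeter_finiteD:
  assumes "perimeter X E < \<infinity>"
  obtains \<nu> where "is_distr_gradient X (indicat_real E) \<nu>" "perimeter X E = total_variation \<nu> UNIV"
proof -
  have ex: "\<exists>\<nu>. is_distr_gradient X (indicat_real E) \<nu>"
    using assms unfolding perimeter_def by (auto split: if_splits)
  show ?thesis
    by (rule that[OF someI_ex[OF ex]]) (use ex in \<open>simp add: perimeter_def\<close>)
qed

text \<open>
  This also holds for sets of infinite perimeter, so that lower bounds of perimeters need no case
  distinction.
\<close>

lemma field_variation_le_perimeter:
  assumes "test_field \<phi>"
  shows "ennreal (field_variation X E \<phi>) \<le> perimeter X E"
proof (cases "perimeter X E < \<infinity>")
  case True
  obtain \<nu> where \<nu>: "is_distr_gradient X (indicat_real E) \<nu>" "perimeter X E = total_variation \<nu> UNIV"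
    by (rule perimeter_finiteD[OF True])
  interpret finite_vector_measure_euclidean \<nu> by (rule finite_vector_measure_gradient[OF \<nu>(1)])
  have "field_variation X E \<phi> = (\<Sum>i\<in>UNIV. signed_integral (\<lambda>A. \<nu> A $ i) (\<phi> i))"
    unfolding field_variation_def using \<nu>(1) assms by (simp add: is_distr_gradient_def test_field_def)
  also have "\<dots> \<le> tv UNIV"
    using assms by (intro sum_signed_integral_le_tv) (auto simp: test_field_def test_functionD)
  finally show ?thesis unfolding \<nu>(2) by (simp add: total_variation_eq_tv ennreal_leI)
qed (simp add: less_top[symmetric])

text \<open>
  The existence of a gradient is a hypothesis: bounds on test fields alone would require a
  representation theorem for functionals. Gradients are obtained from limits of measures instead.
\<close>

lemma perimeter_le_field_variation:
  assumes "is_distr_gradient X (indicat_real E) \<nu>"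
    and "\<And>\<phi>. test_field \<phi> \<Longrightarrow> field_variation X E \<phi> \<le> c"
  shows "perimeter X E \<le> ennreal c"
proof -
  define \<nu>' where "\<nu>' = (SOME \<nu>. is_distr_gradient X (indicat_real E) \<nu>)"
  have \<nu>': "is_distr_gradient X (indicat_real E) \<nu>'"
    unfolding \<nu>'_def by (rule someI[of "is_distr_gradient X (indicat_real E)", OF assms(1)])
  interpret finite_vector_measure_euclidean \<nu>' by (rule finite_vector_measure_gradient[OF \<nu>'])
  have "(\<Sum>i\<in>UNIV. signed_integral (\<lambda>A. \<nu>' A $ i) (\<phi> i)) \<le> c" if "test_field \<phi>" for \<phi>
    using assms(2)[OF that] that \<nu>'
    unfolding field_variation_def by (simp add: is_distr_gradient_def test_field_def)
  then have "total_variation \<nu>' UNIV \<le> ennreal c" by (rule total_variation_le_test_fields)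
  moreover have "perimeter X E = total_variation \<nu>' UNIV"
    unfolding perimeter_def \<nu>'_def using assms(1) by auto
  ultimately show ?thesis by simp
qed

text \<open>
  The components of a gradient, in a form that passes to limits and is invariant under changes of
  variables.
\<close>

definition bounded_variation_by ::
  "real \<Rightarrow> ('i::finite \<Rightarrow> 'a::euclidean_space \<Rightarrow> 'a) \<Rightarrow> 'a set \<Rightarrow> bool" where
  "bounded_variation_by C X E \<longleftrightarrow> (\<forall>i. \<exists>p n. finite_measure p \<and> finite_measure n \<and>
     sets p = sets borel \<and> sets n = sets borel \<and> measure p UNIV \<le> C \<and> measure n UNIV \<le> C \<and>
     (\<forall>\<phi>. test_function \<phi> \<longrightarrow>
        distr_deriv (X i) (indicat_real E) \<phi> = (LINT x|p. \<phi> x) - (LINT x|n. \<phi> x)))"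

lemma perimeter_imp_bounded_variation_by:
  fixes X :: "'i::finite \<Rightarrow> 'a::euclidean_space \<Rightarrow> 'a"
  assumes "perimeter X E \<le> ennreal C" "0 \<le> C"
  shows "bounded_variation_by C X E"
proof -
  obtain \<nu> where \<nu>: "is_distr_gradient X (indicat_real E) \<nu>" "perimeter X E = total_variation \<nu> UNIV"
    using perimeter_finiteD[of X E] assms(1) by (metis ennreal_less_top infinity_ennreal_def le_less_trans)
  interpret finite_vector_measure_euclidean \<nu> by (rule finite_vector_measure_gradient[OF \<nu>(1)])
  have tvC: "tv UNIV \<le> C" using assms unfolding \<nu>(2) by (simp add: total_variation_eq_tv ennreal_le_iff)
  show ?thesis unfolding bounded_variation_by_def
  proof (intro allI exI conjI impI)
    fix i
    interpret D: measure_difference "pos i" "neg i" "\<lambda>A. \<nu> A $ i" by (rule measure_difference_pos_neg)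
    show "finite_measure (pos i)" "finite_measure (neg i)" by unfold_locales
    show "sets (pos i) = sets borel" "sets (neg i) = sets borel" by (rule sets_pos sets_neg)+
    have U: "UNIV \<in> sets (borel :: 'a measure)" by simp
    show "measure (pos i) UNIV \<le> C" "measure (neg i) UNIV \<le> C"
      using abs_le_D1[OF abs_le_ctv[OF U, of i]] abs_le_D2[OF abs_le_ctv[OF U, of i]]
        ctv_le_tv[OF U, of i] tvC unfolding measure_pos[OF U] measure_neg[OF U] by simp_all
    show "distr_deriv (X i) (indicat_real E) \<phi> = (LINT x|pos i. \<phi> x) - (LINT x|neg i. \<phi> x)"
      if "test_function \<phi>" for \<phi>
      using \<nu>(1) that by (simp add: is_distr_gradient_def signed_integral_def)
  qed
qed

text \<open>
  The components are assembled to a vector measure, and the integral against a component does not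
  depend on the decomposition.
\<close>

lemma bounded_variation_by_imp_gradient:
  fixes X :: "'i::finite \<Rightarrow> 'a::euclidean_space \<Rightarrow> 'a"
  assumes "bounded_variation_by C X E"
  obtains \<nu> where "is_distr_gradient X (indicat_real E) \<nu>"
proof -
  obtain p n where pn: "\<And>i. finite_measure (p i)" "\<And>i. finite_measure (n i)" "\<And>i. sets (p i) = sets borel"
    "\<And>i. sets (n i) = sets borel"
    "\<And>i \<phi>. test_function \<phi> \<Longrightarrow> distr_deriv (X i) (indicat_real E) \<phi> = (LINT x|p i. \<phi> x) - (LINT x|n i. \<phi> x)"
    using assms unfolding bounded_variation_by_def by metis
  define \<nu> :: "'a set \<Rightarrow> real ^ 'i" where "\<nu> A = (\<chi> i. measure (p i) A - measure (n i) A)" for A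
  have md: "measure_difference (p i) (n i) (\<lambda>A. \<nu> A $ i)" for i
    using pn by (simp add: measure_difference_def measure_difference_axioms_def \<nu>_def)
  have vm: "vector_measure \<nu>" unfolding vector_measure_def
  proof safe
    fix A :: "nat \<Rightarrow> 'a set" assume "range A \<subseteq> sets borel" "disjoint_family A"
    then have "(\<lambda>k. \<nu> (A k) $ i) sums (\<nu> (\<Union>k. A k) $ i)" for i
      using vector_measure_sums[OF vector_measureI_difference[OF md]] by blast
    then show "(\<lambda>k. \<nu> (A k)) sums \<nu> (\<Union>k. A k)"
      unfolding sums_def by (intro vec_tendstoI) simp
  qed
  define b where "b A = (\<Sum>i\<in>UNIV. measure (p i) A + measure (n i) A)" for A
  have "total_variation \<nu> UNIV \<le> ennreal (b UNIV)"
  proof (rule total_variation_le_additive)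
    show "norm (\<nu> A) \<le> b A" for A
      unfolding b_def by (rule order_trans[OF norm_le_l1_cart sum_mono]) (simp add: \<nu>_def abs_le_iff)
    show "(\<lambda>k. b (A k)) sums b (\<Union>k. A k)"
      if A: "range A \<subseteq> sets borel" "disjoint_family A" for A :: "nat \<Rightarrow> 'a set"
      unfolding b_def using A pn
      by (intro sums_sum sums_add finite_measure.finite_measure_UNION) auto
  qed
  then have tv: "total_variation \<nu> UNIV < \<infinity>" by (simp add: le_less_trans)
  interpret finite_vector_measure \<nu> using vm tv by unfold_locales
  have "is_distr_gradient X (indicat_real E) \<nu>"
    unfolding is_distr_gradient_def
  proof (intro conjI allI impI vm tv)
    fix \<phi> :: "'a \<Rightarrow> real" and i assume \<phi>: "test_function \<phi>"
    obtain B where B: "\<And>x. \<bar>\<phi> x\<bar> \<le> B" using test_function_bounded[OF \<phi>] by blast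
    show "distr_deriv (X i) (indicat_real E) \<phi> = signed_integral (\<lambda>A. \<nu> A $ i) \<phi>"
      using signed_integral_component[OF md test_functionD(4)[OF \<phi>] B] pn(5)[OF \<phi>] by simp
  qed
  then show ?thesis by (rule that)
qed

section \<open>Vague compactness of bounded measures\<close>

text \<open>
  A continuous function of period 2 that is 0 on [0, 1/3] and 1 on [2/3, 1].
\<close>

definition tent :: "real \<Rightarrow> real" where
  "tent t = max 0 (min 1 (1 / 2 - cos (pi * t)))"

lemma continuous_on_tent: "continuous_on A tent"
  unfolding tent_def by (intro continuous_intros)

lemma tent_bounds: "0 \<le> tent t" "tent t \<le> 1" by (auto simp: tent_def)

lemma tent_digit:
  assumes "0 \<le> \<rho>" "\<rho> \<le> 1 / 3"
  shows "tent (2 * of_int m + 2 * of_bool a / 3 + \<rho>) = of_bool a"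
proof -
  let ?y = "2 * of_bool a / 3 + \<rho>"
  have "cos (pi * (2 * of_int m + ?y)) = cos (2 * pi * of_int m + pi * ?y)"
    by (simp add: algebra_simps)
  also have "\<dots> = cos (pi * ?y)" by (simp only: cos_add cos_int_2pin sin_int_2pin)
  finally have *: "cos (pi * (2 * of_int m + 2 * of_bool a / 3 + \<rho>)) = cos (pi * ?y)"
    by (simp add: add.assoc)
  show ?thesis
  proof (cases a)
    case True
    have "cos (pi * ?y) \<le> cos (2 * pi / 3)"
      using assms True by (intro cos_monotone_0_pi_le) (auto simp: field_simps)
    then show ?thesis using True unfolding tent_def * by (simp add: cos_120)
  next
    case False
    have "cos (pi / 3) \<le> cos (pi * ?y)"
      using assms False by (intro cos_monotone_0_pi_le) (auto simp: field_simps)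
    then show ?thesis using False unfolding tent_def * by (simp add: cos_60)
  qed
qed

text \<open>
  The point of the Cantor set whose ternary digits are twice the given bits.
\<close>

definition cantor_code :: "(nat \<Rightarrow> bool) \<Rightarrow> real" where
  "cantor_code b = (\<Sum>k. 2 * of_bool (b k) / 3 ^ Suc k)"

lemma geometric_third: "(\<lambda>k. 2 / 3 ^ Suc k) sums (1::real)"
  using sums_mult[OF geometric_sums[of "1 / 3 :: real"], of "2 / 3"]
  by (simp add: power_one_over divide_simps mult.commute)

lemma cantor_code_summable: "summable (\<lambda>k. 2 * of_bool (b k) / 3 ^ Suc k :: real)"
  by (rule summable_comparison_test'[OF sums_summable[OF geometric_third], of 0]) auto

lemma cantor_code_bounds: "0 \<le> cantor_code b" "cantor_code b \<le> 1"
proof -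
  show "0 \<le> cantor_code b" unfolding cantor_code_def
    by (intro suminf_nonneg cantor_code_summable) auto
  have "cantor_code b \<le> (\<Sum>k. 2 / 3 ^ Suc k)" unfolding cantor_code_def
    by (intro suminf_le cantor_code_summable sums_summable[OF geometric_third]) auto
  then show "cantor_code b \<le> 1" using sums_unique[OF geometric_third] by simp
qed

text \<open>
  Schoenberg's observation: after multiplication by a power of 3 and reduction modulo 2, only the
  corresponding ternary digit of a point of the Cantor set matters, and \<open>tent\<close> reads it off.
\<close>

lemma tent_cantor_code: "tent (3 ^ k * cantor_code b) = of_bool (b k)"
proof -
  let ?f = "\<lambda>k. 2 * of_bool (b k) / 3 ^ Suc k :: real"
  \<comment> \<open>the digits after position k contribute at most 1/3\<close>
  define \<rho> where "\<rho> = cantor_code (\<lambda>l. b (l + Suc k)) / 3"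
  have tail: "3 ^ k * (\<Sum>l. ?f (l + Suc k)) = \<rho>"
  proof -
    have "\<rho> = (\<Sum>l. (2 * of_bool (b (l + Suc k)) / 3 ^ Suc l) / 3)"
      unfolding \<rho>_def cantor_code_def by (rule suminf_divide[OF cantor_code_summable, symmetric])
    moreover have "3 ^ k * (\<Sum>l. ?f (l + Suc k)) = (\<Sum>l. 3 ^ k * ?f (l + Suc k))"
      by (rule suminf_mult[symmetric])
        (use summable_ignore_initial_segment[OF cantor_code_summable[of b], of "Suc k"] in simp)
    moreover have "3 ^ k * ?f (l + Suc k) = (2 * of_bool (b (l + Suc k)) / 3 ^ Suc l) / 3" for l
      by (simp add: power_add field_simps)
    ultimately show ?thesis by simp
  qed
  have head: "3 ^ k * (\<Sum>l<k. ?f l) = 2 * of_int (\<Sum>l<k. of_bool (b l) * 3 ^ (k - Suc l))"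
  proof -
    have "3 ^ k * ?f l = 2 * (of_bool (b l) * 3 ^ (k - Suc l))" if "l < k" for l
    proof -
      have "k = (k - Suc l) + Suc l" using that by simp
      then have "(3::real) ^ k = 3 ^ (k - Suc l) * 3 ^ Suc l" by (metis power_add)
      then show ?thesis by simp
    qed
    then have "3 ^ k * (\<Sum>l<k. ?f l) = (\<Sum>l<k. 2 * (of_bool (b l) * 3 ^ (k - Suc l)))"
      unfolding sum_distrib_left by (intro sum.cong) auto
    also have "\<dots> = 2 * of_int (\<Sum>l<k. of_bool (b l) * 3 ^ (k - Suc l))"
      by (simp only: of_int_sum of_int_mult of_int_of_bool of_int_power of_int_numeral sum_distrib_left)
    finally show ?thesis .
  qed
  have "cantor_code b = (\<Sum>l. ?f (l + Suc k)) + (\<Sum>l<Suc k. ?f l)"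
    unfolding cantor_code_def by (rule suminf_split_initial_segment[OF cantor_code_summable])
  then have "3 ^ k * cantor_code b = \<rho> + (3 ^ k * (\<Sum>l<k. ?f l) + 3 ^ k * ?f k)"
    by (simp add: distrib_left tail[simplified])
  also have "3 ^ k * ?f k = 2 * of_bool (b k) / 3" by simp
  finally have "3 ^ k * cantor_code b =
      2 * of_int (\<Sum>l<k. of_bool (b l) * 3 ^ (k - Suc l)) + 2 * of_bool (b k) / 3 + \<rho>"
    unfolding head by simp
  moreover have "0 \<le> \<rho>" "\<rho> \<le> 1 / 3"
    using cantor_code_bounds[of "\<lambda>l. b (l + Suc k)"] by (auto simp: \<rho>_def)
  ultimately show ?thesis using tent_digit by metis
qed

lemma binary_expansion:
  fixes u :: real
  assumes "0 \<le> u" "u < 1"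
  shows "(\<lambda>n. of_bool (odd \<lfloor>2 ^ Suc n * u\<rfloor>) / 2 ^ Suc n) sums u"
proof -
  have step: "\<lfloor>2 * x\<rfloor> = 2 * \<lfloor>x\<rfloor> + of_bool (odd \<lfloor>2 * x\<rfloor>)" for x :: real
  proof -
    have "\<lfloor>2 * x\<rfloor> = 2 * \<lfloor>x\<rfloor> \<or> \<lfloor>2 * x\<rfloor> = 2 * \<lfloor>x\<rfloor> + 1" by linarith
    then show ?thesis by auto
  qed
  have part: "(\<Sum>n<N. of_bool (odd \<lfloor>2 ^ Suc n * u\<rfloor>) / 2 ^ Suc n) = (of_int \<lfloor>2 ^ N * u\<rfloor> / 2 ^ N :: real)" for N
  proof (induction N)
    case 0
    have "\<lfloor>u\<rfloor> = 0" using assms by linarith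
    then show ?case by simp
  next
    case (Suc N)
    have "\<lfloor>2 ^ Suc N * u\<rfloor> = 2 * \<lfloor>2 ^ N * u\<rfloor> + of_bool (odd \<lfloor>2 ^ Suc N * u\<rfloor>)"
      using step[of "2 ^ N * u"] by (simp add: mult.assoc)
    then have "real_of_int \<lfloor>2 ^ Suc N * u\<rfloor> =
        real_of_int (2 * \<lfloor>2 ^ N * u\<rfloor> + of_bool (odd \<lfloor>2 ^ Suc N * u\<rfloor>))" by (rule arg_cong)
    also have "\<dots> = 2 * of_int \<lfloor>2 ^ N * u\<rfloor> + of_bool (odd \<lfloor>2 ^ Suc N * u\<rfloor>)" by simp
    finally have fl: "real_of_int \<lfloor>2 ^ Suc N * u\<rfloor> =
        2 * of_int \<lfloor>2 ^ N * u\<rfloor> + of_bool (odd \<lfloor>2 ^ Suc N * u\<rfloor>)" .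
    show ?case
      unfolding sum.lessThan_Suc Suc.IH fl by (simp only: power_Suc) (simp add: add_divide_distrib)
  qed
  have "(\<lambda>N. of_int \<lfloor>2 ^ N * u\<rfloor> / 2 ^ N) \<longlonglongrightarrow> u"
  proof (rule tendsto_sandwich)
    have "(\<lambda>N. u - (1 / 2) ^ N) \<longlonglongrightarrow> u - 0" by (intro tendsto_intros LIMSEQ_power_zero) auto
    then show "(\<lambda>N. u - (1 / 2) ^ N) \<longlonglongrightarrow> u" by simp
    have "u - (1 / 2) ^ N \<le> of_int \<lfloor>2 ^ N * u\<rfloor> / 2 ^ N" for N
    proof -
      have "2 ^ N * u - 1 \<le> of_int \<lfloor>2 ^ N * u\<rfloor>" by linarith
      then have "(2 ^ N * u - 1) / 2 ^ N \<le> of_int \<lfloor>2 ^ N * u\<rfloor> / 2 ^ N" by (rule divide_right_mono) simp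
      then show ?thesis by (simp add: diff_divide_distrib power_one_over)
    qed
    then show "\<forall>\<^sub>F N in sequentially. u - (1 / 2) ^ N \<le> of_int \<lfloor>2 ^ N * u\<rfloor> / 2 ^ N" by simp
    show "\<forall>\<^sub>F N in sequentially. of_int \<lfloor>2 ^ N * u\<rfloor> / 2 ^ N \<le> u"
      by (simp add: field_simps)
  qed simp
  then show ?thesis unfolding sums_def part .
qed

text \<open>
  A compactification of the space is a continuous image of the real line, with a measurable section.
  Hence vague limits of measures on the space can be found on the line, where Helly's theorem
  applies.
\<close>

lemma curve_with_measurable_section:
  obtains c :: "'a::euclidean_space \<Rightarrow> real" and G :: "real \<Rightarrow> 'a"
  where "c \<in> borel_measurable borel" "\<And>x. c x \<in> {0..1}" "continuous_on UNIV G"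
    "\<And>x. G (c x) = x /\<^sub>R (1 + norm x)"
proof -
  define d where "d = DIM('a)"
  have "0 < d" by (simp add: d_def)
  obtain e :: "nat \<Rightarrow> 'a" where e: "bij_betw e {..<d} Basis"
    using ex_bij_betw_nat_finite[OF finite_Basis] unfolding d_def atLeast0LessThan by blast
  define u where "u j x = (1 + (x /\<^sub>R (1 + norm x)) \<bullet> e j) / 2" for j x
  have u: "0 \<le> u j x" "u j x < 1" if "j < d" for j x
  proof -
    have "e j \<in> Basis" using e that by (auto simp: bij_betw_def)
    then have "\<bar>(x /\<^sub>R (1 + norm x)) \<bullet> e j\<bar> \<le> norm (x /\<^sub>R (1 + norm x))" by (rule Basis_le_norm)
    also have "\<dots> < 1" by (simp add: divide_simps add_pos_nonneg)
    finally have "\<bar>(x /\<^sub>R (1 + norm x)) \<bullet> e j\<bar> < 1" .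
    from this[unfolded abs_less_iff] show "0 \<le> u j x" "u j x < 1" unfolding u_def by auto
  qed
  have u_meas[measurable]: "u j \<in> borel_measurable borel" for j
    unfolding u_def by (intro borel_measurable_continuous_onI continuous_intros)
      (auto simp: add_nonneg_eq_0_iff)
  \<comment> \<open>the binary digits of the d coordinates are interleaved\<close>
  define b where "b x k = odd \<lfloor>2 ^ Suc (k div d) * u (k mod d) x\<rfloor>" for x k
  define c where "c x = cantor_code (b x)" for x
  define h where "h j t = (\<Sum>n. tent (3 ^ (n * d + j) * t) / 2 ^ Suc n)" for j t
  define G where "G t = (\<Sum>j<d. (2 * h j t - 1) *\<^sub>R e j)" for t
  have h_cont: "continuous_on UNIV (h j)" for j
  proof (rule uniform_limit_theorem)
    show "uniform_limit UNIV (\<lambda>N t. \<Sum>n<N. tent (3 ^ (n * d + j) * t) / 2 ^ Suc n) (h j) sequentially"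
      unfolding h_def
    proof (rule Weierstrass_m_test)
      show "summable (\<lambda>n. 1 / 2 ^ Suc n :: real)"
        using sums_summable[OF power_half_series] by (simp add: power_one_over)
      show "norm (tent (3 ^ (n * d + j) * t) / 2 ^ Suc n) \<le> 1 / 2 ^ Suc n" for n t
        using tent_bounds[of "3 ^ (n * d + j) * t"] by (simp add: divide_right_mono)
    qed
    show "\<forall>\<^sub>F N in sequentially. continuous_on UNIV (\<lambda>t. \<Sum>n<N. tent (3 ^ (n * d + j) * t) / 2 ^ Suc n)"
      by (intro always_eventually allI continuous_on_sum continuous_on_divide continuous_on_const
          continuous_on_compose2[OF continuous_on_tent[of UNIV]] continuous_intros) auto
  qed simp
  show ?thesis
  proof (rule that[of c G])
    have "(\<lambda>x. \<Sum>k. 2 * of_bool (b x k) / 3 ^ Suc k :: real) \<in> borel_measurable borel"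
      unfolding b_def by measurable
    then show "c \<in> borel_measurable borel" by (simp add: c_def[abs_def] cantor_code_def)
    show "c x \<in> {0..1}" for x using cantor_code_bounds[of "b x"] by (simp add: c_def)
    show "continuous_on UNIV G" unfolding G_def by (intro continuous_intros h_cont)
    show "G (c x) = x /\<^sub>R (1 + norm x)" for x
    proof -
      have hu: "h j (c x) = u j x" if "j < d" for j
      proof -
        have "tent (3 ^ (n * d + j) * c x) = of_bool (odd \<lfloor>2 ^ Suc n * u j x\<rfloor>)" for n
        proof -
          have "(n * d + j) div d = n" "(n * d + j) mod d = j" using that by simp_all
          then show ?thesis unfolding c_def tent_cantor_code b_def by simp
        qed
        then show ?thesis unfolding h_def
          using sums_unique[OF binary_expansion[OF u[OF that]]] by simp
      qed
      have half: "2 * ((1 + q) / 2) - 1 = q" for q :: real by (simp add: field_simps)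
      have "2 * h j (c x) - 1 = (x /\<^sub>R (1 + norm x)) \<bullet> e j" if "j < d" for j
        unfolding hu[OF that] u_def by (rule half)
      then have "G (c x) = (\<Sum>j<d. ((x /\<^sub>R (1 + norm x)) \<bullet> e j) *\<^sub>R e j)"
        unfolding G_def by (intro sum.cong) auto
      also have "\<dots> = (\<Sum>b\<in>Basis. ((x /\<^sub>R (1 + norm x)) \<bullet> b) *\<^sub>R b)"
        by (rule sum.reindex_bij_betw[OF e])
      finally show ?thesis by (simp only: euclidean_representation)
    qed
  qed
qed

text \<open>
  The map y \<mapsto> y / (1 - |y|) is the inverse of x \<mapsto> x / (1 + |x|). A compact support
  in the space stays away from the unit sphere.
\<close>

lemma continuous_extension_compactified:
  fixes \<phi> :: "'a::euclidean_space \<Rightarrow> real"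
  assumes \<phi>: "continuous_on UNIV \<phi>" and R: "0 < R" "\<And>x. \<phi> x \<noteq> 0 \<Longrightarrow> norm x < R"
  shows "continuous_on UNIV (\<lambda>y. if norm y < 1 then \<phi> (y /\<^sub>R (1 - norm y)) else 0)" (is "continuous_on UNIV ?\<Phi>")
proof -
  define S where "S = R / (1 + R)"
  have zero: "?\<Phi> y = 0" if "S < norm y" for y
  proof (cases "norm y < 1")
    case True
    have "R \<le> norm (y /\<^sub>R (1 - norm y))"
    proof -
      have "R < norm y * (1 + R)" using that R(1) by (simp add: S_def divide_less_eq)
      then have "R * (1 - norm y) \<le> norm y" by (simp add: algebra_simps)
      then show ?thesis using True by (simp add: divide_simps)
    qed
    then have "\<phi> (y /\<^sub>R (1 - norm y)) = 0" using R(2)[of "y /\<^sub>R (1 - norm y)"] by linarith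
    then show ?thesis by simp
  qed simp
  have S1: "S < 1" using R(1) by (simp add: S_def)
  have "continuous_on ({y::'a. norm y < 1} \<union> {y. S < norm y}) ?\<Phi>"
  proof (rule continuous_on_open_Un)
    show "open {y::'a. norm y < 1}" "open {y::'a. S < norm y}"
      by (intro open_Collect_less continuous_intros)+
    have "continuous_on {y. norm y < 1} (\<lambda>y. \<phi> (y /\<^sub>R (1 - norm y)))"
      by (rule continuous_on_compose2[OF \<phi>]) (auto intro!: continuous_intros)
    then show "continuous_on {y. norm y < 1} ?\<Phi>" by (rule continuous_on_eq) auto
    have "continuous_on {y::'a. S < norm y} (\<lambda>y. 0 :: real)" by simp
    then show "continuous_on {y. S < norm y} ?\<Phi>" by (rule continuous_on_eq) (use zero in auto)
  qed
  moreover have "{y::'a. norm y < 1} \<union> {y. S < norm y} = UNIV" using S1 by force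
  ultimately show ?thesis by simp
qed

lemma bounded_real_convergent_subseq:
  fixes f :: "nat \<Rightarrow> real"
  assumes "\<And>k. f k \<in> {a..b}"
  obtains r l where "strict_mono r" "l \<in> {a..b}" "(f \<circ> r) \<longlonglongrightarrow> l"
  using compact_Icc[of a b] assms unfolding compact_eq_seq_compact_metric seq_compact_def by metis

text \<open>
  The measures are normalized and pushed to the unit interval by the section; Helly's selection
  theorem gives a weak limit there, which is transported back by the curve. Mass that reaches the
  unit sphere has escaped to infinity and is discarded, so that the limit may have smaller mass.
\<close>

lemma vague_compactness:
  fixes \<mu> :: "nat \<Rightarrow> 'a::euclidean_space measure"
  assumes fin: "\<And>k. finite_measure (\<mu> k)" and sets: "\<And>k. sets (\<mu> k) = sets borel"
    and le: "\<And>k. measure (\<mu> k) UNIV \<le> C"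
  obtains r M where "strict_mono r" "finite_measure M" "sets M = sets borel" "measure M UNIV \<le> C"
    "\<And>\<phi> R. continuous_on UNIV \<phi> \<Longrightarrow> 0 < R \<Longrightarrow> (\<forall>x. \<phi> x \<noteq> 0 \<longrightarrow> norm x < R) \<Longrightarrow>
       (\<lambda>k. LINT x|\<mu> (r k). \<phi> x) \<longlonglongrightarrow> (LINT x|M. \<phi> x :: real)"
proof -
  obtain c :: "'a \<Rightarrow> real" and G where c[measurable]: "c \<in> borel_measurable borel"
    and c01: "\<And>x. c x \<in> {0..1}" and G: "continuous_on UNIV G" and Gc: "\<And>x. G (c x) = x /\<^sub>R (1 + norm x)"
    by (rule curve_with_measurable_section) (rule that)
  have sp: "space (\<mu> k) = UNIV" for k using sets_eq_imp_space_eq[OF sets] by simp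
  define m where "m k = measure (\<mu> k) UNIV" for k
  have m: "m k \<in> {0..C}" for k using le by (simp add: m_def)
  obtain s ml where s: "strict_mono s" "ml \<in> {0..C}" "(m \<circ> s) \<longlonglongrightarrow> ml"
    by (rule bounded_real_convergent_subseq[OF m])
  \<comment> \<open>a zero measure cannot be normalized; its values are recovered from the factor m k = 0\<close>
  define L where "L k = (if m k = 0 then return borel 0 else distr (density (\<mu> k) (\<lambda>_. ennreal (1 / m k))) borel c)" for k
  have cm: "c \<in> borel_measurable (\<mu> k)" for k using c by (simp add: measurable_cong_sets[OF sets])
  have em: "emeasure (\<mu> k) UNIV = ennreal (m k)" for k
    using finite_measure.emeasure_eq_measure[OF fin] by (simp add: m_def)
  have L_dist: "real_distribution (L k)" for k
  proof (cases "m k = 0")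
    case True
    have "prob_space (return (borel :: real measure) 0)" by (rule prob_space_return) simp
    then show ?thesis using True by (simp add: L_def real_distribution_def real_distribution_axioms_def)
  next
    case False
    have "prob_space (density (\<mu> k) (\<lambda>_. ennreal (1 / m k)))"
    proof (rule prob_spaceI)
      have "emeasure (density (\<mu> k) (\<lambda>_. ennreal (1 / m k))) UNIV = ennreal (1 / m k) * ennreal (m k)"
        using sets.top[of "\<mu> k"] by (subst emeasure_density) (auto simp: sp em)
      also have "\<dots> = 1" using False m[of k] by (simp flip: ennreal_mult'')
      finally show "emeasure (density (\<mu> k) (\<lambda>_. ennreal (1 / m k))) (space (density (\<mu> k) (\<lambda>_. ennreal (1 / m k)))) = 1"
        by (simp add: sp)
    qed
    then have "prob_space (distr (density (\<mu> k) (\<lambda>_. ennreal (1 / m k))) borel c)"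
      by (rule prob_space.prob_space_distr) (use cm in simp)
    then show ?thesis using False by (simp add: L_def real_distribution_def real_distribution_axioms_def)
  qed
  have int_L: "(LINT x|\<mu> k. f (c x)) = m k * (LINT t|L k. f t)"
    if [measurable]: "f \<in> borel_measurable borel" for f :: "real \<Rightarrow> real" and k
  proof (cases "m k = 0")
    case True
    have "AE x in \<mu> k. f (c x) = 0"
      by (rule AE_I[of _ _ UNIV]) (use True sets.top[of "\<mu> k"] in \<open>auto simp: em sp\<close>)
    then have "(LINT x|\<mu> k. f (c x)) = 0" by (rule integral_eq_zero_AE)
    then show ?thesis using True by simp
  next
    case False
    have fc: "(\<lambda>x. f (c x)) \<in> borel_measurable (\<mu> k)" using that cm by measurable
    have "(LINT t|L k. f t) = (LINT x|density (\<mu> k) (\<lambda>_. ennreal (1 / m k)). f (c x))"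
      using False cm[of k] that by (simp add: L_def integral_distr)
    also have "\<dots> = (LINT x|\<mu> k. (1 / m k) *\<^sub>R f (c x))"
      using fc m[of k] by (intro integral_density) auto
    finally show ?thesis using False by simp
  qed
  have L_mass: "measure (L k) {-1<..1} = 1" for k
  proof -
    interpret real_distribution "L k" by (rule L_dist)
    have "AE t in L k. t \<in> {-1<..1}"
    proof (cases "m k = 0")
      case True
      then have "L k = return borel 0" by (simp add: L_def)
      then show ?thesis by (simp only:) (subst AE_return, auto)
    next
      case False
      have "c x \<in> {-1<..1}" for x using c01[of x] by auto
      moreover have "L k = distr (density (\<mu> k) (\<lambda>_. ennreal (1 / m k))) borel c"
        using False by (simp add: L_def)
      ultimately show ?thesis using cm by (simp only:) (subst AE_distr_iff, auto)
    qed
    then show ?thesis by (subst prob_eq_1) auto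
  qed
  have "tight L"
    unfolding tight_def
  proof (intro conjI allI impI)
    fix \<epsilon> :: real assume "0 < \<epsilon>"
    then have "(-1::real) < 1 \<and> (\<forall>n. 1 - \<epsilon> < measure (L n) {-1<..1})" by (simp add: L_mass)
    then show "\<exists>a b. a < b \<and> (\<forall>n. 1 - \<epsilon> < measure (L n) {a<..b})" by blast
  qed (rule L_dist)
  from tight_imp_convergent_subsubsequence[OF this s(1)] obtain q \<Lambda> where
    q: "strict_mono q" "real_distribution \<Lambda>" "weak_conv_m (L \<circ> s \<circ> q) \<Lambda>" by blast
  interpret \<Lambda>: real_distribution \<Lambda> by (rule q(2))
  define r where "r = s \<circ> q"
  have G_meas[measurable]: "G \<in> borel_measurable borel"
    by (rule borel_measurable_continuous_onI[OF G])
  define w where "w t = G t /\<^sub>R (1 - norm (G t))" for t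
  have w_meas[measurable]: "w \<in> borel_measurable borel" unfolding w_def by measurable
  \<comment> \<open>the indicator discards the mass that does not lie over the open unit ball\<close>
  define D where "D = density \<Lambda> (\<lambda>t. ennreal (ml * indicator {t. norm (G t) < 1} t))"
  define M where "M = distr D borel w"
  have wc: "w (c x) = x" "norm (G (c x)) < 1" for x
  proof -
    have "0 < 1 + norm x" by (simp add: add_pos_nonneg)
    moreover then have n: "norm (G (c x)) = norm x / (1 + norm x)" by (simp add: Gc divide_inverse)
    moreover have "1 - norm x / (1 + norm x) = 1 / (1 + norm x)"
      using \<open>0 < 1 + norm x\<close> by (simp add: field_simps)
    ultimately show "norm (G (c x)) < 1" "w (c x) = x"
      unfolding w_def by (simp_all add: Gc)
  qed
  have eD: "emeasure D UNIV \<le> ennreal ml"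
  proof -
    have "emeasure D UNIV = (\<integral>\<^sup>+t. ennreal (ml * indicator {t. norm (G t) < 1} t) \<partial>\<Lambda>)"
      unfolding D_def using sets.top[of \<Lambda>] by (subst emeasure_density) auto
    also have "\<dots> \<le> (\<integral>\<^sup>+t. ennreal ml \<partial>\<Lambda>)"
      using s(2) by (intro nn_integral_mono ennreal_leI) (auto simp: indicator_def)
    finally show ?thesis by (simp add: \<Lambda>.emeasure_space_1[simplified])
  qed
  have setsD: "sets D = sets borel" by (simp add: D_def)
  have spD: "space D = UNIV" using sets_eq_imp_space_eq[OF setsD] by simp
  have wD: "w \<in> borel_measurable D" using w_meas by (simp add: measurable_cong_sets[OF setsD])
  have eM: "emeasure M UNIV \<le> ennreal ml" unfolding M_def using eD wD spD by (simp add: emeasure_distr)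
  have "space M = UNIV" by (simp add: M_def)
  show ?thesis
  proof (rule that[of r M])
    show "strict_mono r" unfolding r_def using s(1) q(1) by (rule strict_mono_o)
    show "finite_measure M"
      by (rule finite_measureI) (use eM \<open>space M = UNIV\<close> in \<open>auto simp: top_unique\<close>)
    show "sets M = sets borel" by (simp add: M_def)
    have "measure M UNIV \<le> ml"
      using eM s(2) unfolding measure_def by (intro enn2real_leI) auto
    then show "measure M UNIV \<le> C" using s(2) by simp
    fix \<phi> :: "'a \<Rightarrow> real" and R
    assume "continuous_on UNIV \<phi>" "0 < R" "\<forall>x. \<phi> x \<noteq> 0 \<longrightarrow> norm x < R"
    then have \<phi>: "continuous_on UNIV \<phi>" "0 < R" "\<And>x. \<phi> x \<noteq> 0 \<Longrightarrow> norm x < R" by auto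
    define \<Phi> where "\<Phi> y = (if norm y < 1 then \<phi> (y /\<^sub>R (1 - norm y)) else 0)" for y
    have \<Phi>: "continuous_on UNIV \<Phi>"
      unfolding \<Phi>_def using \<phi> by (rule continuous_extension_compactified)
    have cont: "continuous_on UNIV (\<lambda>t. \<Phi> (G t))"
      by (rule continuous_on_compose2[OF \<Phi> G]) auto
    have \<phi>_eq: "\<phi> x = \<Phi> (G (c x))" for x
      using wc[of x] by (simp add: \<Phi>_def w_def)
    have "compact (\<phi> ` cball 0 R)"
      using \<phi>(1) by (intro compact_continuous_image) (auto intro: continuous_on_subset)
    then obtain B where B: "\<forall>y\<in>\<phi> ` cball 0 R. norm y \<le> B" using bounded_iff compact_imp_bounded by blast
    have \<phi>B: "\<bar>\<phi> x\<bar> \<le> \<bar>B\<bar>" for x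
    proof (cases "\<phi> x = 0")
      case False
      then have "x \<in> cball 0 R" using \<phi>(3) by force
      then have "\<bar>\<phi> x\<bar> \<le> B" using B by auto
      then show ?thesis by simp
    qed simp
    have bnd: "norm (\<Phi> (G t)) \<le> \<bar>B\<bar>" for t using \<phi>B by (simp add: \<Phi>_def)
    have [measurable]: "(\<lambda>t. \<Phi> (G t)) \<in> borel_measurable borel"
      by (rule borel_measurable_continuous_onI[OF cont])
    have "(\<lambda>k. LINT t|(L \<circ> s \<circ> q) k. \<Phi> (G t)) \<longlonglongrightarrow> (LINT t|\<Lambda>. \<Phi> (G t))"
      using cont bnd L_dist
      by (intro weak_conv_imp_integral_bdd_continuous_conv[OF _ q(2,3)])
        (auto simp: continuous_on_eq_continuous_at)
    moreover have "(\<lambda>k. m (r k)) \<longlonglongrightarrow> ml"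
      using LIMSEQ_subseq_LIMSEQ[OF s(3) q(1)] by (simp add: r_def o_def)
    ultimately have "(\<lambda>k. m (r k) * (LINT t|L (r k). \<Phi> (G t))) \<longlonglongrightarrow> ml * (LINT t|\<Lambda>. \<Phi> (G t))"
      by (intro tendsto_mult) (simp_all add: r_def o_def)
    moreover have "(LINT x|\<mu> k. \<phi> x) = m k * (LINT t|L k. \<Phi> (G t))" for k
      unfolding \<phi>_eq by (rule int_L) measurable
    moreover have "(LINT x|M. \<phi> x) = ml * (LINT t|\<Lambda>. \<Phi> (G t))"
    proof -
      have \<phi>m: "\<phi> \<in> borel_measurable borel" by (rule borel_measurable_continuous_onI[OF \<phi>(1)])
      have "(LINT x|M. \<phi> x) = (LINT t|D. \<phi> (w t))"
        unfolding M_def using wD \<phi>m by (rule integral_distr)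
      also have "\<dots> = (LINT t|\<Lambda>. (ml * indicator {t. norm (G t) < 1} t) *\<^sub>R \<phi> (w t))"
        unfolding D_def using s(2) \<phi>m w_meas by (intro integral_density) auto
      also have "\<dots> = (LINT t|\<Lambda>. ml * \<Phi> (G t))"
        by (intro Bochner_Integration.integral_cong) (auto simp: \<Phi>_def w_def)
      finally show ?thesis by simp
    qed
    ultimately show "(\<lambda>k. LINT x|\<mu> (r k). \<phi> x) \<longlonglongrightarrow> (LINT x|M. \<phi> x)" by simp
  qed
qed

section \<open>The Heisenberg group and left-invariant fields\<close>

text \<open>
  In exponential coordinates the product of p and q differs from p + q by a central element, which
  is half the symplectic form of the horizontal parts.
\<close>

definition form :: "'n::finite heis \<Rightarrow> 'n heis \<Rightarrow> real" where
  "form p q = (fst p \<bullet> fst (snd q) - fst (snd p) \<bullet> fst q) / 2"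

definition vert :: "real \<Rightarrow> 'n::finite heis" where
  "vert s = (0, 0, s)"

lemma heis_mult_eq: "heis_mult p q = p + q + vert (form p q)"
  by (cases p, cases q) (simp add: heis_mult_def form_def vert_def)

lemma form_simps [simp]:
  "form (p + q) r = form p r + form q r" "form r (p + q) = form r p + form r q"
  "form (p - q) r = form p r - form q r" "form r (p - q) = form r p - form r q"
  "form (s *\<^sub>R p) r = s * form p r" "form r (s *\<^sub>R p) = s * form r p"
  "form (- p) r = - form p r" "form r (- p) = - form r p"
  "form p (vert s) = 0" "form (vert s) p = 0" "form p p = 0" "form 0 p = 0" "form p 0 = 0"
  by (simp_all add: form_def vert_def algebra_simps add_divide_distrib diff_divide_distrib inner_commute)

lemma form_commute: "form q p = - form p q"
  by (simp add: form_def inner_commute minus_divide_left)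

lemma vert_simps [simp]:
  "vert 0 = 0" "vert a + vert b = vert (a + b)" "vert a - vert b = vert (a - b)" "- vert a = vert (- a)"
  "s *\<^sub>R vert a = vert (s * a)"
  by (simp_all add: vert_def zero_prod_def)

lemma norm_vert [simp]: "norm (vert s) = \<bar>s\<bar>"
  by (simp add: vert_def norm_Pair)

lemma bounded_linear_vert: "bounded_linear vert"
  by (rule bounded_linear_intro[where K=1]) auto

lemma abs_form_le: "\<bar>form p q\<bar> \<le> norm p * norm q"
proof -
  have n: "norm (fst p) \<le> norm p" "norm (fst (snd p)) \<le> norm p" for p :: "'a heis"
  proof -
    obtain a b c where p: "p = (a, b, c)" by (cases p)
    have "norm b \<le> norm (b, c)" by (rule norm_fst_le)
    also have "\<dots> \<le> norm (a, b, c)" by (rule norm_snd_le)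
    finally show "norm (fst (snd p)) \<le> norm p" by (simp add: p)
    show "norm (fst p) \<le> norm p" unfolding p fst_conv by (rule norm_fst_le)
  qed
  have "\<bar>fst p \<bullet> fst (snd q)\<bar> \<le> norm p * norm q" "\<bar>fst (snd p) \<bullet> fst q\<bar> \<le> norm p * norm q"
    by (rule order_trans[OF Cauchy_Schwarz_ineq2 mult_mono]; simp add: n)+
  moreover have "\<bar>(a - b) / 2\<bar> \<le> k" if "\<bar>a\<bar> \<le> k" "\<bar>b\<bar> \<le> k" for a b k :: real
    using that abs_triangle_ineq4[of a b] by simp
  ultimately show ?thesis unfolding form_def by blast
qed

lemma bounded_linear_form_left: "bounded_linear (\<lambda>p. form p q)"
  by (rule bounded_linear_intro[where K="norm q"]) (auto simp: abs_form_le)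

lemma bounded_linear_form_right: "bounded_linear (\<lambda>p. form q p)"
  by (rule bounded_linear_intro[where K="norm q"]) (use abs_form_le[of q] in \<open>auto simp: mult.commute\<close>)

lemma heis_cancel [simp]:
  "heis_mult (- p) (heis_mult p q) = q" "heis_mult p (heis_mult (- p) q) = q"
  "heis_mult (heis_mult q p) (- p) = q" "heis_mult (heis_mult q (- p)) p = q"
  by (simp_all add: heis_mult_eq)

lemma heis_left_has_derivative: "(heis_mult p has_derivative (\<lambda>v. v + vert (form p v))) (at q)"
  unfolding heis_mult_eq[abs_def]
  by (auto intro!: derivative_eq_intros bounded_linear.has_derivative[OF bounded_linear_vert]
      bounded_linear.has_derivative[OF bounded_linear_form_right])

lemma heis_right_has_derivative: "((\<lambda>q. heis_mult q h) has_derivative (\<lambda>v. v + vert (form v h))) (at q)"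
  unfolding heis_mult_eq[abs_def]
  by (auto intro!: derivative_eq_intros bounded_linear.has_derivative[OF bounded_linear_vert]
      bounded_linear.has_derivative[OF bounded_linear_form_left])

lemma continuous_heis_left: "continuous_on A (heis_mult p)"
  by (meson continuous_at_imp_continuous_on has_derivative_continuous heis_left_has_derivative)

lemma continuous_heis_right: "continuous_on A (\<lambda>q. heis_mult q h)"
  by (intro continuous_at_imp_continuous_on ballI has_derivative_continuous[OF heis_right_has_derivative])

lemma continuous_heis_mult: "continuous_on A (\<lambda>x. heis_mult (fst x) (snd x))"
  unfolding heis_mult_eq form_def vert_def by (intro continuous_intros) auto

lemma measurable_heis_left [measurable]: "heis_mult p \<in> borel_measurable borel"
  by (rule borel_measurable_continuous_onI[OF continuous_heis_left])

lemma measurable_heis_right [measurable]: "(\<lambda>q. heis_mult q h) \<in> borel_measurable borel"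
  by (rule borel_measurable_continuous_onI[OF continuous_heis_right])

subsection \<open>Invariance of Lebesgue measure\<close>

lemma nn_integral_lborel_translate:
  fixes f :: "'a::euclidean_space \<Rightarrow> ennreal"
  assumes [measurable]: "f \<in> borel_measurable borel"
  shows "(\<integral>\<^sup>+x. f (c + x) \<partial>lborel) = (\<integral>\<^sup>+x. f x \<partial>lborel)"
  by (subst (2) lborel_distr_plus[of c, symmetric]) (simp add: nn_integral_distr)

text \<open>
  Left and right translations are Euclidean translations composed with shears in the central
  direction, and these preserve Lebesgue measure by Fubini's theorem.
\<close>

lemma nn_integral_vertical_shear:
  fixes f :: "'n::finite heis \<Rightarrow> ennreal" and g :: "'n heis \<Rightarrow> real"
  assumes [measurable]: "f \<in> borel_measurable borel" "g \<in> borel_measurable borel"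
    and g: "\<And>x y t. g (x, y, t) = g (x, y, 0)"
  shows "(\<integral>\<^sup>+q. f (q + vert (g q)) \<partial>lborel) = (\<integral>\<^sup>+q. f q \<partial>lborel)"
proof -
  have pair: "(\<integral>\<^sup>+q. F q \<partial>lborel) = (\<integral>\<^sup>+x. \<integral>\<^sup>+y. \<integral>\<^sup>+t. F (x, y, t) \<partial>lborel \<partial>lborel \<partial>lborel)"
    if [measurable]: "F \<in> borel_measurable borel" for F :: "'n heis \<Rightarrow> ennreal"
  proof -
    have "(\<integral>\<^sup>+q. F q \<partial>lborel) = (\<integral>\<^sup>+x. \<integral>\<^sup>+z. F (x, z) \<partial>lborel \<partial>lborel)"
      by (subst lborel_prod[symmetric], subst lborel.nn_integral_fst[symmetric]) (auto simp: lborel_prod)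
    also have "\<dots> = (\<integral>\<^sup>+x. \<integral>\<^sup>+y. \<integral>\<^sup>+t. F (x, y, t) \<partial>lborel \<partial>lborel \<partial>lborel)"
    proof (rule nn_integral_cong)
      fix x
      show "(\<integral>\<^sup>+z. F (x, z) \<partial>lborel) = (\<integral>\<^sup>+y. \<integral>\<^sup>+t. F (x, y, t) \<partial>lborel \<partial>lborel)"
        by (subst lborel_prod[symmetric], subst lborel.nn_integral_fst[symmetric]) (auto simp: lborel_prod)
    qed
    finally show ?thesis .
  qed
  have v[measurable]: "(vert :: real \<Rightarrow> 'n heis) \<in> borel_measurable borel"
    by (rule borel_measurable_continuous_onI[OF linear_continuous_on[OF bounded_linear_vert]])
  have "(\<integral>\<^sup>+q. f (q + vert (g q)) \<partial>lborel) =
      (\<integral>\<^sup>+x. \<integral>\<^sup>+y. \<integral>\<^sup>+t. f ((x, y, t) + vert (g (x, y, t))) \<partial>lborel \<partial>lborel \<partial>lborel)"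
    by (rule pair) measurable
  also have "\<dots> = (\<integral>\<^sup>+x. \<integral>\<^sup>+y. \<integral>\<^sup>+t. f (x, y, g (x, y, 0) + t) \<partial>lborel \<partial>lborel \<partial>lborel)"
    by (subst g) (simp add: vert_def add.commute)
  also have "\<dots> = (\<integral>\<^sup>+x. \<integral>\<^sup>+y. \<integral>\<^sup>+t. f (x, y, t) \<partial>lborel \<partial>lborel \<partial>lborel)"
    by (intro nn_integral_cong nn_integral_lborel_translate) measurable
  also have "\<dots> = (\<integral>\<^sup>+q. f q \<partial>lborel)" by (rule pair[symmetric]) measurable
  finally show ?thesis .
qed

lemma nn_integral_heis_left:
  assumes [measurable]: "f \<in> borel_measurable borel"
  shows "(\<integral>\<^sup>+q. f (heis_mult p q) \<partial>lborel) = (\<integral>\<^sup>+q. f q \<partial>lborel)"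
proof -
  have [measurable]: "(\<lambda>q. form p q) \<in> borel_measurable borel"
    by (rule borel_measurable_continuous_onI[OF linear_continuous_on[OF bounded_linear_form_right]])
  have "(\<integral>\<^sup>+q. f (heis_mult p q) \<partial>lborel) = (\<integral>\<^sup>+q. f (p + (q + vert (form p q))) \<partial>lborel)"
    by (simp add: heis_mult_eq add.assoc)
  also have "\<dots> = (\<integral>\<^sup>+q. f (p + q) \<partial>lborel)"
    by (rule nn_integral_vertical_shear[of "\<lambda>q. f (p + q)"]) (measurable, simp add: form_def)
  also have "\<dots> = (\<integral>\<^sup>+q. f q \<partial>lborel)" by (rule nn_integral_lborel_translate) measurable
  finally show ?thesis .
qed

lemma nn_integral_heis_right:
  assumes [measurable]: "f \<in> borel_measurable borel"
  shows "(\<integral>\<^sup>+q. f (heis_mult q h) \<partial>lborel) = (\<integral>\<^sup>+q. f q \<partial>lborel)"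
proof -
  have [measurable]: "(\<lambda>q. form q h) \<in> borel_measurable borel"
    by (rule borel_measurable_continuous_onI[OF linear_continuous_on[OF bounded_linear_form_left]])
  have "(\<integral>\<^sup>+q. f (heis_mult q h) \<partial>lborel) = (\<integral>\<^sup>+q. f (h + (q + vert (form q h))) \<partial>lborel)"
    by (simp add: heis_mult_eq add_ac)
  also have "\<dots> = (\<integral>\<^sup>+q. f (h + q) \<partial>lborel)"
    by (rule nn_integral_vertical_shear[of "\<lambda>q. f (h + q)"]) (measurable, simp add: form_def)
  also have "\<dots> = (\<integral>\<^sup>+q. f q \<partial>lborel)" by (rule nn_integral_lborel_translate) measurable
  finally show ?thesis .
qed

lemma emeasure_heis_left:
  assumes [measurable]: "A \<in> sets borel"
  shows "emeasure lborel {q. heis_mult p q \<in> A} = emeasure lborel A"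
proof -
  have m: "{q. heis_mult p q \<in> A} \<in> sets borel" by measurable
  have "emeasure lborel {q. heis_mult p q \<in> A} = (\<integral>\<^sup>+q. indicator {q. heis_mult p q \<in> A} q \<partial>lborel)"
    using m by simp
  also have "\<dots> = (\<integral>\<^sup>+q. indicator A (heis_mult p q) \<partial>lborel)"
    by (intro nn_integral_cong) (simp add: indicator_def)
  also have "\<dots> = (\<integral>\<^sup>+q. indicator A q \<partial>lborel)" by (rule nn_integral_heis_left) measurable
  finally show ?thesis by simp
qed

lemma emeasure_heis_right:
  assumes [measurable]: "A \<in> sets borel"
  shows "emeasure lborel {q. heis_mult q h \<in> A} = emeasure lborel A"
proof -
  have m: "{q. heis_mult q h \<in> A} \<in> sets borel" by measurable
  have "emeasure lborel {q. heis_mult q h \<in> A} = (\<integral>\<^sup>+q. indicator {q. heis_mult q h \<in> A} q \<partial>lborel)"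
    using m by simp
  also have "\<dots> = (\<integral>\<^sup>+q. indicator A (heis_mult q h) \<partial>lborel)"
    by (intro nn_integral_cong) (simp add: indicator_def)
  also have "\<dots> = (\<integral>\<^sup>+q. indicator A q \<partial>lborel)" by (rule nn_integral_heis_right) measurable
  finally show ?thesis by simp
qed

lemma lborel_distr_heis_left: "distr lborel lborel (heis_mult p) = lborel"
  by (rule measure_eqI) (simp_all add: emeasure_distr vimage_def emeasure_heis_left)

lemma lborel_distr_heis_right: "distr lborel lborel (\<lambda>q. heis_mult q h) = lborel"
  by (rule measure_eqI) (simp_all add: emeasure_distr vimage_def emeasure_heis_right)

lemma integral_heis_left:
  fixes f :: "'n::finite heis \<Rightarrow> real"
  assumes "f \<in> borel_measurable borel"
  shows "(LINT q|lborel. f (heis_mult p q)) = (LINT q|lborel. f q)"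
  using assms by (subst (2) lborel_distr_heis_left[of p, symmetric]) (simp add: integral_distr)

lemma integral_heis_right:
  fixes f :: "'n::finite heis \<Rightarrow> real"
  assumes "f \<in> borel_measurable borel"
  shows "(LINT q|lborel. f (heis_mult q h)) = (LINT q|lborel. f q)"
  using assms by (subst (2) lborel_distr_heis_right[of h, symmetric]) (simp add: integral_distr)

subsection \<open>Left-invariant fields\<close>

lemma left_invariant_eq:
  assumes "left_invariant V" shows "V p = V 0 + vert (form p (V 0))"
proof -
  have "V (heis_mult p 0) = frechet_derivative (heis_mult p) (at 0) (V 0)"
    using assms unfolding left_invariant_def by blast
  then show ?thesis
    unfolding heis_mult_0_right frechet_derivative_at[OF heis_left_has_derivative, symmetric] .
qed

lemma left_invariant_has_derivative:
  assumes "left_invariant V" shows "(V has_derivative (\<lambda>u. vert (form u (V 0)))) (at p)"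
proof -
  have "((\<lambda>p. V 0 + vert (form p (V 0))) has_derivative (\<lambda>u. vert (form u (V 0)))) (at p)"
    by (auto intro!: derivative_eq_intros bounded_linear.has_derivative[OF bounded_linear_vert]
        bounded_linear.has_derivative[OF bounded_linear_form_left])
  moreover have "(\<lambda>p. V 0 + vert (form p (V 0))) = V"
    by (rule ext, rule left_invariant_eq[OF assms, symmetric])
  ultimately show ?thesis by simp
qed

lemma left_invariant_divergence:
  assumes "left_invariant V" shows "divergence V p = 0"
proof -
  have "vert (form b (V 0)) \<bullet> b = 0" if "b \<in> Basis" for b
    using that by (auto simp: Basis_prod_def vert_def form_def)
  then show ?thesis
    unfolding divergence_def frechet_derivative_at[OF left_invariant_has_derivative[OF assms], symmetric]
    by (intro sum.neutral) auto
qed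

definition along :: "('a::euclidean_space \<Rightarrow> 'a) \<Rightarrow> ('a \<Rightarrow> real) \<Rightarrow> 'a \<Rightarrow> real" where
  "along V \<phi> x = frechet_derivative \<phi> (at x) (V x)"

lemma inner_gradient:
  assumes "\<phi> differentiable (at x)" shows "v \<bullet> gradient \<phi> x = frechet_derivative \<phi> (at x) v"
proof -
  interpret bounded_linear "frechet_derivative \<phi> (at x)"
    using assms by (simp add: frechet_derivative_works has_derivative_bounded_linear)
  have "frechet_derivative \<phi> (at x) v = frechet_derivative \<phi> (at x) (\<Sum>b\<in>Basis. (v \<bullet> b) *\<^sub>R b)"
    by (simp only: euclidean_representation)
  also have "\<dots> = v \<bullet> gradient \<phi> x"
    by (simp add: sum scaleR gradient_def inner_sum_right mult.commute)
  finally show ?thesis by simp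
qed

text \<open>
  Left-invariant fields are free of divergence, which is unimodularity of the group.
\<close>

lemma distr_deriv_left_invariant:
  assumes "left_invariant V" "test_function \<phi>"
  shows "distr_deriv V f \<phi> = - (LINT x|lborel. f x * along V \<phi> x)"
  using inner_gradient[OF test_functionD(3)[OF assms(2)]]
  by (simp add: distr_deriv_def left_invariant_divergence[OF assms(1)] along_def)

lemma along_eq_0:
  assumes "x \<notin> closure {x. \<phi> x \<noteq> 0}" shows "along V \<phi> x = 0"
proof -
  have "((\<lambda>x. 0) has_derivative (\<lambda>v. 0)) (at x)" by simp
  then have "(\<phi> has_derivative (\<lambda>v. 0)) (at x)"
    by (rule has_derivative_transform_within_open[of _ _ _ _ "- closure {x. \<phi> x \<noteq> 0}"])
      (use assms closure_subset[of "{x. \<phi> x \<noteq> 0}"] in auto)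
  then show ?thesis by (simp add: along_def frechet_derivative_at[symmetric])
qed

text \<open>
  The coefficients of a left-invariant field are affine, so that the derivative along it is again
  smooth, with no larger support.
\<close>

lemma test_function_along:
  assumes V: "left_invariant V" and \<phi>: "test_function \<phi>"
  shows "test_function (along V \<phi>)"
proof (rule test_functionI)
  show "compact (closure {x. \<phi> x \<noteq> 0})" using \<phi> by (simp add: test_function_def)
  show "along V \<phi> x = 0" if "x \<notin> closure {x. \<phi> x \<noteq> 0}" for x using along_eq_0[OF that] .
  fix k
  have lin: "k_smooth k (\<lambda>x. V x \<bullet> b)" for b
  proof -
    have "bounded_linear (\<lambda>x. vert (form x (V 0)) \<bullet> b)"
      by (rule bounded_linear_compose[OF bounded_linear_inner_left
            bounded_linear_compose[OF bounded_linear_vert bounded_linear_form_left]])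
    then have "k_smooth k (\<lambda>x. V 0 \<bullet> b + vert (form x (V 0)) \<bullet> b)"
      by (rule k_smooth_add[OF k_smooth_const k_smooth_bounded_linear])
    moreover have "(\<lambda>x. V 0 \<bullet> b + vert (form x (V 0)) \<bullet> b) = (\<lambda>x. V x \<bullet> b)"
      by (rule ext) (simp only: inner_add_left[symmetric] left_invariant_eq[OF V, symmetric])
    ultimately show ?thesis by (simp only:)
  qed
  have "k_smooth k (\<lambda>x. \<Sum>b\<in>Basis. (V x \<bullet> b) * frechet_derivative \<phi> (at x) b)"
    by (rule k_smooth_sum[OF finite_Basis k_smooth_mult[OF lin k_smooth_SucD(2)[OF test_functionD(1)[OF \<phi>]]]])
  moreover have "(\<Sum>b\<in>Basis. (V x \<bullet> b) * frechet_derivative \<phi> (at x) b) = along V \<phi> x" for x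
  proof -
    have "V x \<bullet> gradient \<phi> x = (\<Sum>b\<in>Basis. (V x \<bullet> b) * frechet_derivative \<phi> (at x) b)"
      unfolding gradient_def inner_sum_right by (intro sum.cong) auto
    then show ?thesis using inner_gradient[OF test_functionD(3)[OF \<phi>], of "V x" x] by (simp add: along_def)
  qed
  ultimately show "k_smooth k (along V \<phi>)" by simp
qed

lemma test_function_compose:
  fixes \<phi> :: "'b::euclidean_space \<Rightarrow> real" and g :: "'a::euclidean_space \<Rightarrow> 'b"
  assumes \<phi>: "test_function \<phi>" and g: "\<And>x. (g has_derivative A) (at x)"
    and inv: "continuous_on UNIV g'" "\<And>x. g' (g x) = x"
  shows "test_function (\<lambda>x. \<phi> (g x))"
proof (rule test_functionI)
  show "k_smooth k (\<lambda>x. \<phi> (g x))" for k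
    by (rule k_smooth_compose_affine[OF g test_functionD(1)[OF \<phi>]])
  show "compact (g' ` closure {x. \<phi> x \<noteq> 0})"
    using \<phi> inv(1) by (intro compact_continuous_image) (auto simp: test_function_def intro: continuous_on_subset)
  show "\<phi> (g x) = 0" if "x \<notin> g' ` closure {x. \<phi> x \<noteq> 0}" for x
  proof (rule ccontr)
    assume "\<phi> (g x) \<noteq> 0"
    then have "g x \<in> closure {x. \<phi> x \<noteq> 0}" by (intro subsetD[OF closure_subset]) simp
    then have "g' (g x) \<in> g' ` closure {x. \<phi> x \<noteq> 0}" by (rule imageI)
    then show False using that inv(2) by simp
  qed
qed

lemma test_function_heis_left: "test_function \<phi> \<Longrightarrow> test_function (\<lambda>q. \<phi> (heis_mult p q))"
  by (rule test_function_compose[OF _ heis_left_has_derivative continuous_heis_left[of _ "- p"]]) auto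

lemma test_function_heis_right: "test_function \<phi> \<Longrightarrow> test_function (\<lambda>q. \<phi> (heis_mult q h))"
  by (rule test_function_compose[OF _ heis_right_has_derivative continuous_heis_right[of _ "- h"]]) auto

lemma along_heis_left:
  assumes V: "left_invariant V" and \<phi>: "test_function \<phi>"
  shows "along V (\<lambda>q. \<phi> (heis_mult p q)) q = along V \<phi> (heis_mult p q)"
proof -
  have der: "((\<lambda>q. \<phi> (heis_mult p q)) has_derivative
      (\<lambda>v. frechet_derivative \<phi> (at (heis_mult p q)) (v + vert (form p v)))) (at q)"
    using has_derivative_compose[OF heis_left_has_derivative] frechet_derivative_works
      test_functionD(3)[OF \<phi>] by blast
  have eqV: "V q + vert (form p (V q)) = V (heis_mult p q)"
    unfolding left_invariant_eq[OF V, of q] left_invariant_eq[OF V, of "heis_mult p q"]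
    by (simp add: heis_mult_eq add_ac)
  show ?thesis unfolding along_def frechet_derivative_at[OF der, symmetric] eqV ..
qed

text \<open>
  Left translations preserve the field and the measure.
\<close>

lemma distr_deriv_translate:
  assumes V: "left_invariant V" and \<phi>: "test_function \<phi>" and [measurable]: "E \<in> sets borel"
  shows "distr_deriv V (indicat_real {q. heis_mult p q \<in> E}) (\<lambda>q. \<phi> (heis_mult p q)) =
    distr_deriv V (indicat_real E) \<phi>"
proof -
  have [measurable]: "along V \<phi> \<in> borel_measurable borel"
    using test_functionD(4)[OF test_function_along[OF V \<phi>]] .
  have "indicat_real {q. heis_mult p q \<in> E} q * along V (\<lambda>q. \<phi> (heis_mult p q)) q =
      indicat_real E (heis_mult p q) * along V \<phi> (heis_mult p q)" for q
    by (simp add: along_heis_left[OF V \<phi>] indicator_def)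
  then show ?thesis
    using integral_heis_left[of "\<lambda>q. indicat_real E q * along V \<phi> q" p]
    by (simp add: distr_deriv_left_invariant[OF V] \<phi> test_function_heis_left)
qed

section \<open>Local convergence of sets\<close>

text \<open>
  Convergence of the indicators in the mean on bounded sets: mass may escape to infinity.
\<close>

definition conv_loc :: "(nat \<Rightarrow> 'a::euclidean_space set) \<Rightarrow> 'a set \<Rightarrow> bool" where
  "conv_loc E F \<longleftrightarrow> (\<forall>R. (\<lambda>k. measure lborel (sym_diff (E k) F \<inter> ball 0 R)) \<longlonglongrightarrow> 0)"

lemma integrable_bounded_support:
  fixes f :: "'a::euclidean_space \<Rightarrow> real"
  assumes [measurable]: "f \<in> borel_measurable borel" and C: "\<And>x. \<bar>f x\<bar> \<le> C"
    and R: "\<And>x. f x \<noteq> 0 \<Longrightarrow> norm x < R"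
  shows "integrable lborel f"
proof (rule Bochner_Integration.integrable_bound)
  show "integrable lborel (\<lambda>x. C * indicat_real (ball 0 R) x)"
    by (intro integrable_mult_right integrable_real_indicator) (use emeasure_bounded_finite[OF bounded_ball, of 0 R] in auto)
  show "AE x in lborel. norm (f x) \<le> norm (C * indicat_real (ball 0 R) x)"
  proof (rule AE_I2)
    fix x show "norm (f x) \<le> norm (C * indicat_real (ball 0 R) x)"
      using C[of x] R[of x] by (cases "f x = 0") auto
  qed
qed simp

lemma integral_indicator_diff_le:
  fixes g :: "'a::euclidean_space \<Rightarrow> real"
  assumes [measurable]: "E \<in> sets borel" "F \<in> sets borel" "g \<in> borel_measurable borel"
    and C: "\<And>x. \<bar>g x\<bar> \<le> C" and R: "\<And>x. g x \<noteq> 0 \<Longrightarrow> norm x < R"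
  shows "\<bar>(LINT x|lborel. indicat_real E x * g x) - (LINT x|lborel. indicat_real F x * g x)\<bar>
    \<le> C * measure lborel (sym_diff E F \<inter> ball 0 R)"
proof -
  have i: "integrable lborel (\<lambda>x. indicat_real A x * g x)" if [measurable]: "A \<in> sets borel" for A
    using C R by (intro integrable_bounded_support[of _ C R]) (auto simp: indicator_def intro: order_trans[OF abs_ge_zero])
  have j: "integrable lborel (\<lambda>x. C * indicat_real (sym_diff E F \<inter> ball 0 R) x)"
    by (intro integrable_mult_right integrable_real_indicator) (use emeasure_bounded_finite[OF bounded_Int[OF disjI2[OF bounded_ball]], of _ 0 R] in auto)
  have "\<bar>LINT x|lborel. indicat_real E x * g x - indicat_real F x * g x\<bar>
      \<le> (LINT x|lborel. C * indicat_real (sym_diff E F \<inter> ball 0 R) x)"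
  proof (rule order_trans[OF integral_abs_bound integral_mono[OF _ j]])
    show "integrable lborel (\<lambda>x. \<bar>indicat_real E x * g x - indicat_real F x * g x\<bar>)"
      using i by auto
    show "\<bar>indicat_real E x * g x - indicat_real F x * g x\<bar> \<le> C * indicat_real (sym_diff E F \<inter> ball 0 R) x" for x
      using C[of x] R[of x] by (cases "g x = 0") (auto simp: indicator_def)
  qed
  then show ?thesis using i by (simp add: Bochner_Integration.integral_diff)
qed

lemma conv_loc_integral:
  fixes g :: "'a::euclidean_space \<Rightarrow> real"
  assumes "conv_loc E F" and [measurable]: "\<And>k. E k \<in> sets borel" "F \<in> sets borel" "g \<in> borel_measurable borel"
    and C: "\<And>x. \<bar>g x\<bar> \<le> C" and R: "\<And>x. g x \<noteq> 0 \<Longrightarrow> norm x < R"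
  shows "(\<lambda>k. LINT x|lborel. indicat_real (E k) x * g x) \<longlonglongrightarrow> (LINT x|lborel. indicat_real F x * g x)"
proof (rule LIM_zero_cancel, rule Lim_null_comparison)
  show "\<forall>\<^sub>F k in sequentially. norm ((LINT x|lborel. indicat_real (E k) x * g x) - (LINT x|lborel. indicat_real F x * g x))
      \<le> C * measure lborel (sym_diff (E k) F \<inter> ball 0 R)"
    using integral_indicator_diff_le[OF _ _ _ C R] by simp
  show "(\<lambda>k. C * measure lborel (sym_diff (E k) F \<inter> ball 0 R)) \<longlonglongrightarrow> 0"
    using assms(1) by (auto simp: conv_loc_def intro!: tendsto_mult_right_zero)
qed

text \<open>
  The total variation of the difference of two indicator densities is the measure of the symmetric
  difference, so the duality for vector measures applies.
\<close>

lemma measure_sym_diff_le_test: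
  fixes A B :: "'a::euclidean_space set"
  assumes [measurable]: "A \<in> sets borel" "B \<in> sets borel"
    and fin: "emeasure lborel A < \<infinity>" "emeasure lborel B < \<infinity>"
    and le: "\<And>\<psi>. test_function \<psi> \<Longrightarrow> (\<And>x. \<bar>\<psi> x\<bar> \<le> 1) \<Longrightarrow>
      (LINT x|lborel. indicat_real A x * \<psi> x) - (LINT x|lborel. indicat_real B x * \<psi> x) \<le> K"
  shows "measure lborel (sym_diff A B) \<le> K"
proof -
  define p where "p = density lborel (\<lambda>x. ennreal (indicat_real A x))"
  define n where "n = density lborel (\<lambda>x. ennreal (indicat_real B x))"
  have e: "emeasure (density lborel (\<lambda>x. ennreal (indicat_real S x))) T = emeasure lborel (S \<inter> T)"
    if [measurable]: "S \<in> sets borel" "T \<in> sets borel" for S T :: "'a set"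
  proof -
    have "emeasure (density lborel (\<lambda>x. ennreal (indicat_real S x))) T
        = (\<integral>\<^sup>+x. ennreal (indicat_real S x) * indicator T x \<partial>lborel)"
      by (subst emeasure_density) auto
    also have "\<dots> = (\<integral>\<^sup>+x. indicator (S \<inter> T) x \<partial>lborel)"
      by (intro nn_integral_cong) (auto simp: indicator_def)
    finally show ?thesis by simp
  qed
  have int: "(LINT x|density lborel (\<lambda>x. ennreal (indicat_real S x)). \<psi> x) = (LINT x|lborel. indicat_real S x * \<psi> x)"
    if [measurable]: "S \<in> sets borel" "\<psi> \<in> borel_measurable borel" for S :: "'a set" and \<psi> :: "'a \<Rightarrow> real"
    by (subst integral_density) auto
  \<comment> \<open>the type unit turns a signed measure into a vector measure with one component\<close>
  define \<nu> :: "'a set \<Rightarrow> real ^ unit" where "\<nu> S = (\<chi> i. measure p S - measure n S)" for S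
  have md: "measure_difference p n (\<lambda>S. \<nu> S $ i)" for i
    unfolding measure_difference_def measure_difference_axioms_def
  proof (intro conjI)
    show "finite_measure p" "finite_measure n"
      using fin e[of A UNIV] e[of B UNIV] by (auto intro!: finite_measureI simp: p_def n_def)
  qed (auto simp: p_def n_def \<nu>_def)
  interpret D: measure_difference p n "\<lambda>S. \<nu> S $ ()" by (rule md)
  have vm: "vector_measure \<nu>" unfolding vector_measure_def
  proof safe
    fix S :: "nat \<Rightarrow> 'a set" assume "range S \<subseteq> sets borel" "disjoint_family S"
    then have "(\<lambda>k. \<nu> (S k) $ i) sums (\<nu> (\<Union>k. S k) $ i)" for i
      using vector_measure_sums[OF vector_measureI_difference[OF md]] by blast
    then show "(\<lambda>k. \<nu> (S k)) sums \<nu> (\<Union>k. S k)"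
      unfolding sums_def by (intro vec_tendstoI) simp
  qed
  define b where "b S = measure p S + measure n S" for S
  have "total_variation \<nu> UNIV \<le> ennreal (b UNIV)"
  proof (rule total_variation_le_additive)
    show "norm (\<nu> S) \<le> b S" for S
      using norm_le_l1_cart[of "\<nu> S"] by (simp add: UNIV_unit \<nu>_def b_def)
        (smt (verit) measure_nonneg)
    show "(\<lambda>k. b (S k)) sums b (\<Union>k. S k)"
      if S: "range S \<subseteq> sets borel" "disjoint_family S" for S :: "nat \<Rightarrow> 'a set"
      unfolding b_def using S
      by (intro sums_add D.P.finite_measure_UNION D.N.finite_measure_UNION) (auto simp: p_def n_def)
  qed
  then have tv: "total_variation \<nu> UNIV < \<infinity>" by (simp add: le_less_trans)
  interpret finite_vector_measure_euclidean \<nu>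
    using vm tv by (simp add: finite_vector_measure_euclidean_def finite_vector_measure_def)
  have "total_variation \<nu> UNIV \<le> ennreal K"
  proof (rule total_variation_le_test_fields)
    fix \<phi> :: "unit \<Rightarrow> 'a \<Rightarrow> real" assume \<phi>: "test_field \<phi>"
    have t: "test_function (\<phi> ())" using \<phi> by (simp add: test_field_def)
    have "signed_integral (\<lambda>S. \<nu> S $ ()) (\<phi> ()) = (LINT x|p. \<phi> () x) - (LINT x|n. \<phi> () x)"
      by (rule signed_integral_component[OF md test_functionD(4)[OF t] test_field_component_le[OF \<phi>]])
    also have "\<dots> \<le> K"
      using le[OF t test_field_component_le[OF \<phi>]] test_functionD(4)[OF t] by (simp add: p_def n_def int)
    finally show "(\<Sum>i\<in>UNIV. signed_integral (\<lambda>S. \<nu> S $ i) (\<phi> i)) \<le> K" by (simp add: UNIV_unit)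
  qed
  moreover have "ennreal (norm (\<nu> (A - B))) + ennreal (norm (\<nu> (B - A))) \<le> total_variation \<nu> UNIV"
  proof -
    have "(\<Sum>b\<in>{True, False}. ennreal (norm (\<nu> (if b then A - B else B - A)))) \<le> total_variation \<nu> UNIV"
      by (rule total_variation_finite_upper) (auto simp: disjoint_family_on_def)
    then show ?thesis by simp
  qed
  moreover have "norm (\<nu> (A - B)) = measure lborel (A - B)" "norm (\<nu> (B - A)) = measure lborel (B - A)"
  proof -
    have "A \<inter> (A - B) = A - B" "B \<inter> (B - A) = B - A" by blast+
    then show "norm (\<nu> (A - B)) = measure lborel (A - B)" "norm (\<nu> (B - A)) = measure lborel (B - A)"
      by (auto simp: norm_vec_def UNIV_unit \<nu>_def measure_def p_def n_def e)
  qed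
  ultimately have "ennreal (measure lborel (A - B) + measure lborel (B - A)) \<le> ennreal K"
    by (simp add: ennreal_plus)
  moreover have "measure lborel (sym_diff A B) = measure lborel (A - B) + measure lborel (B - A)"
  proof (rule measure_Un_AE)
    have "emeasure lborel (A - B) \<le> emeasure lborel A" "emeasure lborel (B - A) \<le> emeasure lborel B"
      by (intro emeasure_mono; auto)+
    then show "A - B \<in> fmeasurable lborel" "B - A \<in> fmeasurable lborel"
      using fin by (auto intro!: fmeasurableI simp: le_less_trans)
  qed auto
  moreover have "0 \<le> K"
    using le[of "\<lambda>x. 0"] by (simp add: test_functionI[of _ "{}"] k_smooth_const)
  ultimately show ?thesis by (simp only: ennreal_le_iff)
qed

section \<open>Perimeter and right translations\<close>

locale heis_frame =
  fixes X :: "'n::finite + 'n \<Rightarrow> 'n heis \<Rightarrow> 'n heis"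
  assumes left_inv: "\<And>i. left_invariant (X i)" and hoer: "hoermander X"
begin

lemma distr_deriv_conv:
  assumes "conv_loc E F" "\<And>k. E k \<in> sets borel" "F \<in> sets borel" and \<phi>: "test_function \<phi>"
  shows "(\<lambda>k. distr_deriv (X i) (indicat_real (E k)) \<phi>) \<longlonglongrightarrow> distr_deriv (X i) (indicat_real F) \<phi>"
proof -
  have t: "test_function (along (X i) \<phi>)" by (rule test_function_along[OF left_inv \<phi>])
  obtain C where C: "\<And>x. \<bar>along (X i) \<phi> x\<bar> \<le> C" using test_function_bounded[OF t] by blast
  obtain R where R: "\<And>x. along (X i) \<phi> x \<noteq> 0 \<Longrightarrow> norm x < R" using test_functionD(5)[OF t] by blast
  show ?thesis
    unfolding distr_deriv_left_invariant[OF left_inv \<phi>]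
    by (intro tendsto_minus conv_loc_integral[OF assms(1-3) test_functionD(4)[OF t] C R])
qed

text \<open>
  Distributional derivatives pass to local limits, and vague limits of the measures that represent
  them represent the derivatives of the limit. This replaces the Riesz representation theorem.
\<close>

lemma bounded_variation_by_limit:
  assumes conv: "conv_loc E F" "\<And>k. E k \<in> sets borel" "F \<in> sets borel"
    and bv: "\<And>k. bounded_variation_by C X (E k)"
  shows "bounded_variation_by C X F"
  unfolding bounded_variation_by_def
proof
  fix i
  obtain p n where pn: "\<And>k. finite_measure (p k)" "\<And>k. finite_measure (n k)"
    "\<And>k. sets (p k) = sets borel" "\<And>k. sets (n k) = sets borel"
    "\<And>k. measure (p k) UNIV \<le> C" "\<And>k. measure (n k) UNIV \<le> C"
    "\<And>k \<phi>. test_function \<phi> \<Longrightarrow> distr_deriv (X i) (indicat_real (E k)) \<phi> = (LINT x|p k. \<phi> x) - (LINT x|n k. \<phi> x)"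
    using bv[unfolded bounded_variation_by_def, rule_format, of i] by metis
  obtain r M where rM: "strict_mono r" "finite_measure M" "sets M = sets borel" "measure M UNIV \<le> C"
    "\<And>\<phi> R. continuous_on UNIV \<phi> \<Longrightarrow> 0 < R \<Longrightarrow> (\<forall>x. \<phi> x \<noteq> 0 \<longrightarrow> norm x < R) \<Longrightarrow>
       (\<lambda>k. LINT x|p (r k). \<phi> x) \<longlonglongrightarrow> (LINT x|M. \<phi> x :: real)"
    by (rule vague_compactness[of p C]) (rule pn, rule pn, rule pn, rule that)
  obtain s L where sL: "strict_mono s" "finite_measure L" "sets L = sets borel" "measure L UNIV \<le> C"
    "\<And>\<phi> R. continuous_on UNIV \<phi> \<Longrightarrow> 0 < R \<Longrightarrow> (\<forall>x. \<phi> x \<noteq> 0 \<longrightarrow> norm x < R) \<Longrightarrow>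
       (\<lambda>k. LINT x|n (r (s k)). \<phi> x) \<longlonglongrightarrow> (LINT x|L. \<phi> x :: real)"
    by (rule vague_compactness[of "\<lambda>k. n (r k)" C]) (rule pn, rule pn, rule pn, rule that)
  have "distr_deriv (X i) (indicat_real F) \<phi> = (LINT x|M. \<phi> x) - (LINT x|L. \<phi> x)"
    if \<phi>: "test_function \<phi>" for \<phi>
  proof -
    obtain R where R: "0 < R" "\<forall>x. \<phi> x \<noteq> 0 \<longrightarrow> norm x < R" using test_functionD(5)[OF \<phi>] by blast
    have "(\<lambda>k. LINT x|p (r (s k)). \<phi> x) \<longlonglongrightarrow> (LINT x|M. \<phi> x)"
      using LIMSEQ_subseq_LIMSEQ[OF rM(5)[OF test_functionD(2)[OF \<phi>] R] sL(1)] by (simp add: o_def)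
    from tendsto_diff[OF this sL(5)[OF test_functionD(2)[OF \<phi>] R]]
    have "(\<lambda>k. distr_deriv (X i) (indicat_real (E (r (s k)))) \<phi>) \<longlonglongrightarrow> (LINT x|M. \<phi> x) - (LINT x|L. \<phi> x)"
      by (simp only: pn(7)[OF \<phi>])
    moreover have "(\<lambda>k. distr_deriv (X i) (indicat_real (E (r (s k)))) \<phi>) \<longlonglongrightarrow> distr_deriv (X i) (indicat_real F) \<phi>"
      using LIMSEQ_subseq_LIMSEQ[OF distr_deriv_conv[OF conv \<phi>] strict_mono_o[OF rM(1) sL(1)]]
      by (simp add: o_def)
    ultimately show ?thesis by (rule LIMSEQ_unique[symmetric])
  qed
  then show "\<exists>p n. finite_measure p \<and> finite_measure n \<and> sets p = sets borel \<and> sets n = sets borel \<and>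
      measure p UNIV \<le> C \<and> measure n UNIV \<le> C \<and>
      (\<forall>\<phi>. test_function \<phi> \<longrightarrow> distr_deriv (X i) (indicat_real F) \<phi> = (LINT x|p. \<phi> x) - (LINT x|n. \<phi> x))"
    using rM(2-4) sL(2-4) by blast
qed

text \<open>
  The representing measures are transported by the translation.
\<close>

lemma bounded_variation_by_translate:
  assumes bv: "bounded_variation_by C X E" and E: "E \<in> sets borel"
  shows "bounded_variation_by C X {q. heis_mult a q \<in> E}"
  unfolding bounded_variation_by_def
proof
  fix i
  obtain p n where pn: "finite_measure p" "finite_measure n" "sets p = sets borel" "sets n = sets borel"
    "measure p UNIV \<le> C" "measure n UNIV \<le> C"
    "\<And>\<phi>. test_function \<phi> \<Longrightarrow> distr_deriv (X i) (indicat_real E) \<phi> = (LINT x|p. \<phi> x) - (LINT x|n. \<phi> x)"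
    using bv unfolding bounded_variation_by_def by metis
  let ?T = "\<lambda>M. distr M borel (heis_mult (- a))"
  have T: "finite_measure (?T M)" "sets (?T M) = sets borel" "measure (?T M) UNIV = measure M UNIV"
    "\<And>\<phi>. test_function \<phi> \<Longrightarrow> (LINT x|?T M. \<phi> x) = (LINT x|M. \<phi> (heis_mult (- a) x))"
    if M: "finite_measure M" "sets M = sets borel" for M
  proof -
    have m: "heis_mult (- a) \<in> measurable M borel" by (simp add: measurable_cong_sets[OF M(2)])
    have sp: "space M = UNIV" using sets_eq_imp_space_eq[OF M(2)] by simp
    show "finite_measure (?T M)" by (rule finite_measure.finite_measure_distr[OF M(1) m])
    show "measure (?T M) UNIV = measure M UNIV" using m sp by (simp add: measure_distr)
    show "(LINT x|?T M. \<phi> x) = (LINT x|M. \<phi> (heis_mult (- a) x))" if "test_function \<phi>" for \<phi>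
      by (rule integral_distr[OF m test_functionD(4)[OF that]])
  qed simp
  have "distr_deriv (X i) (indicat_real {q. heis_mult a q \<in> E}) \<psi> = (LINT x|?T p. \<psi> x) - (LINT x|?T n. \<psi> x)"
    if \<psi>: "test_function \<psi>" for \<psi>
  proof -
    let ?\<phi> = "\<lambda>q. \<psi> (heis_mult (- a) q)"
    have t: "test_function ?\<phi>" by (rule test_function_heis_left[OF \<psi>])
    have "distr_deriv (X i) (indicat_real {q. heis_mult a q \<in> E}) \<psi> = distr_deriv (X i) (indicat_real E) ?\<phi>"
      using distr_deriv_translate[OF left_inv t E, of i a] by simp
    then show ?thesis using pn(7)[OF t] T(4)[OF pn(1,3) \<psi>] T(4)[OF pn(2,4) \<psi>] by simp
  qed
  then show "\<exists>p n. finite_measure p \<and> finite_measure n \<and> sets p = sets borel \<and> sets n = sets borel \<and>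
      measure p UNIV \<le> C \<and> measure n UNIV \<le> C \<and>
      (\<forall>\<phi>. test_function \<phi> \<longrightarrow>
        distr_deriv (X i) (indicat_real {q. heis_mult a q \<in> E}) \<phi> = (LINT x|p. \<phi> x) - (LINT x|n. \<phi> x))"
    using T[OF pn(1,3)] T[OF pn(2,4)] pn(5,6)
    by (intro exI[of _ "?T p"] exI[of _ "?T n"]) auto
qed

text \<open>
  A test function of modulus at most 1 in the direction i is an admissible field.
\<close>

lemma abs_distr_deriv_le_perimeter:
  assumes \<phi>: "test_function \<phi>" "\<And>x. \<bar>\<phi> x\<bar> \<le> 1" and c: "perimeter X E \<le> ennreal c" "0 \<le> c"
  shows "\<bar>distr_deriv (X i) (indicat_real E) \<phi>\<bar> \<le> c"
proof -
  have *: "distr_deriv (X i) (indicat_real E) \<psi> \<le> c"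
    if \<psi>: "test_function \<psi>" "\<And>x. \<bar>\<psi> x\<bar> \<le> 1" for \<psi>
  proof -
    define \<Psi> where "\<Psi> j = (if j = i then \<psi> else (\<lambda>x. 0))" for j
    have z: "test_function (\<lambda>x::'n heis. 0)" by (rule test_functionI[of _ "{}"]) (auto simp: k_smooth_const)
    have "(\<Sum>j\<in>UNIV. (\<Psi> j x)\<^sup>2) = (\<psi> x)\<^sup>2" for x
    proof -
      have "(\<Sum>j\<in>UNIV. (\<Psi> j x)\<^sup>2) = (\<Sum>j\<in>UNIV. if j = i then (\<psi> x)\<^sup>2 else 0)"
        by (intro sum.cong) (auto simp: \<Psi>_def)
      then show ?thesis by simp
    qed
    moreover have "(\<psi> x)\<^sup>2 \<le> 1" for x using \<psi>(2)[of x] by (simp add: abs_square_le_1)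
    ultimately have "test_field \<Psi>" using \<psi>(1) z by (simp add: test_field_def \<Psi>_def)
    have "along V (\<lambda>x. 0) x = 0" for V :: "'n heis \<Rightarrow> 'n heis" and x by (simp add: along_def)
    then have "distr_deriv (X j) f (\<lambda>x. 0) = 0" for j f
      by (simp add: distr_deriv_left_invariant[OF left_inv z])
    then have "field_variation X E \<Psi> = (\<Sum>j\<in>UNIV. if j = i then distr_deriv (X i) (indicat_real E) \<psi> else 0)"
      unfolding field_variation_def by (intro sum.cong) (auto simp: \<Psi>_def)
    then have "field_variation X E \<Psi> = distr_deriv (X i) (indicat_real E) \<psi>" by simp
    then have "ennreal (distr_deriv (X i) (indicat_real E) \<psi>) \<le> ennreal c"
      using field_variation_le_perimeter[OF \<open>test_field \<Psi>\<close>, of X E] c(1) by (metis order_trans)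
    then show ?thesis using c(2) by (simp add: ennreal_le_iff)
  qed
  have m: "test_function (\<lambda>x. - \<phi> x)"
    using test_function_sum_mult[of "{()}" "\<lambda>_. \<phi>" "\<lambda>_. -1"] \<phi>(1) by simp
  have "((\<lambda>x. - \<phi> x) has_derivative (\<lambda>v. - frechet_derivative \<phi> (at x) v)) (at x)" for x
    using test_functionD(3)[OF \<phi>(1)] by (intro has_derivative_minus) (simp add: frechet_derivative_works)
  then have "along (X i) (\<lambda>x. - \<phi> x) x = - along (X i) \<phi> x" for x
    unfolding along_def by (metis frechet_derivative_at)
  then have "distr_deriv (X i) (indicat_real E) (\<lambda>x. - \<phi> x) = - distr_deriv (X i) (indicat_real E) \<phi>"
    by (simp add: distr_deriv_left_invariant[OF left_inv] m \<phi>(1))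
  then show ?thesis using *[OF \<phi>] *[OF m] \<phi>(2) by (simp add: abs_le_iff)
qed

lemma flow_eq: "heis_mult q (s *\<^sub>R X i 0) = q + s *\<^sub>R X i q"
proof -
  have "q + s *\<^sub>R X i q = q + s *\<^sub>R (X i 0 + vert (form q (X i 0)))"
    by (subst left_invariant_eq[OF left_inv]) (rule refl)
  then show ?thesis by (simp add: heis_mult_eq scaleR_add_right add.assoc)
qed

text \<open>
  The integral curves of a left-invariant field are straight lines in exponential coordinates,
  namely right translates by multiples of its value at 0.
\<close>

lemma flow_derivative:
  assumes \<phi>: "test_function \<phi>"
  shows "((\<lambda>s. \<phi> (heis_mult q (s *\<^sub>R X i 0))) has_real_derivative
    along (X i) \<phi> (heis_mult q (s *\<^sub>R X i 0))) (at s within S)"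
proof -
  let ?g = "\<lambda>s. q + s *\<^sub>R X i q"
  have "(?g has_derivative (\<lambda>h. h *\<^sub>R X i q)) (at s within S)"
    by (auto intro!: derivative_eq_intros)
  moreover have "(\<phi> has_derivative frechet_derivative \<phi> (at (?g s))) (at (?g s))"
    using test_functionD(3)[OF \<phi>] by (simp add: frechet_derivative_works)
  ultimately have "((\<lambda>s. \<phi> (?g s)) has_derivative (\<lambda>h. frechet_derivative \<phi> (at (?g s)) (h *\<^sub>R X i q))) (at s within S)"
    by (rule has_derivative_compose)
  moreover have "frechet_derivative \<phi> (at (?g s)) (h *\<^sub>R X i q) = along (X i) \<phi> (?g s) * h" for h
  proof -
    interpret bounded_linear "frechet_derivative \<phi> (at (?g s))"
      using test_functionD(3)[OF \<phi>, of "?g s", unfolded frechet_derivative_works]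
      by (rule has_derivative_bounded_linear)
    have "X i (?g s) = X i q"
    proof -
      have e1: "X i (?g s) = X i 0 + vert (form (?g s) (X i 0))" by (rule left_invariant_eq[OF left_inv])
      have e2: "X i q = X i 0 + vert (form q (X i 0))" by (rule left_invariant_eq[OF left_inv])
      have "form (X i q) (X i 0) = 0" by (subst e2) simp
      then have "form (?g s) (X i 0) = form q (X i 0)" by simp
      then show ?thesis unfolding e1 by (simp only: e2[symmetric])
    qed
    then show ?thesis by (simp add: scaleR along_def mult.commute)
  qed
  ultimately show ?thesis by (simp add: has_field_derivative_def flow_eq)
qed

lemma flow_lipschitz:
  assumes \<phi>: "test_function \<phi>" and C: "\<And>x. \<bar>along (X i) \<phi> x\<bar> \<le> C"
  shows "\<bar>\<phi> (heis_mult q (s *\<^sub>R X i 0)) - \<phi> q\<bar> \<le> C * \<bar>s\<bar>"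
proof -
  have "norm (\<phi> (heis_mult q (s *\<^sub>R X i 0)) - \<phi> (heis_mult q (0 *\<^sub>R X i 0))) \<le> C * norm (s - 0)"
    by (rule field_differentiable_bound[OF convex_UNIV flow_derivative[OF \<phi>]]) (use C in auto)
  then show ?thesis by (simp add: heis_mult_0_right)
qed

lemma flow_integral_derivative_0:
  assumes \<phi>: "test_function \<phi>" and [measurable]: "E \<in> sets borel" and fin: "emeasure lborel E < \<infinity>"
  shows "((\<lambda>s. LINT q|lborel. indicat_real E q * \<phi> (heis_mult q (s *\<^sub>R X i 0))) has_real_derivative
    (LINT q|lborel. indicat_real E q * along (X i) \<phi> q)) (at 0)"
proof -
  have t: "test_function (along (X i) \<phi>)" by (rule test_function_along[OF left_inv \<phi>])
  obtain C where C: "\<And>x. \<bar>along (X i) \<phi> x\<bar> \<le> C" using test_function_bounded[OF t] by blast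
  obtain C' where C': "\<And>x. \<bar>\<phi> x\<bar> \<le> C'" using test_function_bounded[OF \<phi>] by blast
  have [measurable]: "\<phi> \<in> borel_measurable borel" "along (X i) \<phi> \<in> borel_measurable borel"
    using test_functionD(4) \<phi> t by blast+
  let ?F = "\<lambda>s q. indicat_real E q * \<phi> (heis_mult q (s *\<^sub>R X i 0))"
  have iE: "integrable lborel (\<lambda>q. K * indicat_real E q)" for K
    using fin by (intro integrable_mult_right integrable_real_indicator) auto
  have iF: "integrable lborel (?F s)" for s
    by (rule Bochner_Integration.integrable_bound[OF iE[of C']])
      (use C' in \<open>auto simp: indicator_def intro!: AE_I2 order_trans[OF C' abs_ge_self]\<close>)
  have "((\<lambda>h. ((LINT q|lborel. ?F h q) - (LINT q|lborel. ?F 0 q)) / h) \<longlongrightarrow>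
      (LINT q|lborel. indicat_real E q * along (X i) \<phi> q)) (at 0)"
    unfolding tendsto_at_iff_sequentially
  proof (intro allI impI)
    fix h :: "nat \<Rightarrow> real" assume h: "\<forall>k. h k \<in> UNIV - {0}" "h \<longlonglongrightarrow> 0"
    have "(\<lambda>k. LINT q|lborel. (?F (h k) q - ?F 0 q) / h k) \<longlonglongrightarrow> (LINT q|lborel. indicat_real E q * along (X i) \<phi> q)"
    proof (rule integral_dominated_convergence[where w="\<lambda>q. C * indicat_real E q"])
      show "AE q in lborel. (\<lambda>k. (?F (h k) q - ?F 0 q) / h k) \<longlonglongrightarrow> indicat_real E q * along (X i) \<phi> q"
      proof (rule AE_I2)
        fix q
        have "((\<lambda>s. (\<phi> (heis_mult q (s *\<^sub>R X i 0)) - \<phi> q) / s) \<longlongrightarrow> along (X i) \<phi> q) (at 0)"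
          using flow_derivative[OF \<phi>, of q i 0 UNIV]
          by (simp add: has_field_derivative_iff heis_mult_0_right)
        then have "(\<lambda>k. (\<phi> (heis_mult q (h k *\<^sub>R X i 0)) - \<phi> q) / h k) \<longlonglongrightarrow> along (X i) \<phi> q"
          using h unfolding tendsto_at_iff_sequentially by (auto simp: o_def)
        from tendsto_mult[OF tendsto_const[of "indicat_real E q"] this]
        show "(\<lambda>k. (?F (h k) q - ?F 0 q) / h k) \<longlonglongrightarrow> indicat_real E q * along (X i) \<phi> q"
          by (simp add: heis_mult_0_right right_diff_distrib)
      qed
      show "AE q in lborel. norm ((?F (h k) q - ?F 0 q) / h k) \<le> C * indicat_real E q" for k
      proof (rule AE_I2)
        fix q
        have "\<bar>\<phi> (heis_mult q (h k *\<^sub>R X i 0)) - \<phi> q\<bar> / \<bar>h k\<bar> \<le> C"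
          using flow_lipschitz[OF \<phi> C, of q "h k"] h(1) by (simp add: divide_le_eq)
        then show "norm ((?F (h k) q - ?F 0 q) / h k) \<le> C * indicat_real E q"
          by (auto simp: indicator_def heis_mult_0_right abs_divide)
      qed
    qed (use iE in auto)
    moreover have "(LINT q|lborel. (?F (h k) q - ?F 0 q) / h k) = ((LINT q|lborel. ?F (h k) q) - (LINT q|lborel. ?F 0 q)) / h k" for k
      by (subst Bochner_Integration.integral_diff[OF iF iF, symmetric]) simp
    ultimately show "((\<lambda>h. ((LINT q|lborel. ?F h q) - (LINT q|lborel. ?F 0 q)) / h) \<circ> h) \<longlonglongrightarrow>
        (LINT q|lborel. indicat_real E q * along (X i) \<phi> q)"
      by (simp only: o_def)
  qed
  then show ?thesis by (simp add: has_field_derivative_iff)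
qed

text \<open>
  The flow of a left-invariant field commutes with the field, so the derivative at every time is
  again an integral of a derivative along the field, applied to a test function of modulus at most
  1. It is bounded by the perimeter.
\<close>

lemma flow_integral_bound:
  assumes \<phi>: "test_function \<phi>" "\<And>x. \<bar>\<phi> x\<bar> \<le> 1" and E: "E \<in> sets borel" "emeasure lborel E < \<infinity>"
    and c: "perimeter X E \<le> ennreal c" "0 \<le> c"
  shows "\<bar>(LINT q|lborel. indicat_real E q * \<phi> (heis_mult q (s *\<^sub>R X i 0))) - (LINT q|lborel. indicat_real E q * \<phi> q)\<bar>
    \<le> c * \<bar>s\<bar>"
proof -
  let ?F = "\<lambda>s. LINT q|lborel. indicat_real E q * \<phi> (heis_mult q (s *\<^sub>R X i 0))"
  let ?\<phi> = "\<lambda>s q. \<phi> (heis_mult q (s *\<^sub>R X i 0))"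
  let ?D = "\<lambda>s. LINT q|lborel. indicat_real E q * along (X i) (?\<phi> s) q"
  have t: "test_function (?\<phi> s)" for s by (rule test_function_heis_right[OF \<phi>(1)])
  have D: "(?F has_real_derivative ?D s) (at s)" for s
  proof -
    \<comment> \<open>the group property of the flow moves the derivative from time 0 to time s\<close>
    have "?\<phi> s (heis_mult q (h *\<^sub>R X i 0)) = ?\<phi> (h + s) q" for h q
      by (simp add: heis_mult_assoc) (simp add: heis_mult_eq scaleR_add_left)
    then have "((\<lambda>h. ?F (h + s)) has_real_derivative ?D s) (at 0)"
      using flow_integral_derivative_0[OF t[of s] E, where i=i] by simp
    then show ?thesis using DERIV_shift[of ?F "?D s" 0 s] by simp
  qed
  have "norm (?D s) \<le> c" for s
    using abs_distr_deriv_le_perimeter[OF t _ c, of s i] \<phi>(2)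
    by (simp add: distr_deriv_left_invariant[OF left_inv t])
  then have "norm (?F s - ?F 0) \<le> c * norm (s - 0)"
    by (intro field_differentiable_bound[of UNIV ?F ?D]) (auto intro: D)
  then show ?thesis by (simp add: heis_mult_0_right)
qed

text \<open>
  The smallest such K is at most the length of any path from 0 to h that follows the flows of the
  fields one after the other, by the triangle inequality \<open>shift_bound_mult\<close>.
\<close>

definition shift_bound :: "real \<Rightarrow> 'n heis \<Rightarrow> bool" where
  "shift_bound K h \<longleftrightarrow> (\<forall>E c. E \<in> sets borel \<longrightarrow> emeasure lborel E < \<infinity> \<longrightarrow>
     perimeter X E \<le> ennreal c \<longrightarrow> 0 \<le> c \<longrightarrow> measure lborel (sym_diff E {q. heis_mult q h \<in> E}) \<le> K * c)"

text \<open>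
  The symmetric difference is tested against functions of modulus at most 1, for which the
  previous estimate applies after a change of variables.
\<close>

lemma shift_bound_flow: "shift_bound \<bar>s\<bar> (s *\<^sub>R X i 0)"
  unfolding shift_bound_def
proof (intro allI impI)
  fix E :: "'n heis set" and c
  assume E: "E \<in> sets borel" "emeasure lborel E < \<infinity>" and c: "perimeter X E \<le> ennreal c" "0 \<le> c"
  let ?h = "s *\<^sub>R X i 0"
  let ?E = "{q. heis_mult q ?h \<in> E}"
  have Es: "?E \<in> sets borel" using E(1) by measurable
  have "measure lborel (sym_diff ?E E) \<le> c * \<bar>- s\<bar>"
  proof (rule measure_sym_diff_le_test[OF Es E(1)])
    show "emeasure lborel ?E < \<infinity>" using E by (simp add: emeasure_heis_right)
    fix \<psi> :: "'n heis \<Rightarrow> real" assume \<psi>: "test_function \<psi>" "\<And>x. \<bar>\<psi> x\<bar> \<le> 1"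
    have [measurable]: "\<psi> \<in> borel_measurable borel" using test_functionD(4)[OF \<psi>(1)] .
    have "heis_mult (heis_mult q ?h) (- s *\<^sub>R X i 0) = q" for q by simp
    then have "(LINT q|lborel. indicat_real ?E q * \<psi> q) =
        (LINT q|lborel. indicat_real E (heis_mult q ?h) * \<psi> (heis_mult (heis_mult q ?h) (- s *\<^sub>R X i 0)))"
      by (intro Bochner_Integration.integral_cong) (auto simp: indicator_def)
    also have "\<dots> = (LINT q|lborel. indicat_real E q * \<psi> (heis_mult q (- s *\<^sub>R X i 0)))"
      by (rule integral_heis_right[of "\<lambda>q. indicat_real E q * \<psi> (heis_mult q (- s *\<^sub>R X i 0))"])
        (intro borel_measurable_times borel_measurable_indicator E(1)
          measurable_compose[OF measurable_heis_right test_functionD(4)[OF \<psi>(1)]])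
    finally show "(LINT q|lborel. indicat_real ?E q * \<psi> q) - (LINT q|lborel. indicat_real E q * \<psi> q) \<le> c * \<bar>- s\<bar>"
      using flow_integral_bound[OF \<psi> E c, of "- s" i] by simp
  qed fact
  then show "measure lborel (sym_diff E ?E) \<le> \<bar>s\<bar> * c" by (simp add: Un_commute mult.commute)
qed

lemma shift_bound_mono: "shift_bound K h \<Longrightarrow> K \<le> L \<Longrightarrow> shift_bound L h"
  unfolding shift_bound_def by (meson mult_right_mono order_trans)

lemma shift_bound_0: "shift_bound 0 0"
  by (simp add: shift_bound_def heis_mult_0_right)

lemma sym_diff_fmeasurable:
  assumes [measurable]: "A \<in> sets borel" "B \<in> sets borel" and "emeasure lborel A < \<infinity>" "emeasure lborel B < \<infinity>"
  shows "sym_diff A B \<in> fmeasurable lborel"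
proof -
  have "A \<union> B \<in> fmeasurable lborel" using assms by (intro fmeasurable.Un fmeasurableI) auto
  then show ?thesis by (rule fmeasurableI2) auto
qed

text \<open>
  Right translation preserves measure, so the symmetric difference of the second step can be
  translated back to that of the set itself.
\<close>

lemma shift_bound_mult:
  assumes "shift_bound K g" "shift_bound L h"
  shows "shift_bound (K + L) (heis_mult g h)"
  unfolding shift_bound_def
proof (intro allI impI)
  fix E :: "'n heis set" and c
  assume E[measurable]: "E \<in> sets borel" and fin: "emeasure lborel E < \<infinity>" and c: "perimeter X E \<le> ennreal c" "0 \<le> c"
  let ?S = "\<lambda>h E. {q. heis_mult q h \<in> E}"
  have m[measurable]: "?S h A \<in> sets borel" if [measurable]: "A \<in> sets borel" for h A by measurable
  have f: "emeasure lborel (?S h A) < \<infinity>" if "A \<in> sets borel" "emeasure lborel A < \<infinity>" for h A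
    using that by (simp add: emeasure_heis_right)
  have "measure lborel (sym_diff E (?S (heis_mult g h) E))
      \<le> measure lborel (sym_diff E (?S g E) \<union> ?S g (sym_diff E (?S h E)))"
  proof (rule measure_mono_fmeasurable)
    show "sym_diff E (?S (heis_mult g h) E) \<subseteq> sym_diff E (?S g E) \<union> ?S g (sym_diff E (?S h E))"
      by (auto simp: heis_mult_assoc)
    have "?S g (sym_diff E (?S h E)) = sym_diff (?S g E) (?S g (?S h E))" by auto
    then show "sym_diff E (?S g E) \<union> ?S g (sym_diff E (?S h E)) \<in> fmeasurable lborel"
      by (simp only:) (intro fmeasurable.Un sym_diff_fmeasurable m f E fin)
  qed (auto simp: E)
  also have "\<dots> \<le> measure lborel (sym_diff E (?S g E)) + measure lborel (?S g (sym_diff E (?S h E)))"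
    by (rule measure_Un_le) auto
  also have "measure lborel (?S g (sym_diff E (?S h E))) = measure lborel (sym_diff E (?S h E))"
    unfolding measure_def by (subst emeasure_heis_right) auto
  also have "measure lborel (sym_diff E (?S g E)) \<le> K * c"
    using assms(1) E fin c unfolding shift_bound_def by blast
  also have "measure lborel (sym_diff E (?S h E)) \<le> L * c"
    using assms(2) E fin c unfolding shift_bound_def by blast
  finally show "measure lborel (sym_diff E (?S (heis_mult g h) E)) \<le> (K + L) * c"
    by (simp add: distrib_right)
qed

end

section \<open>Translations by arbitrary elements\<close>

definition hor :: "'n::finite heis \<Rightarrow> (real ^ 'n) \<times> (real ^ 'n)" where
  "hor p = (fst p, fst (snd p))"

lemma linear_hor: "linear hor"
  by (rule linearI) (simp_all add: hor_def)

lemma hor_vert [simp]: "hor (vert t) = 0"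
  by (simp add: hor_def vert_def zero_prod_def)

lemma norm_hor_le: "norm (hor p) \<le> norm p"
proof -
  obtain a b c where p: "p = (a, b, c)" by (cases p)
  have "norm (a, b) \<le> norm (a, b, c)" by (simp add: norm_Pair)
  then show ?thesis by (simp add: p hor_def)
qed

lemma hor_eq_imp_vert:
  assumes "hor p = hor q" shows "p = q + vert (snd (snd p) - snd (snd q))"
  using assms by (cases p, cases q) (simp add: hor_def vert_def)

lemma span_range_finite_index:
  fixes f :: "'i::finite \<Rightarrow> 'b::real_vector"
  assumes "x \<in> span (range f)" obtains s where "x = (\<Sum>i\<in>UNIV. s i *\<^sub>R f i)"
proof -
  let ?S = "range (\<lambda>s. \<Sum>i\<in>UNIV. s i *\<^sub>R f i)"
  have "subspace ?S"
    unfolding subspace_def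
  proof (intro conjI ballI allI)
    show "0 \<in> ?S" by (rule range_eqI[of _ _ "\<lambda>_. 0"]) simp
    show "x + y \<in> ?S" if "x \<in> ?S" "y \<in> ?S" for x y
    proof -
      from that obtain s t where "x = (\<Sum>i\<in>UNIV. s i *\<^sub>R f i)" "y = (\<Sum>i\<in>UNIV. t i *\<^sub>R f i)" by blast
      then show ?thesis
        by (intro range_eqI[of _ _ "\<lambda>i. s i + t i"]) (simp add: scaleR_add_left sum.distrib)
    qed
    show "c *\<^sub>R x \<in> ?S" if "x \<in> ?S" for c x
    proof -
      from that obtain s where "x = (\<Sum>i\<in>UNIV. s i *\<^sub>R f i)" by blast
      then show ?thesis
        by (intro range_eqI[of _ _ "\<lambda>i. c * s i"]) (simp add: scaleR_sum_right)
    qed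
  qed
  moreover have "range f \<subseteq> ?S"
  proof safe
    fix j
    have "(\<Sum>i\<in>UNIV. (if i = j then 1 else 0) *\<^sub>R f i) = (\<Sum>i\<in>UNIV. if i = j then f i else 0)"
      by (intro sum.cong) auto
    then show "f j \<in> ?S" by (intro range_eqI[of _ _ "\<lambda>i. if i = j then 1 else 0"]) simp
  qed
  ultimately have "span (range f) \<subseteq> ?S" by (intro span_minimal)
  then show ?thesis using assms that by blast
qed

text \<open>
  The coefficients are chosen linearly by prescribing them on an orthonormal basis.
\<close>

lemma spanning_family_bounded_coefficients:
  fixes f :: "'i::finite \<Rightarrow> 'b::euclidean_space"
  assumes "span (range f) = UNIV"
  obtains C where "0 \<le> C" "\<And>w. \<exists>s. w = (\<Sum>i\<in>UNIV. s i *\<^sub>R f i) \<and> (\<Sum>i\<in>UNIV. \<bar>s i\<bar>) \<le> C * norm w"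
proof -
  have "\<exists>s. b = (\<Sum>i\<in>UNIV. s i *\<^sub>R f i)" for b
    using span_range_finite_index[of b f] assms by (metis UNIV_I)
  then obtain c where c: "\<And>b. b = (\<Sum>i\<in>UNIV. c b i *\<^sub>R f i)" by metis
  define C where "C = (\<Sum>i\<in>UNIV. \<Sum>b\<in>Basis. \<bar>c b i\<bar>)"
  show ?thesis
  proof (rule that[of C])
    show "0 \<le> C" by (auto simp: C_def intro!: sum_nonneg)
    fix w
    define s where "s i = (\<Sum>b\<in>Basis. (w \<bullet> b) * c b i)" for i
    have "w = (\<Sum>b\<in>Basis. (w \<bullet> b) *\<^sub>R b)" by (simp only: euclidean_representation)
    also have "\<dots> = (\<Sum>b\<in>Basis. (w \<bullet> b) *\<^sub>R (\<Sum>i\<in>UNIV. c b i *\<^sub>R f i))"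
      by (intro sum.cong arg_cong2[of _ _ _ _ scaleR] c) auto
    also have "\<dots> = (\<Sum>i\<in>UNIV. s i *\<^sub>R f i)"
      unfolding s_def scaleR_sum_right scaleR_sum_left scaleR_scaleR by (rule sum.swap)
    finally have "w = (\<Sum>i\<in>UNIV. s i *\<^sub>R f i)" .
    moreover have "(\<Sum>i\<in>UNIV. \<bar>s i\<bar>) \<le> (\<Sum>i\<in>UNIV. (\<Sum>b\<in>Basis. \<bar>c b i\<bar>) * norm w)"
    proof (rule sum_mono)
      fix i
      have "\<bar>s i\<bar> \<le> (\<Sum>b\<in>Basis. \<bar>(w \<bullet> b) * c b i\<bar>)" unfolding s_def by (rule sum_abs)
      also have "\<dots> \<le> (\<Sum>b\<in>Basis. \<bar>c b i\<bar> * norm w)"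
      proof (rule sum_mono)
        fix b :: 'b assume "b \<in> Basis"
        then have "\<bar>w \<bullet> b\<bar> * \<bar>c b i\<bar> \<le> norm w * \<bar>c b i\<bar>" by (intro mult_right_mono Basis_le_norm) auto
        then show "\<bar>(w \<bullet> b) * c b i\<bar> \<le> \<bar>c b i\<bar> * norm w" by (simp add: abs_mult mult.commute)
      qed
      finally show "\<bar>s i\<bar> \<le> (\<Sum>b\<in>Basis. \<bar>c b i\<bar>) * norm w" by (simp add: sum_distrib_right)
    qed
    ultimately show "\<exists>s. w = (\<Sum>i\<in>UNIV. s i *\<^sub>R f i) \<and> (\<Sum>i\<in>UNIV. \<bar>s i\<bar>) \<le> C * norm w"
      by (auto simp: C_def sum_distrib_right)
  qed
qed

context heis_frame
begin

lemma lie_bracket_fields: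
  "lie_bracket (X i) (X j) = (\<lambda>p. vert (2 * form (X i 0) (X j 0)))"
proof
  fix p
  have d: "frechet_derivative (X k) (at p) = (\<lambda>u. vert (form u (X k 0)))" for k
    by (rule frechet_derivative_at[OF left_invariant_has_derivative[OF left_inv], symmetric])
  have e: "form (X k p) q = form (X k 0) q" for k q
    unfolding left_invariant_eq[OF left_inv, of k p] by simp
  show "lie_bracket (X i) (X j) p = vert (2 * form (X i 0) (X j 0))"
    unfolding lie_bracket_def d e using form_commute[of "X i 0" "X j 0"] by simp
qed

text \<open>
  The group has step two, so brackets only add central directions, and only if some pair of the
  fields fails to commute.
\<close>

lemma iterated_brackets_cases:
  assumes "V \<in> iterated_brackets X"
  shows "(\<exists>i. V = X i) \<or> (\<exists>c. V = (\<lambda>p. vert c) \<and> ((\<forall>i j. form (X i 0) (X j 0) = 0) \<longrightarrow> c = 0))"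
  using assms
proof (induction rule: iterated_brackets.induct)
  case (base i) then show ?case by blast
next
  case (bracket V W)
  have d: "frechet_derivative (X k) (at p) (vert c) = 0" for k p c
    unfolding frechet_derivative_at[OF left_invariant_has_derivative[OF left_inv], symmetric] by simp
  have z: "frechet_derivative (\<lambda>p::'n heis. vert c :: 'n heis) (at p) u = 0" for c p u
    by (simp add: frechet_derivative_const)
  have k: "frechet_derivative U (at p) (vert c) = 0"
    if "(\<exists>i. U = X i) \<or> (\<exists>c. U = (\<lambda>p. vert c) \<and> Q c)" for U Q p c
    using that by (elim disjE exE conjE) (simp_all only: d z)
  have "lie_bracket V W = (\<lambda>p. vert 0)" if "W = (\<lambda>p. vert c)" for c
    unfolding lie_bracket_def that z k[OF bracket.IH(1)] by simp
  moreover have "lie_bracket V W = (\<lambda>p. vert 0)" if "V = (\<lambda>p. vert c)" for c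
    unfolding lie_bracket_def that z k[OF bracket.IH(2)] by simp
  moreover have "lie_bracket V W = (\<lambda>p. vert (2 * form (X i 0) (X j 0)))" if "V = X i" "W = X j" for i j
    using that lie_bracket_fields by simp
  ultimately show ?case using bracket.IH by (metis mult_zero_right)
qed

lemma bracket_values_span: "span ((\<lambda>V. V 0) ` iterated_brackets X) = UNIV"
  using hoer unfolding hoermander_def by (rule spec)

lemma bracket_values_subset:
  "(\<lambda>V. V 0) ` iterated_brackets X \<subseteq> range (\<lambda>i. X i 0) \<union> range vert"
  using iterated_brackets_cases by fastforce

text \<open>
  Otherwise the 2n fields alone would span the tangent space at 0, which has dimension 2n + 1.
\<close>

lemma noncommuting_pair: "\<exists>i j. form (X i 0) (X j 0) \<noteq> 0"
proof (rule ccontr)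
  assume "\<not> ?thesis"
  then have "(\<lambda>V. V 0) ` iterated_brackets X \<subseteq> insert 0 (range (\<lambda>i. X i 0))"
    using iterated_brackets_cases by fastforce
  then have "span ((\<lambda>V. V 0) ` iterated_brackets X) \<subseteq> span (insert 0 (range (\<lambda>i. X i 0)))"
    by (rule span_mono)
  then have "(UNIV :: 'n heis set) \<subseteq> span (range (\<lambda>i. X i 0))"
    unfolding bracket_values_span span_insert_0 .
  then have "dim (UNIV :: 'n heis set) \<le> card (range (\<lambda>i. X i 0))" by (rule dim_le_card) simp
  also have "\<dots> \<le> CARD('n + 'n)" by (rule card_image_le) simp
  finally show False by (simp add: dim_UNIV)
qed

text \<open>
  All brackets are central, so the fields themselves have to span modulo the center.
\<close>

lemma horizontal_span: "span (range (\<lambda>i. hor (X i 0))) = UNIV"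
proof -
  let ?S = "(\<lambda>V. V 0) ` iterated_brackets X"
  have "hor ` ?S \<subseteq> insert 0 (range (\<lambda>i. hor (X i 0)))" using bracket_values_subset by force
  then have "span (hor ` ?S) \<subseteq> span (range (\<lambda>i. hor (X i 0)))" by (metis span_insert_0 span_mono)
  moreover have "span (hor ` ?S) = hor ` span ?S" by (rule linear_span_image[OF linear_hor])
  moreover have "hor ` span ?S = UNIV"
  proof -
    have "x \<in> hor ` UNIV" for x :: "(real ^ 'n) \<times> (real ^ 'n)"
      by (rule image_eqI[of _ _ "(fst x, snd x, 0)"]) (simp_all add: hor_def)
    then show ?thesis unfolding bracket_values_span by blast
  qed
  ultimately show ?thesis by auto
qed

text \<open>
  The product of the flows in some order has the desired horizontal part; the central error is a
  sum of symplectic forms and thus quadratic.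
\<close>

lemma shift_bound_ordered_product:
  assumes "finite S"
  shows "\<exists>K\<ge>0. \<forall>s. \<exists>t. shift_bound (\<Sum>i\<in>S. \<bar>s i\<bar>) ((\<Sum>i\<in>S. s i *\<^sub>R X i 0) + vert t) \<and>
    \<bar>t\<bar> \<le> K * (\<Sum>i\<in>S. \<bar>s i\<bar>)\<^sup>2"
  using assms
proof (induction S rule: finite_induct)
  case empty
  show ?case by (intro exI[of _ 0] conjI allI) (auto intro!: exI[of _ 0] simp: shift_bound_0)
next
  case (insert j S)
  then obtain K where K: "0 \<le> K" "\<And>s. \<exists>t. shift_bound (\<Sum>i\<in>S. \<bar>s i\<bar>) ((\<Sum>i\<in>S. s i *\<^sub>R X i 0) + vert t) \<and>
    \<bar>t\<bar> \<le> K * (\<Sum>i\<in>S. \<bar>s i\<bar>)\<^sup>2" by blast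
  define B where "B = (\<Sum>i\<in>UNIV. norm (X i 0))"
  have B: "norm (X i 0) \<le> B" for i unfolding B_def by (rule member_le_sum) auto
  then have B0: "0 \<le> B" using norm_ge_zero order_trans by blast
  show ?case
  proof (rule exI[of _ "K + B\<^sup>2"], intro conjI allI)
    show "0 \<le> K + B\<^sup>2" using K(1) by simp
    fix s
    obtain t where t: "shift_bound (\<Sum>i\<in>S. \<bar>s i\<bar>) ((\<Sum>i\<in>S. s i *\<^sub>R X i 0) + vert t)"
      "\<bar>t\<bar> \<le> K * (\<Sum>i\<in>S. \<bar>s i\<bar>)\<^sup>2" using K(2) by blast
    define q where "q = (\<Sum>i\<in>S. s i *\<^sub>R X i 0)"
    define \<sigma> where "\<sigma> = (\<Sum>i\<in>S. \<bar>s i\<bar>)"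
    have \<sigma>0: "0 \<le> \<sigma>" by (auto simp: \<sigma>_def intro: sum_nonneg)
    have "norm q \<le> (\<Sum>i\<in>S. \<bar>s i\<bar> * B)"
      unfolding q_def by (rule order_trans[OF norm_sum sum_mono]) (simp add: B mult_left_mono)
    then have q: "norm q \<le> \<sigma> * B" by (simp add: \<sigma>_def sum_distrib_right)
    let ?t = "t + s j * form (X j 0) q"
    have "heis_mult (s j *\<^sub>R X j 0) (q + vert t) = (s j *\<^sub>R X j 0 + q) + vert ?t"
      by (simp add: heis_mult_eq add_ac)
    then have "shift_bound (\<bar>s j\<bar> + \<sigma>) ((s j *\<^sub>R X j 0 + q) + vert ?t)"
      using shift_bound_mult[OF shift_bound_flow[of "s j" j] t(1)] by (simp add: q_def \<sigma>_def)
    moreover have "\<bar>?t\<bar> \<le> (K + B\<^sup>2) * (\<bar>s j\<bar> + \<sigma>)\<^sup>2"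
    proof -
      have "\<bar>form (X j 0) q\<bar> \<le> B * (\<sigma> * B)"
        by (rule order_trans[OF abs_form_le mult_mono]) (use B q B0 in auto)
      then have "\<bar>s j\<bar> * \<bar>form (X j 0) q\<bar> \<le> \<bar>s j\<bar> * (B * (\<sigma> * B))" by (rule mult_left_mono) simp
      moreover have "\<bar>?t\<bar> \<le> \<bar>t\<bar> + \<bar>s j\<bar> * \<bar>form (X j 0) q\<bar>"
        using abs_triangle_ineq[of t "s j * form (X j 0) q"] by (simp only: abs_mult)
      moreover have "\<bar>t\<bar> \<le> K * \<sigma>\<^sup>2" using t(2) by (simp add: \<sigma>_def)
      moreover have "K * \<sigma>\<^sup>2 \<le> K * (\<bar>s j\<bar> + \<sigma>)\<^sup>2"
        using K(1) \<sigma>0 by (intro mult_left_mono power_mono) auto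
      moreover have "\<bar>s j\<bar> * (B * (\<sigma> * B)) \<le> B\<^sup>2 * (\<bar>s j\<bar> + \<sigma>)\<^sup>2"
      proof -
        have "\<bar>s j\<bar> * \<sigma> \<le> (\<bar>s j\<bar> + \<sigma>)\<^sup>2"
          using \<sigma>0 mult_mono[of "\<bar>s j\<bar>" "\<bar>s j\<bar> + \<sigma>" \<sigma> "\<bar>s j\<bar> + \<sigma>"] by (simp add: power2_eq_square)
        from mult_left_mono[OF this, of "B\<^sup>2"] show ?thesis by (simp add: power2_eq_square mult_ac)
      qed
      ultimately show ?thesis unfolding distrib_right by linarith
    qed
    ultimately show "\<exists>t. shift_bound (\<Sum>i\<in>insert j S. \<bar>s i\<bar>) ((\<Sum>i\<in>insert j S. s i *\<^sub>R X i 0) + vert t) \<and>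
        \<bar>t\<bar> \<le> (K + B\<^sup>2) * (\<Sum>i\<in>insert j S. \<bar>s i\<bar>)\<^sup>2"
      using insert.hyps by (intro exI[of _ ?t]) (simp add: q_def \<sigma>_def)
  qed
qed

text \<open>
  A central element is the commutator of two horizontal elements, and commutators are quadratic in
  their size. Hence the square root.
\<close>

lemma shift_bound_vert: "\<exists>D\<ge>0. \<forall>\<tau>. shift_bound (D * sqrt \<bar>\<tau>\<bar>) (vert \<tau>)"
proof -
  obtain i j where ij: "form (X i 0) (X j 0) \<noteq> 0" using noncommuting_pair by blast
  define w where "w = 2 * form (X i 0) (X j 0)"
  have w: "w \<noteq> 0" using ij by (simp add: w_def)
  have "shift_bound (4 / sqrt \<bar>w\<bar> * sqrt \<bar>\<tau>\<bar>) (vert \<tau>)" for \<tau>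
  proof -
    \<comment> \<open>the commutator of s X i and u X j is s u w in the central direction\<close>
    define s where "s = sqrt (\<bar>\<tau>\<bar> / \<bar>w\<bar>)"
    define u where "u = sgn \<tau> * sgn w * s"
    let ?a = "s *\<^sub>R X i 0" and ?b = "u *\<^sub>R X j 0"
    have s: "0 \<le> s" "s * s = \<bar>\<tau>\<bar> / \<bar>w\<bar>" by (simp_all add: s_def)
    have "s * u * w = sgn \<tau> * (s * s) * (sgn w * w)" by (simp add: u_def)
    also have "sgn w * w = \<bar>w\<bar>" by (simp add: sgn_if)
    also have "sgn \<tau> * (s * s) * \<bar>w\<bar> = sgn \<tau> * \<bar>\<tau>\<bar>" using w by (simp add: s(2))
    finally have su: "s * u * w = \<tau>" by (simp add: sgn_mult_abs)
    have u_le: "\<bar>u\<bar> \<le> s" using s(1) by (simp add: u_def abs_mult abs_sgn_eq)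
    have "heis_mult (heis_mult ?a ?b) (heis_mult (- ?a) (- ?b)) = vert (2 * (s * u * form (X i 0) (X j 0)))"
      using form_commute[of "X i 0" "X j 0"] by (simp add: heis_mult_eq mult_ac)
    also have "2 * (s * u * form (X i 0) (X j 0)) = \<tau>" using su by (simp add: w_def)
    finally have "vert \<tau> = heis_mult (heis_mult ?a ?b) (heis_mult ((- s) *\<^sub>R X i 0) ((- u) *\<^sub>R X j 0))"
      by simp
    then have "shift_bound ((\<bar>s\<bar> + \<bar>u\<bar>) + (\<bar>- s\<bar> + \<bar>- u\<bar>)) (vert \<tau>)"
      by (simp only: shift_bound_mult shift_bound_flow)
    then show ?thesis
      by (rule shift_bound_mono) (use u_le s(1) in \<open>simp add: s_def real_sqrt_divide\<close>)
  qed
  then show ?thesis by (intro exI[of _ "4 / sqrt \<bar>w\<bar>"]) auto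
qed

text \<open>
  An element is the product of an ordered product of flows with the right horizontal part and a
  central correction. The correction is of order |h| + |h|^2, hence costs the square root of this.
\<close>

lemma shift_bound_exists: "\<exists>C>0. \<forall>h. shift_bound (C * (sqrt (norm h) + norm h)) h"
proof -
  obtain A where A: "0 \<le> A" "\<And>w. \<exists>s. w = (\<Sum>i\<in>UNIV. s i *\<^sub>R hor (X i 0)) \<and> (\<Sum>i\<in>UNIV. \<bar>s i\<bar>) \<le> A * norm w"
    by (rule spanning_family_bounded_coefficients[OF horizontal_span]) blast
  obtain K where K: "0 \<le> K" "\<And>s. \<exists>t. shift_bound (\<Sum>i\<in>UNIV. \<bar>s i\<bar>) ((\<Sum>i\<in>UNIV. s i *\<^sub>R X i 0) + vert t) \<and>
    \<bar>t\<bar> \<le> K * (\<Sum>i\<in>UNIV. \<bar>s i\<bar>)\<^sup>2" using shift_bound_ordered_product[of UNIV] by auto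
  obtain D where D: "0 \<le> D" "\<And>\<tau>. shift_bound (D * sqrt \<bar>\<tau>\<bar>) (vert \<tau>)" using shift_bound_vert by blast
  define B where "B = (\<Sum>i\<in>UNIV. norm (X i 0))"
  have B: "norm (X i 0) \<le> B" for i unfolding B_def by (rule member_le_sum) auto
  then have B0: "0 \<le> B" using norm_ge_zero order_trans by blast
  define L where "L = 1 + A * B"
  define M where "M = K * A\<^sup>2"
  have L0: "0 \<le> L" and M0: "0 \<le> M" using A(1) B0 K(1) by (auto simp: L_def M_def)
  define C where "C = 1 + A + D * sqrt L + D * sqrt M"
  have C: "0 < C" using A(1) D(1) L0 M0 by (auto simp: C_def intro!: add_pos_nonneg)
  have "shift_bound (C * (sqrt (norm h) + norm h)) h" for h
  proof -
    obtain s where s: "hor h = (\<Sum>i\<in>UNIV. s i *\<^sub>R hor (X i 0))" "(\<Sum>i\<in>UNIV. \<bar>s i\<bar>) \<le> A * norm (hor h)"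
      using A(2) by blast
    define \<sigma> where "\<sigma> = (\<Sum>i\<in>UNIV. \<bar>s i\<bar>)"
    have \<sigma>: "0 \<le> \<sigma>" "\<sigma> \<le> A * norm h"
      using s(2) mult_left_mono[OF norm_hor_le[of h] A(1)] by (auto simp: \<sigma>_def intro: sum_nonneg)
    obtain t where t: "shift_bound \<sigma> ((\<Sum>i\<in>UNIV. s i *\<^sub>R X i 0) + vert t)" "\<bar>t\<bar> \<le> K * \<sigma>\<^sup>2"
      using K(2)[of s] unfolding \<sigma>_def by blast
    define g where "g = (\<Sum>i\<in>UNIV. s i *\<^sub>R X i 0)"
    define \<tau> where "\<tau> = snd (snd h) - snd (snd (g + vert t))"
    have "hor (g + vert t) = hor h"
      by (simp add: s(1) g_def linear_add[OF linear_hor] linear_sum[OF linear_hor] linear_scale[OF linear_hor])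
    then have "h = (g + vert t) + vert \<tau>" unfolding \<tau>_def by (intro hor_eq_imp_vert) simp
    then have h: "h = heis_mult (g + vert t) (vert \<tau>)" by (simp add: heis_mult_eq)
    have "norm g \<le> (\<Sum>i\<in>UNIV. \<bar>s i\<bar> * B)"
      unfolding g_def by (rule order_trans[OF norm_sum sum_mono]) (simp add: B mult_left_mono)
    also have "\<dots> = \<sigma> * B" by (simp add: \<sigma>_def sum_distrib_right)
    also have "\<dots> \<le> A * norm h * B" using \<sigma>(2) B0 by (rule mult_right_mono)
    finally have g: "norm g \<le> A * norm h * B" .
    have sn: "\<bar>snd (snd p)\<bar> \<le> norm p" for p :: "'n heis"
    proof -
      have "norm (snd (snd p)) \<le> norm (snd p)" "norm (snd p) \<le> norm p"
        by (metis norm_snd_le prod.collapse)+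
      then show ?thesis by simp
    qed
    have "\<sigma>\<^sup>2 \<le> (A * norm h)\<^sup>2" using \<sigma> by (intro power_mono) auto
    then have t2: "\<bar>t\<bar> \<le> M * (norm h)\<^sup>2"
      using t(2) mult_left_mono[of "\<sigma>\<^sup>2" "(A * norm h)\<^sup>2" K] K(1)
      by (simp add: M_def power_mult_distrib mult.assoc)
    have "\<bar>\<tau>\<bar> \<le> \<bar>snd (snd h)\<bar> + (\<bar>snd (snd g)\<bar> + \<bar>t\<bar>)"
    proof -
      have "\<tau> = snd (snd h) - (snd (snd g) + t)" by (simp add: \<tau>_def vert_def)
      then show ?thesis by (smt (verit))
    qed
    also have "\<dots> \<le> norm h + (A * norm h * B + M * (norm h)\<^sup>2)"
      using sn[of h] sn[of g] g t2 by linarith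
    finally have "\<bar>\<tau>\<bar> \<le> L * norm h + M * (norm h)\<^sup>2" by (simp add: L_def algebra_simps)
    then have "sqrt \<bar>\<tau>\<bar> \<le> sqrt (L * norm h + M * (norm h)\<^sup>2)" by simp
    also have "\<dots> \<le> sqrt (L * norm h) + sqrt (M * (norm h)\<^sup>2)"
      using L0 M0 by (intro sqrt_add_le_add_sqrt) auto
    also have "\<dots> = sqrt L * sqrt (norm h) + sqrt M * norm h" by (simp add: real_sqrt_mult)
    finally have "D * sqrt \<bar>\<tau>\<bar> \<le> D * (sqrt L * sqrt (norm h) + sqrt M * norm h)"
      using D(1) by (rule mult_left_mono)
    moreover have "D * (sqrt L * sqrt (norm h)) \<le> D * sqrt L * (sqrt (norm h) + norm h)"
      "D * (sqrt M * norm h) \<le> D * sqrt M * (sqrt (norm h) + norm h)"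
      "A * norm h \<le> A * (sqrt (norm h) + norm h)"
      "0 \<le> sqrt (norm h) + norm h"
      using A(1) D(1) L0 M0 unfolding mult.assoc by (auto intro!: mult_left_mono)
    ultimately have "\<sigma> + D * sqrt \<bar>\<tau>\<bar> \<le> C * (sqrt (norm h) + norm h)"
      using \<sigma>(2) unfolding C_def distrib_left distrib_right by linarith
    moreover have "shift_bound (\<sigma> + D * sqrt \<bar>\<tau>\<bar>) h"
      unfolding h using t(1) D(2) unfolding g_def by (rule shift_bound_mult)
    ultimately show ?thesis by (rule shift_bound_mono[rotated])
  qed
  then show ?thesis using C by blast
qed

definition shift_const :: real where
  "shift_const = (SOME C. 0 < C \<and> (\<forall>h. shift_bound (C * (sqrt (norm h) + norm h)) h))"

text \<open>
  A common modulus of continuity under right translations for all sets of perimeter at most 1.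
\<close>

definition modulus :: "real \<Rightarrow> real" where "modulus r = shift_const * (sqrt r + r)"

lemma shift_const: "0 < shift_const" "shift_bound (modulus (norm h)) h"
proof -
  have "0 < shift_const \<and> (\<forall>h. shift_bound (shift_const * (sqrt (norm h) + norm h)) h)"
    unfolding shift_const_def using shift_bound_exists by (rule someI_ex)
  then show "0 < shift_const" "shift_bound (modulus (norm h)) h"
    unfolding modulus_def by blast+
qed

lemma modulus_mono: "0 \<le> r \<Longrightarrow> r \<le> s \<Longrightarrow> modulus r \<le> modulus s"
  unfolding modulus_def using shift_const(1) by (intro mult_left_mono add_mono) auto

lemma modulus_nonneg: "0 \<le> r \<Longrightarrow> 0 \<le> modulus r"
  unfolding modulus_def using shift_const(1) by (intro mult_nonneg_nonneg) auto

lemma modulus_small: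
  assumes "0 < e" obtains r where "0 < r" "r \<le> 1" "modulus r \<le> e"
proof -
  \<comment> \<open>the modulus at a^2 is at most 2 a times the constant\<close>
  define a where "a = min 1 (e / (2 * shift_const))"
  have a: "0 < a" "a \<le> 1" "a \<le> e / (2 * shift_const)" using assms shift_const(1) by (auto simp: a_def)
  have "modulus (a\<^sup>2) = shift_const * (a + a\<^sup>2)" using a(1) by (simp add: modulus_def)
  also have "\<dots> \<le> shift_const * (a + a)"
    using a shift_const(1) by (intro mult_left_mono add_left_mono) (auto simp: power2_eq_square mult_left_le)
  also have "\<dots> \<le> e" using a(3) shift_const(1) by (simp add: field_simps)
  finally show ?thesis using a by (intro that[of "a\<^sup>2"]) (auto simp: power_le_one)
qed

section \<open>Sets and their averages over small balls\<close>

text \<open>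
  Averaging the translation estimate over the elements of a ball compares a set of finite perimeter
  with its density at scale r. This one inequality serves as Poincare inequality, isoperimetric
  inequality and compactness estimate.
\<close>

definition ball_vol :: "real \<Rightarrow> real" where "ball_vol r = measure lborel (ball (0 :: 'n heis) r)"

definition density_at :: "real \<Rightarrow> 'n heis set \<Rightarrow> 'n heis \<Rightarrow> real" where
  "density_at r E x = measure lborel {h \<in> ball 0 r. heis_mult x h \<in> E} / ball_vol r"

lemma ball_vol_pos: "0 < r \<Longrightarrow> 0 < ball_vol r"
  unfolding ball_vol_def using content_ball_pos by blast

lemma emeasure_ball_0: "emeasure lborel (ball (0 :: 'n heis) r) = ennreal (ball_vol r)"
  unfolding ball_vol_def using emeasure_bounded_finite[OF bounded_ball, of "0 :: 'n heis" r]
  by (simp add: emeasure_eq_ennreal_measure top.not_eq_extremum)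

lemma slice_sets [measurable]:
  assumes [measurable]: "E \<in> sets borel"
  shows "{h \<in> ball 0 r. heis_mult x h \<in> E} \<in> sets borel"
proof -
  have "{h. heis_mult x h \<in> E} \<in> sets borel" by measurable
  moreover have "{h \<in> ball 0 r. heis_mult x h \<in> E} = ball 0 r \<inter> {h. heis_mult x h \<in> E}" by auto
  ultimately show ?thesis by simp
qed

lemma density_deviation:
  assumes E[measurable]: "E \<in> sets borel" and r: "0 < r"
  shows "ennreal (ball_vol r) * ennreal \<bar>indicat_real E x - density_at r E x\<bar> =
    emeasure lborel {h \<in> ball 0 r. (x \<in> E) \<noteq> (heis_mult x h \<in> E)}"
proof -
  let ?B = "ball (0 :: 'n heis) r"
  let ?S = "{h \<in> ?B. heis_mult x h \<in> E}"
  have S: "?S \<in> sets borel" by (rule slice_sets[OF E])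
  have B: "0 < ball_vol r" using ball_vol_pos[OF r] .
  have leS: "emeasure lborel ?S \<le> ennreal (ball_vol r)"
    unfolding emeasure_ball_0[symmetric] by (rule emeasure_mono) auto
  then have fin: "emeasure lborel ?S \<noteq> \<infinity>" by (metis ennreal_neq_top infinity_ennreal_def top_unique)
  have m: "emeasure lborel ?S = ennreal (measure lborel ?S)"
    using fin by (simp add: emeasure_eq_ennreal_measure)
  have le: "measure lborel ?S \<le> ball_vol r"
    using leS B by (simp only: m ennreal_le_iff less_imp_le)
  have mult: "ennreal (ball_vol r) * ennreal \<bar>y\<bar> = ennreal (ball_vol r * \<bar>y\<bar>)" for y
    using B by (simp add: ennreal_mult)
  show ?thesis
  proof (cases "x \<in> E")
    case True
    have "ball_vol r * \<bar>1 - density_at r E x\<bar> = ball_vol r - measure lborel ?S"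
      using B le by (simp add: density_at_def field_simps abs_of_nonneg)
    moreover have "{h \<in> ?B. (x \<in> E) \<noteq> (heis_mult x h \<in> E)} = ?B - ?S" using True by auto
    moreover have "emeasure lborel (?B - ?S) = emeasure lborel ?B - emeasure lborel ?S"
      using S fin by (intro emeasure_Diff) auto
    ultimately show ?thesis using True by (simp only: mult indicator_simps m emeasure_ball_0 ennreal_minus[OF measure_nonneg])
  next
    case False
    have "ball_vol r * \<bar>0 - density_at r E x\<bar> = measure lborel ?S"
      using B by (simp add: density_at_def)
    moreover have "{h \<in> ?B. (x \<in> E) \<noteq> (heis_mult x h \<in> E)} = ?S" using False by auto
    moreover have "indicat_real E x = 0" using False by simp
    ultimately show ?thesis using False by (simp only: mult m)
  qed
qed

lemma measurable_density_at [measurable]: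
  assumes E[measurable]: "E \<in> sets borel"
  shows "density_at r E \<in> borel_measurable borel"
proof -
  have hm[measurable]: "(\<lambda>z::'n heis \<times> 'n heis. heis_mult (fst z) (snd z)) \<in> borel_measurable borel"
    by (rule borel_measurable_continuous_onI[OF continuous_heis_mult])
  have fs: "(fst :: 'n heis \<times> 'n heis \<Rightarrow> 'n heis) \<in> borel_measurable borel"
    "(snd :: 'n heis \<times> 'n heis \<Rightarrow> 'n heis) \<in> borel_measurable borel"
    by (intro borel_measurable_continuous_onI continuous_intros)+
  have B_set: "snd -` ball (0 :: 'n heis) r \<in> sets (borel :: ('n heis \<times> 'n heis) measure)"
    by (rule measurable_sets_borel[OF fs(2)]) simp
  have E_set: "fst -` E \<in> sets (borel :: ('n heis \<times> 'n heis) measure)"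
    by (rule measurable_sets_borel[OF fs(1) E])
  have hE_set: "(\<lambda>z. heis_mult (fst z) (snd z)) -` E \<in> sets (borel :: ('n heis \<times> 'n heis) measure)"
    by (rule measurable_sets_borel[OF hm E])
  have "(\<lambda>x. emeasure lborel {h \<in> ball 0 r. heis_mult x h \<in> E}) \<in> borel_measurable borel"
  proof -
    have Q: "{z. snd z \<in> ball 0 r \<and> heis_mult (fst z) (snd z) \<in> E} \<in> sets (borel :: ('n heis \<times> 'n heis) measure)"
      using sets.Int[OF B_set hE_set] by (simp add: vimage_def Int_def)
    then have "{z. snd z \<in> ball 0 r \<and> heis_mult (fst z) (snd z) \<in> E} \<in> sets (lborel \<Otimes>\<^sub>M lborel)"
      unfolding lborel_prod sets_lborel .
    from lborel.measurable_emeasure_Pair[OF this] show ?thesis by (simp add: vimage_def)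
  qed
  then show ?thesis unfolding density_at_def[abs_def] measure_def by measurable
qed

text \<open>
  By Fubini's theorem the deviation from the mean over a ball is the mean over the elements of the
  ball of the effect of a translation.
\<close>

lemma density_deviation_integral:
  assumes E[measurable]: "E \<in> sets borel" and fin: "emeasure lborel E < \<infinity>"
    and c: "perimeter X E \<le> ennreal c" "0 \<le> c" and r: "0 < r"
  shows "(\<integral>\<^sup>+x. ennreal \<bar>indicat_real E x - density_at r E x\<bar> \<partial>lborel) \<le> ennreal (modulus r * c)"
proof -
  let ?B = "ball (0 :: 'n heis) r"
  let ?g = "\<lambda>x. ennreal \<bar>indicat_real E x - density_at r E x\<bar>"
  let ?Q = "\<lambda>x h. h \<in> ?B \<and> (x \<in> E) \<noteq> (heis_mult x h \<in> E)"
  let ?f = "\<lambda>x h. indicator {z. ?Q (fst z) (snd z)} (x, h) :: ennreal"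
  have hm[measurable]: "(\<lambda>z::'n heis \<times> 'n heis. heis_mult (fst z) (snd z)) \<in> borel_measurable borel"
    by (rule borel_measurable_continuous_onI[OF continuous_heis_mult])
  have fs: "(fst :: 'n heis \<times> 'n heis \<Rightarrow> 'n heis) \<in> borel_measurable borel"
    "(snd :: 'n heis \<times> 'n heis \<Rightarrow> 'n heis) \<in> borel_measurable borel"
    by (intro borel_measurable_continuous_onI continuous_intros)+
  have B_set: "snd -` ball (0 :: 'n heis) r \<in> sets (borel :: ('n heis \<times> 'n heis) measure)"
    by (rule measurable_sets_borel[OF fs(2)]) simp
  have E_set: "fst -` E \<in> sets (borel :: ('n heis \<times> 'n heis) measure)"
    by (rule measurable_sets_borel[OF fs(1) E])
  have hE_set: "(\<lambda>z. heis_mult (fst z) (snd z)) -` E \<in> sets (borel :: ('n heis \<times> 'n heis) measure)"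
    by (rule measurable_sets_borel[OF hm E])
  have "{z. ?Q (fst z) (snd z)} =
      snd -` ?B \<inter> sym_diff (fst -` E) ((\<lambda>z. heis_mult (fst z) (snd z)) -` E)" by auto
  then have Q: "{z. ?Q (fst z) (snd z)} \<in> sets (borel :: ('n heis \<times> 'n heis) measure)"
    using B_set E_set hE_set by simp
  then have fm: "indicator {z. ?Q (fst z) (snd z)} \<in> borel_measurable (lborel \<Otimes>\<^sub>M lborel)"
    by (simp add: lborel_prod)
  have B: "0 < ball_vol r" using ball_vol_pos[OF r] .
  have "ennreal (ball_vol r) * (\<integral>\<^sup>+x. ?g x \<partial>lborel) = (\<integral>\<^sup>+x. ennreal (ball_vol r) * ?g x \<partial>lborel)"
    by (rule nn_integral_cmult[symmetric]) measurable
  also have "\<dots> = (\<integral>\<^sup>+x. \<integral>\<^sup>+h. ?f x h \<partial>lborel \<partial>lborel)"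
  proof (rule nn_integral_cong)
    fix x
    have S: "{h. ?Q x h} \<in> sets borel"
    proof -
      have "{h. ?Q x h} = (if x \<in> E then ?B - {h \<in> ?B. heis_mult x h \<in> E} else {h \<in> ?B. heis_mult x h \<in> E})"
        by auto
      then show ?thesis using slice_sets[OF E, of r x] by simp
    qed
    have "(\<integral>\<^sup>+h. ?f x h \<partial>lborel) = (\<integral>\<^sup>+h. indicator {h. ?Q x h} h \<partial>lborel)"
      by (intro nn_integral_cong) (simp add: indicator_def)
    also have "\<dots> = emeasure lborel {h. ?Q x h}" using S by simp
    finally show "ennreal (ball_vol r) * ?g x = (\<integral>\<^sup>+h. ?f x h \<partial>lborel)"
      by (simp add: density_deviation[OF E r])
  qed
  also have "\<dots> = (\<integral>\<^sup>+h. \<integral>\<^sup>+x. ?f x h \<partial>lborel \<partial>lborel)"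
    using lborel_pair.Fubini[OF fm] by simp
  also have "\<dots> \<le> (\<integral>\<^sup>+h. ennreal (modulus r * c) * indicator ?B h \<partial>lborel)"
  proof (rule nn_integral_mono)
    fix h :: "'n heis"
    let ?E = "{q. heis_mult q h \<in> E}"
    have Es: "?E \<in> sets borel" by measurable
    show "(\<integral>\<^sup>+x. ?f x h \<partial>lborel) \<le> ennreal (modulus r * c) * indicator ?B h"
    proof (cases "h \<in> ?B")
      case True
      have "(\<integral>\<^sup>+x. ?f x h \<partial>lborel) = (\<integral>\<^sup>+x. indicator (sym_diff E ?E) x \<partial>lborel)"
        using True by (intro nn_integral_cong) (auto simp: indicator_def)
      also have "\<dots> = emeasure lborel (sym_diff E ?E)" using Es by simp
      also have "\<dots> = ennreal (measure lborel (sym_diff E ?E))"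
      proof -
        have "sym_diff E ?E \<in> fmeasurable lborel"
          using fin Es by (intro sym_diff_fmeasurable) (simp_all add: emeasure_heis_right)
        then show ?thesis by (simp add: fmeasurable_def emeasure_eq_ennreal_measure less_top)
      qed
      also have "\<dots> \<le> ennreal (modulus (norm h) * c)"
        using shift_const(2)[of h] E fin c unfolding shift_bound_def by (intro ennreal_leI) blast
      also have "\<dots> \<le> ennreal (modulus r * c)"
        using True c(2) by (intro ennreal_leI mult_right_mono modulus_mono) auto
      finally show ?thesis using True by simp
    next
      case False then show ?thesis by simp
    qed
  qed
  also have "\<dots> = ennreal (ball_vol r) * ennreal (modulus r * c)"
    by (subst nn_integral_cmult_indicator) (auto simp: emeasure_ball_0 mult.commute)
  finally have "ennreal (ball_vol r) * (\<integral>\<^sup>+x. ?g x \<partial>lborel) \<le> ennreal (ball_vol r) * ennreal (modulus r * c)" .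
  then show ?thesis using B by (simp add: ennreal_mult_le_mult_iff)
qed

text \<open>
  Where the density is below one half, a point of the set contributes at least one half to the
  deviation.
\<close>

lemma sparse_points_small:
  assumes E[measurable]: "E \<in> sets borel" and fin: "emeasure lborel E < \<infinity>"
    and c: "perimeter X E \<le> ennreal c" "0 \<le> c" and r: "0 < r"
  shows "emeasure lborel {x \<in> E. density_at r E x < 1 / 2} \<le> ennreal (2 * (modulus r * c))"
proof -
  let ?S = "{x \<in> E. density_at r E x < 1 / 2}"
  have S: "?S \<in> sets borel"
  proof -
    have "?S = E \<inter> {x \<in> space borel. density_at r E x < 1 / 2}" by auto
    moreover have "{x \<in> space borel. density_at r E x < 1 / 2} \<in> sets borel" by measurable
    ultimately show ?thesis using E by (simp only: sets.Int)
  qed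
  have "emeasure lborel ?S = (\<integral>\<^sup>+x. indicator ?S x \<partial>lborel)" using S by simp
  also have "\<dots> \<le> (\<integral>\<^sup>+x. 2 * ennreal \<bar>indicat_real E x - density_at r E x\<bar> \<partial>lborel)"
  proof (rule nn_integral_mono)
    fix x
    show "indicator ?S x \<le> 2 * ennreal \<bar>indicat_real E x - density_at r E x\<bar>"
    proof (cases "x \<in> ?S")
      case True
      then have "1 \<le> 2 * \<bar>indicat_real E x - density_at r E x\<bar>" by auto
      then have "ennreal 1 \<le> ennreal (2 * \<bar>indicat_real E x - density_at r E x\<bar>)" by (rule ennreal_leI)
      then show ?thesis using True by (simp add: ennreal_mult')
    qed simp
  qed
  also have "\<dots> = 2 * (\<integral>\<^sup>+x. ennreal \<bar>indicat_real E x - density_at r E x\<bar> \<partial>lborel)"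
    by (rule nn_integral_cmult) measurable
  also have "\<dots> \<le> 2 * ennreal (modulus r * c)"
    by (intro mult_left_mono density_deviation_integral assms) auto
  finally show ?thesis using c(2) modulus_nonneg[of r] r by (simp add: ennreal_mult')
qed

end

section \<open>Countable sums of extended nonnegative numbers\<close>

lemma sum_le_nn_integral_count_space:
  fixes f :: "'a \<Rightarrow> ennreal"
  assumes "finite F" "F \<subseteq> A" shows "sum f F \<le> (\<integral>\<^sup>+x. f x \<partial>count_space A)"
proof -
  have "sum f F = (\<integral>\<^sup>+x. f x * indicator F x \<partial>count_space A)"
    using assms by (subst nn_integral_count_space'[of F]) (auto simp: indicator_def)
  also have "\<dots> \<le> (\<integral>\<^sup>+x. f x \<partial>count_space A)"
    by (intro nn_integral_mono) (auto simp: indicator_def)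
  finally show ?thesis .
qed

lemma nn_integral_count_space_le:
  fixes f :: "'a \<Rightarrow> ennreal"
  assumes "countable A" "\<And>F. finite F \<Longrightarrow> F \<subseteq> A \<Longrightarrow> sum f F \<le> c"
  shows "(\<integral>\<^sup>+x. f x \<partial>count_space A) \<le> c"
proof (cases "finite A")
  case True then show ?thesis using assms(2)[of A] by (simp add: nn_integral_count_space_finite)
next
  case False
  have g: "bij_betw (from_nat_into A) UNIV A" using bij_betw_from_nat_into[OF assms(1) False] .
  have "(\<integral>\<^sup>+x. f x \<partial>count_space A) = (\<integral>\<^sup>+i. f (from_nat_into A i) \<partial>count_space UNIV)"
    by (rule nn_integral_bij_count_space[OF g, symmetric])
  also have "\<dots> = (SUP n. \<Sum>i<n. f (from_nat_into A i))"
    by (simp only: nn_integral_count_space_nat suminf_eq_SUP)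
  also have "\<dots> \<le> c"
  proof (rule SUP_least)
    fix n :: nat
    have "inj_on (from_nat_into A) {..<n}" using g by (meson bij_betw_def inj_on_subset subset_UNIV)
    then have "(\<Sum>i<n. f (from_nat_into A i)) = sum f (from_nat_into A ` {..<n})"
      by (simp add: sum.reindex)
    also have "\<dots> \<le> c" using g by (intro assms(2)) (auto simp: bij_betw_def)
    finally show "(\<Sum>i<n. f (from_nat_into A i)) \<le> c" .
  qed
  finally show ?thesis .
qed

lemma infsum_ennreal_eq_nn_integral:
  fixes f :: "'a \<Rightarrow> ennreal"
  assumes "countable A" shows "infsum f A = (\<integral>\<^sup>+x. f x \<partial>count_space A)"
proof (rule antisym)
  have eq: "infsum f A = (SUP F\<in>{F. finite F \<and> F \<subseteq> A}. sum f F)"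
    by (rule nonneg_infsum_complete) simp
  show "infsum f A \<le> (\<integral>\<^sup>+x. f x \<partial>count_space A)"
    unfolding eq by (intro SUP_least sum_le_nn_integral_count_space) auto
  show "(\<integral>\<^sup>+x. f x \<partial>count_space A) \<le> infsum f A"
    unfolding eq by (intro nn_integral_count_space_le[OF assms] SUP_upper) auto
qed

text \<open>
  The points of a finite set are counted layer by layer.
\<close>

lemma sum_grouped_le_nn_integral:
  fixes f :: "'a \<Rightarrow> ennreal" and g :: "'b \<Rightarrow> ennreal"
  assumes "finite A" "\<And>b. (\<Sum>a\<in>{a\<in>A. l a = b}. f a) \<le> g b"
  shows "sum f A \<le> (\<integral>\<^sup>+b. g b \<partial>count_space UNIV)"
proof -
  have "sum f A = (\<Sum>b\<in>l ` A. \<Sum>a\<in>{a\<in>A. l a = b}. f a)"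
    by (rule sum.image_gen[OF assms(1)])
  also have "\<dots> \<le> sum g (l ` A)" by (intro sum_mono assms(2))
  also have "\<dots> \<le> (\<integral>\<^sup>+b. g b \<partial>count_space UNIV)"
    using assms(1) by (intro sum_le_nn_integral_count_space) auto
  finally show ?thesis .
qed

section \<open>Compactness\<close>

text \<open>
  Diagonal argument for countably many bounded real sequences.
\<close>

lemma common_convergent_subseq:
  fixes f :: "'c::countable \<Rightarrow> nat \<Rightarrow> real"
  assumes "\<And>a k. f a k \<in> {u a..v a}"
  obtains r where "strict_mono r" "\<And>a. convergent (\<lambda>k. f a (r k))"
proof -
  define P where "P n s \<longleftrightarrow> (\<forall>a. to_nat a = n \<longrightarrow> convergent (\<lambda>k. f a (s k)))" for n s
  interpret subseqs P
  proof
    fix n and s :: "nat \<Rightarrow> nat"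
    show "\<exists>r'. strict_mono r' \<and> P n (s \<circ> r')"
    proof (cases "\<exists>a::'c. to_nat a = n")
      case True
      then obtain a :: 'c where a: "to_nat a = n" by blast
      obtain r l where r: "strict_mono r" "l \<in> {u a..v a}" "((\<lambda>k. f a (s k)) \<circ> r) \<longlonglongrightarrow> l"
        by (rule bounded_real_convergent_subseq[of "\<lambda>k. f a (s k)" "u a" "v a"]) (rule assms, rule that)
      then have "convergent (\<lambda>k. f a ((s \<circ> r) k))" by (auto simp: convergent_def o_def)
      then have "P n (s \<circ> r)" unfolding P_def using a by (metis injD inj_to_nat)
      then show ?thesis using r(1) by blast
    next
      case False then show ?thesis unfolding P_def using strict_mono_id by blast
    qed
  qed
  have closed: "P n (s \<circ> r)" if r: "strict_mono r" and s: "P n s" for n s r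
    unfolding P_def
  proof (intro allI impI)
    fix a :: 'c assume "to_nat a = n"
    then obtain l where "(\<lambda>k. f a (s k)) \<longlonglongrightarrow> l" using s by (auto simp: P_def convergent_def)
    from LIMSEQ_subseq_LIMSEQ[OF this r] show "convergent (\<lambda>k. f a ((s \<circ> r) k))"
      by (auto simp: convergent_def o_def)
  qed
  show ?thesis
  proof (rule that[OF subseq_diagseq])
    fix a :: 'c
    have "P (to_nat a) (diagseq \<circ> ((+) (Suc (to_nat a))))"
      by (rule diagseq_holds) (rule closed)
    then have "convergent (\<lambda>k. f a (diagseq (k + Suc (to_nat a))))"
      by (simp add: P_def add.commute)
    then show "convergent (\<lambda>k. f a (diagseq k))"
      by (subst (asm) convergent_ignore_initial_segment)
  qed
qed

lemma sym_diff_ball_finite: "emeasure lborel (S \<inter> ball (x::'a::euclidean_space) R) < \<infinity>"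
  by (rule emeasure_bounded_finite) (simp add: bounded_Int)

lemma Int_ball_fmeasurable: "S \<in> sets borel \<Longrightarrow> S \<inter> ball (x::'a::euclidean_space) R \<in> fmeasurable lborel"
  using sym_diff_ball_finite[of S x R] by (intro fmeasurableI) auto

lemma measure_sym_diff_triangle:
  fixes A B C :: "'a::euclidean_space set"
  assumes "A \<in> sets borel" "B \<in> sets borel" "C \<in> sets borel"
  shows "measure lborel (sym_diff A C \<inter> ball x R) \<le>
    measure lborel (sym_diff A B \<inter> ball x R) + measure lborel (sym_diff B C \<inter> ball x R)"
proof -
  have "measure lborel (sym_diff A C \<inter> ball x R) \<le>
      measure lborel ((sym_diff A B \<inter> ball x R) \<union> (sym_diff B C \<inter> ball x R))"
    using assms by (intro measure_mono_fmeasurable fmeasurable.Un Int_ball_fmeasurable) auto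
  also have "\<dots> \<le> measure lborel (sym_diff A B \<inter> ball x R) + measure lborel (sym_diff B C \<inter> ball x R)"
    using assms by (intro measure_Un_le) auto
  finally show ?thesis .
qed

text \<open>
  Borel sets are complete with respect to local convergence: a subsequence whose successive
  differences have summable measure converges almost everywhere.
\<close>

lemma conv_loc_complete:
  fixes E :: "nat \<Rightarrow> 'a::euclidean_space set"
  assumes E: "\<And>k. E k \<in> sets borel"
    and cauchy: "\<And>R e. 0 < e \<Longrightarrow> \<exists>N. \<forall>k\<ge>N. \<forall>l\<ge>N. measure lborel (sym_diff (E k) (E l) \<inter> ball 0 R) < e"
  obtains F where "F \<in> sets borel" "conv_loc E F"
proof -
  have "\<exists>N. \<forall>k\<ge>N. \<forall>l\<ge>N. measure lborel (sym_diff (E k) (E l) \<inter> ball 0 (real j)) < (1 / 2) ^ j" for j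
    by (rule cauchy) simp
  then obtain n where n: "\<And>j k l. k \<ge> n j \<Longrightarrow> l \<ge> n j \<Longrightarrow>
      measure lborel (sym_diff (E k) (E l) \<inter> ball 0 (real j)) < (1 / 2) ^ j" by metis
  \<comment> \<open>the indices are made monotone, so that the estimate for j also holds between later members\<close>
  define q where "q j = Max (n ` {..j})" for j
  have q: "n i \<le> q j" if "i \<le> j" for i j unfolding q_def using that by (intro Max_ge) auto
  define G where "G j = E (q j)" for j
  have G[measurable]: "G j \<in> sets borel" for j by (simp add: G_def E)
  \<comment> \<open>the lower limit of the subsequence\<close>
  define F where "F = (\<Union>j. \<Inter>i\<in>{j..}. G i)"
  have F[measurable]: "F \<in> sets borel" unfolding F_def by measurable
  have tail: "measure lborel (sym_diff (G j) F \<inter> ball 0 R) \<le> 2 * (1 / 2) ^ j" if "R \<le> real j" for j R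
  proof -
    let ?D = "\<lambda>i. sym_diff (G (j + i)) (G (j + Suc i)) \<inter> ball 0 (real (j + i))"
    have "sym_diff (G j) F \<inter> ball 0 R \<subseteq> (\<Union>i. ?D i)"
    proof
      fix x assume x: "x \<in> sym_diff (G j) F \<inter> ball 0 R"
      show "x \<in> (\<Union>i. ?D i)"
      proof (rule ccontr)
        assume "x \<notin> (\<Union>i. ?D i)"
        moreover have "x \<in> ball 0 (real (j + i))" for i using x that by auto
        ultimately have step: "x \<in> G (j + i) \<longleftrightarrow> x \<in> G (j + Suc i)" for i by blast
        have const: "x \<in> G (j + i) \<longleftrightarrow> x \<in> G j" for i
          by (induction i) (use step in auto)
        have ev: "x \<in> G i \<longleftrightarrow> x \<in> G j" if "j \<le> i" for i using that const[of "i - j"] by simp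
        have "x \<in> F \<longleftrightarrow> x \<in> G j"
        proof
          assume "x \<in> F"
          then obtain j' where "x \<in> (\<Inter>i\<in>{j'..}. G i)" unfolding F_def by (rule UN_E)
          then have "x \<in> G (max j j')" by (rule INT_D) simp
          then show "x \<in> G j" using ev[of "max j j'"] by simp
        next
          assume xj: "x \<in> G j"
          have "x \<in> (\<Inter>i\<in>{j..}. G i)"
          proof (rule INT_I)
            fix i assume "i \<in> {j..}"
            then show "x \<in> G i" using xj ev[of i] by (simp only: atLeast_iff)
          qed
          then show "x \<in> F" unfolding F_def by (rule UN_I[OF UNIV_I])
        qed
        then show False using x by auto
      qed
    qed
    then have "emeasure lborel (sym_diff (G j) F \<inter> ball 0 R) \<le> emeasure lborel (\<Union>i. ?D i)"
      by (intro emeasure_mono) auto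
    also have "\<dots> \<le> (\<Sum>i. emeasure lborel (?D i))"
      by (intro emeasure_subadditive_countably) auto
    also have "\<dots> \<le> (\<Sum>i. ennreal ((1 / 2) ^ (j + i)))"
    proof (intro suminf_le)
      fix i
      have "measure lborel (?D i) < (1 / 2) ^ (j + i)"
        unfolding G_def using q[of "j + i" "j + i"] q[of "j + i" "j + Suc i"] by (intro n) auto
      then show "emeasure lborel (?D i) \<le> ennreal ((1 / 2) ^ (j + i))"
        using sym_diff_ball_finite[of "sym_diff (G (j + i)) (G (j + Suc i))" 0 "real (j + i)"]
        by (subst emeasure_eq_ennreal_measure) (auto intro: ennreal_leI)
    qed auto
    also have "\<dots> = ennreal (2 * (1 / 2) ^ j)"
    proof (rule suminf_ennreal_eq)
      have "(\<lambda>i. (1 / 2) ^ j * (1 / 2) ^ i) sums ((1 / 2) ^ j * (1 / (1 - 1 / 2)) :: real)"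
        by (intro sums_mult geometric_sums) simp
      then show "(\<lambda>i. (1 / 2) ^ (j + i)) sums (2 * (1 / 2) ^ j :: real)"
        by (simp add: power_add mult.commute)
    qed simp
    finally show ?thesis unfolding measure_def by (intro enn2real_leI) auto
  qed
  have "conv_loc E F"
    unfolding conv_loc_def
  proof (intro allI LIMSEQ_I)
    fix R e :: real assume e: "0 < e"
    obtain j0 where j0: "(1 / 2 :: real) ^ j0 < e / 4" using real_arch_pow_inv[of "e / 4" "1 / 2"] e by auto
    obtain j1 where j1: "R \<le> real j1" using real_arch_simple by blast
    define j where "j = max j0 j1"
    have jR: "R \<le> real j" using j1 by (auto simp: j_def)
    have "(1 / 2 :: real) ^ j \<le> (1 / 2) ^ j0" by (intro power_decreasing) (auto simp: j_def)
    then have je: "3 * (1 / 2) ^ j < e" using j0 e by linarith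
    have "norm (measure lborel (sym_diff (E k) F \<inter> ball 0 R) - 0) < e" if k: "k \<ge> n j" for k
    proof -
      have "measure lborel (sym_diff (E k) F \<inter> ball 0 R) \<le>
          measure lborel (sym_diff (E k) (G j) \<inter> ball 0 R) + measure lborel (sym_diff (G j) F \<inter> ball 0 R)"
        by (intro measure_sym_diff_triangle E G F)
      also have "measure lborel (sym_diff (E k) (G j) \<inter> ball 0 R) \<le> measure lborel (sym_diff (E k) (G j) \<inter> ball 0 (real j))"
        using jR E by (intro measure_mono_fmeasurable Int_ball_fmeasurable) auto
      also have "\<dots> < (1 / 2) ^ j" unfolding G_def using k q[of j j] by (intro n) auto
      also note tail[OF jR]
      finally have "measure lborel (sym_diff (E k) F \<inter> ball 0 R) < e" using je by simp
      then show ?thesis by simp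
    qed
    then show "\<exists>N. \<forall>k\<ge>N. norm (measure lborel (sym_diff (E k) F \<inter> ball 0 R) - 0) < e" by blast
  qed
  then show ?thesis using that F by blast
qed

lemma open_basis_sequence:
  obtains B :: "nat \<Rightarrow> 'a::second_countable_topology set"
  where "\<And>j. open (B j)" "\<And>A. open A \<Longrightarrow> \<exists>J. A = (\<Union>j\<in>J. B j)"
proof -
  obtain \<B> :: "'a set set" where \<B>: "countable \<B>" "topological_basis \<B>" using ex_countable_basis by blast
  define B where "B = from_nat_into (insert {} \<B>)"
  have range: "range B = insert {} \<B>" unfolding B_def using \<B>(1) by (intro range_from_nat_into) auto
  show ?thesis
  proof (rule that[of B])
    show "open (B j)" for j
    proof -
      have "B j \<in> insert {} \<B>" using range by blast
      then show ?thesis using topological_basis_open[OF \<B>(2)] by auto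
    qed
    show "\<exists>J. A = (\<Union>j\<in>J. B j)" if "open A" for A
    proof -
      have "\<exists>\<C>. \<C> \<subseteq> \<B> \<and> \<Union>\<C> = A" using \<B>(2) that unfolding topological_basis_def by simp
      then obtain \<C> where C: "\<C> \<subseteq> \<B>" "\<Union>\<C> = A" by (elim exE conjE)
      have "\<C> = B ` {j. B j \<in> \<C>}"
      proof
        show "\<C> \<subseteq> B ` {j. B j \<in> \<C>}"
        proof
          fix S assume S: "S \<in> \<C>"
          then have "S \<in> range B" using C(1) unfolding range by blast
          then show "S \<in> B ` {j. B j \<in> \<C>}" using S by auto
        qed
      qed auto
      then have "A = (\<Union>j\<in>{j. B j \<in> \<C>}. B j)" using C(2) by metis
      then show ?thesis by blast
    qed
  qed
qed

text \<open>
  A bounded open set is exhausted by finite unions of basic sets, up to a part of small measure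
  that is the same for the whole sequence.
\<close>

lemma convergent_measure_open_bounded:
  fixes B :: "nat \<Rightarrow> 'a::euclidean_space set"
  assumes B: "\<And>j. open (B j)" "\<And>A. open A \<Longrightarrow> \<exists>J. A = (\<Union>j\<in>J. B j)"
    and E: "\<And>k. E k \<in> sets borel"
    and conv: "\<And>xs. convergent (\<lambda>k. measure lborel (E k \<inter> (\<Union>j\<in>set xs. B j)))"
    and A: "open A" "bounded A"
  shows "convergent (\<lambda>k. measure lborel (E k \<inter> A))"
proof -
  obtain J where J: "A = (\<Union>j\<in>J. B j)" using B(2)[OF A(1)] by blast
  define D where "D n = (\<Union>j\<in>J \<inter> {..<n}. B j)" for n
  have D: "open (D n)" "D n \<subseteq> A" for n unfolding D_def J using B(1) by (auto intro: open_UN)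
  have fm: "S \<in> fmeasurable lborel" if "S \<subseteq> A" "S \<in> sets borel" for S
  proof -
    have "emeasure lborel S < \<infinity>" using that(1) A(2) by (intro emeasure_bounded_finite bounded_subset[OF A(2)])
    then show ?thesis using that(2) by (intro fmeasurableI) auto
  qed
  have "(\<lambda>n. measure lborel (D n)) \<longlonglongrightarrow> measure lborel (\<Union>n. D n)"
  proof (rule Lim_measure_incseq)
    show "incseq D" by (auto simp: incseq_def D_def)
    have U: "(\<Union>n. D n) \<in> sets borel" using D(1) by auto
    have "(\<Union>n. D n) \<in> fmeasurable lborel" by (rule fm[OF _ U]) (use D(2) in auto)
    then show "emeasure lborel (\<Union>n. D n) \<noteq> \<infinity>" by (auto simp: fmeasurable_def)
  qed (use D(1) in auto)
  moreover have "(\<Union>n. D n) = A" unfolding D_def J by auto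
  ultimately have lim: "(\<lambda>n. measure lborel (D n)) \<longlonglongrightarrow> measure lborel A" by simp
  have near: "measure lborel (E k \<inter> D n) \<le> measure lborel (E k \<inter> A) \<and>
      measure lborel (E k \<inter> A) \<le> measure lborel (E k \<inter> D n) + (measure lborel A - measure lborel (D n))" for k n
  proof
    have DA: "E k \<inter> D n \<in> sets borel" "E k \<inter> A \<in> sets borel" "D n \<in> sets borel" "A \<in> sets borel"
      using D(1)[of n] A(1) E[of k] by auto
    show "measure lborel (E k \<inter> D n) \<le> measure lborel (E k \<inter> A)"
      using D(2) DA by (intro measure_mono_fmeasurable fm) auto
    have "measure lborel (E k \<inter> A) \<le> measure lborel ((E k \<inter> D n) \<union> (A - D n))"
      using D(2)[of n] DA by (intro measure_mono_fmeasurable fm) auto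
    also have "\<dots> \<le> measure lborel (E k \<inter> D n) + measure lborel (A - D n)"
      using DA by (intro measure_Un_le) auto
    also have "measure lborel (A - D n) = measure lborel A - measure lborel (D n)"
      using D(2)[of n] DA fm[of A] by (intro measurable_measure_Diff) auto
    finally show "measure lborel (E k \<inter> A) \<le> measure lborel (E k \<inter> D n) + (measure lborel A - measure lborel (D n))" .
  qed
  have "Cauchy (\<lambda>k. measure lborel (E k \<inter> A))"
  proof (rule metric_CauchyI)
    fix e :: real assume e: "0 < e"
    then obtain n where n: "\<bar>measure lborel (D n) - measure lborel A\<bar> < e / 2"
      using LIMSEQ_D[OF lim, of "e / 2"] by auto
    have "convergent (\<lambda>k. measure lborel (E k \<inter> D n))"
      using conv[of "sorted_list_of_set (J \<inter> {..<n})"] unfolding D_def by simp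
    then have "Cauchy (\<lambda>k. measure lborel (E k \<inter> D n))" by (rule convergent_Cauchy)
    then obtain N where N: "\<And>k l. k \<ge> N \<Longrightarrow> l \<ge> N \<Longrightarrow>
        dist (measure lborel (E k \<inter> D n)) (measure lborel (E l \<inter> D n)) < e / 2"
      using e unfolding Cauchy_def by (meson half_gt_zero)
    have "dist (measure lborel (E k \<inter> A)) (measure lborel (E l \<inter> A)) < e" if "k \<ge> N" "l \<ge> N" for k l
    proof -
      have *: "\<bar>a - b\<bar> < e" if "\<bar>a' - b'\<bar> < e / 2" "\<bar>d - m\<bar> < e / 2" "a' \<le> a \<and> a \<le> a' + (m - d)"
        "b' \<le> b \<and> b \<le> b' + (m - d)" for a b a' b' d m :: real
      proof -
        have "a' - b' < e / 2" "b' - a' < e / 2" "m - d < e / 2"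
          using that(1,2) unfolding abs_less_iff by linarith+
        then have "a - b < e" "- (a - b) < e" using that(3,4) by linarith+
        then show ?thesis by (simp only: abs_less_iff simp_thms)
      qed
      show ?thesis unfolding dist_real_def
        by (rule *[OF N[OF that, unfolded dist_real_def] n near near])
    qed
    then show "\<exists>M. \<forall>m\<ge>M. \<forall>n\<ge>M. dist (measure lborel (E m \<inter> A)) (measure lborel (E n \<inter> A)) < e" by blast
  qed
  then show ?thesis by (simp add: Cauchy_convergent_iff)
qed

context heis_frame
begin

definition heis_ball :: "'n heis \<Rightarrow> real \<Rightarrow> 'n heis set" where
  "heis_ball x r = {y. norm (heis_mult (- x) y) < r}"

lemma heis_ball_vimage: "heis_ball x r = heis_mult (- x) -` ball 0 r"
  by (auto simp: heis_ball_def)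

lemma open_heis_ball: "open (heis_ball x r)"
  unfolding heis_ball_vimage by (rule open_vimage[OF open_ball continuous_heis_left])

lemma heis_ball_sets [measurable]: "heis_ball x r \<in> sets borel"
  by (rule borel_open[OF open_heis_ball])

lemma bounded_heis_ball: "bounded (heis_ball x r)"
proof -
  have "heis_ball x r \<subseteq> heis_mult x ` cball 0 r"
  proof
    fix y assume "y \<in> heis_ball x r"
    then show "y \<in> heis_mult x ` cball 0 r"
      by (intro image_eqI[of _ _ "heis_mult (- x) y"]) (auto simp: heis_ball_def)
  qed
  moreover have "compact (heis_mult x ` cball 0 r)"
    by (intro compact_continuous_image continuous_heis_left compact_cball)
  ultimately show ?thesis by (meson bounded_subset compact_imp_bounded)
qed

lemma emeasure_heis_ball_translate:
  assumes "E \<in> sets borel"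
  shows "emeasure lborel ({q. heis_mult p q \<in> E} \<inter> ball 0 r) = emeasure lborel (E \<inter> heis_ball p r)"
proof -
  have "{q. heis_mult p q \<in> E} \<inter> ball 0 r = {q. heis_mult p q \<in> E \<inter> heis_ball p r}"
    by (auto simp: heis_ball_def)
  then show ?thesis using emeasure_heis_left[of "E \<inter> heis_ball p r" p] assms by simp
qed

lemma density_at_eq:
  assumes "E \<in> sets borel"
  shows "density_at r E x = measure lborel (E \<inter> heis_ball x r) / ball_vol r"
proof -
  have "{h \<in> ball 0 r. heis_mult x h \<in> E} = {q. heis_mult x q \<in> E} \<inter> ball 0 r" by auto
  then show ?thesis
    using emeasure_heis_ball_translate[OF assms, of x r] by (simp add: density_at_def measure_def)
qed

lemma density_at_bounds:
  assumes "E \<in> sets borel" "0 < r" shows "0 \<le> density_at r E x" "density_at r E x \<le> 1"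
proof -
  have B: "0 < ball_vol r" using ball_vol_pos assms(2) .
  show "0 \<le> density_at r E x" using B by (simp add: density_at_def)
  have "measure lborel {h \<in> ball 0 r. heis_mult x h \<in> E} \<le> measure lborel (ball (0 :: 'n heis) r)"
    using slice_sets[OF assms(1), of r x] Int_ball_fmeasurable[of UNIV 0 r]
    by (intro measure_mono_fmeasurable) auto
  then show "density_at r E x \<le> 1" using B by (simp add: density_at_def ball_vol_def divide_le_eq)
qed

text \<open>
  At each scale, the densities converge pointwise and hence locally in the mean, and they are
  uniformly close to the sets. So the sequence of sets is Cauchy in the mean on bounded sets.
\<close>

lemma finite_perimeter_compact:
  fixes B :: "nat \<Rightarrow> 'n heis set"
  assumes B: "\<And>j. open (B j)" "\<And>A. open A \<Longrightarrow> \<exists>J. A = (\<Union>j\<in>J. B j)"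
    and E: "\<And>k. E k \<in> sets borel" "\<And>k. emeasure lborel (E k) < \<infinity>"
    and c: "\<And>k. perimeter X (E k) \<le> ennreal c" "0 \<le> c"
    and conv: "\<And>xs. convergent (\<lambda>k. measure lborel (E k \<inter> (\<Union>j\<in>set xs. B j)))"
  obtains F where "F \<in> sets borel" "conv_loc E F"
proof (rule conv_loc_complete[OF E(1)])
  fix R e :: real assume e: "0 < e"
  obtain r where r: "0 < r" "modulus r \<le> e / (8 * (c + 1))"
    using modulus_small[of "e / (8 * (c + 1))"] e c(2) by auto
  have mc: "modulus r * c \<le> e / 8"
  proof -
    have "modulus r * c \<le> e / (8 * (c + 1)) * (c + 1)"
      using r c(2) e by (intro mult_mono) (auto intro: modulus_nonneg)
    also have "\<dots> = (e * (c + 1)) / (8 * (c + 1))" by simp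
    also have "\<dots> = e / 8" using c(2) by (intro nonzero_mult_divide_mult_cancel_right) simp
    finally show ?thesis .
  qed
  let ?d = "\<lambda>k. density_at r (E k)"
  have "convergent (\<lambda>k. ?d k x)" for x
  proof -
    have "convergent (\<lambda>k. measure lborel (E k \<inter> heis_ball x r))"
      by (rule convergent_measure_open_bounded[where B=B and E=E])
        (rule B(1), erule B(2), rule E(1), rule conv, rule open_heis_ball, rule bounded_heis_ball)
    then obtain l where "(\<lambda>k. measure lborel (E k \<inter> heis_ball x r)) \<longlonglongrightarrow> l" by (auto simp: convergent_def)
    then have "(\<lambda>k. measure lborel (E k \<inter> heis_ball x r) / ball_vol r) \<longlonglongrightarrow> l / ball_vol r"
      by (intro tendsto_divide tendsto_const) (use ball_vol_pos[OF r(1)] in auto)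
    then show ?thesis by (auto simp: convergent_def density_at_eq[OF E(1)])
  qed
  then obtain d where d: "\<And>x. (\<lambda>k. ?d k x) \<longlonglongrightarrow> d x" unfolding convergent_def by metis
  have dm[measurable]: "d \<in> borel_measurable borel"
    by (rule borel_measurable_LIMSEQ_metric[OF measurable_density_at[OF E(1)] d])
  have dkm[measurable]: "?d k \<in> borel_measurable borel" for k by (rule measurable_density_at[OF E(1)])
  have d01: "0 \<le> d x" "d x \<le> 1" for x
    using LIMSEQ_le_const[OF d] LIMSEQ_le_const2[OF d] density_at_bounds[OF E(1) r(1)] by blast+
  let ?g = "\<lambda>k x. indicat_real (ball 0 R) x * \<bar>?d k x - d x\<bar>"
  have ib: "integrable lborel (indicat_real (ball (0 :: 'n heis) R))"
    using sym_diff_ball_finite[of UNIV "0 :: 'n heis" R] by (intro integrable_real_indicator) auto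
  have g1: "?g k x \<le> indicat_real (ball 0 R) x" for k x
    using density_at_bounds[OF E(1) r(1), of k x] d01[of x] by (auto simp: indicator_def abs_le_iff)
  have gm: "?g k \<in> borel_measurable lborel" for k
    unfolding measurable_lborel2
    by (intro borel_measurable_times borel_measurable_indicator borel_measurable_abs
        borel_measurable_diff dkm dm) simp
  have gi: "integrable lborel (?g k)" for k
  proof (rule Bochner_Integration.integrable_bound[OF ib])
    show "?g k \<in> borel_measurable lborel" by (rule gm)
    show "AE x in lborel. norm (?g k x) \<le> norm (indicat_real (ball 0 R) x)"
      by (rule AE_I2) (use g1 in \<open>simp add: abs_mult\<close>)
  qed
  have "(\<lambda>k. LINT x|lborel. ?g k x) \<longlonglongrightarrow> (LINT x|lborel. indicat_real (ball (0 :: 'n heis) R) x * 0)"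
  proof (rule integral_dominated_convergence[where w="indicat_real (ball 0 R)"])
    show "integrable lborel (indicat_real (ball (0 :: 'n heis) R))" by (rule ib)
    show "AE x in lborel. (\<lambda>k. ?g k x) \<longlonglongrightarrow> indicat_real (ball 0 R) x * 0"
    proof (rule AE_I2, intro tendsto_mult tendsto_const)
      fix x
      have "(\<lambda>k. \<bar>?d k x - d x\<bar>) \<longlonglongrightarrow> \<bar>d x - d x\<bar>" by (intro tendsto_intros d)
      then show "(\<lambda>k. \<bar>?d k x - d x\<bar>) \<longlonglongrightarrow> 0" by simp
    qed
    show "AE x in lborel. norm (?g k x) \<le> indicat_real (ball 0 R) x" for k
      using g1 by (auto intro!: AE_I2 simp: abs_mult)
    show "(\<lambda>x. indicat_real (ball (0 :: 'n heis) R) x * 0) \<in> borel_measurable lborel" by simp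
    show "?g k \<in> borel_measurable lborel" for k by (rule gm)
  qed
  then have a0: "(\<lambda>k. LINT x|lborel. ?g k x) \<longlonglongrightarrow> 0" by simp
  have gpos: "0 \<le> (LINT x|lborel. ?g k x)" for k by (intro integral_nonneg_AE AE_I2) auto
  obtain N where N: "\<And>k. k \<ge> N \<Longrightarrow> (LINT x|lborel. ?g k x) < e / 8"
    using LIMSEQ_D[OF a0, of "e / 8"] e gpos by auto
  have "measure lborel (sym_diff (E k) (E l) \<inter> ball 0 R) < e" if kl: "k \<ge> N" "l \<ge> N" for k l
  proof -
    let ?dev = "\<lambda>k x. ennreal \<bar>indicat_real (E k) x - ?d k x\<bar>"
    have Em[measurable]: "E k \<in> sets borel" for k by (rule E(1))
    have Sm: "sym_diff (E k) (E l) \<inter> ball 0 R \<in> sets borel" by auto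
    have "emeasure lborel (sym_diff (E k) (E l) \<inter> ball 0 R) =
        (\<integral>\<^sup>+x. indicator (sym_diff (E k) (E l) \<inter> ball 0 R) x \<partial>lborel)" using Sm by simp
    also have "\<dots> \<le> (\<integral>\<^sup>+x. (?dev k x + ?dev l x) + (ennreal (?g k x) + ennreal (?g l x)) \<partial>lborel)"
    proof (rule nn_integral_mono)
      fix x
      show "indicator (sym_diff (E k) (E l) \<inter> ball 0 R) x \<le> (?dev k x + ?dev l x) + (ennreal (?g k x) + ennreal (?g l x))"
      proof (cases "x \<in> sym_diff (E k) (E l) \<inter> ball 0 R")
        case True
        have "1 \<le> (\<bar>indicat_real (E k) x - ?d k x\<bar> + \<bar>indicat_real (E l) x - ?d l x\<bar>) + (?g k x + ?g l x)"
        proof -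
          have "\<bar>indicat_real (E k) x - indicat_real (E l) x\<bar> = 1" "x \<in> ball 0 R" using True by auto
          then show ?thesis by (simp only: indicator_simps) (smt (verit) mult_1)
        qed
        then have "ennreal 1 \<le> ennreal ((\<bar>indicat_real (E k) x - ?d k x\<bar> + \<bar>indicat_real (E l) x - ?d l x\<bar>) + (?g k x + ?g l x))"
          by (rule ennreal_leI)
        also have "\<dots> = (?dev k x + ?dev l x) + (ennreal (?g k x) + ennreal (?g l x))"
          by (simp add: ennreal_plus)
        finally show ?thesis using True by simp
      qed simp
    qed
    also have "\<dots> = ((\<integral>\<^sup>+x. ?dev k x \<partial>lborel) + (\<integral>\<^sup>+x. ?dev l x \<partial>lborel)) +
        ((\<integral>\<^sup>+x. ennreal (?g k x) \<partial>lborel) + (\<integral>\<^sup>+x. ennreal (?g l x) \<partial>lborel))"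
    proof -
      have devm: "?dev k \<in> borel_measurable lborel" for k
        unfolding measurable_lborel2
        by (intro measurable_compose[OF _ measurable_ennreal] borel_measurable_abs
            borel_measurable_diff borel_measurable_indicator E(1) dkm)
      have ggm: "(\<lambda>x. ennreal (?g k x)) \<in> borel_measurable lborel" for k
        by (rule measurable_compose[OF gm measurable_ennreal])
      show ?thesis
        unfolding nn_integral_add[OF borel_measurable_add[OF devm devm] borel_measurable_add[OF ggm ggm]]
          nn_integral_add[OF devm devm] nn_integral_add[OF ggm ggm] ..
    qed
    also have "\<dots> \<le> (ennreal (e / 8) + ennreal (e / 8)) + (ennreal (e / 8) + ennreal (e / 8))"
    proof (intro add_mono)
      have dev: "(\<integral>\<^sup>+x. ?dev k x \<partial>lborel) \<le> ennreal (e / 8)" for k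
        by (rule order_trans[OF density_deviation_integral[OF E(1,2) c r(1)] ennreal_leI[OF mc]])
      show "(\<integral>\<^sup>+x. ?dev k x \<partial>lborel) \<le> ennreal (e / 8)" "(\<integral>\<^sup>+x. ?dev l x \<partial>lborel) \<le> ennreal (e / 8)"
        by (rule dev)+
      have gg: "(\<integral>\<^sup>+x. ennreal (?g k x) \<partial>lborel) \<le> ennreal (e / 8)" if "k \<ge> N" for k
        using N[OF that] by (subst nn_integral_eq_integral[OF gi]) (auto intro: ennreal_leI)
      show "(\<integral>\<^sup>+x. ennreal (?g k x) \<partial>lborel) \<le> ennreal (e / 8)" "(\<integral>\<^sup>+x. ennreal (?g l x) \<partial>lborel) \<le> ennreal (e / 8)"
        by (rule gg[OF kl(1)], rule gg[OF kl(2)])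
    qed
    also have "\<dots> = ennreal (e / 2)" using e by (simp flip: ennreal_plus)
    finally have "measure lborel (sym_diff (E k) (E l) \<inter> ball 0 R) \<le> e / 2"
      unfolding measure_def using e by (intro enn2real_leI) auto
    then show ?thesis using e by simp
  qed
  then show "\<exists>N. \<forall>k\<ge>N. \<forall>l\<ge>N. measure lborel (sym_diff (E k) (E l) \<inter> ball 0 R) < e" by blast
qed (rule that)

section \<open>Concentration\<close>

lemma finite_sum_layers_le:
  fixes E :: "int \<Rightarrow> 'n heis set" and U :: "'a \<Rightarrow> 'n heis set"
  assumes "finite A" "\<And>l. E l \<in> sets borel" "\<And>a. a \<in> A \<Longrightarrow> U a \<in> sets borel"
    and dj: "\<And>a b. a \<in> A \<Longrightarrow> b \<in> A \<Longrightarrow> a \<noteq> b \<Longrightarrow> l a = l b \<Longrightarrow> U a \<inter> U b = {}"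
  shows "(\<Sum>a\<in>A. emeasure lborel (E (l a) \<inter> U a)) \<le> (\<integral>\<^sup>+j. emeasure lborel (E j) \<partial>count_space UNIV)"
proof (rule sum_grouped_le_nn_integral[where l=l, OF assms(1)])
  fix j
  have "(\<Sum>a\<in>{a \<in> A. l a = j}. emeasure lborel (E (l a) \<inter> U a)) =
      (\<Sum>a\<in>{a \<in> A. l a = j}. emeasure lborel (E j \<inter> U a))"
    by (intro sum.cong) auto
  also have "\<dots> = emeasure lborel (\<Union>a\<in>{a \<in> A. l a = j}. E j \<inter> U a)"
  proof (rule sum_emeasure)
    show "(\<lambda>a. E j \<inter> U a) ` {a \<in> A. l a = j} \<subseteq> sets lborel" using assms(2,3) by auto
    show "disjoint_family_on (\<lambda>a. E j \<inter> U a) {a \<in> A. l a = j}"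
      unfolding disjoint_family_on_def using dj by blast
  qed (use assms(1) in auto)
  also have "\<dots> \<le> emeasure lborel (E j)" using assms(2) by (intro emeasure_mono) auto
  finally show "(\<Sum>a\<in>{a \<in> A. l a = j}. emeasure lborel (E (l a) \<inter> U a)) \<le> emeasure lborel (E j)" .
qed

lemma sparse_points_small_ennreal:
  assumes E: "E \<in> sets borel" "emeasure lborel E < \<infinity>" and r: "0 < r"
  shows "emeasure lborel {x \<in> E. density_at r E x < 1 / 2} \<le> ennreal (2 * modulus r) * perimeter X E"
proof (cases "perimeter X E = \<infinity>")
  case True
  have "0 < modulus r" unfolding modulus_def using shift_const(1) r by (intro mult_pos_pos add_pos_pos) auto
  then show ?thesis using True by (simp add: ennreal_mult_top)
next
  case False
  then obtain c where c: "perimeter X E = ennreal c" "0 \<le> c" by (cases "perimeter X E") auto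
  then show ?thesis using sparse_points_small[OF E _ c(2) r] modulus_nonneg[of r] r
    by (simp add: ennreal_mult' mult.assoc)
qed

text \<open>
  Take a maximal family of points of density at least one half whose balls of radius r are
  disjoint in each layer. By volume it is finite, by maximality the balls of radius 3 around it
  contain all points of density at least one half, and the remaining points carry little mass.
\<close>

lemma concentration:
  fixes E :: "int \<Rightarrow> 'n heis set"
  assumes E: "\<And>l. E l \<in> sets borel"
    and m: "(\<integral>\<^sup>+l. emeasure lborel (E l) \<partial>count_space UNIV) \<le> ennreal m" "0 \<le> m"
    and r: "0 < r" "r \<le> 1"
  obtains Q where "finite Q" "real (card Q) \<le> 2 * m / ball_vol r"
    "(\<integral>\<^sup>+l. emeasure lborel (E l - (\<Union>x\<in>{x. (l, x) \<in> Q}. heis_ball x 3)) \<partial>count_space UNIV)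
      \<le> ennreal (2 * modulus r) * (\<integral>\<^sup>+l. perimeter X (E l) \<partial>count_space UNIV)"
proof -
  have B: "0 < ball_vol r" using ball_vol_pos[OF r(1)] .
  define Good where "Good Q \<longleftrightarrow> finite Q \<and> (\<forall>(l, x)\<in>Q. x \<in> E l \<and> 1 / 2 \<le> density_at r (E l) x) \<and>
    (\<forall>a\<in>Q. \<forall>b\<in>Q. a \<noteq> b \<longrightarrow> fst a = fst b \<longrightarrow> heis_ball (snd a) r \<inter> heis_ball (snd b) r = {})" for Q
  have fin: "emeasure lborel (E l) < \<infinity>" for l
  proof -
    have "emeasure lborel (E l) \<le> (\<integral>\<^sup>+l. emeasure lborel (E l) \<partial>count_space UNIV)"
      using sum_le_nn_integral_count_space[of "{l}" UNIV "\<lambda>l. emeasure lborel (E l)"] by simp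
    also note m(1)
    finally show ?thesis by (simp add: le_less_trans)
  qed
  have card: "real (card Q) \<le> 2 * m / ball_vol r" if "Good Q" for Q
  proof -
    have "(\<Sum>a\<in>Q. ennreal (ball_vol r / 2)) \<le> (\<Sum>a\<in>Q. emeasure lborel (E (fst a) \<inter> heis_ball (snd a) r))"
    proof (rule sum_mono)
      fix a assume a: "a \<in> Q"
      obtain l x where lx: "a = (l, x)" by (cases a)
      have "1 / 2 \<le> density_at r (E l) x" using that a lx by (auto simp: Good_def)
      then have "ball_vol r / 2 \<le> measure lborel (E l \<inter> heis_ball x r)"
        using B by (simp add: density_at_eq[OF E] field_simps)
      then have "ennreal (ball_vol r / 2) \<le> ennreal (measure lborel (E l \<inter> heis_ball x r))" by (rule ennreal_leI)
      also have "\<dots> \<le> emeasure lborel (E l \<inter> heis_ball x r)"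
        unfolding measure_def by (rule ennreal_enn2real_if[THEN ord_eq_le_trans]) auto
      finally show "ennreal (ball_vol r / 2) \<le> emeasure lborel (E (fst a) \<inter> heis_ball (snd a) r)" by (simp add: lx)
    qed
    also have "\<dots> \<le> (\<integral>\<^sup>+j. emeasure lborel (E j) \<partial>count_space UNIV)"
      using that E by (intro finite_sum_layers_le) (auto simp: Good_def)
    also note m(1)
    finally have "ennreal (real (card Q)) * ennreal (ball_vol r / 2) \<le> ennreal m"
      by (simp only: sum_constant ennreal_of_nat_eq_real_of_nat)
    moreover have "ennreal (real (card Q) * (ball_vol r / 2)) = ennreal (real (card Q)) * ennreal (ball_vol r / 2)"
      using B by (intro ennreal_mult) auto
    ultimately have "ennreal (real (card Q) * (ball_vol r / 2)) \<le> ennreal m" by (simp only:)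
    then have "real (card Q) * (ball_vol r / 2) \<le> m" using m(2) by (simp only: ennreal_le_iff)
    then show ?thesis using B by (simp add: field_simps)
  qed
  have "Good {}" by (simp add: Good_def)
  moreover have "card Q \<le> nat \<lceil>2 * m / ball_vol r\<rceil>" if "Good Q" for Q using card[OF that] by linarith
  ultimately have "\<exists>Q. Good Q \<and> (\<forall>Q'. Good Q' \<longrightarrow> card Q' \<le> card Q)"
    by (intro ex_has_greatest_nat[of Good "{}" card "Suc (nat \<lceil>2 * m / ball_vol r\<rceil>)"])
      (auto intro: le_imp_less_Suc)
  then obtain Q where Q: "Good Q" "\<And>Q'. Good Q' \<Longrightarrow> card Q' \<le> card Q" by (elim exE conjE) simp
  have cover: "E l - (\<Union>x\<in>{x. (l, x) \<in> Q}. heis_ball x 3) \<subseteq> {x \<in> E l. density_at r (E l) x < 1 / 2}" for l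
  proof (rule ccontr)
    assume "\<not> ?thesis"
    then obtain x where x0: "x \<in> E l - (\<Union>x\<in>{x. (l, x) \<in> Q}. heis_ball x 3)"
      "x \<notin> {x \<in> E l. density_at r (E l) x < 1 / 2}" by (meson subsetI)
    have x1: "x \<in> E l" using x0(1) by (rule DiffD1)
    have x2: "x \<notin> heis_ball y 3" if "(l, y) \<in> Q" for y using x0(1) that by blast
    have x3: "1 / 2 \<le> density_at r (E l) x" using x0(2) x1 by (simp add: not_less)
    note x = x1 x2 x3
    have far: "heis_ball x r \<inter> heis_ball y r = {}" if "(l, y) \<in> Q" for y
    proof (rule ccontr)
      assume "heis_ball x r \<inter> heis_ball y r \<noteq> {}"
      then obtain z where z: "norm (heis_mult (- x) z) < r" "norm (heis_mult (- y) z) < r"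
        by (auto simp: heis_ball_def)
      \<comment> \<open>with |a|, |b| < 1 the product has norm less than 1 + 1 + 1, whence the radius 3\<close>
      define a b where "a = heis_mult (- y) z" and "b = heis_mult (- x) z"
      have ab: "norm a < 1" "norm b < 1" using z r(2) by (auto simp: a_def b_def)
      have "heis_mult (- y) x = heis_mult a (- b)"
      proof -
        have "z = heis_mult x b" by (simp add: b_def)
        then have "a = heis_mult (heis_mult (- y) x) b" by (simp add: a_def heis_mult_assoc)
        then show ?thesis by simp
      qed
      also have "norm \<dots> \<le> norm a + norm b + \<bar>form a b\<bar>"
        unfolding heis_mult_eq
        by (rule order_trans[OF norm_triangle_ineq add_mono[OF order_trans[OF norm_triangle_ineq]]]) auto
      also have "\<bar>form a b\<bar> \<le> norm a * norm b" by (rule abs_form_le)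
      also have "norm a * norm b \<le> 1 * 1" using ab by (intro mult_mono) auto
      finally have "norm (heis_mult (- y) x) < 3" using ab by linarith
      then show False using x(2)[OF that] by (simp add: heis_ball_def)
    qed
    have "(l, x) \<notin> Q"
    proof
      assume "(l, x) \<in> Q"
      from x(2)[OF this] show False by (simp add: heis_ball_def heis_mult_uminus_left)
    qed
    moreover have "Good (insert (l, x) Q)"
    proof -
      have far': "heis_ball x r \<inter> heis_ball (snd b) r = {}" if "b \<in> Q" "fst b = l" for b
        using far[of "snd b"] that by (metis prod.collapse)
      have "heis_ball (snd a) r \<inter> heis_ball (snd b) r = {}"
        if ab: "a \<in> insert (l, x) Q" "b \<in> insert (l, x) Q" "a \<noteq> b" "fst a = fst b" for a b
      proof (cases "a = (l, x)")
        case True then show ?thesis using far'[of b] ab by simp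
      next
        case False
        then have a: "a \<in> Q" using ab by blast
        show ?thesis
        proof (cases "b = (l, x)")
          case True then show ?thesis using far'[OF a] ab(4) by (simp add: Int_commute)
        next
          case False
          then show ?thesis using a ab Q(1) unfolding Good_def by blast
        qed
      qed
      then show ?thesis using Q(1) x1 x3 unfolding Good_def by simp
    qed
    ultimately show False using Q(2)[of "insert (l, x) Q"] Q(1) by (auto simp: Good_def)
  qed
  have "(\<integral>\<^sup>+l. emeasure lborel (E l - (\<Union>x\<in>{x. (l, x) \<in> Q}. heis_ball x 3)) \<partial>count_space UNIV)
      \<le> (\<integral>\<^sup>+l. ennreal (2 * modulus r) * perimeter X (E l) \<partial>count_space UNIV)"
  proof (rule nn_integral_mono)
    fix l
    have "{x \<in> E l. density_at r (E l) x < 1 / 2} = E l \<inter> (density_at r (E l) -` {..<1 / 2})" by auto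
    moreover have "density_at r (E l) -` {..<1 / 2} \<in> sets borel"
      by (rule measurable_sets_borel[OF measurable_density_at[OF E]]) simp
    ultimately have "{x \<in> E l. density_at r (E l) x < 1 / 2} \<in> sets lborel" using E[of l] by simp
    from emeasure_mono[OF cover this]
    show "emeasure lborel (E l - (\<Union>x\<in>{x. (l, x) \<in> Q}. heis_ball x 3)) \<le> ennreal (2 * modulus r) * perimeter X (E l)"
      by (rule order_trans[OF _ sparse_points_small_ennreal[OF E fin r(1)]])
  qed
  also have "\<dots> = ennreal (2 * modulus r) * (\<integral>\<^sup>+l. perimeter X (E l) \<partial>count_space UNIV)"
    by (rule nn_integral_cmult) simp
  finally show ?thesis using that[of Q] Q(1) card[OF Q(1)] by (auto simp: Good_def)
qed

text \<open>
  When the total mass is less than half the volume of a ball of radius r, every point is sparse at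
  scale r.
\<close>

lemma isoperimetric_layers:
  fixes E :: "int \<Rightarrow> 'n heis set"
  assumes E: "\<And>l. E l \<in> sets borel"
    and m: "(\<integral>\<^sup>+l. emeasure lborel (E l) \<partial>count_space UNIV) = ennreal m" "0 \<le> m"
    and r: "0 < r" "m < ball_vol r / 2"
  shows "ennreal m \<le> ennreal (2 * modulus r) * (\<integral>\<^sup>+l. perimeter X (E l) \<partial>count_space UNIV)"
proof -
  have B: "0 < ball_vol r" using ball_vol_pos[OF r(1)] .
  have le: "emeasure lborel (E l) \<le> ennreal m" for l
    using sum_le_nn_integral_count_space[of "{l}" UNIV "\<lambda>l. emeasure lborel (E l)"] m(1) by simp
  have fin: "emeasure lborel (E l) < \<infinity>" for l
    using le_less_trans[OF le[of l] ennreal_less_top] by simp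
  have all: "{x \<in> E l. density_at r (E l) x < 1 / 2} = E l" for l
  proof -
    have "density_at r (E l) x < 1 / 2" for x
    proof -
      have "emeasure lborel (E l \<inter> heis_ball x r) \<le> ennreal m"
        by (rule order_trans[OF emeasure_mono le[of l]]) (use E in auto)
      then have "measure lborel (E l \<inter> heis_ball x r) \<le> m"
        unfolding measure_def using m(2) by (intro enn2real_leI) auto
      then show ?thesis using r(2) B by (simp add: density_at_eq[OF E] field_simps)
    qed
    then show ?thesis by auto
  qed
  have "ennreal m \<le> (\<integral>\<^sup>+l. ennreal (2 * modulus r) * perimeter X (E l) \<partial>count_space UNIV)"
    unfolding m(1)[symmetric]
  proof (rule nn_integral_mono)
    fix l show "emeasure lborel (E l) \<le> ennreal (2 * modulus r) * perimeter X (E l)"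
      using sparse_points_small_ennreal[OF E fin r(1), of l] unfolding all .
  qed
  also have "\<dots> = ennreal (2 * modulus r) * (\<integral>\<^sup>+l. perimeter X (E l) \<partial>count_space UNIV)"
    by (rule nn_integral_cmult) simp
  finally show ?thesis .
qed

end

section \<open>Perimeter of translates, finite sums of fields\<close>

context heis_frame
begin

lemma test_field_translate:
  assumes "test_field \<phi>" shows "test_field (\<lambda>i q. \<phi> i (heis_mult a q))"
  using assms test_function_heis_left unfolding test_field_def by blast

text \<open>
  The energy does not distinguish a set from its left translates, so that clusters can be viewed
  from moving centers.
\<close>

lemma field_variation_translate:
  assumes \<phi>: "test_field \<phi>" and E: "E \<in> sets borel"
  shows "field_variation X {q. heis_mult a q \<in> E} \<phi> = field_variation X E (\<lambda>i q. \<phi> i (heis_mult (- a) q))"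
  unfolding field_variation_def
proof (rule sum.cong)
  fix i
  have t: "test_function (\<lambda>q. \<phi> i (heis_mult (- a) q))"
    using test_field_translate[OF \<phi>] by (simp add: test_field_def)
  show "distr_deriv (X i) (indicat_real {q. heis_mult a q \<in> E}) (\<phi> i) =
      distr_deriv (X i) (indicat_real E) (\<lambda>q. \<phi> i (heis_mult (- a) q))"
    using distr_deriv_translate[OF left_inv t E, of i a] by simp
qed simp

lemma perimeter_translate_le:
  assumes E: "E \<in> sets borel" and c: "perimeter X E \<le> ennreal c" "0 \<le> c"
  shows "perimeter X {q. heis_mult a q \<in> E} \<le> ennreal c"
proof -
  have "bounded_variation_by c X {q. heis_mult a q \<in> E}"
    by (rule bounded_variation_by_translate[OF perimeter_imp_bounded_variation_by[OF c] E])
  then obtain \<nu> where \<nu>: "is_distr_gradient X (indicat_real {q. heis_mult a q \<in> E}) \<nu>"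
    by (rule bounded_variation_by_imp_gradient)
  show ?thesis
  proof (rule perimeter_le_field_variation[OF \<nu>])
    fix \<phi> :: "'n + 'n \<Rightarrow> 'n heis \<Rightarrow> real" assume \<phi>: "test_field \<phi>"
    have "ennreal (field_variation X {q. heis_mult a q \<in> E} \<phi>) \<le> ennreal c"
      unfolding field_variation_translate[OF \<phi> E]
      by (rule order_trans[OF field_variation_le_perimeter[OF test_field_translate[OF \<phi>]] c(1)])
    then show "field_variation X {q. heis_mult a q \<in> E} \<phi> \<le> c" using c(2) by (simp only: ennreal_le_iff)
  qed
qed

lemma perimeter_empty: "perimeter X {} = 0"
proof -
  have "bounded_variation_by 0 X {}"
    unfolding bounded_variation_by_def
  proof (intro allI exI conjI impI)
    let ?z = "measure_of UNIV (sets borel) (\<lambda>A. 0) :: 'n heis measure"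
    have s: "sets ?z = sets borel" by (rule sets_borel_measure_of)
    have e: "emeasure ?z A = 0" if "A \<in> sets borel" for A
      using emeasure_borel_measure_of[of "\<lambda>A. 0" A] that by simp
    have sp: "space ?z = UNIV" using sets_eq_imp_space_eq[OF s] by simp
    show "finite_measure ?z" "finite_measure ?z" by (auto intro!: finite_measureI simp: sp e)
    show "sets ?z = sets borel" "sets ?z = sets borel" by (rule s)+
    show "measure ?z UNIV \<le> 0" "measure ?z UNIV \<le> 0" by (simp_all add: measure_def e)
    show "distr_deriv (X i) (indicat_real {}) \<phi> = (LINT x|?z. \<phi> x) - (LINT x|?z. \<phi> x)" for i \<phi>
      by (simp add: distr_deriv_def)
  qed
  then obtain \<nu> where "is_distr_gradient X (indicat_real {}) \<nu>" by (rule bounded_variation_by_imp_gradient)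
  then have "perimeter X {} \<le> ennreal 0"
    by (rule perimeter_le_field_variation) (simp add: field_variation_def distr_deriv_def)
  then show ?thesis by simp
qed

lemma distr_deriv_sum:
  assumes "finite S" "\<And>a. a \<in> S \<Longrightarrow> test_function (\<phi> a)" and [measurable]: "E \<in> sets borel"
  shows "distr_deriv (X i) (indicat_real E) (\<lambda>x. \<Sum>a\<in>S. \<phi> a x) = (\<Sum>a\<in>S. distr_deriv (X i) (indicat_real E) (\<phi> a))"
proof -
  have t: "test_function (\<lambda>x. \<Sum>a\<in>S. \<phi> a x)"
    using test_function_sum_mult[of S \<phi> "\<lambda>_. 1"] assms(1,2) by simp
  have al: "along (X i) (\<lambda>x. \<Sum>a\<in>S. \<phi> a x) x = (\<Sum>a\<in>S. along (X i) (\<phi> a) x)" for x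
  proof -
    have "((\<lambda>x. \<Sum>a\<in>S. \<phi> a x) has_derivative (\<lambda>v. \<Sum>a\<in>S. frechet_derivative (\<phi> a) (at x) v)) (at x)"
      using test_functionD(3)[OF assms(2)]
      by (intro has_derivative_sum) (simp add: frechet_derivative_works)
    from frechet_derivative_at[OF this] show ?thesis unfolding along_def by (metis (no_types))
  qed
  have int: "integrable lborel (\<lambda>x. indicat_real E x * along (X i) (\<phi> a) x)" if a: "a \<in> S" for a
  proof -
    have ta: "test_function (along (X i) (\<phi> a))" by (rule test_function_along[OF left_inv assms(2)[OF a]])
    obtain C where C: "0 < C" "\<And>x. \<bar>along (X i) (\<phi> a) x\<bar> \<le> C" using test_function_bounded[OF ta] by blast
    obtain R where R: "\<And>x. along (X i) (\<phi> a) x \<noteq> 0 \<Longrightarrow> norm x < R" using test_functionD(5)[OF ta] by blast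
    show ?thesis
    proof (rule integrable_bounded_support)
      show "(\<lambda>x. indicat_real E x * along (X i) (\<phi> a) x) \<in> borel_measurable borel"
        using test_functionD(4)[OF ta] by measurable
      show "\<bar>indicat_real E x * along (X i) (\<phi> a) x\<bar> \<le> C" for x
        using C(1) C(2)[of x] by (auto simp: indicator_def)
      show "norm x < R" if "indicat_real E x * along (X i) (\<phi> a) x \<noteq> 0" for x
        using that R by auto
    qed
  qed
  show ?thesis
    unfolding distr_deriv_left_invariant[OF left_inv t] al
    using int assms(2)
    by (simp add: distr_deriv_left_invariant[OF left_inv] sum_distrib_left sum_negf Bochner_Integration.integral_sum)
qed

lemma field_variation_sum:
  assumes "finite S" "\<And>a. a \<in> S \<Longrightarrow> test_field (\<phi> a)" "E \<in> sets borel"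
  shows "field_variation X E (\<lambda>i x. \<Sum>a\<in>S. \<phi> a i x) = (\<Sum>a\<in>S. field_variation X E (\<phi> a))"
proof -
  have "field_variation X E (\<lambda>i x. \<Sum>a\<in>S. \<phi> a i x) =
      (\<Sum>i\<in>UNIV. \<Sum>a\<in>S. distr_deriv (X i) (indicat_real E) (\<phi> a i))"
    unfolding field_variation_def
    by (intro sum.cong refl distr_deriv_sum[OF assms(1) _ assms(3)]) (use assms(2) in \<open>simp add: test_field_def\<close>)
  also have "\<dots> = (\<Sum>a\<in>S. field_variation X E (\<phi> a))"
    unfolding field_variation_def by (rule sum.swap)
  finally show ?thesis .
qed

text \<open>
  At each point at most one summand is nonzero. This is why distant pieces do not compete in the
  supremum that defines the perimeter.
\<close>

lemma test_field_sum_disjoint: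
  fixes \<phi> :: "'b \<Rightarrow> 'n + 'n \<Rightarrow> 'n heis \<Rightarrow> real"
  assumes "finite S" "\<And>a. a \<in> S \<Longrightarrow> test_field (\<phi> a)"
    and supp: "\<And>a i x. a \<in> S \<Longrightarrow> \<phi> a i x \<noteq> 0 \<Longrightarrow> x \<in> U a"
    and dj: "\<And>a b. a \<in> S \<Longrightarrow> b \<in> S \<Longrightarrow> a \<noteq> b \<Longrightarrow> U a \<inter> U b = {}"
  shows "test_field (\<lambda>i x. \<Sum>a\<in>S. \<phi> a i x)"
  unfolding test_field_def
proof (intro conjI allI)
  show "test_function (\<lambda>x. \<Sum>a\<in>S. \<phi> a i x)" for i
    using test_function_sum_mult[of S "\<lambda>a. \<phi> a i" "\<lambda>_. 1"] assms(1,2) by (simp add: test_field_def)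
  show "(\<Sum>i\<in>UNIV. (\<Sum>a\<in>S. \<phi> a i x)\<^sup>2) \<le> 1" for x
  proof (cases "\<exists>b\<in>S. x \<in> U b")
    case True
    then obtain b where b: "b \<in> S" "x \<in> U b" by blast
    have "(\<Sum>a\<in>S. \<phi> a i x) = \<phi> b i x" for i
    proof -
      have "(\<Sum>a\<in>S. \<phi> a i x) = (\<Sum>a\<in>S. if a = b then \<phi> b i x else 0)"
      proof (rule sum.cong)
        fix a assume a: "a \<in> S"
        have "x \<notin> U a" if "a \<noteq> b" using dj[OF a b(1) that] b(2) by blast
        then show "\<phi> a i x = (if a = b then \<phi> b i x else 0)" using supp[OF a, of i x] by auto
      qed simp
      then show ?thesis using assms(1) b(1) by simp
    qed
    moreover have "(\<Sum>i\<in>UNIV. (\<phi> b i x)\<^sup>2) \<le> 1"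
      using assms(2)[OF b(1)] unfolding test_field_def by blast
    ultimately show ?thesis by simp
  next
    case False
    then have "\<phi> a i x = 0" if "a \<in> S" for a i using supp[OF that] that by blast
    then show ?thesis by simp
  qed
qed

section \<open>Generalized clusters\<close>

text \<open>
  Index 0, which no component uses, is given to the union of all components. In this way all the
  sets whose perimeters enter the energy are treated alike.
\<close>

definition component :: "enat \<Rightarrow> (nat \<Rightarrow> (int \<times> 'n heis) set) \<Rightarrow> nat \<Rightarrow> int \<Rightarrow> 'n heis set" where
  "component N E i l = (if i = 0 then (\<Union>j\<in>indices N. layer l E j) else layer l E i)"

lemma zero_notin_indices: "0 \<notin> indices N" by (simp add: indices_def)

lemma component_sets:
  assumes "gen_cluster N E" "i \<in> insert 0 (indices N)" shows "component N E i l \<in> sets borel"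
proof -
  have "layer l E j \<in> sets borel" if "j \<in> indices N" for j
    using assms(1) that by (simp add: gen_cluster_def cluster_def)
  moreover have "countable (indices N)" by (rule countableI_type)
  ultimately show ?thesis using assms(2) by (auto simp: component_def intro!: sets.countable_UN')
qed

lemma gen_mass_eq:
  assumes "i \<in> indices N"
  shows "gen_mass E i = (\<integral>\<^sup>+l. emeasure lborel (component N E i l) \<partial>count_space UNIV)"
proof -
  have "i \<noteq> 0" using assms zero_notin_indices by metis
  then show ?thesis
    unfolding gen_mass_def component_def by (simp add: infsum_ennreal_eq_nn_integral)
qed

lemma nn_integral_count_space_insert:
  fixes f :: "'b \<Rightarrow> ennreal"
  assumes "a \<notin> A"
  shows "(\<integral>\<^sup>+x. f x \<partial>count_space (insert a A)) = f a + (\<integral>\<^sup>+x. f x \<partial>count_space A)"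
proof -
  have "(\<integral>\<^sup>+x. f x \<partial>count_space (insert a A)) = (\<integral>\<^sup>+x. f x * indicator (insert a A) x \<partial>count_space UNIV)"
    by (cases "insert a A = UNIV") (simp_all add: nn_integral_count_space_indicator)
  also have "\<dots> = (\<integral>\<^sup>+x. f x * indicator {a} x + f x * indicator A x \<partial>count_space UNIV)"
    using assms by (intro nn_integral_cong) (auto simp: indicator_def)
  also have "\<dots> = (\<integral>\<^sup>+x. f x * indicator {a} x \<partial>count_space UNIV) + (\<integral>\<^sup>+x. f x * indicator A x \<partial>count_space UNIV)"
    by (rule nn_integral_add) auto
  also have "(\<integral>\<^sup>+x. f x * indicator {a} x \<partial>count_space UNIV) = f a"
    by (subst nn_integral_count_space'[of "{a}"]) auto
  also have "(\<integral>\<^sup>+x. f x * indicator A x \<partial>count_space UNIV) = (\<integral>\<^sup>+x. f x \<partial>count_space A)"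
    by (cases "A = UNIV") (simp_all add: nn_integral_count_space_indicator)
  finally show ?thesis .
qed

lemma gen_perimeter_eq:
  "gen_perimeter X N E =
    (\<integral>\<^sup>+i. \<integral>\<^sup>+l. perimeter X (component N E i l) \<partial>count_space UNIV \<partial>count_space (insert 0 (indices N))) / 2"
proof -
  let ?I = "insert 0 (indices N)"
  have cI: "countable (indices N)" "countable ?I" by (rule countableI_type)+
  have "cluster_perimeter X N (layer l E) = (\<integral>\<^sup>+i. perimeter X (component N E i l) \<partial>count_space ?I) / 2" for l
  proof -
    have "(\<integral>\<^sup>+i. perimeter X (component N E i l) \<partial>count_space ?I) =
        perimeter X (component N E 0 l) + (\<integral>\<^sup>+i. perimeter X (component N E i l) \<partial>count_space (indices N))"
      by (rule nn_integral_count_space_insert) (use zero_notin_indices in auto)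
    also have "(\<integral>\<^sup>+i. perimeter X (component N E i l) \<partial>count_space (indices N)) =
        (\<integral>\<^sup>+i. perimeter X (layer l E i) \<partial>count_space (indices N))"
      by (intro nn_integral_cong) (auto simp: component_def indices_def)
    finally show ?thesis
      unfolding cluster_perimeter_def infsum_ennreal_eq_nn_integral[OF cI(1)]
      by (simp add: component_def add_divide_distrib_ennreal add.commute)
  qed
  then have "gen_perimeter X N E = (\<integral>\<^sup>+l. (\<integral>\<^sup>+i. perimeter X (component N E i l) \<partial>count_space ?I) / 2 \<partial>count_space UNIV)"
    unfolding gen_perimeter_def by (simp add: infsum_ennreal_eq_nn_integral)
  also have "\<dots> = (\<integral>\<^sup>+l. (\<integral>\<^sup>+i. perimeter X (component N E i l) \<partial>count_space ?I) \<partial>count_space UNIV) / 2"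
    by (rule nn_integral_divide) simp
  also have "(\<integral>\<^sup>+l. (\<integral>\<^sup>+i. perimeter X (component N E i l) \<partial>count_space ?I) \<partial>count_space UNIV) =
      (\<integral>\<^sup>+i. \<integral>\<^sup>+l. perimeter X (component N E i l) \<partial>count_space UNIV \<partial>count_space ?I)"
    by (rule nn_integral_count_space_nn_integral[OF cI(2)]) simp
  finally show ?thesis .
qed

lemma ball_vol_power: "0 \<le> r \<Longrightarrow> ball_vol r = ball_vol 1 * r ^ DIM('n heis)"
  unfolding ball_vol_def by (simp add: content_ball)

text \<open>
  Take r with ball volume 4 m. The isoperimetric inequality at scale r gives m \<le> 2 (modulus r)
  P, and since r \<ge> 1 the modulus is at most a multiple of r, thus of m.
\<close>

lemma large_mass_perimeter:
  fixes E :: "int \<Rightarrow> 'n heis set"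
  assumes E: "\<And>l. E l \<in> sets borel"
    and m: "(\<integral>\<^sup>+l. emeasure lborel (E l) \<partial>count_space UNIV) = ennreal m" "ball_vol 1 / 2 \<le> m"
  shows "ennreal (ball_vol 1 / (16 * shift_const)) \<le> (\<integral>\<^sup>+l. perimeter X (E l) \<partial>count_space UNIV)"
proof -
  have B: "0 < ball_vol 1" by (rule ball_vol_pos) simp
  have m0: "0 < m" using m(2) B by linarith
  define D where "D = DIM('n heis)"
  have D: "1 \<le> D" unfolding D_def by (rule DIM_ge_Suc0[unfolded One_nat_def[symmetric]])
  define r where "r = root D (4 * m / ball_vol 1)"
  have q: "1 \<le> 4 * m / ball_vol 1" using m(2) B by (simp add: field_simps)
  have r1: "1 \<le> r" unfolding r_def using D q by (simp add: real_root_ge_1_iff)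
  have rD: "r ^ D = 4 * m / ball_vol 1" unfolding r_def using D m0 B by (intro real_root_pow_pos2) auto
  have vol: "ball_vol r = 4 * m"
  proof -
    have "ball_vol r = ball_vol 1 * r ^ D" unfolding D_def by (rule ball_vol_power) (use r1 in simp)
    then show ?thesis using B unfolding rD by simp
  qed
  let ?P = "\<integral>\<^sup>+l. perimeter X (E l) \<partial>count_space UNIV"
  have iso: "ennreal m \<le> ennreal (2 * modulus r) * ?P"
    using r1 m0 vol by (intro isoperimetric_layers[OF E m(1)]) auto
  show ?thesis
  proof (cases "?P = \<infinity>")
    case False
    then obtain p where p: "?P = ennreal p" "0 \<le> p" by (cases ?P) auto
    have C: "0 < shift_const" by (rule shift_const)
    have mod0: "0 \<le> modulus r" using modulus_nonneg r1 by simp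
    have "ennreal m \<le> ennreal (2 * modulus r * p)"
      using iso p mod0 by (simp add: ennreal_mult)
    then have "m \<le> 2 * modulus r * p" using mod0 p(2) by (subst (asm) ennreal_le_iff) auto
    also have "\<dots> \<le> 2 * (shift_const * (2 * r)) * p"
    proof -
      have "sqrt r \<le> r" using r1 sqrt_le_D real_sqrt_le_iff by (intro real_le_lsqrt) (auto simp: power2_eq_square)
      then have "modulus r \<le> shift_const * (2 * r)" unfolding modulus_def using C by (intro mult_left_mono) auto
      from mult_right_mono[OF mult_left_mono[OF this, of 2] p(2)] show ?thesis by (simp only: zero_le_numeral)
    qed
    also have "\<dots> \<le> 2 * (shift_const * (2 * (4 * m / ball_vol 1))) * p"
    proof -
      have "r ^ 1 \<le> r ^ D" using D r1 by (intro power_increasing) auto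
      then have "r \<le> 4 * m / ball_vol 1" using rD by simp
      then show ?thesis using C p(2) by (intro mult_right_mono mult_left_mono) auto
    qed
    also have "\<dots> = m * (16 * shift_const * p / ball_vol 1)" by simp
    finally have "1 \<le> 16 * shift_const * p / ball_vol 1" using m0 by (simp only: mult_le_cancel_left1)
    then have "ball_vol 1 / (16 * shift_const) \<le> p" using B C by (simp add: field_simps)
    then show ?thesis unfolding p(1) by (rule ennreal_leI)
  qed simp
qed

text \<open>
  Components of small mass satisfy m \<le> C P by the isoperimetric inequality at scale 1, and
  only finitely many components have large mass since their perimeters are bounded below.
\<close>

lemma masses_summable:
  assumes E: "gen_cluster N E" "gen_perimeter X N E < \<infinity>"
    and m: "\<And>i. i \<in> indices N \<Longrightarrow> gen_mass E i = ennreal (m i)" "\<And>i. i \<in> indices N \<Longrightarrow> 0 \<le> m i"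
  shows "summable (\<lambda>i. if i \<in> indices N then m i else 0)"
proof -
  let ?I = "indices N"
  define P where "P i = (\<integral>\<^sup>+l. perimeter X (component N E i l) \<partial>count_space UNIV)" for i
  have cI: "countable ?I" by (rule countableI_type)
  define T where "T = (\<integral>\<^sup>+i. P i \<partial>count_space (insert 0 ?I))"
  have "T < \<infinity>"
    using E(2) unfolding gen_perimeter_eq T_def[symmetric] P_def[symmetric]
    by (metis ennreal_top_divide ennreal_neq_top infinity_ennreal_def less_top ennreal_numeral)
  then obtain t where t: "T = ennreal t" "0 \<le> t" by (cases T) auto
  have sumP: "sum P F \<le> ennreal t" if "finite F" "F \<subseteq> ?I" for F
    unfolding t(1)[symmetric] T_def using that by (intro sum_le_nn_integral_count_space) auto
  have mi: "(\<integral>\<^sup>+l. emeasure lborel (component N E i l) \<partial>count_space UNIV) = ennreal (m i)" if "i \<in> ?I" for i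
    using m(1)[OF that] gen_mass_eq[OF that] by simp
  have Es: "component N E i l \<in> sets borel" if "i \<in> ?I" for i l
    using component_sets[OF E(1)] that by blast
  have B: "0 < ball_vol 1" by (rule ball_vol_pos) simp
  define A where "A = {i \<in> ?I. ball_vol 1 / 2 \<le> m i}"
  define c where "c = ball_vol 1 / (16 * shift_const)"
  have c: "0 < c" using B shift_const(1) by (simp add: c_def)
  have "finite A"
  proof (rule conjunct1[OF finite_if_finite_subsets_card_bdd])
    fix F assume F: "F \<subseteq> A" "finite F"
    have "(\<Sum>i\<in>F. ennreal c) \<le> sum P F"
      unfolding P_def c_def using F Es mi by (intro sum_mono large_mass_perimeter) (auto simp: A_def)
    also have "\<dots> \<le> ennreal t" using F by (intro sumP) (auto simp: A_def)
    finally have "ennreal (real (card F)) * ennreal c \<le> ennreal t"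
      by (simp only: sum_constant ennreal_of_nat_eq_real_of_nat)
    moreover have "ennreal (real (card F) * c) = ennreal (real (card F)) * ennreal c"
      using c by (intro ennreal_mult) auto
    ultimately have "ennreal (real (card F) * c) \<le> ennreal t" by (simp only:)
    then have "real (card F) * c \<le> t" using t(2) by (simp only: ennreal_le_iff)
    then have "real (card F) \<le> t / c" using c by (simp add: field_simps)
    then show "card F \<le> nat \<lceil>t / c\<rceil>" by linarith
  qed
  define K where "K = 2 * modulus 1"
  have K: "0 \<le> K" using modulus_nonneg[of 1] by (simp add: K_def)
  have small: "sum m F \<le> K * t" if F: "finite F" "F \<subseteq> ?I - A" for F
  proof -
    have "ennreal (sum m F) = (\<Sum>i\<in>F. ennreal (m i))"
      using F m(2) by (intro sum_ennreal[symmetric]) auto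
    also have "\<dots> \<le> (\<Sum>i\<in>F. ennreal K * P i)"
    proof (rule sum_mono)
      fix i assume "i \<in> F"
      then have "i \<in> ?I" "m i < ball_vol 1 / 2" using F by (auto simp: A_def)
      then show "ennreal (m i) \<le> ennreal K * P i"
        unfolding P_def K_def using Es mi m(2) by (intro isoperimetric_layers) auto
    qed
    also have "\<dots> = ennreal K * sum P F" by (simp add: sum_distrib_left)
    also have "\<dots> \<le> ennreal K * ennreal t" using F by (intro mult_left_mono sumP) auto
    also have "\<dots> = ennreal (K * t)" using K t(2) by (simp add: ennreal_mult)
    finally show ?thesis using K t(2) by (subst (asm) ennreal_le_iff) auto
  qed
  show ?thesis
  proof (rule summableI_nonneg_bounded)
    show "0 \<le> (if i \<in> ?I then m i else 0)" for i using m(2) by simp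
    fix n
    have "(\<Sum>i<n. if i \<in> ?I then m i else 0) = sum m ({..<n} \<inter> ?I)"
      by (simp add: sum.inter_restrict)
    also have "\<dots> = sum m ({..<n} \<inter> ?I \<inter> A) + sum m ({..<n} \<inter> ?I - A)"
      by (rule sum.Int_Diff) simp
    also have "\<dots> \<le> sum m A + K * t"
      using \<open>finite A\<close> m(2) by (intro add_mono sum_mono2 small) (auto simp: A_def)
    finally show "(\<Sum>i<n. if i \<in> ?I then m i else 0) \<le> sum m A + K * t" .
  qed
qed

end

lemma conv_loc_measure_ball:
  fixes F :: "'a::euclidean_space set"
  assumes conv: "conv_loc E F" and E: "\<And>k. E k \<in> sets borel" "F \<in> sets borel"
  shows "(\<lambda>k. measure lborel (E k \<inter> ball 0 R)) \<longlonglongrightarrow> measure lborel (F \<inter> ball 0 R)"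
proof (rule LIM_zero_cancel, rule Lim_null_comparison)
  show "(\<lambda>k. measure lborel (sym_diff (E k) F \<inter> ball 0 R)) \<longlonglongrightarrow> 0"
    using conv by (simp add: conv_loc_def)
  have le: "measure lborel (A \<inter> ball 0 R) \<le> measure lborel (B \<inter> ball 0 R) + measure lborel (sym_diff A B \<inter> ball 0 R)"
    if "A \<in> sets borel" "B \<in> sets borel" for A B :: "'a set"
  proof -
    have "measure lborel (A \<inter> ball 0 R) \<le> measure lborel ((B \<inter> ball 0 R) \<union> (sym_diff A B \<inter> ball 0 R))"
      using that by (intro measure_mono_fmeasurable fmeasurable.Un Int_ball_fmeasurable) auto
    also have "\<dots> \<le> measure lborel (B \<inter> ball 0 R) + measure lborel (sym_diff A B \<inter> ball 0 R)"
      using that by (intro measure_Un_le) auto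
    finally show ?thesis .
  qed
  have "norm (measure lborel (E k \<inter> ball 0 R) - measure lborel (F \<inter> ball 0 R))
      \<le> measure lborel (sym_diff (E k) F \<inter> ball 0 R)" for k
    using le[OF E(1) E(2), of k] le[OF E(2) E(1), of k] by (simp add: abs_le_iff Un_commute)
  then show "\<forall>\<^sub>F k in sequentially. norm (measure lborel (E k \<inter> ball 0 R) - measure lborel (F \<inter> ball 0 R))
      \<le> measure lborel (sym_diff (E k) F \<inter> ball 0 R)" by simp
qed

text \<open>
  The measure is lower semicontinuous: no mass can appear in the limit.
\<close>

lemma conv_loc_emeasure_le:
  fixes F :: "'a::euclidean_space set"
  assumes conv: "conv_loc E F" and E: "\<And>k. E k \<in> sets borel" "F \<in> sets borel"
    and le: "\<And>k. emeasure lborel (E k) \<le> ennreal c" "0 \<le> c"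
  shows "emeasure lborel F \<le> ennreal c"
proof -
  have b: "emeasure lborel (F \<inter> ball 0 (real n)) \<le> ennreal c" for n
  proof -
    have "measure lborel (E k \<inter> ball 0 (real n)) \<le> c" for k
    proof -
      have "emeasure lborel (E k \<inter> ball 0 (real n)) \<le> ennreal c"
        using E by (intro order_trans[OF emeasure_mono le(1)]) auto
      then show ?thesis unfolding measure_def using le(2) by (intro enn2real_leI) auto
    qed
    then have "measure lborel (F \<inter> ball 0 (real n)) \<le> c"
      by (intro LIMSEQ_le_const2[OF conv_loc_measure_ball[OF conv E]]) auto
    moreover have "emeasure lborel (F \<inter> ball 0 (real n)) = ennreal (measure lborel (F \<inter> ball 0 (real n)))"
      using sym_diff_ball_finite[of F 0 "real n"] by (intro emeasure_eq_ennreal_measure) auto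
    ultimately show ?thesis by (simp add: ennreal_leI)
  qed
  have "emeasure lborel (\<Union>n. F \<inter> ball 0 (real n)) = (SUP n. emeasure lborel (F \<inter> ball 0 (real n)))"
  proof (rule SUP_emeasure_incseq[symmetric])
    show "range (\<lambda>n. F \<inter> ball 0 (real n)) \<subseteq> sets lborel" using E(2) by auto
    show "incseq (\<lambda>n. F \<inter> ball 0 (real n))" unfolding incseq_def by force
  qed
  moreover have "(\<Union>n. F \<inter> ball 0 (real n)) = F"
  proof -
    have "x \<in> (\<Union>n. F \<inter> ball 0 (real n))" if "x \<in> F" for x
    proof -
      obtain n where "norm x < real n" using reals_Archimedean2 by blast
      then have "x \<in> F \<inter> ball 0 (real n)" using that by simp
      then show ?thesis by (rule UN_I[OF UNIV_I])
    qed
    then show ?thesis by blast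
  qed
  ultimately show ?thesis using b by (simp add: SUP_least)
qed

lemma conv_loc_Int_null:
  fixes F G :: "'a::euclidean_space set"
  assumes "conv_loc E F" "conv_loc D G" and E: "\<And>k. E k \<in> sets borel" "F \<in> sets borel"
    and D: "\<And>k. D k \<in> sets borel" "G \<in> sets borel"
    and null: "\<And>k. emeasure lborel (E k \<inter> D k) = 0"
  shows "emeasure lborel (F \<inter> G) = 0"
proof -
  have cl: "conv_loc (\<lambda>k. E k \<inter> D k) (F \<inter> G)"
    unfolding conv_loc_def
  proof (intro allI, rule Lim_null_comparison)
    fix R
    have "measure lborel (sym_diff (E k \<inter> D k) (F \<inter> G) \<inter> ball 0 R) \<le>
        measure lborel (sym_diff (E k) F \<inter> ball 0 R) + measure lborel (sym_diff (D k) G \<inter> ball 0 R)" for k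
    proof -
      have "measure lborel (sym_diff (E k \<inter> D k) (F \<inter> G) \<inter> ball 0 R) \<le>
          measure lborel ((sym_diff (E k) F \<inter> ball 0 R) \<union> (sym_diff (D k) G \<inter> ball 0 R))"
        using E D by (intro measure_mono_fmeasurable fmeasurable.Un Int_ball_fmeasurable) auto
      also have "\<dots> \<le> measure lborel (sym_diff (E k) F \<inter> ball 0 R) + measure lborel (sym_diff (D k) G \<inter> ball 0 R)"
        using E D by (intro measure_Un_le) auto
      finally show ?thesis .
    qed
    then show "\<forall>\<^sub>F k in sequentially. norm (measure lborel (sym_diff (E k \<inter> D k) (F \<inter> G) \<inter> ball 0 R)) \<le>
        measure lborel (sym_diff (E k) F \<inter> ball 0 R) + measure lborel (sym_diff (D k) G \<inter> ball 0 R)" by simp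
    show "(\<lambda>k. measure lborel (sym_diff (E k) F \<inter> ball 0 R) + measure lborel (sym_diff (D k) G \<inter> ball 0 R)) \<longlonglongrightarrow> 0"
      using assms(1,2) by (auto simp: conv_loc_def intro!: tendsto_add_zero)
  qed
  have "emeasure lborel (F \<inter> G) \<le> ennreal 0"
    by (rule conv_loc_emeasure_le[OF cl]) (use E D null in simp_all)
  then show ?thesis by simp
qed

text \<open>
  Finite unions are clear, and summability of the masses makes the measures of the remaining parts
  of the unions uniformly small.
\<close>

lemma conv_loc_UN:
  fixes E :: "nat \<Rightarrow> nat \<Rightarrow> 'a::euclidean_space set"
  assumes conv: "\<And>i. i \<in> I \<Longrightarrow> conv_loc (\<lambda>k. E k i) (F i)"
    and E: "\<And>k i. i \<in> I \<Longrightarrow> E k i \<in> sets borel" and F: "\<And>i. i \<in> I \<Longrightarrow> F i \<in> sets borel"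
    and m: "\<And>k i. i \<in> I \<Longrightarrow> emeasure lborel (E k i) \<le> ennreal (m i)" "\<And>i. i \<in> I \<Longrightarrow> 0 \<le> m i"
    and sm: "summable (\<lambda>i. if i \<in> I then m i else 0)"
  shows "conv_loc (\<lambda>k. \<Union>i\<in>I. E k i) (\<Union>i\<in>I. F i)"
  unfolding conv_loc_def
proof (intro allI LIMSEQ_I)
  fix R e :: real assume e: "0 < e"
  let ?m = "\<lambda>i. if i \<in> I then m i else 0"
  have m0: "0 \<le> ?m i" for i using m(2) by simp
  have "\<exists>n. \<forall>k\<ge>n. norm (\<Sum>i. ?m (i + k)) < e / 4"
    by (rule suminf_exist_split) (use sm e in auto)
  then obtain n where "norm (\<Sum>i. ?m (i + n)) < e / 4" by blast
  then have n: "(\<Sum>i. ?m (i + n)) < e / 4" unfolding real_norm_def abs_less_iff by (rule conjunct1)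
  have sm': "summable (\<lambda>i. ?m (i + n))" using sm by (subst summable_iff_shift)
  have Fm: "emeasure lborel (F i) \<le> ennreal (m i)" if "i \<in> I" for i
    by (rule conv_loc_emeasure_le[OF conv[OF that] E[OF that] F[OF that] m(1)[OF that] m(2)[OF that]])
  have cI: "countable J" for J :: "nat set" by (rule countableI_type)
  have tail: "emeasure lborel (\<Union>i\<in>I \<inter> {n..}. S i) \<le> ennreal (e / 4)"
    if S: "\<And>i. i \<in> I \<Longrightarrow> S i \<in> sets borel" "\<And>i. i \<in> I \<Longrightarrow> emeasure lborel (S i) \<le> ennreal (m i)" for S
  proof -
    let ?S = "\<lambda>i. if i + n \<in> I then S (i + n) else {}"
    have "(\<Union>i\<in>I \<inter> {n..}. S i) \<subseteq> (\<Union>i. ?S i)"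
    proof
      fix x assume "x \<in> (\<Union>i\<in>I \<inter> {n..}. S i)"
      then obtain i where "i \<in> I" "n \<le> i" "x \<in> S i" by auto
      then have "x \<in> ?S (i - n)" by simp
      then show "x \<in> (\<Union>i. ?S i)" by blast
    qed
    then have "emeasure lborel (\<Union>i\<in>I \<inter> {n..}. S i) \<le> emeasure lborel (\<Union>i. ?S i)"
      using S(1) by (intro emeasure_mono) auto
    also have "\<dots> \<le> (\<Sum>i. emeasure lborel (?S i))"
      using S(1) by (intro emeasure_subadditive_countably) auto
    also have "\<dots> \<le> (\<Sum>i. ennreal (?m (i + n)))"
      using S(2) by (intro suminf_le) auto
    also have "\<dots> = ennreal (\<Sum>i. ?m (i + n))"
      using sm' m0 by (intro suminf_ennreal_eq summable_sums) auto
    also have "\<dots> \<le> ennreal (e / 4)" using n by (intro ennreal_leI) simp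
    finally show ?thesis .
  qed
  have mtail: "measure lborel (\<Union>i\<in>I \<inter> {n..}. S i) \<le> e / 4" "(\<Union>i\<in>I \<inter> {n..}. S i) \<in> fmeasurable lborel"
    if S: "\<And>i. i \<in> I \<Longrightarrow> S i \<in> sets borel" "\<And>i. i \<in> I \<Longrightarrow> emeasure lborel (S i) \<le> ennreal (m i)" for S
  proof -
    have "emeasure lborel (\<Union>i\<in>I \<inter> {n..}. S i) \<le> ennreal (e / 4)" by (rule tail) (use S in auto)
    then show "measure lborel (\<Union>i\<in>I \<inter> {n..}. S i) \<le> e / 4"
      unfolding measure_def using e by (intro enn2real_leI) auto
    have "emeasure lborel (\<Union>i\<in>I \<inter> {n..}. S i) < \<infinity>" using \<open>_ \<le> ennreal (e / 4)\<close> by (simp add: le_less_trans)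
    moreover have "(\<Union>i\<in>I \<inter> {n..}. S i) \<in> sets borel" using S(1) by (intro sets.countable_UN' cI) auto
    ultimately show "(\<Union>i\<in>I \<inter> {n..}. S i) \<in> fmeasurable lborel" by (intro fmeasurableI) auto
  qed
  let ?J = "I \<inter> {..<n}"
  have "(\<lambda>k. \<Sum>i\<in>?J. measure lborel (sym_diff (E k i) (F i) \<inter> ball 0 R)) \<longlonglongrightarrow> (\<Sum>i\<in>?J. 0)"
    using conv by (intro tendsto_sum) (auto simp: conv_loc_def)
  then obtain k0 where k0: "\<And>k. k \<ge> k0 \<Longrightarrow> \<bar>\<Sum>i\<in>?J. measure lborel (sym_diff (E k i) (F i) \<inter> ball 0 R)\<bar> < e / 4"
    using LIMSEQ_D[of _ 0 "e / 4"] e by fastforce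
  have "norm (measure lborel (sym_diff (\<Union>i\<in>I. E k i) (\<Union>i\<in>I. F i) \<inter> ball 0 R) - 0) < e" if k: "k \<ge> k0" for k
  proof -
    let ?A = "\<Union>i\<in>?J. sym_diff (E k i) (F i) \<inter> ball 0 R"
    let ?B = "\<Union>i\<in>I \<inter> {n..}. E k i" and ?C = "\<Union>i\<in>I \<inter> {n..}. F i"
    have A: "?A \<in> fmeasurable lborel"
      using E F by (intro fmeasurable.finite_UN Int_ball_fmeasurable) auto
    have B: "?B \<in> fmeasurable lborel" "measure lborel ?B \<le> e / 4"
      by (intro mtail; use E m in auto)+
    have C: "?C \<in> fmeasurable lborel" "measure lborel ?C \<le> e / 4"
      by (intro mtail; use F Fm in auto)+
    have "sym_diff (\<Union>i\<in>I. E k i) (\<Union>i\<in>I. F i) \<inter> ball 0 R \<subseteq> ?A \<union> (?B \<union> ?C)"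
    proof
      fix x assume x: "x \<in> sym_diff (\<Union>i\<in>I. E k i) (\<Union>i\<in>I. F i) \<inter> ball 0 R"
      then obtain i where i: "i \<in> I" "x \<in> sym_diff (E k i) (F i)" by blast
      show "x \<in> ?A \<union> (?B \<union> ?C)"
      proof (cases "i < n")
        case True then show ?thesis using i x by (intro UnI1 UN_I[of i]) auto
      next
        case False
        then have "i \<in> I \<inter> {n..}" using i(1) by simp
        then show ?thesis using i(2) by blast
      qed
    qed
    moreover have "(\<Union>i\<in>I. E k i) \<in> sets borel" "(\<Union>i\<in>I. F i) \<in> sets borel"
      using E F by (intro sets.countable_UN' cI; auto)+
    ultimately have "measure lborel (sym_diff (\<Union>i\<in>I. E k i) (\<Union>i\<in>I. F i) \<inter> ball 0 R) \<le> measure lborel (?A \<union> (?B \<union> ?C))"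
      using A B C by (intro measure_mono_fmeasurable fmeasurable.Un) auto
    also have "\<dots> \<le> measure lborel ?A + measure lborel (?B \<union> ?C)"
      by (rule measure_Un_le[OF fmeasurableD[OF A] fmeasurableD[OF fmeasurable.Un[OF B(1) C(1)]]])
    also have "measure lborel (?B \<union> ?C) \<le> measure lborel ?B + measure lborel ?C"
      by (rule measure_Un_le[OF fmeasurableD[OF B(1)] fmeasurableD[OF C(1)]])
    also have "measure lborel ?A \<le> (\<Sum>i\<in>?J. measure lborel (sym_diff (E k i) (F i) \<inter> ball 0 R))"
      using E F by (intro measure_UNION_le) auto
    finally have "measure lborel (sym_diff (\<Union>i\<in>I. E k i) (\<Union>i\<in>I. F i) \<inter> ball 0 R) < e"
      using B(2) C(2) k0[OF k] e by (simp add: abs_less_iff)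
    then show ?thesis by simp
  qed
  then show "\<exists>k0. \<forall>k\<ge>k0. norm (measure lborel (sym_diff (\<Union>i\<in>I. E k i) (\<Union>i\<in>I. F i) \<inter> ball 0 R) - 0) < e" by blast
qed

section \<open>Limits of clusters\<close>

text \<open>
  The Euclidean norm is a substitute for a homogeneous norm. It satisfies a weak triangle
  inequality, which suffices to compare left-invariant balls up to bounded factors.
\<close>

lemma norm_heis_mult_le: "norm (heis_mult a b) \<le> norm a + norm b + norm a * norm b"
proof -
  have "norm (heis_mult a b) \<le> norm (a + b) + norm (vert (form a b) :: 'a heis)"
    unfolding heis_mult_eq by (rule norm_triangle_ineq)
  also have "\<dots> \<le> (norm a + norm b) + norm a * norm b"
    using abs_form_le[of a b] by (intro add_mono norm_triangle_ineq) simp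
  finally show ?thesis .
qed

lemma norm_heis_quotient_commute: "norm (heis_mult (- y) x) = norm (heis_mult (- x) y)"
proof -
  have "heis_mult (- y) x = - heis_mult (- x) y"
    using form_commute[of x y] by (simp add: heis_mult_eq)
  then show ?thesis by simp
qed

lemma heis_quotient_split: "heis_mult (- x) z = heis_mult (heis_mult (- x) y) (heis_mult (- y) z)"
  by (simp add: heis_mult_assoc)

context heis_frame
begin

lemma heis_balls_disjoint:
  assumes "2 * R + R * R \<le> norm (heis_mult (- x) y)"
  shows "heis_ball x R \<inter> heis_ball y R = {}"
proof (rule ccontr)
  assume "\<not> ?thesis"
  then obtain z where z: "norm (heis_mult (- x) z) < R" "norm (heis_mult (- y) z) < R"
    unfolding heis_ball_def by blast
  let ?a = "heis_mult (- x) z" and ?b = "heis_mult (- z) y"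
  have b: "norm ?b < R" using z(2) by (simp add: norm_heis_quotient_commute)
  have R: "0 < R" using z(1) by (meson le_less_trans norm_ge_zero)
  have "norm ?a * norm ?b \<le> R * R" using z(1) b R by (intro mult_mono) auto
  moreover have "norm (heis_mult (- x) y) \<le> norm ?a + norm ?b + norm ?a * norm ?b"
    unfolding heis_quotient_split[of x y z] by (rule norm_heis_mult_le)
  ultimately show False using assms z(1) b by linarith
qed

lemma heis_ball_subset:
  assumes "norm (heis_mult (- x) y) \<le> D" "0 \<le> D" "D + s + D * s \<le> R"
  shows "heis_ball y s \<subseteq> heis_ball x R"
proof
  fix z assume "z \<in> heis_ball y s"
  then have z: "norm (heis_mult (- y) z) < s" by (simp add: heis_ball_def)
  have "norm (heis_mult (- x) y) * norm (heis_mult (- y) z) \<le> D * s"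
    using assms z by (intro mult_mono) auto
  moreover have "norm (heis_mult (- x) z) \<le> norm (heis_mult (- x) y) + norm (heis_mult (- y) z)
      + norm (heis_mult (- x) y) * norm (heis_mult (- y) z)"
    unfolding heis_quotient_split[of x z y] by (rule norm_heis_mult_le)
  ultimately have "norm (heis_mult (- x) z) < R" using assms z by linarith
  then show "z \<in> heis_ball x R" by (simp add: heis_ball_def)
qed

text \<open>
  Two sequences of centers see the same limit, up to a translation, when they stay in the same
  layer at bounded distance. Distance is measured by the left-invariant quotient. Centers in
  different layers are far from each other.
\<close>

definition near :: "(nat \<Rightarrow> nat \<Rightarrow> int \<times> 'n heis) \<Rightarrow> nat \<Rightarrow> nat \<Rightarrow> bool" where
  "near p a b \<longleftrightarrow> (\<exists>D. \<forall>\<^sub>F k in sequentially. fst (p k a) = fst (p k b) \<and>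
     norm (heis_mult (- snd (p k a)) (snd (p k b))) \<le> D)"

definition far :: "(nat \<Rightarrow> nat \<Rightarrow> int \<times> 'n heis) \<Rightarrow> nat \<Rightarrow> nat \<Rightarrow> bool" where
  "far p a b \<longleftrightarrow> (\<forall>D. \<forall>\<^sub>F k in sequentially. fst (p k a) = fst (p k b) \<longrightarrow>
     D < norm (heis_mult (- snd (p k a)) (snd (p k b))))"

lemma near_refl: "near p a a"
  by (auto simp: near_def heis_mult_uminus_left intro!: exI[of _ 0])

lemma near_sym: "near p a b \<Longrightarrow> near p b a"
  unfolding near_def by (subst norm_heis_quotient_commute) (simp add: eq_commute)

lemma near_trans:
  assumes "near p a b" "near p b c" shows "near p a c"
proof -
  obtain D1 where 1: "\<forall>\<^sub>F k in sequentially. fst (p k a) = fst (p k b) \<and>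
     norm (heis_mult (- snd (p k a)) (snd (p k b))) \<le> D1" using assms(1) unfolding near_def by blast
  obtain D2 where 2: "\<forall>\<^sub>F k in sequentially. fst (p k b) = fst (p k c) \<and>
     norm (heis_mult (- snd (p k b)) (snd (p k c))) \<le> D2" using assms(2) unfolding near_def by blast
  have "\<forall>\<^sub>F k in sequentially. fst (p k a) = fst (p k c) \<and>
      norm (heis_mult (- snd (p k a)) (snd (p k c))) \<le> D1 + D2 + D1 * D2"
    using 1 2
  proof eventually_elim
    case (elim k)
    let ?x = "heis_mult (- snd (p k a)) (snd (p k b))" and ?y = "heis_mult (- snd (p k b)) (snd (p k c))"
    have "norm ?x * norm ?y \<le> D1 * D2"
      using elim by (intro mult_mono) (auto intro: order_trans[OF norm_ge_zero])
    moreover have "norm (heis_mult (- snd (p k a)) (snd (p k c))) \<le> norm ?x + norm ?y + norm ?x * norm ?y"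
      unfolding heis_quotient_split[of "snd (p k a)" "snd (p k c)" "snd (p k b)"] by (rule norm_heis_mult_le)
    ultimately show ?case using elim by linarith
  qed
  then show ?thesis unfolding near_def by blast
qed

text \<open>
  The bounded quantity has the limit 0 exactly when the centers separate.
\<close>

lemma near_or_far:
  assumes "convergent (\<lambda>k. if fst (p k a) = fst (p k b)
      then 1 / (1 + norm (heis_mult (- snd (p k a)) (snd (p k b)))) else 0 :: real)" (is "convergent ?d")
  shows "near p a b \<or> far p a b"
proof -
  obtain l where l: "?d \<longlonglongrightarrow> l" using assms by (auto simp: convergent_def)
  show ?thesis
  proof (cases "0 < l")
    case True
    have "\<forall>\<^sub>F k in sequentially. l / 2 < ?d k" using True by (intro order_tendstoD(1)[OF l]) simp
    then have "\<forall>\<^sub>F k in sequentially. fst (p k a) = fst (p k b) \<and>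
        norm (heis_mult (- snd (p k a)) (snd (p k b))) \<le> 2 / l"
    proof eventually_elim
      case (elim k)
      let ?n = "norm (heis_mult (- snd (p k a)) (snd (p k b)))"
      have eq: "fst (p k a) = fst (p k b)" using elim True by (auto split: if_splits)
      have "0 < 1 + ?n" by (simp add: add_pos_nonneg)
      moreover have "l / 2 < 1 / (1 + ?n)" using elim eq by simp
      ultimately have "l / 2 * (1 + ?n) < 1" by (simp add: less_divide_eq)
      then have "l * (1 + ?n) \<le> 2" by simp
      then have "1 + ?n \<le> 2 / l" using True by (simp add: le_divide_eq mult.commute)
      then show ?case using eq by simp
    qed
    then show ?thesis unfolding near_def by blast
  next
    case False
    have "far p a b" unfolding far_def
    proof
      fix D :: real
      have "l < 1 / (1 + \<bar>D\<bar>)"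
        using False by (intro le_less_trans[of l 0]) (auto simp: add_pos_nonneg)
      then have "\<forall>\<^sub>F k in sequentially. ?d k < 1 / (1 + \<bar>D\<bar>)" by (rule order_tendstoD(2)[OF l])
      then show "\<forall>\<^sub>F k in sequentially. fst (p k a) = fst (p k b) \<longrightarrow>
          D < norm (heis_mult (- snd (p k a)) (snd (p k b)))"
      proof eventually_elim
        case (elim k)
        show ?case
        proof
          assume eq: "fst (p k a) = fst (p k b)"
          let ?n = "norm (heis_mult (- snd (p k a)) (snd (p k b)))"
          have pos: "0 < 1 + ?n" "0 < 1 + \<bar>D\<bar>" by (auto simp: add_pos_nonneg)
          have "1 / (1 + ?n) < 1 / (1 + \<bar>D\<bar>)" using elim eq by simp
          then have "1 + \<bar>D\<bar> < 1 + ?n" using pos by (simp add: divide_less_eq less_divide_eq mult.commute)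
          then show "D < ?n" by linarith
        qed
      qed
    qed
    then show ?thesis ..
  qed
qed

end

text \<open>
  A sequence of clusters with the prescribed masses and bounded perimeter, seen from moving
  centers p. Near the center number a, the component i converges to G a i. Up to mass 1 / (l + 1),
  the component i is contained in balls of radius 3 around the finitely many centers in A i l. Any
  two centers either stay at bounded distance or separate.
\<close>

locale cluster_sequence = heis_frame X for X :: "'n::finite + 'n \<Rightarrow> 'n heis \<Rightarrow> 'n heis" +
  fixes N :: enat and m :: "nat \<Rightarrow> real" and F :: "nat \<Rightarrow> nat \<Rightarrow> (int \<times> 'n heis) set" and M :: real
    and p :: "nat \<Rightarrow> nat \<Rightarrow> int \<times> 'n heis" and A :: "nat \<Rightarrow> nat \<Rightarrow> nat set" and G :: "nat \<Rightarrow> nat \<Rightarrow> 'n heis set"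
  assumes F: "\<And>k. gen_cluster N (F k)"
    and mass: "\<And>k i. i \<in> indices N \<Longrightarrow> gen_mass (F k) i = ennreal (m i)"
    and m_nonneg: "\<And>i. i \<in> indices N \<Longrightarrow> 0 \<le> m i"
    and per: "\<And>k. gen_perimeter X N (F k) \<le> ennreal M" and M_nonneg: "0 \<le> M"
    and near_far: "\<And>a b. near p a b \<or> far p a b"
    and finite_A: "\<And>i l. finite (A i l)"
    and tail: "\<And>k i l. i \<in> indices N \<Longrightarrow>
      (\<integral>\<^sup>+j. emeasure lborel (component N (F k) i j - (\<Union>b\<in>{b \<in> A i l. fst (p k b) = j}. heis_ball (snd (p k b)) 3))
        \<partial>count_space UNIV) \<le> ennreal (1 / (real l + 1))"
    and G_sets: "\<And>a i. i \<in> indices N \<Longrightarrow> G a i \<in> sets borel"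
    and G_conv: "\<And>a i. i \<in> indices N \<Longrightarrow>
      conv_loc (\<lambda>k. {q. heis_mult (snd (p k a)) q \<in> component N (F k) i (fst (p k a))}) (G a i)"

context heis_frame
begin

lemma sum_perimeters_le:
  assumes "gen_perimeter X N E \<le> ennreal M" "0 \<le> M"
  shows "(\<integral>\<^sup>+i. \<integral>\<^sup>+l. perimeter X (component N E i l) \<partial>count_space UNIV \<partial>count_space (insert 0 (indices N)))
    \<le> ennreal (2 * M)" (is "?T \<le> _")
proof -
  have T: "?T / 2 \<le> ennreal M" using assms(1) unfolding gen_perimeter_eq .
  show ?thesis
  proof (cases ?T)
    case (real t)
    then have "ennreal (t / 2) \<le> ennreal M" using T divide_ennreal[of t 2] by simp
    then have "t / 2 \<le> M" using assms(2) by (simp only: ennreal_le_iff)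
    then show ?thesis using real by (simp add: ennreal_leI)
  next
    case top
    then show ?thesis using T by (simp add: ennreal_top_divide top_unique)
  qed
qed

lemma component_perimeter_le:
  assumes "gen_perimeter X N E \<le> ennreal M" "0 \<le> M" "i \<in> insert 0 (indices N)"
  shows "(\<integral>\<^sup>+l. perimeter X (component N E i l) \<partial>count_space UNIV) \<le> ennreal (2 * M)"
    and "perimeter X (component N E i l) \<le> ennreal (2 * M)"
proof -
  show 1: "(\<integral>\<^sup>+l. perimeter X (component N E i l) \<partial>count_space UNIV) \<le> ennreal (2 * M)"
    using order_trans[OF sum_le_nn_integral_count_space[of "{i}"
          "insert 0 (indices N)" "\<lambda>i. \<integral>\<^sup>+l. perimeter X (component N E i l) \<partial>count_space UNIV"]
        sum_perimeters_le[OF assms(1,2)]] assms(3) by simp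
  show "perimeter X (component N E i l) \<le> ennreal (2 * M)"
    using order_trans[OF sum_le_nn_integral_count_space[of "{l}" UNIV "\<lambda>l. perimeter X (component N E i l)"] 1] by simp
qed

lemma component_mass:
  assumes "i \<in> indices N" "gen_mass E i = ennreal c"
  shows "(\<integral>\<^sup>+l. emeasure lborel (component N E i l) \<partial>count_space UNIV) = ennreal c"
    and "emeasure lborel (component N E i l) \<le> ennreal c"
proof -
  show 1: "(\<integral>\<^sup>+l. emeasure lborel (component N E i l) \<partial>count_space UNIV) = ennreal c"
    using assms gen_mass_eq by metis
  show "emeasure lborel (component N E i l) \<le> ennreal c"
    using sum_le_nn_integral_count_space[of "{l}" UNIV "\<lambda>l. emeasure lborel (component N E i l)"] 1 by simp
qed

lemma field_variation_conv:
  assumes "conv_loc E F" "\<And>k. E k \<in> sets borel" "F \<in> sets borel" "test_field \<phi>"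
  shows "(\<lambda>k. field_variation X (E k) \<phi>) \<longlonglongrightarrow> field_variation X F \<phi>"
  unfolding field_variation_def using assms
  by (intro tendsto_sum distr_deriv_conv) (auto simp: test_field_def)

text \<open>
  Existence of the gradient of the limit comes from vague compactness of measures, and the sharp
  constant from the supremum over test fields.
\<close>

lemma perimeter_limit_le:
  assumes conv: "conv_loc E F" "\<And>k. E k \<in> sets borel" "F \<in> sets borel"
    and c: "\<And>k. perimeter X (E k) \<le> ennreal c" "0 \<le> c"
  shows "perimeter X F \<le> ennreal c" "\<exists>\<nu>. is_distr_gradient X (indicat_real F) \<nu>"
proof -
  have "bounded_variation_by c X F"
    by (rule bounded_variation_by_limit[OF conv perimeter_imp_bounded_variation_by[OF c]])
  then obtain \<nu> where \<nu>: "is_distr_gradient X (indicat_real F) \<nu>" by (rule bounded_variation_by_imp_gradient)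
  then show "\<exists>\<nu>. is_distr_gradient X (indicat_real F) \<nu>" by blast
  show "perimeter X F \<le> ennreal c"
  proof (rule perimeter_le_field_variation[OF \<nu>])
    fix \<phi> :: "'n + 'n \<Rightarrow> 'n heis \<Rightarrow> real" assume \<phi>: "test_field \<phi>"
    have "field_variation X (E k) \<phi> \<le> c" for k
      using order_trans[OF field_variation_le_perimeter[OF \<phi>] c(1)[of k]] c(2) by (simp only: ennreal_le_iff)
    then show "field_variation X F \<phi> \<le> c"
      by (intro LIMSEQ_le_const2[OF field_variation_conv[OF conv \<phi>]]) auto
  qed
qed

lemma almost_optimal_field:
  assumes "\<exists>\<nu>. is_distr_gradient X (indicat_real E) \<nu>" "perimeter X E = ennreal P" "0 \<le> P" "0 < e"
    and opt: "\<And>\<phi>. test_field \<phi> \<Longrightarrow> P - e \<le> field_variation X E \<phi> \<Longrightarrow> thesis"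
  shows thesis
proof (rule ccontr)
  assume no: "\<not> thesis"
  have lt: "field_variation X E \<phi> < P - e" if "test_field \<phi>" for \<phi>
  proof (rule ccontr)
    assume "\<not> field_variation X E \<phi> < P - e"
    then have "P - e \<le> field_variation X E \<phi>" by simp
    from opt[OF that this] no show False by simp
  qed
  have "test_field (\<lambda>i x. 0)"
    unfolding test_field_def by (auto intro!: test_functionI[of _ "{}"] simp: k_smooth_const)
  moreover have "field_variation X E (\<lambda>i x. 0) = 0"
  proof -
    have z: "test_function (\<lambda>x::'n heis. 0)" by (rule test_functionI[of _ "{}"]) (auto simp: k_smooth_const)
    show ?thesis
      by (simp add: field_variation_def distr_deriv_left_invariant[OF left_inv z] along_def)
  qed
  ultimately have "0 < P - e" using lt by metis
  obtain \<nu> where "is_distr_gradient X (indicat_real E) \<nu>" using assms(1) by blast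
  then have "ennreal P \<le> ennreal (P - e)"
    unfolding assms(2)[symmetric] by (rule perimeter_le_field_variation) (use lt in \<open>auto intro: less_imp_le\<close>)
  then show False using \<open>0 < P - e\<close> assms(4) by (simp add: ennreal_le_iff)
qed

end

context cluster_sequence
begin

abbreviation "I \<equiv> indices N"

definition moved :: "nat \<Rightarrow> nat \<Rightarrow> nat \<Rightarrow> 'n heis set" where
  "moved k a i = {q. heis_mult (snd (p k a)) q \<in> component N (F k) i (fst (p k a))}"

text \<open>
  Index 0 again denotes the union, whose convergence is derived from that of the components.
\<close>

definition limit :: "nat \<Rightarrow> nat \<Rightarrow> 'n heis set" where
  "limit a i = (if i = 0 then (\<Union>j\<in>I. G a j) else G a i)"

lemma comp_sets: "i \<in> insert 0 I \<Longrightarrow> component N (F k) i l \<in> sets borel"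
  by (rule component_sets[OF F])

lemma moved_sets: "i \<in> insert 0 I \<Longrightarrow> moved k a i \<in> sets borel"
  unfolding moved_def by (rule measurable_sets_borel[OF measurable_heis_left comp_sets, unfolded vimage_def])

lemma limit_sets:
  assumes "i \<in> insert 0 I" shows "limit a i \<in> sets borel"
proof -
  have "countable I" by (rule countableI_type)
  then have "(\<Union>j\<in>I. G a j) \<in> sets borel" using G_sets by (intro sets.countable_UN') auto
  then show ?thesis using assms G_sets by (auto simp: limit_def)
qed

lemma moved_mass:
  assumes i: "i \<in> I" shows "emeasure lborel (moved k a i) \<le> ennreal (m i)"
  unfolding moved_def emeasure_heis_left[OF comp_sets[OF insertI2[OF i]]]
  by (rule component_mass(2)[OF i mass[OF i]])

lemma moved_perimeter: "i \<in> insert 0 I \<Longrightarrow> perimeter X (moved k a i) \<le> ennreal (2 * M)"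
  unfolding moved_def
  using M_nonneg by (intro perimeter_translate_le comp_sets component_perimeter_le(2)[OF per]) auto

lemma masses_summable': "summable (\<lambda>i. if i \<in> I then m i else 0)"
proof (rule masses_summable[OF F[of 0] _ mass m_nonneg])
  show "gen_perimeter X N (F 0) < \<infinity>" using per[of 0] by (simp add: le_less_trans)
qed

text \<open>
  The union of infinitely many components converges since their masses are summable, uniformly
  along the sequence because they are prescribed.
\<close>

lemma moved_conv:
  assumes "i \<in> insert 0 I" shows "conv_loc (\<lambda>k. moved k a i) (limit a i)"
proof -
  have Gc: "conv_loc (\<lambda>k. moved k a j) (G a j)" if "j \<in> I" for j
    using G_conv[OF that] by (simp add: moved_def)
  show ?thesis
  proof (cases "i = 0")
    case True
    have "moved k a 0 = (\<Union>j\<in>I. moved k a j)" for k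
      using zero_notin_indices[of N] by (auto simp: moved_def component_def split: if_splits)
    moreover have "conv_loc (\<lambda>k. \<Union>j\<in>I. moved k a j) (\<Union>j\<in>I. G a j)"
      by (rule conv_loc_UN[where m=m])
        (use Gc moved_sets G_sets moved_mass m_nonneg masses_summable' in auto)
    ultimately show ?thesis using True by (simp add: limit_def)
  next
    case False then show ?thesis using assms Gc by (simp add: limit_def)
  qed
qed

lemma limit_perimeter:
  assumes "i \<in> insert 0 I"
  shows "perimeter X (limit a i) \<le> ennreal (2 * M)" "\<exists>\<nu>. is_distr_gradient X (indicat_real (limit a i)) \<nu>"
  using perimeter_limit_le[OF moved_conv[OF assms] moved_sets[OF assms] limit_sets[OF assms] moved_perimeter[OF assms]]
    M_nonneg by auto

text \<open>
  The first center of each class of nearby centers stands for the whole class, so that no limit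
  piece is counted twice.
\<close>

definition rep :: "nat \<Rightarrow> bool" where "rep a \<longleftrightarrow> (\<forall>b<a. \<not> near p b a)"

definition rho :: "nat \<Rightarrow> nat" where "rho a = (LEAST b. near p b a)"

lemma near_rho: "near p (rho a) a"
  unfolding rho_def by (rule LeastI[of _ a]) (rule near_refl)

lemma rep_rho: "rep (rho a)"
  unfolding rep_def
proof (intro allI impI notI)
  fix b assume "b < rho a" "near p b (rho a)"
  then have "near p b a" using near_trans near_rho by blast
  then show False using \<open>b < rho a\<close> not_less_Least unfolding rho_def by blast
qed

lemma reps_far:
  assumes "rep a" "rep b" "a \<noteq> b" shows "far p a b"
proof -
  have "\<not> near p a b" using assms near_sym unfolding rep_def by (metis linorder_neqE_nat)
  then show ?thesis using near_far by blast
qed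

text \<open>
  The quotient norm exceeds every bound, whereas it is at most 2 R + R^2 for centers whose balls
  of radius R meet.
\<close>

lemma reps_eventually_disjoint:
  assumes "finite T" "\<forall>a\<in>T. rep a"
  shows "\<forall>\<^sub>F k in sequentially. \<forall>a\<in>T. \<forall>b\<in>T. a \<noteq> b \<longrightarrow> fst (p k a) = fst (p k b) \<longrightarrow>
    heis_ball (snd (p k a)) R \<inter> heis_ball (snd (p k b)) R = {}"
proof (intro eventually_ball_finite[OF assms(1)] ballI)
  fix a b assume ab: "a \<in> T" "b \<in> T"
  show "\<forall>\<^sub>F k in sequentially. a \<noteq> b \<longrightarrow> fst (p k a) = fst (p k b) \<longrightarrow>
    heis_ball (snd (p k a)) R \<inter> heis_ball (snd (p k b)) R = {}"
  proof (cases "a = b")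
    case False
    then have "far p a b" using reps_far assms(2) ab by blast
    then have "\<forall>\<^sub>F k in sequentially. fst (p k a) = fst (p k b) \<longrightarrow>
        2 * R + R * R < norm (heis_mult (- snd (p k a)) (snd (p k b)))" unfolding far_def by blast
    then show ?thesis by eventually_elim (auto intro!: heis_balls_disjoint[OF less_imp_le])
  qed simp
qed

lemma moved_ball_measure:
  assumes "i \<in> insert 0 I"
  shows "emeasure lborel (component N (F k) i (fst (p k a)) \<inter> heis_ball (snd (p k a)) R) =
    ennreal (measure lborel (moved k a i \<inter> ball 0 R))"
proof -
  have "emeasure lborel (moved k a i \<inter> ball 0 R) =
      emeasure lborel (component N (F k) i (fst (p k a)) \<inter> heis_ball (snd (p k a)) R)"
    unfolding moved_def by (rule emeasure_heis_ball_translate[OF comp_sets[OF assms]])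
  moreover have "emeasure lborel (moved k a i \<inter> ball 0 R) = ennreal (measure lborel (moved k a i \<inter> ball 0 R))"
    using sym_diff_ball_finite[of "moved k a i" 0 R] by (intro emeasure_eq_ennreal_measure) auto
  ultimately show ?thesis by simp
qed

text \<open>
  Balls around different representatives are disjoint eventually, so the limit pieces do not carry
  more than the mass of the sequence.
\<close>

lemma limit_mass_upper:
  assumes i: "i \<in> I" and T: "finite T" "\<And>a. a \<in> T \<Longrightarrow> rep a"
  shows "(\<Sum>a\<in>T. emeasure lborel (limit a i)) \<le> ennreal (m i)"
proof -
  have T': "\<forall>a\<in>T. rep a" using T(2) by blast
  have i0: "i \<in> insert 0 I" using i by simp
  have ball: "(\<Sum>a\<in>T. emeasure lborel (limit a i \<inter> ball 0 R)) \<le> ennreal (m i)" for R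
  proof -
    have "\<forall>\<^sub>F k in sequentially. (\<Sum>a\<in>T. measure lborel (moved k a i \<inter> ball 0 R)) \<le> m i"
      using reps_eventually_disjoint[OF T(1) T', of R]
    proof eventually_elim
      case (elim k)
      have "(\<Sum>a\<in>T. emeasure lborel (component N (F k) i (fst (p k a)) \<inter> heis_ball (snd (p k a)) R))
          \<le> (\<integral>\<^sup>+j. emeasure lborel (component N (F k) i j) \<partial>count_space UNIV)"
      proof (rule finite_sum_layers_le[OF T(1)])
        show "component N (F k) i j \<in> sets borel" for j by (rule comp_sets[OF i0])
        show "heis_ball (snd (p k a)) R \<inter> heis_ball (snd (p k b)) R = {}"
          if "a \<in> T" "b \<in> T" "a \<noteq> b" "fst (p k a) = fst (p k b)" for a b
          using elim that by blast
      qed (rule heis_ball_sets)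
      also have "\<dots> = ennreal (m i)" by (rule component_mass(1)[OF i mass[OF i]])
      finally have "ennreal (\<Sum>a\<in>T. measure lborel (moved k a i \<inter> ball 0 R)) \<le> ennreal (m i)"
        unfolding moved_ball_measure[OF i0] by (subst (asm) sum_ennreal) auto
      then show ?case using m_nonneg[OF i] by (simp only: ennreal_le_iff)
    qed
    moreover have "(\<lambda>k. \<Sum>a\<in>T. measure lborel (moved k a i \<inter> ball 0 R)) \<longlonglongrightarrow>
        (\<Sum>a\<in>T. measure lborel (limit a i \<inter> ball 0 R))"
      by (intro tendsto_sum conv_loc_measure_ball[OF moved_conv[OF i0] moved_sets[OF i0] limit_sets[OF i0]])
    ultimately have "(\<Sum>a\<in>T. measure lborel (limit a i \<inter> ball 0 R)) \<le> m i"
      by (intro tendsto_upperbound[where F=sequentially]) auto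
    then have "ennreal (\<Sum>a\<in>T. measure lborel (limit a i \<inter> ball 0 R)) \<le> ennreal (m i)" by (rule ennreal_leI)
    also have "ennreal (\<Sum>a\<in>T. measure lborel (limit a i \<inter> ball 0 R)) = (\<Sum>a\<in>T. emeasure lborel (limit a i \<inter> ball 0 R))"
    proof -
      have "emeasure lborel (limit a i \<inter> ball 0 R) = ennreal (measure lborel (limit a i \<inter> ball 0 R))" for a
        using sym_diff_ball_finite[of "limit a i" 0 R] by (intro emeasure_eq_ennreal_measure) auto
      then show ?thesis by (simp add: sum_ennreal)
    qed
    finally show ?thesis .
  qed
  have "(\<lambda>n. emeasure lborel (limit a i \<inter> ball 0 (real n))) \<longlonglongrightarrow> emeasure lborel (limit a i)" for a
  proof -
    have "(\<lambda>n. emeasure lborel (limit a i \<inter> ball 0 (real n))) \<longlonglongrightarrow> emeasure lborel (\<Union>n. limit a i \<inter> ball 0 (real n))"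
    proof (rule Lim_emeasure_incseq)
      show "range (\<lambda>n. limit a i \<inter> ball 0 (real n)) \<subseteq> sets lborel" using limit_sets[OF i0] by auto
      show "incseq (\<lambda>n. limit a i \<inter> ball 0 (real n))" unfolding incseq_def by force
    qed
    moreover have "(\<Union>n. limit a i \<inter> ball 0 (real n)) = limit a i"
    proof -
      have "x \<in> (\<Union>n. limit a i \<inter> ball 0 (real n))" if "x \<in> limit a i" for x
      proof -
        obtain n where "norm x < real n" using reals_Archimedean2 by blast
        then have "x \<in> limit a i \<inter> ball 0 (real n)" using that by simp
        then show ?thesis by (rule UN_I[OF UNIV_I])
      qed
      then show ?thesis by blast
    qed
    ultimately show ?thesis by simp
  qed
  then have "(\<lambda>n. \<Sum>a\<in>T. emeasure lborel (limit a i \<inter> ball 0 (real n))) \<longlonglongrightarrow> (\<Sum>a\<in>T. emeasure lborel (limit a i))"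
    by (intro tendsto_sum)
  then show ?thesis by (rule LIMSEQ_le_const2) (use ball in blast)
qed

text \<open>
  No mass is lost: all but 1 / (l + 1) of it lies in balls around finitely many centers, each of
  which is at bounded distance from its representative and thus seen by the limit there.
\<close>

lemma limit_mass_lower:
  assumes i: "i \<in> I"
  shows "\<exists>T. finite T \<and> (\<forall>a\<in>T. rep a) \<and> ennreal (m i) \<le> ennreal (1 / (real l + 1)) + (\<Sum>a\<in>T. emeasure lborel (limit a i))"
proof -
  have i0: "i \<in> insert 0 I" using i by simp
  have "\<forall>b. \<exists>D. \<forall>\<^sub>F k in sequentially. fst (p k (rho b)) = fst (p k b) \<and>
      norm (heis_mult (- snd (p k (rho b))) (snd (p k b))) \<le> D"
    by (rule allI, rule near_rho[unfolded near_def])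
  from choice[OF this] obtain D where D0: "\<forall>b. \<forall>\<^sub>F k in sequentially. fst (p k (rho b)) = fst (p k b) \<and>
      norm (heis_mult (- snd (p k (rho b))) (snd (p k b))) \<le> D b" by (rule exE)
  note D = D0[rule_format]
  define D' where "D' = (\<Sum>b\<in>A i l. \<bar>D b\<bar>)"
  have D': "D b \<le> D'" if "b \<in> A i l" for b
  proof -
    have "\<bar>D b\<bar> \<le> D'" unfolding D'_def using that finite_A by (intro member_le_sum) auto
    then show ?thesis by simp
  qed
  have D'0: "0 \<le> D'" by (auto simp: D'_def intro: sum_nonneg)
  \<comment> \<open>the weak triangle inequality puts a ball of radius 3 at distance at most D' inside a ball of this radius\<close>
  define R where "R = D' + 3 + D' * 3"
  define T where "T = rho ` A i l"
  have T: "finite T" "\<And>a. a \<in> T \<Longrightarrow> rep a" using finite_A rep_rho by (auto simp: T_def)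
  have "\<forall>\<^sub>F k in sequentially. \<forall>b\<in>A i l. fst (p k (rho b)) = fst (p k b) \<and>
      norm (heis_mult (- snd (p k (rho b))) (snd (p k b))) \<le> D b"
    by (intro eventually_ball_finite finite_A ballI D)
  then have "\<forall>\<^sub>F k in sequentially. m i \<le> 1 / (real l + 1) + (\<Sum>a\<in>T. measure lborel (moved k a i \<inter> ball 0 R))"
  proof eventually_elim
    case (elim k)
    let ?e = "component N (F k) i"
    let ?x = "\<lambda>a. emeasure lborel (?e (fst (p k a)) \<inter> heis_ball (snd (p k a)) R)"
    let ?U = "\<lambda>j. \<Union>b\<in>{b \<in> A i l. fst (p k b) = j}. heis_ball (snd (p k b)) 3"
    have e: "?e j \<in> sets borel" for j by (rule comp_sets[OF i0])
    have U: "?U j \<in> sets borel" for j using finite_A by (intro sets.finite_UN) auto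
    have le: "emeasure lborel (?e j) \<le> emeasure lborel (?e j - ?U j) + (\<Sum>a\<in>T. if fst (p k a) = j then ?x a else 0)" for j
    proof -
      let ?Tj = "{a \<in> T. fst (p k a) = j}"
      have "?U j \<subseteq> (\<Union>a\<in>?Tj. heis_ball (snd (p k a)) R)"
      proof
        fix y assume "y \<in> ?U j"
        then obtain b where b: "b \<in> A i l" "fst (p k b) = j" "y \<in> heis_ball (snd (p k b)) 3" by blast
        have near: "norm (heis_mult (- snd (p k (rho b))) (snd (p k b))) \<le> D'"
          using elim b(1) D'[OF b(1)] by fastforce
        have "y \<in> heis_ball (snd (p k (rho b))) R"
          by (rule subsetD[OF heis_ball_subset[OF near D'0] b(3)]) (simp add: R_def)
        moreover have "rho b \<in> ?Tj" using elim b by (auto simp: T_def)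
        ultimately show "y \<in> (\<Union>a\<in>?Tj. heis_ball (snd (p k a)) R)" by blast
      qed
      then have "?e j \<subseteq> (?e j - ?U j) \<union> (\<Union>a\<in>?Tj. ?e j \<inter> heis_ball (snd (p k a)) R)" by blast
      moreover have V: "(\<Union>a\<in>?Tj. ?e j \<inter> heis_ball (snd (p k a)) R) \<in> sets lborel"
        using T(1) e by (intro sets.finite_UN) auto
      ultimately have "emeasure lborel (?e j) \<le> emeasure lborel ((?e j - ?U j) \<union> (\<Union>a\<in>?Tj. ?e j \<inter> heis_ball (snd (p k a)) R))"
        using e U by (intro emeasure_mono sets.Un) auto
      also have "\<dots> \<le> emeasure lborel (?e j - ?U j) + emeasure lborel (\<Union>a\<in>?Tj. ?e j \<inter> heis_ball (snd (p k a)) R)"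
        using e U V by (intro emeasure_subadditive) auto
      also have "emeasure lborel (\<Union>a\<in>?Tj. ?e j \<inter> heis_ball (snd (p k a)) R) \<le> (\<Sum>a\<in>?Tj. emeasure lborel (?e j \<inter> heis_ball (snd (p k a)) R))"
        using T(1) e by (intro emeasure_subadditive_finite) auto
      also have "\<dots> = (\<Sum>a\<in>?Tj. ?x a)" by (intro sum.cong) auto
      also have "\<dots> = (\<Sum>a\<in>T. if fst (p k a) = j then ?x a else 0)"
        using T(1) by (intro sum.mono_neutral_cong_left) auto
      finally show ?thesis by (simp add: add_left_mono)
    qed
    have "ennreal (m i) = (\<integral>\<^sup>+j. emeasure lborel (?e j) \<partial>count_space UNIV)"
      by (rule component_mass(1)[OF i mass[OF i], symmetric])
    also have "\<dots> \<le> (\<integral>\<^sup>+j. emeasure lborel (?e j - ?U j) + (\<Sum>a\<in>T. if fst (p k a) = j then ?x a else 0) \<partial>count_space UNIV)"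
      by (intro nn_integral_mono le)
    also have "\<dots> = (\<integral>\<^sup>+j. emeasure lborel (?e j - ?U j) \<partial>count_space UNIV) +
        (\<integral>\<^sup>+j. (\<Sum>a\<in>T. if fst (p k a) = j then ?x a else 0) \<partial>count_space UNIV)"
      by (rule nn_integral_add) auto
    also have "(\<integral>\<^sup>+j. (\<Sum>a\<in>T. if fst (p k a) = j then ?x a else 0) \<partial>count_space UNIV) =
        (\<Sum>a\<in>T. \<integral>\<^sup>+j. (if fst (p k a) = j then ?x a else 0) \<partial>count_space UNIV)"
      by (rule nn_integral_sum) auto
    also have "\<dots> = (\<Sum>a\<in>T. ?x a)"
    proof (rule sum.cong)
      fix a
      show "(\<integral>\<^sup>+j. (if fst (p k a) = j then ?x a else 0) \<partial>count_space UNIV) = ?x a"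
        by (subst nn_integral_count_space'[of "{fst (p k a)}"]) auto
    qed simp
    also have "\<dots> = ennreal (\<Sum>a\<in>T. measure lborel (moved k a i \<inter> ball 0 R))"
      unfolding moved_ball_measure[OF i0] by (rule sum_ennreal) simp
    also have "(\<integral>\<^sup>+j. emeasure lborel (?e j - ?U j) \<partial>count_space UNIV) \<le> ennreal (1 / (real l + 1))"
      by (rule tail[OF i])
    finally have "ennreal (m i) \<le> ennreal (1 / (real l + 1)) + ennreal (\<Sum>a\<in>T. measure lborel (moved k a i \<inter> ball 0 R))"
      by (simp add: add_right_mono)
    also have "\<dots> = ennreal (1 / (real l + 1) + (\<Sum>a\<in>T. measure lborel (moved k a i \<inter> ball 0 R)))"
      by (rule ennreal_plus[symmetric]) (auto intro: sum_nonneg)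
    finally show ?case by (subst (asm) ennreal_le_iff) (auto intro!: add_nonneg_nonneg sum_nonneg)
  qed
  moreover have "(\<lambda>k. 1 / (real l + 1) + (\<Sum>a\<in>T. measure lborel (moved k a i \<inter> ball 0 R))) \<longlonglongrightarrow>
      1 / (real l + 1) + (\<Sum>a\<in>T. measure lborel (limit a i \<inter> ball 0 R))"
    by (intro tendsto_add tendsto_const tendsto_sum
        conv_loc_measure_ball[OF moved_conv[OF i0] moved_sets[OF i0] limit_sets[OF i0]])
  ultimately have "m i \<le> 1 / (real l + 1) + (\<Sum>a\<in>T. measure lborel (limit a i \<inter> ball 0 R))"
    by (intro tendsto_lowerbound[where F=sequentially]) auto
  then have "ennreal (m i) \<le> ennreal (1 / (real l + 1) + (\<Sum>a\<in>T. measure lborel (limit a i \<inter> ball 0 R)))"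
    by (rule ennreal_leI)
  also have "\<dots> = ennreal (1 / (real l + 1)) + (\<Sum>a\<in>T. ennreal (measure lborel (limit a i \<inter> ball 0 R)))"
    by (subst ennreal_plus) (auto intro: sum_nonneg simp: sum_ennreal)
  also have "\<dots> \<le> ennreal (1 / (real l + 1)) + (\<Sum>a\<in>T. emeasure lborel (limit a i))"
  proof (intro add_left_mono sum_mono)
    fix a
    have "ennreal (measure lborel (limit a i \<inter> ball 0 R)) = emeasure lborel (limit a i \<inter> ball 0 R)"
      using sym_diff_ball_finite[of "limit a i" 0 R] by (intro emeasure_eq_ennreal_measure[symmetric]) auto
    also have "\<dots> \<le> emeasure lborel (limit a i)" using limit_sets[OF i0] by (intro emeasure_mono) auto
    finally show "ennreal (measure lborel (limit a i \<inter> ball 0 R)) \<le> emeasure lborel (limit a i)" .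
  qed
  finally show ?thesis using T by blast
qed

text \<open>
  Almost optimal test fields for finitely many limit pieces have compact support. Carried back to
  the clusters of the sequence they have disjoint supports eventually, hence they add up to
  admissible fields.
\<close>

lemma limit_perimeter_lsc:
  assumes i: "i \<in> insert 0 I" and T: "finite T" "\<And>a. a \<in> T \<Longrightarrow> rep a"
  shows "(\<Sum>a\<in>T. perimeter X (limit a i)) \<le>
    liminf (\<lambda>k. \<integral>\<^sup>+l. perimeter X (component N (F k) i l) \<partial>count_space UNIV)" (is "_ \<le> ?L")
proof -
  have T': "\<forall>a\<in>T. rep a" using T(2) by blast
  define P where "P a = enn2real (perimeter X (limit a i))" for a
  have P: "perimeter X (limit a i) = ennreal (P a)" "0 \<le> P a" for a
  proof -
    have "perimeter X (limit a i) < top" using limit_perimeter(1)[OF i, of a] by (simp add: le_less_trans)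
    then show "perimeter X (limit a i) = ennreal (P a)" by (simp add: P_def)
  qed (simp add: P_def)
  have main: "ennreal (\<Sum>a\<in>T. P a - e) \<le> ?L" if e: "0 < e" for e
  proof -
    have "\<exists>\<phi>. test_field \<phi> \<and> P a - e \<le> field_variation X (limit a i) \<phi>" for a
      by (rule almost_optimal_field[OF limit_perimeter(2)[OF i] P e]) blast
    then obtain \<phi> where \<phi>: "\<And>a. test_field (\<phi> a)" "\<And>a. P a - e \<le> field_variation X (limit a i) (\<phi> a)" by metis
    have "\<exists>R>0. \<forall>x. \<phi> a j x \<noteq> 0 \<longrightarrow> norm x < R" for a j
      using \<phi>(1) test_functionD(5) unfolding test_field_def by blast
    then obtain r where r: "\<And>a j. 0 < r a j" "\<And>a j x. \<phi> a j x \<noteq> 0 \<Longrightarrow> norm x < r a j" by metis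
    \<comment> \<open>a common radius for the supports of finitely many fields with finitely many components\<close>
    define R where "R = (\<Sum>a\<in>T. \<Sum>j\<in>UNIV. r a j)"
    have R: "r a j \<le> R" if "a \<in> T" for a j
    proof -
      have "r a j \<le> (\<Sum>j\<in>UNIV. r a j)" using r(1) by (intro member_le_sum) (auto intro: less_imp_le)
      also have "\<dots> \<le> R" unfolding R_def using that T(1) r(1)
        by (intro member_le_sum sum_nonneg less_imp_le[OF r(1)])
      finally show ?thesis .
    qed
    have ev: "\<forall>\<^sub>F k in sequentially. ennreal (\<Sum>a\<in>T. field_variation X (moved k a i) (\<phi> a)) \<le>
        (\<integral>\<^sup>+l. perimeter X (component N (F k) i l) \<partial>count_space UNIV)"
      using reps_eventually_disjoint[OF T(1) T', of R]
    proof eventually_elim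
      case (elim k)
      let ?e = "component N (F k) i"
      let ?l = "\<lambda>a. fst (p k a)"
      define \<psi> where "\<psi> a j q = \<phi> a j (heis_mult (- snd (p k a)) q)" for a j q
      have \<psi>: "test_field (\<psi> a)" for a unfolding \<psi>_def by (rule test_field_translate[OF \<phi>(1)])
      define x where "x a = field_variation X (moved k a i) (\<phi> a)" for a
      have x: "x a = field_variation X (?e (?l a)) (\<psi> a)" for a
        unfolding x_def moved_def \<psi>_def by (rule field_variation_translate[OF \<phi>(1) comp_sets[OF i]])
      have group: "ennreal (\<Sum>a\<in>{a \<in> T. ?l a = j}. x a) \<le> perimeter X (?e j)" for j
      proof -
        let ?Tj = "{a \<in> T. ?l a = j}"
        have "(\<Sum>a\<in>?Tj. x a) = (\<Sum>a\<in>?Tj. field_variation X (?e j) (\<psi> a))"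
          by (intro sum.cong) (auto simp: x)
        also have "\<dots> = field_variation X (?e j) (\<lambda>i x. \<Sum>a\<in>?Tj. \<psi> a i x)"
          using T(1) by (intro field_variation_sum[symmetric] \<psi> comp_sets[OF i]) simp
        finally have "(\<Sum>a\<in>?Tj. x a) = field_variation X (?e j) (\<lambda>i x. \<Sum>a\<in>?Tj. \<psi> a i x)" .
        moreover have "test_field (\<lambda>i x. \<Sum>a\<in>?Tj. \<psi> a i x)"
        proof (rule test_field_sum_disjoint[where U="\<lambda>a. heis_ball (snd (p k a)) R"])
          show "q \<in> heis_ball (snd (p k a)) R" if "a \<in> ?Tj" "\<psi> a j' q \<noteq> 0" for a j' q
            using r(2)[of a j'] R[of a j'] that unfolding \<psi>_def heis_ball_def by fastforce
          show "heis_ball (snd (p k a)) R \<inter> heis_ball (snd (p k b)) R = {}"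
            if "a \<in> ?Tj" "b \<in> ?Tj" "a \<noteq> b" for a b using elim that by simp
        qed (use T(1) \<psi> in auto)
        ultimately show ?thesis by (simp only: field_variation_le_perimeter)
      qed
      have "ennreal (\<Sum>a\<in>T. x a) = ennreal (\<Sum>j\<in>?l ` T. \<Sum>a\<in>{a \<in> T. ?l a = j}. x a)"
        by (rule arg_cong[OF sum.image_gen[OF T(1)]])
      also have "\<dots> \<le> ennreal (\<Sum>j\<in>?l ` T. max 0 (\<Sum>a\<in>{a \<in> T. ?l a = j}. x a))"
        by (intro ennreal_leI sum_mono) simp
      also have "\<dots> = (\<Sum>j\<in>?l ` T. ennreal (max 0 (\<Sum>a\<in>{a \<in> T. ?l a = j}. x a)))"
        by (rule sum_ennreal[symmetric]) simp
      also have "\<dots> \<le> (\<Sum>j\<in>?l ` T. perimeter X (?e j))"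
        by (intro sum_mono) (simp only: ennreal_max_0 group)
      also have "\<dots> \<le> (\<integral>\<^sup>+l. perimeter X (?e l) \<partial>count_space UNIV)"
        using T(1) by (intro sum_le_nn_integral_count_space) auto
      finally show ?case by (simp only: x_def)
    qed
    have "(\<lambda>k. ennreal (\<Sum>a\<in>T. field_variation X (moved k a i) (\<phi> a))) \<longlonglongrightarrow>
        ennreal (\<Sum>a\<in>T. field_variation X (limit a i) (\<phi> a))"
      by (intro tendsto_ennrealI tendsto_sum
          field_variation_conv[OF moved_conv[OF i] moved_sets[OF i] limit_sets[OF i] \<phi>(1)])
    then have "ennreal (\<Sum>a\<in>T. field_variation X (limit a i) (\<phi> a)) =
        liminf (\<lambda>k. ennreal (\<Sum>a\<in>T. field_variation X (moved k a i) (\<phi> a)))"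
      by (intro lim_imp_Liminf[symmetric]) auto
    also have "\<dots> \<le> ?L" by (rule Liminf_mono[OF ev])
    finally have "ennreal (\<Sum>a\<in>T. field_variation X (limit a i) (\<phi> a)) \<le> ?L" .
    moreover have "(\<Sum>a\<in>T. P a - e) \<le> (\<Sum>a\<in>T. field_variation X (limit a i) (\<phi> a))"
      by (intro sum_mono \<phi>(2))
    ultimately show ?thesis by (meson ennreal_leI order_trans)
  qed
  have "(\<Sum>a\<in>T. perimeter X (limit a i)) = ennreal (\<Sum>a\<in>T. P a)"
    unfolding P(1) by (rule sum_ennreal) (rule P(2))
  also have "\<dots> \<le> ?L"
  proof (rule ennreal_le_epsilon)
    fix e :: real assume e: "0 < e"
    define d where "d = e / (real (card T) + 1)"
    have d: "0 < d" "real (card T) * d \<le> e" using e by (auto simp: d_def field_simps)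
    have "ennreal (\<Sum>a\<in>T. P a) \<le> ennreal ((\<Sum>a\<in>T. P a - d) + e)"
      using d(2) by (intro ennreal_leI) (simp add: sum_subtractf)
    also have "\<dots> \<le> ennreal (\<Sum>a\<in>T. P a - d) + ennreal e"
      by (cases "0 \<le> (\<Sum>a\<in>T. P a - d)") (use e in \<open>auto simp: ennreal_plus ennreal_neg intro!: ennreal_leI\<close>)
    also have "\<dots> \<le> ?L + ennreal e" by (intro add_right_mono main d)
    finally show "ennreal (\<Sum>a\<in>T. P a) \<le> ?L + ennreal e" .
  qed
  finally show ?thesis .
qed

text \<open>
  Each class of centers gets a layer of its own, numbered by its representative.
\<close>

definition limit_cluster :: "nat \<Rightarrow> (int \<times> 'n heis) set" where
  "limit_cluster i = {(l, x). 0 \<le> l \<and> rep (nat l) \<and> x \<in> G (nat l) i}"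

lemma component_limit_cluster:
  assumes "i \<in> insert 0 I"
  shows "component N limit_cluster i l = (if 0 \<le> l \<and> rep (nat l) then limit (nat l) i else {})"
  using assms zero_notin_indices[of N] by (auto simp: component_def layer_def limit_cluster_def limit_def)

text \<open>
  Masses and perimeters of the limit cluster are sums over the representatives.
\<close>

lemma limit_cluster_sum_le:
  fixes f :: "'n heis set \<Rightarrow> ennreal"
  assumes i: "i \<in> insert 0 I" and f0: "f {} = 0"
    and le: "\<And>T. finite T \<Longrightarrow> (\<And>a. a \<in> T \<Longrightarrow> rep a) \<Longrightarrow> (\<Sum>a\<in>T. f (limit a i)) \<le> c"
  shows "(\<integral>\<^sup>+l. f (component N limit_cluster i l) \<partial>count_space UNIV) \<le> c"
proof (rule nn_integral_count_space_le)
  fix S :: "int set" assume S: "finite S"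
  let ?S = "{l \<in> S. 0 \<le> l \<and> rep (nat l)}"
  have "(\<Sum>l\<in>S. f (component N limit_cluster i l)) = (\<Sum>l\<in>?S. f (limit (nat l) i))"
    using S by (intro sum.mono_neutral_cong_right) (auto simp: component_limit_cluster[OF i] f0)
  also have "\<dots> = (\<Sum>a\<in>nat ` ?S. f (limit a i))"
    by (subst sum.reindex) (auto simp: inj_on_def)
  also have "\<dots> \<le> c" using S by (intro le) auto
  finally show "(\<Sum>l\<in>S. f (component N limit_cluster i l)) \<le> c" .
qed (rule countableI_type)

lemma limit_cluster_sum_ge:
  fixes f :: "'n heis set \<Rightarrow> ennreal"
  assumes i: "i \<in> insert 0 I" and T: "finite T" "\<And>a. a \<in> T \<Longrightarrow> rep a"
  shows "(\<Sum>a\<in>T. f (limit a i)) \<le> (\<integral>\<^sup>+l. f (component N limit_cluster i l) \<partial>count_space UNIV)"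
proof -
  have "(\<Sum>a\<in>T. f (limit a i)) = (\<Sum>l\<in>int ` T. f (component N limit_cluster i l))"
    by (subst sum.reindex) (auto simp: component_limit_cluster[OF i] T(2))
  also have "\<dots> \<le> (\<integral>\<^sup>+l. f (component N limit_cluster i l) \<partial>count_space UNIV)"
    using T(1) by (intro sum_le_nn_integral_count_space) auto
  finally show ?thesis .
qed

lemma gen_cluster_limit_cluster: "gen_cluster N limit_cluster"
  unfolding gen_cluster_def cluster_def
proof (intro allI conjI ballI impI)
  have lay: "layer l limit_cluster i = (if 0 \<le> l \<and> rep (nat l) then G (nat l) i else {})" for l i
    by (auto simp: layer_def limit_cluster_def)
  fix l
  show "layer l limit_cluster i \<in> sets borel" if "i \<in> I" for i using G_sets[OF that] by (simp add: lay)
  fix i j assume ij: "i \<in> I" "j \<in> I" "i \<noteq> j"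
  have "emeasure lborel (G a i \<inter> G a j) = 0" for a
  proof (rule conv_loc_Int_null[OF G_conv[OF ij(1)] G_conv[OF ij(2)]])
    have i0: "i \<in> insert 0 I" "j \<in> insert 0 I" using ij by auto
    show "{q. heis_mult (snd (p k a)) q \<in> component N (F k) i (fst (p k a))} \<in> sets borel" for k
      using moved_sets[OF i0(1)] by (simp add: moved_def)
    show "{q. heis_mult (snd (p k a)) q \<in> component N (F k) j (fst (p k a))} \<in> sets borel" for k
      using moved_sets[OF i0(2)] by (simp add: moved_def)
    show "emeasure lborel ({q. heis_mult (snd (p k a)) q \<in> component N (F k) i (fst (p k a))} \<inter>
        {q. heis_mult (snd (p k a)) q \<in> component N (F k) j (fst (p k a))}) = 0" for k
    proof -
      let ?S = "component N (F k) i (fst (p k a)) \<inter> component N (F k) j (fst (p k a))"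
      have "i \<noteq> 0" "j \<noteq> 0" using ij zero_notin_indices by metis+
      then have "emeasure lborel ?S = 0"
        using F[of k] ij by (simp add: gen_cluster_def cluster_def component_def)
      moreover have "?S \<in> sets borel" using comp_sets i0 by blast
      moreover have "{q. heis_mult (snd (p k a)) q \<in> component N (F k) i (fst (p k a))} \<inter>
          {q. heis_mult (snd (p k a)) q \<in> component N (F k) j (fst (p k a))} = {q. heis_mult (snd (p k a)) q \<in> ?S}"
        by blast
      ultimately show ?thesis using emeasure_heis_left[of ?S "snd (p k a)"] by simp
    qed
  qed (rule G_sets[OF ij(1)], rule G_sets[OF ij(2)])
  then show "emeasure lborel (layer l limit_cluster i \<inter> layer l limit_cluster j) = 0" by (simp add: lay)
qed

lemma gen_mass_limit_cluster:
  assumes i: "i \<in> I" shows "gen_mass limit_cluster i = ennreal (m i)"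
proof (rule antisym)
  have i0: "i \<in> insert 0 I" using i by simp
  show "gen_mass limit_cluster i \<le> ennreal (m i)"
    unfolding gen_mass_eq[OF i] by (rule limit_cluster_sum_le[OF i0]) (auto intro: limit_mass_upper[OF i])
  show "ennreal (m i) \<le> gen_mass limit_cluster i"
  proof (rule ennreal_le_epsilon)
    fix e :: real assume "0 < e"
    then obtain l where l: "inverse (real (Suc l)) < e" using reals_Archimedean by blast
    obtain T where T: "finite T" "\<forall>a\<in>T. rep a"
      "ennreal (m i) \<le> ennreal (1 / (real l + 1)) + (\<Sum>a\<in>T. emeasure lborel (limit a i))"
      using limit_mass_lower[OF i] by blast
    have "ennreal (1 / (real l + 1)) \<le> ennreal e" using l by (intro ennreal_leI) (simp add: inverse_eq_divide add.commute)
    moreover have "(\<Sum>a\<in>T. emeasure lborel (limit a i)) \<le> gen_mass limit_cluster i"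
      unfolding gen_mass_eq[OF i] using T by (intro limit_cluster_sum_ge[OF i0]) auto
    ultimately have "ennreal (1 / (real l + 1)) + (\<Sum>a\<in>T. emeasure lborel (limit a i)) \<le> ennreal e + gen_mass limit_cluster i"
      by (rule add_mono)
    then show "ennreal (m i) \<le> gen_mass limit_cluster i + ennreal e" using T(3) by (simp add: add.commute)
  qed
qed

text \<open>
  Lower semicontinuity for each component and for the union is summed up with Fatou's lemma.
  Keeping the doubled energy avoids the division by 2.
\<close>

lemma gen_perimeter_limit_cluster:
  assumes g: "(\<lambda>k. gen_perimeter X N (F k)) \<longlonglongrightarrow> g"
  shows "gen_perimeter X N limit_cluster \<le> g"
proof -
  let ?\<pi> = "\<lambda>E i. \<integral>\<^sup>+l. perimeter X (component N E i l) \<partial>count_space UNIV"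
  let ?T = "\<lambda>E. \<integral>\<^sup>+i. ?\<pi> E i \<partial>count_space (insert 0 I)"
  have half: "(x + x) / 2 = x" for x :: ennreal
  proof -
    have "(x + x) / 2 = x * (2 / 2)" by (simp only: mult_2_right[symmetric] ennreal_times_divide)
    then show ?thesis by simp
  qed
  have T: "?T E = gen_perimeter X N E + gen_perimeter X N E" for E
    unfolding gen_perimeter_eq using half[of "?T E"] by (simp only: add_divide_distrib_ennreal)
  have "?T limit_cluster \<le> (\<integral>\<^sup>+i. liminf (\<lambda>k. ?\<pi> (F k) i) \<partial>count_space (insert 0 I))"
  proof (rule nn_integral_mono)
    fix i assume "i \<in> space (count_space (insert 0 I))"
    then have i: "i \<in> insert 0 I" by simp
    show "?\<pi> limit_cluster i \<le> liminf (\<lambda>k. ?\<pi> (F k) i)"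
      by (rule limit_cluster_sum_le[OF i perimeter_empty limit_perimeter_lsc[OF i]])
  qed
  also have "\<dots> \<le> liminf (\<lambda>k. ?T (F k))" by (rule nn_integral_liminf) simp
  also have "\<dots> = g + g"
    unfolding T by (intro lim_imp_Liminf tendsto_add g) simp
  finally have "?T limit_cluster / 2 \<le> (g + g) / 2" by (rule divide_right_mono_ennreal)
  then show ?thesis unfolding half gen_perimeter_eq .
qed

end

section \<open>Extraction of a convergent sequence and existence of minimizers\<close>

context heis_frame
begin

text \<open>
  The number of centers depends on the mass, the perimeter bound and the precision only, so that
  along a sequence of clusters they can be numbered once and for all.
\<close>

lemma concentration_points:
  assumes E: "gen_cluster N E" and i: "i \<in> indices N" and c: "gen_mass E i = ennreal c" "0 \<le> c"
    and M: "gen_perimeter X N E \<le> ennreal M" "0 \<le> M" and r: "0 < r" "r \<le> 1" "modulus r \<le> e / (4 * M + 4)"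
    and e: "0 < e"
  obtains pt :: "nat \<Rightarrow> int \<times> 'n heis" where
    "(\<integral>\<^sup>+j. emeasure lborel (component N E i j -
        (\<Union>s\<in>{s. s < nat \<lceil>2 * c / ball_vol r\<rceil> \<and> fst (pt s) = j}. heis_ball (snd (pt s)) 3))
      \<partial>count_space UNIV) \<le> ennreal e"
proof -
  let ?K = "nat \<lceil>2 * c / ball_vol r\<rceil>"
  have i0: "i \<in> insert 0 (indices N)" using i by simp
  obtain Q where Q: "finite Q" "real (card Q) \<le> 2 * c / ball_vol r"
    and tail: "(\<integral>\<^sup>+l. emeasure lborel (component N E i l - (\<Union>x\<in>{x. (l, x) \<in> Q}. heis_ball x 3)) \<partial>count_space UNIV)
      \<le> ennreal (2 * modulus r) * (\<integral>\<^sup>+l. perimeter X (component N E i l) \<partial>count_space UNIV)"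
  proof (rule concentration[OF component_sets[OF E i0] _ c(2) r(1,2)])
    show "(\<integral>\<^sup>+l. emeasure lborel (component N E i l) \<partial>count_space UNIV) \<le> ennreal c"
      by (simp only: component_mass(1)[OF i c(1)] order_refl)
  qed (rule that)
  have "card Q \<le> ?K" using Q(2) by linarith
  obtain h where h: "bij_betw h {0..<card Q} Q" using ex_bij_betw_nat_finite[OF Q(1)] by blast
  have "emeasure lborel (component N E i j - (\<Union>s\<in>{s. s < ?K \<and> fst (h s) = j}. heis_ball (snd (h s)) 3))
     \<le> emeasure lborel (component N E i j - (\<Union>x\<in>{x. (j, x) \<in> Q}. heis_ball x 3))" for j
  proof (rule emeasure_mono)
    show "component N E i j - (\<Union>x\<in>{x. (j, x) \<in> Q}. heis_ball x 3) \<in> sets lborel"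
    proof -
      have "finite {x. (j, x) \<in> Q}"
        by (rule finite_subset[OF _ finite_imageI[OF Q(1), of snd]]) force
      then show ?thesis
        using component_sets[OF E i0, of j] heis_ball_sets by (auto intro!: sets.Diff sets.finite_UN)
    qed
    have "heis_ball x 3 \<subseteq> (\<Union>s\<in>{s. s < ?K \<and> fst (h s) = j}. heis_ball (snd (h s)) 3)" if "(j, x) \<in> Q" for x
    proof -
      have "(j, x) \<in> h ` {0..<card Q}" using that bij_betw_imp_surj_on[OF h] by simp
      then obtain s where s: "(j, x) = h s" "s \<in> {0..<card Q}" by (rule imageE)
      then have "s \<in> {s. s < ?K \<and> fst (h s) = j}" "snd (h s) = x"
        using \<open>card Q \<le> ?K\<close> s(2) by (simp_all add: s(1)[symmetric])
      then show ?thesis by blast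
    qed
    then have "(\<Union>x\<in>{x. (j, x) \<in> Q}. heis_ball x 3) \<subseteq> (\<Union>s\<in>{s. s < ?K \<and> fst (h s) = j}. heis_ball (snd (h s)) 3)"
      by (rule UN_least[OF _]) (unfold mem_Collect_eq)
    then show "component N E i j - (\<Union>s\<in>{s. s < ?K \<and> fst (h s) = j}. heis_ball (snd (h s)) 3)
        \<subseteq> component N E i j - (\<Union>x\<in>{x. (j, x) \<in> Q}. heis_ball x 3)"
      by (rule Diff_mono[OF order_refl])
  qed
  then have "(\<integral>\<^sup>+j. emeasure lborel (component N E i j -
        (\<Union>s\<in>{s. s < ?K \<and> fst (h s) = j}. heis_ball (snd (h s)) 3)) \<partial>count_space UNIV)
    \<le> (\<integral>\<^sup>+l. emeasure lborel (component N E i l - (\<Union>x\<in>{x. (l, x) \<in> Q}. heis_ball x 3)) \<partial>count_space UNIV)"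
    by (rule nn_integral_mono)
  also note tail
  also have "ennreal (2 * modulus r) * (\<integral>\<^sup>+l. perimeter X (component N E i l) \<partial>count_space UNIV)
    \<le> ennreal (2 * modulus r) * ennreal (2 * M)"
    by (rule mult_left_mono[OF component_perimeter_le(1)[OF M i0]]) simp
  also have "\<dots> = ennreal (2 * modulus r * (2 * M))" using M(2) by (simp only: ennreal_mult'')
  also have "\<dots> \<le> ennreal e"
  proof (rule ennreal_leI)
    have "4 * M * modulus r \<le> 4 * M * (e / (4 * M + 4))" using r(3) M(2) by (intro mult_left_mono) auto
    also have "\<dots> \<le> e" using M(2) e by (simp add: field_simps)
    finally show "2 * modulus r * (2 * M) \<le> e" by (simp add: mult.commute mult.left_commute)
  qed
  finally show thesis by (rule that)
qed

text \<open>
  Centers of all components and precisions are labelled by natural numbers. A subsequence makes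
  the relative positions of the centers converge, as well as the measures of the translated
  components in finite unions of basic open sets; this determines the limits of the components
  seen from the centers.
\<close>

lemma convergent_cluster_sequence:
  fixes F :: "nat \<Rightarrow> nat \<Rightarrow> (int \<times> 'n heis) set"
  assumes F: "\<And>k. gen_cluster N (F k)"
    and mass: "\<And>k i. i \<in> indices N \<Longrightarrow> gen_mass (F k) i = ennreal (m i)"
    and m: "\<And>i. i \<in> indices N \<Longrightarrow> 0 \<le> m i"
    and per: "\<And>k. gen_perimeter X N (F k) \<le> ennreal M" and M: "0 \<le> M"
  obtains r p A G where "strict_mono r" "cluster_sequence X N m (\<lambda>k. F (r k)) M p A G"
proof -
  have "\<exists>r. 0 < r \<and> r \<le> 1 \<and> modulus r \<le> 1 / (real l + 1) / (4 * M + 4)" for l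
  proof -
    have "0 < 1 / (real l + 1) / (4 * M + 4)" using M by simp
    then show ?thesis by (rule modulus_small) blast
  qed
  then obtain \<rho> where \<rho>: "\<And>l. 0 < \<rho> l" "\<And>l. \<rho> l \<le> 1" "\<And>l. modulus (\<rho> l) \<le> 1 / (real l + 1) / (4 * M + 4)"
    by metis
  define K where "K i l = nat \<lceil>2 * m i / ball_vol (\<rho> l)\<rceil>" for i l
  let ?tail = "\<lambda>k i l pt. (\<integral>\<^sup>+j. emeasure lborel (component N (F k) i j -
      (\<Union>s\<in>{s. s < K i l \<and> fst (pt s) = j}. heis_ball (snd (pt s)) 3)) \<partial>count_space UNIV)"
  have ex: "\<exists>pt :: nat \<Rightarrow> int \<times> 'n heis. i \<in> indices N \<longrightarrow> ?tail k i l pt \<le> ennreal (1 / (real l + 1))" for k i l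
  proof (cases "i \<in> indices N")
    case True
    have pos: "0 < 1 / (real l + 1)" by simp
    obtain q where "?tail k i l q \<le> ennreal (1 / (real l + 1))"
      unfolding K_def
      by (rule concentration_points[OF F[of k] True mass[OF True, of k] m[OF True] per[of k] M \<rho>(1)[of l] \<rho>(2)[of l] \<rho>(3)[of l] pos])
    then show ?thesis by (intro exI[of _ q] impI)
  qed blast
  define pt where "pt k i l = (SOME pt. i \<in> indices N \<longrightarrow> ?tail k i l pt \<le> ennreal (1 / (real l + 1)))" for k i l
  have pt: "?tail k i l (pt k i l) \<le> ennreal (1 / (real l + 1))" if "i \<in> indices N" for k i l
    using someI_ex[OF ex[of i k l]] that unfolding pt_def[symmetric] by (rule mp)
  define enc where "enc i l s = prod_encode (i, prod_encode (l, s))" for i l s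
  define p where "p k a = (case prod_decode a of (i, b) \<Rightarrow> case prod_decode b of (l, s) \<Rightarrow> pt k i l s)" for k a
  define A where "A i l = enc i l ` {..<K i l}" for i l
  have p_enc: "p k (enc i l s) = pt k i l s" for k i l s by (simp add: p_def enc_def)
  have tail: "(\<integral>\<^sup>+j. emeasure lborel (component N (F k) i j -
      (\<Union>b\<in>{b \<in> A i l. fst (p k b) = j}. heis_ball (snd (p k b)) 3)) \<partial>count_space UNIV) \<le> ennreal (1 / (real l + 1))"
    if i: "i \<in> indices N" for k i l
  proof -
    have "{b \<in> A i l. fst (p k b) = j} = enc i l ` {s. s < K i l \<and> fst (pt k i l s) = j}" for j
      unfolding A_def using p_enc by auto
    then have "(\<Union>b\<in>{b \<in> A i l. fst (p k b) = j}. heis_ball (snd (p k b)) 3) =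
        (\<Union>s\<in>{s. s < K i l \<and> fst (pt k i l s) = j}. heis_ball (snd (pt k i l s)) 3)" for j
      by (simp only: image_image p_enc)
    then show ?thesis using pt[OF i, of k l] by (simp only:)
  qed
  obtain B :: "nat \<Rightarrow> 'n heis set"
    where B: "\<And>j. open (B j)" "\<And>V. open V \<Longrightarrow> \<exists>J. V = (\<Union>j\<in>J. B j)" by (rule open_basis_sequence) (rule that)
  define mv where "mv k a i = {q. heis_mult (snd (p k a)) q \<in> component N (F k) i (fst (p k a))}" for k a i
  have mv: "mv k a i \<in> sets borel" "emeasure lborel (mv k a i) \<le> ennreal (m i)"
    "perimeter X (mv k a i) \<le> ennreal (2 * M)" if i: "i \<in> indices N" for k a i
  proof -
    have i0: "i \<in> insert 0 (indices N)" using i by simp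
    have [measurable]: "component N (F k) i l \<in> sets borel" for l by (rule component_sets[OF F i0])
    show "mv k a i \<in> sets borel" unfolding mv_def by measurable
    show "emeasure lborel (mv k a i) \<le> ennreal (m i)"
      unfolding mv_def by (subst emeasure_heis_left) (auto intro: component_mass(2)[OF i mass[OF i]])
    show "perimeter X (mv k a i) \<le> ennreal (2 * M)"
      unfolding mv_def using M by (intro perimeter_translate_le component_perimeter_le(2)[OF per]) (use i0 in auto)
  qed
  define f where "f x k = (case x of
      Inl (a, b) \<Rightarrow> (if fst (p k a) = fst (p k b) then 1 / (1 + norm (heis_mult (- snd (p k a)) (snd (p k b)))) else 0)
    | Inr (a, i, xs) \<Rightarrow> (if i \<in> indices N then measure lborel (mv k a i \<inter> (\<Union>j\<in>set xs. B j)) else 0))"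
    for x :: "(nat \<times> nat) + (nat \<times> nat \<times> nat list)" and k
  define v where "v x = (case x of Inl _ \<Rightarrow> 1 | Inr (a, i, xs) \<Rightarrow> if i \<in> indices N then m i else (0 :: real))"
    for x :: "(nat \<times> nat) + (nat \<times> nat \<times> nat list)"
  have f: "f x k \<in> {0..v x}" for x k
  proof (cases x)
    case (Inl y)
    have "1 / (1 + norm w) \<le> 1" for w :: "'n heis"
      using norm_ge_zero[of w] by (subst divide_le_eq_1_pos) (linarith, linarith)
    then show ?thesis using Inl by (cases y) (auto simp: f_def v_def)
  next
    case (Inr y)
    obtain a i xs where y: "y = (a, i, xs)" by (cases y)
    show ?thesis
    proof (cases "i \<in> indices N")
      case True
      have "emeasure lborel (mv k a i \<inter> (\<Union>j\<in>set xs. B j)) \<le> emeasure lborel (mv k a i)"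
        by (rule emeasure_mono) (use mv(1)[OF True] in auto)
      also note mv(2)[OF True]
      finally have "measure lborel (mv k a i \<inter> (\<Union>j\<in>set xs. B j)) \<le> m i"
        unfolding measure_def using m[OF True] by (rule enn2real_leI[rotated])
      then show ?thesis by (simp add: f_def v_def Inr y True)
    qed (simp add: f_def v_def Inr y)
  qed
  obtain r where r: "strict_mono r" "\<And>x. convergent (\<lambda>k. f x (r k))"
    by (rule common_convergent_subseq[of f "\<lambda>_. 0" v, OF f]) (rule that)
  have G: "\<exists>V. V \<in> sets borel \<and> conv_loc (\<lambda>k. mv (r k) a i) V" if i: "i \<in> indices N" for a i
  proof (rule finite_perimeter_compact[OF B, of "\<lambda>k. mv (r k) a i" "2 * M"])
    show "emeasure lborel (mv (r k) a i) < \<infinity>" for k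
      using mv(2)[OF i, of "r k" a] by (simp add: le_less_trans)
    show "convergent (\<lambda>k. measure lborel (mv (r k) a i \<inter> (\<Union>j\<in>set xs. B j)))" for xs
      using r(2)[of "Inr (a, i, xs)"] i by (simp add: f_def)
  qed (use mv[OF i] M in auto)
  define G where "G a i = (SOME V. V \<in> sets borel \<and> conv_loc (\<lambda>k. mv (r k) a i) V)" for a i
  have G: "G a i \<in> sets borel" "conv_loc (\<lambda>k. mv (r k) a i) (G a i)" if "i \<in> indices N" for a i
    using someI_ex[OF G[OF that, of a]] unfolding G_def by blast+
  show thesis
  proof (rule that[OF r(1)])
    show "cluster_sequence X N m (\<lambda>k. F (r k)) M (\<lambda>k. p (r k)) A G"
    proof unfold_locales
      show "near (\<lambda>k. p (r k)) a b \<or> far (\<lambda>k. p (r k)) a b" for a b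
        using r(2)[of "Inl (a, b)"] by (intro near_or_far) (simp add: f_def)
      show "finite (A i l)" for i l by (simp add: A_def)
      show "conv_loc (\<lambda>k. {q. heis_mult (snd (p (r k) a)) q \<in> component N (F (r k)) i (fst (p (r k) a))}) (G a i)"
        if "i \<in> indices N" for a i using G(2)[OF that] unfolding mv_def .
    qed (use F mass m per M tail G in auto)
  qed
qed

text \<open>Balls of the prescribed masses, one in each layer.\<close>

lemma gen_cluster_with_masses:
  assumes m: "\<And>i. i \<in> indices N \<Longrightarrow> 0 \<le> m i"
  obtains E :: "nat \<Rightarrow> (int \<times> 'n heis) set"
  where "gen_cluster N E" "\<And>i. i \<in> indices N \<Longrightarrow> gen_mass E i = ennreal (m i)"
proof -
  let ?D = "DIM('n heis)"
  define s where "s i = root ?D (m i / ball_vol 1)" for i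
  define E where "E i = {int i} \<times> ball (0 :: 'n heis) (s i)" for i
  have layer: "layer l E i = (if l = int i then ball 0 (s i) else {})" for l i
    by (auto simp: layer_def E_def)
  have "gen_cluster N E"
    unfolding gen_cluster_def cluster_def by (auto simp: layer)
  moreover have "gen_mass E i = ennreal (m i)" if i: "i \<in> indices N" for i
  proof -
    have b: "0 < ball_vol 1" by (rule ball_vol_pos) simp
    have "0 \<le> s i" unfolding s_def using m[OF i] b by simp
    then have "ball_vol (s i) = ball_vol 1 * s i ^ ?D" by (rule ball_vol_power)
    also have "s i ^ ?D = m i / ball_vol 1"
      unfolding s_def using m[OF i] b by (intro real_root_pow_pos2) auto
    finally have v: "ball_vol (s i) = m i" using b by simp
    have "gen_mass E i = (\<integral>\<^sup>+l. emeasure lborel (layer l E i) \<partial>count_space UNIV)"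
      unfolding gen_mass_def by (rule infsum_ennreal_eq_nn_integral) simp
    also have "\<dots> = (\<Sum>l\<in>{int i}. emeasure lborel (layer l E i))"
      by (rule nn_integral_count_space') (auto simp: layer)
    also have "\<dots> = ennreal (m i)" by (simp add: layer emeasure_ball_0 v)
    finally show ?thesis .
  qed
  ultimately show thesis by (rule that)
qed

text \<open>
  If every competitor has infinite perimeter, each of them is minimal. Otherwise the limit cluster
  of a minimizing sequence has the same masses and no larger perimeter.
\<close>

lemma minimal_gen_cluster_exists:
  assumes m: "\<And>i. i \<in> indices N \<Longrightarrow> 0 \<le> m i"
  shows "\<exists>E. minimal_gen_cluster X N E \<and> (\<forall>i\<in>indices N. gen_mass E i = ennreal (m i))"
proof -
  define S where "S = {F :: nat \<Rightarrow> (int \<times> 'n heis) set. gen_cluster N F \<and> (\<forall>i\<in>indices N. gen_mass F i = ennreal (m i))}"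
  define I where "I = (INF F\<in>S. gen_perimeter X N F)"
  have minimal: "minimal_gen_cluster X N E \<and> (\<forall>i\<in>indices N. gen_mass E i = ennreal (m i))"
    if E: "E \<in> S" "gen_perimeter X N E = I" for E
  proof -
    have "{F. gen_cluster N F \<and> (\<forall>i\<in>indices N. gen_mass F i = gen_mass E i)} = S"
      using E(1) unfolding S_def by auto
    then show ?thesis using E unfolding minimal_gen_cluster_def I_def S_def by simp
  qed
  obtain E0 where E0: "E0 \<in> S"
    by (rule gen_cluster_with_masses[of N m]) (use m in \<open>auto simp: S_def\<close>)
  show ?thesis
  proof (cases "I = \<infinity>")
    case True
    then have "gen_perimeter X N E0 = I" using INF_lower[OF E0, of "gen_perimeter X N"] unfolding I_def by (simp add: top_unique)
    then show ?thesis using minimal[OF E0] by blast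
  next
    case False
    define g where "g = enn2real I"
    have Ig: "I = ennreal g" "0 \<le> g" using False by (auto simp: g_def less_top)
    have "\<exists>F. F \<in> S \<and> gen_perimeter X N F < ennreal (g + 1 / (real k + 1))" for k
    proof -
      have "I < ennreal (g + 1 / (real k + 1))" unfolding Ig(1) using Ig(2) by (intro ennreal_lessI) (auto intro: add_nonneg_pos)
      then show ?thesis unfolding I_def INF_less_iff by blast
    qed
    then obtain F where F: "\<And>k. F k \<in> S" "\<And>k. gen_perimeter X N (F k) < ennreal (g + 1 / (real k + 1))" by metis
    have lim: "(\<lambda>k. gen_perimeter X N (F k)) \<longlonglongrightarrow> I"
    proof (rule tendsto_sandwich[where f="\<lambda>_. I" and h="\<lambda>k. ennreal (g + 1 / (real k + 1))"])
      have "(\<lambda>k. g + 1 / (real k + 1)) \<longlonglongrightarrow> g + 0"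
        by (intro tendsto_add tendsto_const) (use LIMSEQ_inverse_real_of_nat in \<open>simp add: inverse_eq_divide add.commute\<close>)
      then show "(\<lambda>k. ennreal (g + 1 / (real k + 1))) \<longlonglongrightarrow> I" unfolding Ig(1) by (intro tendsto_ennrealI) simp
      show "\<forall>\<^sub>F k in sequentially. I \<le> gen_perimeter X N (F k)" unfolding I_def by (intro always_eventually allI INF_lower F(1))
      show "\<forall>\<^sub>F k in sequentially. gen_perimeter X N (F k) \<le> ennreal (g + 1 / (real k + 1))"
        by (intro always_eventually allI less_imp_le F(2))
    qed simp
    have M: "gen_perimeter X N (F k) \<le> ennreal (g + 1)" for k
    proof -
      have "ennreal (g + 1 / (real k + 1)) \<le> ennreal (g + 1)" by (intro ennreal_leI) simp
      then show ?thesis using F(2)[of k] by (meson less_imp_le order_trans)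
    qed
    have FS: "gen_cluster N (F k)" "i \<in> indices N \<Longrightarrow> gen_mass (F k) i = ennreal (m i)" for k i
      using F(1)[of k] by (auto simp: S_def)
    have M0: "0 \<le> g + 1" using Ig(2) by simp
    obtain r p A G where r: "strict_mono r" and cs: "cluster_sequence X N m (\<lambda>k. F (r k)) (g + 1) p A G"
    proof (rule convergent_cluster_sequence[of N F m "g + 1", OF FS(1) _ _ M M0])
      show "gen_mass (F k) i = ennreal (m i)" if "i \<in> indices N" for k i using that by (rule FS(2))
      show "0 \<le> m i" if "i \<in> indices N" for i using that by (rule m)
    qed (rule that)
    interpret cs: cluster_sequence X N m "\<lambda>k. F (r k)" "g + 1" p A G by (rule cs)
    have S: "cs.limit_cluster \<in> S"
      unfolding S_def using cs.gen_cluster_limit_cluster cs.gen_mass_limit_cluster by blast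
    have "(\<lambda>k. gen_perimeter X N (F (r k))) \<longlonglongrightarrow> I"
      using LIMSEQ_subseq_LIMSEQ[OF lim r] by (simp add: o_def)
    then have "gen_perimeter X N cs.limit_cluster \<le> I" by (rule cs.gen_perimeter_limit_cluster)
    moreover have "I \<le> gen_perimeter X N cs.limit_cluster" unfolding I_def by (rule INF_lower[OF S])
    ultimately show ?thesis using minimal[OF S] by (metis order_antisym)
  qed
qed

end

theorem corollary6p4:
  fixes X :: "'n::finite + 'n \<Rightarrow> 'n heis \<Rightarrow> 'n heis"
    and N :: enat
    and m :: "nat \<Rightarrow> real"
  assumes "\<And>i. left_invariant (X i)"
    and "hoermander X"
    and "\<And>i. i \<in> indices N \<Longrightarrow> 0 \<le> m i"
  shows "\<exists>E. minimal_gen_cluster X N E \<and> (\<forall>i\<in>indices N. gen_mass E i = ennreal (m i))"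
proof -
  interpret heis_frame X using assms(1,2) by unfold_locales
  show ?thesis using assms(3) by (rule minimal_gen_cluster_exists)
qed

end
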